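(* Let $\lambda\in\Lambda(d)$. The character $\chi_\lambda:\mathrm{Gr}(D(B))\to\mathbb{C}$ factors through $\mathrm{Gr}^{\mathrm{st}_B}(D(B))$ if and only if $\lambda\in\Lambda^\#(d)$. Consequently, the $(\chi_\lambda)_{\lambda\in[\Lambda^\#(d)/\iota]}$ are all the characters (ring morphisms to $\mathbb{C}$) of $\mathrm{Gr}^{\mathrm{st}_B}(D(B))$, and the $\mathbb{C}$-algebra $\mathbb{C}\otimes_{\mathbb{Z}}\mathrm{Gr}^{\mathrm{st}_B}(D(B))$ is semisimple.
   Context: Fix an integer $d\ge 2$ and a primitive $d$-th root of unity $\zeta\in\mathbb{C}$. $D(B)$ (the Drinfeld double of the Taft algebra $B$) is the $\mathbb{C}$-algebra with generators $E,F,K,z$ and relations $K^d=z^d=1$, $E^d=F^d=0$, $z$ central, $KE=\zeta EK$, $KF=\zeta^{-1}FK$, $[E,F]=K-zK^{-1}$. It is a (braided) Hopf algebra with $\Delta(K)=K\otimes K$, $\Delta(z)=z\otimes z$, $\Delta(E)=1\otimes E+E\otimes K$, $\Delta(F)=F\otimes 1+zK^{-1}\otimes F$, $\varepsilon(K)=\varepsilon(z)=1$, $\varepsilon(E)=\varepsilon(F)=0$. $B$ is the Hopf subalgebra generated by $E,K$. Modules are finite-dimensional left modules, and $\mathrm{Gr}(D(B))$ is the Grothendieck ring of the category of $D(B)$-modules. $\Lambda(d)=\mathbb{Z}/d\mathbb{Z}\times\mathbb{Z}/d\mathbb{Z}$; $\Lambda^\#(d)=\{(l,p)\in\Lambda(d):l\neq0\}$;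 $\iota(l,p)=(-l,p+l)$ is an involution of $\Lambda(d)$; $[\Lambda^\#(d)/\iota]$ is a set of representatives of $\iota$-orbits in $\Lambda^\#(d)$. For $(i,j)\in\Lambda(d)$, $\chi_{i,j}:\mathrm{Gr}(D(B))\to\mathbb{C}$ is the ring morphism $[M]\mapsto\mathrm{trace}(K^iz^j|_M)$ (ordinary trace; $K^iz^j$ is group-like). $D(B)\text{-stab}$ is the stable category of $D(B)$ (finite-dimensional modules modulo projectives), a triangulated monoidal category. $D(B)\text{-proj}_B$ is the full subcategory of $D(B)$-modules whose restriction to $B$ is projective; its image in $D(B)\text{-stab}$ is a thick triangulated subcategory and a tensor ideal. $D(B)\text{-stab}_B$ is the (Verdier) quotient of $D(B)\text{-stab}$ by this image, a triangulated category with a compatible monoidal structure, and $\mathrm{Gr}^{\mathrm{st}_B}(D(B))$ is its Grothendieck ring as a triangulated category. "Factors through $\mathrm{Gr}^{\mathrm{st}_B}(D(B))$" refers to the natural surjective ring morphism $\mathrm{Gr}(D(B))\to\mathrm{Gr}^{\mathrm{st}_B}(D(B))$. *)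

theory Defs
  imports
    "HOL-Algebra.QuotRing"
    "HOL-Algebra.Generated_Groups"
    "HOL-Library.FuncSet"
    "HOL-Library.Poly_Mapping"
    "Jordan_Normal_Form.Matrix"
    "Jordan_Normal_Form.VS_Connect"
begin

section \<open>Finite-dimensional modules given by matrices\<close>

text \<open>A finite-dimensional complex module over an algebra with generators \<open>'g\<close> is a space
  \<open>\<complex>\<^sup>n\<close> with one \<open>n \<times> n\<close> matrix for each generator, subject to the relations of the
  algebra. The relations are recorded by a set \<open>C\<close> of admissible modules. The modules of a
  fixed algebra then form a small category equivalent to that of all its finite-dimensional left
  modules (the zero module is the case \<open>n = 0\<close>).\<close>

datatype 'g fdmod = FDMod (vdim: nat) (act: "'g \<Rightarrow> complex mat")

definition fd_hom :: "'g fdmod \<Rightarrow> 'g fdmod \<Rightarrow> complex mat \<Rightarrow> bool" where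
  "fd_hom X Y f \<longleftrightarrow> f \<in> carrier_mat (vdim Y) (vdim X) \<and> (\<forall>g. f * act X g = act Y g * f)"

definition fd_mono :: "'g fdmod \<Rightarrow> 'g fdmod \<Rightarrow> complex mat \<Rightarrow> bool" where
  "fd_mono X Y f \<longleftrightarrow> fd_hom X Y f \<and> inj_on (\<lambda>x. f *\<^sub>v x) (carrier_vec (vdim X))"

definition fd_epi :: "'g fdmod \<Rightarrow> 'g fdmod \<Rightarrow> complex mat \<Rightarrow> bool" where
  "fd_epi X Y f \<longleftrightarrow> fd_hom X Y f \<and> (\<lambda>x. f *\<^sub>v x) ` carrier_vec (vdim X) = carrier_vec (vdim Y)"

definition projective :: "'g fdmod set \<Rightarrow> 'g fdmod \<Rightarrow> bool" where
  "projective C P \<longleftrightarrow> P \<in> C \<and>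
     (\<forall>X\<in>C. \<forall>Y\<in>C. \<forall>p f. fd_epi X Y p \<and> fd_hom P Y f \<longrightarrow> (\<exists>h. fd_hom P X h \<and> p * h = f))"

definition injective :: "'g fdmod set \<Rightarrow> 'g fdmod \<Rightarrow> bool" where
  "injective C I \<longleftrightarrow> I \<in> C \<and>
     (\<forall>X\<in>C. \<forall>Y\<in>C. \<forall>i f. fd_mono X Y i \<and> fd_hom X I f \<longrightarrow> (\<exists>h. fd_hom Y I h \<and> h * i = f))"

definition short_exact ::
  "'g fdmod set \<Rightarrow> 'g fdmod \<Rightarrow> 'g fdmod \<Rightarrow> 'g fdmod \<Rightarrow> complex mat \<Rightarrow> complex mat \<Rightarrow> bool" where
  "short_exact C X Y Z u v \<longleftrightarrow> X \<in> C \<and> Y \<in> C \<and> Z \<in> C \<and> fd_mono X Y u \<and> fd_epi Y Z v \<and>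
     (\<lambda>x. u *\<^sub>v x) ` carrier_vec (vdim X) = {y \<in> carrier_vec (vdim Y). v *\<^sub>v y = 0\<^sub>v (vdim Z)}"


section \<open>The Taft algebra, its Drinfeld double and their modules\<close>

datatype taft_gen = TE | TK
datatype double_gen = DE | DF | DK | DZ

definition taft_modules :: "nat \<Rightarrow> complex \<Rightarrow> taft_gen fdmod set" where
  "taft_modules d \<zeta> = {X. let n = vdim X; E = act X TE; K = act X TK in
     E \<in> carrier_mat n n \<and> K \<in> carrier_mat n n \<and>
     K ^\<^sub>m d = 1\<^sub>m n \<and> E ^\<^sub>m d = 0\<^sub>m n n \<and> K * E = \<zeta> \<cdot>\<^sub>m (E * K)}"

text \<open>Since \<open>K\<^sup>d = 1\<close>, the inverse of \<open>K\<close> is \<open>K\<^sup>d\<^sup>-\<^sup>1\<close>.\<close>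

definition double_modules :: "nat \<Rightarrow> complex \<Rightarrow> double_gen fdmod set" where
  "double_modules d \<zeta> = {X. let n = vdim X; E = act X DE; F = act X DF; K = act X DK; z = act X DZ in
     E \<in> carrier_mat n n \<and> F \<in> carrier_mat n n \<and> K \<in> carrier_mat n n \<and> z \<in> carrier_mat n n \<and>
     K ^\<^sub>m d = 1\<^sub>m n \<and> z ^\<^sub>m d = 1\<^sub>m n \<and> E ^\<^sub>m d = 0\<^sub>m n n \<and> F ^\<^sub>m d = 0\<^sub>m n n \<and>
     z * E = E * z \<and> z * F = F * z \<and> z * K = K * z \<and>
     K * E = \<zeta> \<cdot>\<^sub>m (E * K) \<and> K * F = inverse \<zeta> \<cdot>\<^sub>m (F * K) \<and>
     E * F - F * E = K - z * K ^\<^sub>m (d - 1)}"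

definition res_taft :: "double_gen fdmod \<Rightarrow> taft_gen fdmod" where
  "res_taft X = FDMod (vdim X) (\<lambda>g. case g of TE \<Rightarrow> act X DE | TK \<Rightarrow> act X DK)"

definition proj_B :: "nat \<Rightarrow> complex \<Rightarrow> double_gen fdmod set" where
  "proj_B d \<zeta> = {X \<in> double_modules d \<zeta>. projective (taft_modules d \<zeta>) (res_taft X)}"

definition kronecker :: "complex mat \<Rightarrow> complex mat \<Rightarrow> complex mat" where
  "kronecker A B = mat (dim_row A * dim_row B) (dim_col A * dim_col B)
     (\<lambda>(i, j). A $$ (i div dim_row B, j div dim_col B) * B $$ (i mod dim_row B, j mod dim_col B))"

text \<open>The tensor product of modules, through the comultiplication
  \<open>E \<mapsto> 1 \<otimes> E + E \<otimes> K\<close>, \<open>F \<mapsto> F \<otimes> 1 + z K\<^sup>-\<^sup>1 \<otimes> F\<close>, \<open>K \<mapsto> K \<otimes> K\<close>, \<open>z \<mapsto> z \<otimes> z\<close>,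
  and the trivial module, through the counit. With the Kronecker product, these are strictly
  associative and unital on the set of modules.\<close>

definition mod_tensor :: "nat \<Rightarrow> double_gen fdmod \<Rightarrow> double_gen fdmod \<Rightarrow> double_gen fdmod" where
  "mod_tensor d X Y = FDMod (vdim X * vdim Y) (\<lambda>g. case g of
       DE \<Rightarrow> kronecker (1\<^sub>m (vdim X)) (act Y DE) + kronecker (act X DE) (act Y DK)
     | DF \<Rightarrow> kronecker (act X DF) (1\<^sub>m (vdim Y)) + kronecker (act X DZ * act X DK ^\<^sub>m (d - 1)) (act Y DF)
     | DK \<Rightarrow> kronecker (act X DK) (act Y DK)
     | DZ \<Rightarrow> kronecker (act X DZ) (act Y DZ))"

definition trivial_mod :: "double_gen fdmod" where
  "trivial_mod = FDMod 1 (\<lambda>g. case g of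
       DE \<Rightarrow> 0\<^sub>m 1 1 | DF \<Rightarrow> 0\<^sub>m 1 1 | DK \<Rightarrow> 1\<^sub>m 1 | DZ \<Rightarrow> 1\<^sub>m 1)"

definition double_monoid :: "nat \<Rightarrow> complex \<Rightarrow> double_gen fdmod monoid" where
  "double_monoid d \<zeta> = \<lparr>carrier = double_modules d \<zeta>, mult = mod_tensor d, one = trivial_mod\<rparr>"


section \<open>Categories with a shift, triangles, Verdier quotients\<close>

text \<open>\<open>Comp T X Y Z g f\<close> is the composite of \<open>f : X \<rightarrow> Y\<close> and \<open>g : Y \<rightarrow> Z\<close>. \<open>Sh\<close> and \<open>ShM\<close> are
  the action of the shift functor on objects and on morphisms \<open>X \<rightarrow> Y\<close>.\<close>

record ('o, 'm) shift_category =
  Ob :: "'o set"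
  Mor :: "'o \<Rightarrow> 'o \<Rightarrow> 'm set"
  Id :: "'o \<Rightarrow> 'm"
  Comp :: "'o \<Rightarrow> 'o \<Rightarrow> 'o \<Rightarrow> 'm \<Rightarrow> 'm \<Rightarrow> 'm"
  Sh :: "'o \<Rightarrow> 'o"
  ShM :: "'o \<Rightarrow> 'o \<Rightarrow> 'm \<Rightarrow> 'm"

text \<open>The tuple \<open>(X, Y, Z, u, v, w)\<close> stands for the triangle \<open>X \<rightarrow> Y \<rightarrow> Z \<rightarrow> Sh X\<close>.\<close>

type_synonym ('o, 'm) triangle = "'o \<times> 'o \<times> 'o \<times> 'm \<times> 'm \<times> 'm"

definition is_iso :: "('o, 'm) shift_category \<Rightarrow> 'o \<Rightarrow> 'o \<Rightarrow> 'm \<Rightarrow> bool" where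
  "is_iso T X Y f \<longleftrightarrow> f \<in> Mor T X Y \<and>
     (\<exists>g\<in>Mor T Y X. Comp T X Y X g f = Id T X \<and> Comp T Y X Y f g = Id T Y)"

definition is_triangle :: "('o, 'm) shift_category \<Rightarrow> ('o, 'm) triangle \<Rightarrow> bool" where
  "is_triangle T = (\<lambda>(X, Y, Z, u, v, w). X \<in> Ob T \<and> Y \<in> Ob T \<and> Z \<in> Ob T \<and>
     u \<in> Mor T X Y \<and> v \<in> Mor T Y Z \<and> w \<in> Mor T Z (Sh T X))"

definition triangle_iso ::
  "('o, 'm) shift_category \<Rightarrow> ('o, 'm) triangle \<Rightarrow> ('o, 'm) triangle \<Rightarrow> bool" where
  "triangle_iso T = (\<lambda>(X, Y, Z, u, v, w) (X', Y', Z', u', v', w').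
     \<exists>a b c. is_iso T X X' a \<and> is_iso T Y Y' b \<and> is_iso T Z Z' c \<and>
       Comp T X Y Y' b u = Comp T X X' Y' u' a \<and>
       Comp T Y Z Z' c v = Comp T Y Y' Z' v' b \<and>
       Comp T Z (Sh T X) (Sh T X') (ShM T X X' a) w = Comp T Z Z' (Sh T X') w' c)"

text \<open>For a category \<open>T\<close> with distinguished triangles \<open>\<Delta>\<close> and a class \<open>N\<close> of objects (a thick
  subcategory), \<open>cone_in\<close> is the class of morphisms with cone in \<open>N\<close>, and the morphisms of the
  Verdier quotient are the equivalence classes of left fractions \<open>X \<leftarrow>s\<midarrow> W \<midarrow>f\<rightarrow> Y\<close> with \<open>s\<close> in
  that class.\<close>

definition cone_in ::
  "('o, 'm) triangle set \<Rightarrow> 'o set \<Rightarrow> 'o \<Rightarrow> 'o \<Rightarrow> 'm \<Rightarrow> bool" where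
  "cone_in \<Delta> N X Y s \<longleftrightarrow> (\<exists>Z v w. (X, Y, Z, s, v, w) \<in> \<Delta> \<and> Z \<in> N)"

definition roofs ::
  "('o, 'm) shift_category \<Rightarrow> ('o, 'm) triangle set \<Rightarrow> 'o set \<Rightarrow> 'o \<Rightarrow> 'o \<Rightarrow> ('o \<times> 'm \<times> 'm) set" where
  "roofs T \<Delta> N X Y = {(W, s, f). W \<in> Ob T \<and> s \<in> Mor T W X \<and> cone_in \<Delta> N W X s \<and> f \<in> Mor T W Y}"

definition roof_class ::
  "('o, 'm) shift_category \<Rightarrow> ('o, 'm) triangle set \<Rightarrow> 'o set \<Rightarrow> 'o \<Rightarrow> 'o
    \<Rightarrow> 'o \<times> 'm \<times> 'm \<Rightarrow> ('o \<times> 'm \<times> 'm) set" where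
  "roof_class T \<Delta> N X Y = (\<lambda>(W, s, f). {(W', s', f') \<in> roofs T \<Delta> N X Y.
     \<exists>V\<in>Ob T. \<exists>a\<in>Mor T V W. \<exists>b\<in>Mor T V W'.
       Comp T V W X s a = Comp T V W' X s' b \<and> Comp T V W Y f a = Comp T V W' Y f' b \<and>
       cone_in \<Delta> N V X (Comp T V W X s a)})"

text \<open>The composite of the fractions \<open>(W, s, f) : X \<rightarrow> Y\<close> and \<open>(W', t, g) : Y \<rightarrow> Z\<close> is formed with any
  commutative square \<open>f \<circ> a = t \<circ> b\<close> in which \<open>a\<close> has its cone in \<open>N\<close>. All choices give the same
  class, so the union below is that class.\<close>

definition roof_comp ::
  "('o, 'm) shift_category \<Rightarrow> ('o, 'm) triangle set \<Rightarrow> 'o set \<Rightarrow> 'o \<Rightarrow> 'o \<Rightarrow> 'o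
    \<Rightarrow> ('o \<times> 'm \<times> 'm) set \<Rightarrow> ('o \<times> 'm \<times> 'm) set \<Rightarrow> ('o \<times> 'm \<times> 'm) set" where
  "roof_comp T \<Delta> N X Y Z G F =
     \<Union>{roof_class T \<Delta> N X Z (V, Comp T V W X s a, Comp T V W' Z g b) | V W W' s f t g a b.
        (W, s, f) \<in> F \<and> (W', t, g) \<in> G \<and> V \<in> Ob T \<and> a \<in> Mor T V W \<and> cone_in \<Delta> N V W a \<and>
        b \<in> Mor T V W' \<and> Comp T V W Y f a = Comp T V W' Y t b}"

definition verdier_quotient ::
  "('o, 'm) shift_category \<Rightarrow> ('o, 'm) triangle set \<Rightarrow> 'o set
    \<Rightarrow> ('o, ('o \<times> 'm \<times> 'm) set) shift_category" where
  "verdier_quotient T \<Delta> N = \<lparr>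
     Ob = Ob T,
     Mor = (\<lambda>X Y. roof_class T \<Delta> N X Y ` roofs T \<Delta> N X Y),
     Id = (\<lambda>X. roof_class T \<Delta> N X X (X, Id T X, Id T X)),
     Comp = roof_comp T \<Delta> N,
     Sh = Sh T,
     ShM = (\<lambda>X Y F. \<Union>(W, s, f)\<in>F.
              roof_class T \<Delta> N (Sh T X) (Sh T Y) (Sh T W, ShM T W X s, ShM T W Y f))\<rparr>"

definition verdier_map ::
  "('o, 'm) shift_category \<Rightarrow> ('o, 'm) triangle set \<Rightarrow> 'o set \<Rightarrow> 'o \<Rightarrow> 'o \<Rightarrow> 'm
    \<Rightarrow> ('o \<times> 'm \<times> 'm) set" where
  "verdier_map T \<Delta> N X Y f = roof_class T \<Delta> N X Y (X, Id T X, f)"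

definition verdier_triangles ::
  "('o, 'm) shift_category \<Rightarrow> ('o, 'm) triangle set \<Rightarrow> 'o set
    \<Rightarrow> ('o, ('o \<times> 'm \<times> 'm) set) triangle set" where
  "verdier_triangles T \<Delta> N = {t. is_triangle (verdier_quotient T \<Delta> N) t \<and>
     (\<exists>X Y Z u v w. (X, Y, Z, u, v, w) \<in> \<Delta> \<and>
        triangle_iso (verdier_quotient T \<Delta> N) t
          (X, Y, Z, verdier_map T \<Delta> N X Y u, verdier_map T \<Delta> N Y Z v,
           verdier_map T \<Delta> N Z (Sh T X) w))}"


section \<open>The stable category\<close>

text \<open>This is used for modules of a self-injective algebra, where projective and injective modules
  agree.\<close>

definition factors_proj ::
  "'g fdmod set \<Rightarrow> 'g fdmod \<Rightarrow> 'g fdmod \<Rightarrow> complex mat \<Rightarrow> bool" where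
  "factors_proj C X Y f \<longleftrightarrow> (\<exists>P a b. projective C P \<and> fd_hom X P a \<and> fd_hom P Y b \<and> f = b * a)"

definition stab_class ::
  "'g fdmod set \<Rightarrow> 'g fdmod \<Rightarrow> 'g fdmod \<Rightarrow> complex mat \<Rightarrow> complex mat set" where
  "stab_class C X Y f = {g. fd_hom X Y g \<and> factors_proj C X Y (g - f)}"

text \<open>A chosen embedding of \<open>X\<close> into an injective module \<open>I\<close>, with cokernel \<open>S\<close>. This \<open>S\<close> is the
  shift of \<open>X\<close>.\<close>

definition inj_embedding ::
  "'g fdmod set \<Rightarrow> 'g fdmod \<Rightarrow> 'g fdmod \<times> 'g fdmod \<times> complex mat \<times> complex mat" where
  "inj_embedding C X = (SOME (I, S, i, p). injective C I \<and> short_exact C X I S i p)"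

definition stab_shift :: "'g fdmod set \<Rightarrow> 'g fdmod \<Rightarrow> 'g fdmod" where
  "stab_shift C X = (case inj_embedding C X of (I, S, i, p) \<Rightarrow> S)"

definition stab_shift_mor ::
  "'g fdmod set \<Rightarrow> 'g fdmod \<Rightarrow> 'g fdmod \<Rightarrow> complex mat set \<Rightarrow> complex mat set" where
  "stab_shift_mor C X Y F =
     (case inj_embedding C X of (I, S, i, p) \<Rightarrow> case inj_embedding C Y of (I', S', i', p') \<Rightarrow>
        {g. fd_hom S S' g \<and> (\<exists>f\<in>F. \<exists>h. fd_hom I I' h \<and> h * i = i' * f \<and> g * p = p' * h)})"

definition stab :: "'g fdmod set \<Rightarrow> ('g fdmod, complex mat set) shift_category" where
  "stab C = \<lparr>
     Ob = C,
     Mor = (\<lambda>X Y. stab_class C X Y ` {f. fd_hom X Y f}),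
     Id = (\<lambda>X. stab_class C X X (1\<^sub>m (vdim X))),
     Comp = (\<lambda>X Y Z G F. \<Union>g\<in>G. \<Union>f\<in>F. stab_class C X Z (g * f)),
     Sh = stab_shift C,
     ShM = stab_shift_mor C\<rparr>"

text \<open>The standard triangles come from the short exact sequences: extend \<open>X \<rightarrow> I\<close> to \<open>h : Y \<rightarrow> I\<close>
  and pass to the quotients. The sign is the one for which the triangles of mapping cones are
  distinguished.\<close>

definition standard_triangles :: "'g fdmod set \<Rightarrow> ('g fdmod, complex mat set) triangle set" where
  "standard_triangles C =
     {(X, Y, Z, stab_class C X Y u, stab_class C Y Z v, stab_class C Z S w) | X Y Z S u v w.
        short_exact C X Y Z u v \<and>
        (\<exists>I i p h. inj_embedding C X = (I, S, i, p) \<and> fd_hom Y I h \<and> fd_hom Z S w \<and>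
           h * u = i \<and> w * v = - (p * h))}"

definition stab_triangles :: "'g fdmod set \<Rightarrow> ('g fdmod, complex mat set) triangle set" where
  "stab_triangles C =
     {t. is_triangle (stab C) t \<and> (\<exists>t'\<in>standard_triangles C. triangle_iso (stab C) t t')}"


section \<open>Grothendieck rings\<close>

text \<open>The integral monoid ring on the free abelian group with basis \<open>carrier M\<close>.\<close>

definition int_monoid_ring :: "('a, 'b) monoid_scheme \<Rightarrow> ('a \<Rightarrow>\<^sub>0 int) ring" where
  "int_monoid_ring M = \<lparr>
     carrier = {c. Poly_Mapping.keys c \<subseteq> carrier M},
     mult = (\<lambda>a b. frag_extend (\<lambda>x. frag_extend (\<lambda>y. frag_of (x \<otimes>\<^bsub>M\<^esub> y)) b) a),
     one = frag_of \<one>\<^bsub>M\<^esub>,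
     zero = 0,
     add = (+)\<rparr>"

text \<open>The quotient by the additive subgroup generated by \<open>S\<close>. It is a ring if this subgroup is an
  ideal, as is the case in the uses below.\<close>

definition additive_span :: "('a, 'b) ring_scheme \<Rightarrow> 'a set \<Rightarrow> 'a set" where
  "additive_span R S = generate (add_monoid R) S"

text \<open>The relations \<open>[Y] = [X] + [Z]\<close> for the triples \<open>(X, Y, Z)\<close> of a set \<open>S\<close>.\<close>

definition additivity_relations :: "('a \<times> 'a \<times> 'a) set \<Rightarrow> ('a \<Rightarrow>\<^sub>0 int) set" where
  "additivity_relations S = {frag_of Y - (frag_of X + frag_of Z) | X Y Z. (X, Y, Z) \<in> S}"

definition Gr_rel :: "nat \<Rightarrow> complex \<Rightarrow> (double_gen fdmod \<Rightarrow>\<^sub>0 int) set" where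
  "Gr_rel d \<zeta> = additive_span (int_monoid_ring (double_monoid d \<zeta>))
     (additivity_relations {(X, Y, Z). \<exists>u v. short_exact (double_modules d \<zeta>) X Y Z u v})"

definition Gr :: "nat \<Rightarrow> complex \<Rightarrow> (double_gen fdmod \<Rightarrow>\<^sub>0 int) set ring" where
  "Gr d \<zeta> = int_monoid_ring (double_monoid d \<zeta>) Quot Gr_rel d \<zeta>"

definition stab_B_triangles ::
  "nat \<Rightarrow> complex \<Rightarrow>
    (double_gen fdmod, (double_gen fdmod \<times> complex mat set \<times> complex mat set) set) triangle set" where
  "stab_B_triangles d \<zeta> = (let C = double_modules d \<zeta> in
     verdier_triangles (stab C) (stab_triangles C) (proj_B d \<zeta>))"

definition Gr_stB_rel :: "nat \<Rightarrow> complex \<Rightarrow> (double_gen fdmod \<Rightarrow>\<^sub>0 int) set" where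
  "Gr_stB_rel d \<zeta> = additive_span (int_monoid_ring (double_monoid d \<zeta>))
     (additivity_relations {(X, Y, Z). \<exists>u v w. (X, Y, Z, u, v, w) \<in> stab_B_triangles d \<zeta>})"

definition Gr_stB :: "nat \<Rightarrow> complex \<Rightarrow> (double_gen fdmod \<Rightarrow>\<^sub>0 int) set ring" where
  "Gr_stB d \<zeta> = int_monoid_ring (double_monoid d \<zeta>) Quot Gr_stB_rel d \<zeta>"

text \<open>The natural map \<open>[M] \<mapsto> [M]\<close>: it sends a coset of \<open>Gr_rel\<close> to the coset of \<open>Gr_stB_rel\<close> that
  contains it.\<close>

definition Gr_to_stB ::
  "nat \<Rightarrow> complex \<Rightarrow> (double_gen fdmod \<Rightarrow>\<^sub>0 int) set \<Rightarrow> (double_gen fdmod \<Rightarrow>\<^sub>0 int) set" where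
  "Gr_to_stB d \<zeta> A = Gr_stB_rel d \<zeta> <+>\<^bsub>int_monoid_ring (double_monoid d \<zeta>)\<^esub> A"


section \<open>Characters\<close>

definition mat_trace :: "complex mat \<Rightarrow> complex" where
  "mat_trace A = (\<Sum>i<dim_row A. A $$ (i, i))"

definition lin_chi :: "nat \<times> nat \<Rightarrow> (double_gen fdmod \<Rightarrow>\<^sub>0 int) \<Rightarrow> complex" where
  "lin_chi = (\<lambda>(i, j) c. \<Sum>X\<in>Poly_Mapping.keys c.
     of_int (Poly_Mapping.lookup c X) * mat_trace (act X DK ^\<^sub>m i * act X DZ ^\<^sub>m j))"

text \<open>The trace is additive on short exact sequences, so \<open>lin_chi\<close> is constant on each element of
  \<open>Gr\<close>, and \<open>chi\<close> takes this value.\<close>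

definition chi :: "nat \<times> nat \<Rightarrow> (double_gen fdmod \<Rightarrow>\<^sub>0 int) set \<Rightarrow> complex" where
  "chi \<mu> A = the_elem (lin_chi \<mu> ` A)"

abbreviation complex_ring :: "complex ring" where
  "complex_ring \<equiv> class_ring"

text \<open>Maps are taken extensional on the carrier, so that equality of characters is equality of
  functions.\<close>

definition characters :: "('a, 'b) ring_scheme \<Rightarrow> ('a \<Rightarrow> complex) set" where
  "characters R = Ring.ring_hom R complex_ring \<inter> extensional (carrier R)"

text \<open>\<open>\<int>/d \<times> \<int>/d\<close>, by representatives.\<close>

definition Lam :: "nat \<Rightarrow> (nat \<times> nat) set" where
  "Lam d = {0..<d} \<times> {0..<d}"

definition Lam_sharp :: "nat \<Rightarrow> (nat \<times> nat) set" where
  "Lam_sharp d = {(l, p) \<in> Lam d. l \<noteq> 0}"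

definition iota :: "nat \<Rightarrow> nat \<times> nat \<Rightarrow> nat \<times> nat" where
  "iota d = (\<lambda>(l, p). ((d - l) mod d, (p + l) mod d))"

definition orbit_representatives :: "nat \<Rightarrow> (nat \<times> nat) set \<Rightarrow> bool" where
  "orbit_representatives d R \<longleftrightarrow>
     R \<subseteq> Lam_sharp d \<and> (\<forall>\<mu>\<in>Lam_sharp d. \<exists>!\<nu>. \<nu> \<in> R \<and> (\<nu> = \<mu> \<or> \<nu> = iota d \<mu>))"


section \<open>Tensor products over the integers and semisimplicity\<close>

definition tensor_relations ::
  "('a, 'c) ring_scheme \<Rightarrow> ('b, 'd) ring_scheme \<Rightarrow> ('a \<times> 'b \<Rightarrow>\<^sub>0 int) set" where
  "tensor_relations R S =
     {frag_of (a \<oplus>\<^bsub>R\<^esub> a', b) - (frag_of (a, b) + frag_of (a', b)) | a a' b.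
        a \<in> carrier R \<and> a' \<in> carrier R \<and> b \<in> carrier S} \<union>
     {frag_of (a, b \<oplus>\<^bsub>S\<^esub> b') - (frag_of (a, b) + frag_of (a, b')) | a b b'.
        a \<in> carrier R \<and> b \<in> carrier S \<and> b' \<in> carrier S}"

text \<open>The ring \<open>R \<otimes>\<^sub>\<int> S\<close>, with \<open>(a \<otimes> b)(a' \<otimes> b') = aa' \<otimes> bb'\<close>.\<close>

definition tensor_ring ::
  "('a, 'c) ring_scheme \<Rightarrow> ('b, 'd) ring_scheme \<Rightarrow> ('a \<times> 'b \<Rightarrow>\<^sub>0 int) set ring" where
  "tensor_ring R S = int_monoid_ring (R \<times>\<times> S) Quot
     additive_span (int_monoid_ring (R \<times>\<times> S)) (tensor_relations R S)"

definition left_ideal :: "'a set \<Rightarrow> ('a, 'b) ring_scheme \<Rightarrow> bool" where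
  "left_ideal I R \<longleftrightarrow> additive_subgroup I R \<and> (\<forall>r\<in>carrier R. \<forall>x\<in>I. r \<otimes>\<^bsub>R\<^esub> x \<in> I)"

text \<open>The left regular module is semisimple: every submodule is a direct summand.\<close>

definition semisimple_ring :: "('a, 'b) ring_scheme \<Rightarrow> bool" where
  "semisimple_ring R \<longleftrightarrow> ring R \<and>
     (\<forall>I. left_ideal I R \<longrightarrow>
        (\<exists>J. left_ideal J R \<and> I \<inter> J = {\<zero>\<^bsub>R\<^esub>} \<and> I <+>\<^bsub>R\<^esub> J = carrier R))"

end

theory Submission
  imports Defs
begin

text \<open>For a linear map \<open>T\<close> put \<open>TrE T = \<Sum>i<d. E\<^sup>i T E\<^sup>d\<^sup>-\<^sup>1\<^sup>-\<^sup>i\<close>. A module is projective over \<open>B\<close> if and only if its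
  identity has the form \<open>TrE T\<close>, where \<open>T\<close> commutes with \<open>z\<close> and has weight \<open>\<zeta>\<close> under \<open>K\<close>, and a morphism
  becomes invertible in the Verdier quotient if and only if it is invertible, as a map that commutes with
  \<open>E\<close>, \<open>K\<close>, \<open>z\<close>, modulo such maps. For \<open>l \<noteq> 0\<close> the trace of \<open>K\<^sup>l z\<^sup>p\<close> against \<open>TrE T\<close> vanishes, so \<open>\<chi>\<^sub>l\<^sub>,\<^sub>p\<close> is
  additive on the triangles of the quotient. For \<open>l = 0\<close> it does not vanish on a \<open>B\<close>-projective module.

  Every module is filtered by lowest weight modules of length \<open>n \<le> d\<close>. Those of length \<open>d\<close> are projective
  over \<open>B\<close>. The others are paired, lengths \<open>n\<close> and \<open>d - n\<close>, as quotient and kernel of one of length \<open>d\<close>, so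
  that their classes are opposite. By Fourier inversion on \<open>(\<int>/d)\<^sup>2\<close>, a combination of such classes that is
  killed by all \<open>\<chi>\<^sub>l\<^sub>,\<^sub>p\<close> with \<open>l \<noteq> 0\<close> is a consequence of these relations. Hence the Grothendieck ring of the
  quotient, and likewise its tensor product with \<open>\<complex>\<close>, is a ring of functions on the finite set of these
  \<open>(l, p)\<close>; the description of the characters and the semisimplicity follow.\<close>

section \<open>A ring containing all matrices\<close>

text \<open>The obstacle is that the quotient is defined by roofs of maps of the double, while
  invertibility in it is governed by maps that commute with \<open>E\<close>, \<open>K\<close>,
  \<open>z\<close> only and need not be maps of the double. Both kinds of map live in one operator
  ring and are compared through two ideals, \<open>nD\<close> for the double and \<open>nE\<close>
  for the smaller algebra, which have the same formal properties. These properties have one source: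
  truncated polynomials in \<open>E\<close> form a Frobenius algebra with dual bases
  \<open>E^i\<close> and \<open>E^(d-1-i)\<close>, so that relative traces can stand for
  projectivity (Higman's criterion), and averaging over the finite group generated by
  \<open>K\<close> and \<open>z\<close> splits every surjection. The generator \<open>z\<close> is
  kept among those to be respected because averaging over it is harmless and the traces of
  \<open>K^l z^p\<close> call for maps that commute with it. The relations of the quotient ring are
  given as an additive subgroup only; that they form an ideal with a commutative quotient comes out
  of their equality with a common kernel of characters.\<close>

text \<open>Matrices of all sizes are embedded in the single ring of linear operators on \<open>nat \<Rightarrow> complex\<close>, so
  that identities between products of matrices become identities in a ring. The identity matrix of
  size \<open>n\<close> becomes the idempotent \<open>un n\<close>.\<close>

typedef lop = "{f :: (nat \<Rightarrow> complex) \<Rightarrow> nat \<Rightarrow> complex.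
    (\<forall>x y. f (\<lambda>i. x i + y i) = (\<lambda>i. f x i + f y i)) \<and> (\<forall>c x. f (\<lambda>i. c * x i) = (\<lambda>i. c * f x i))}"
  morphisms app Lop
  by (rule exI[of _ "\<lambda>x i. 0"]) auto

setup_lifting type_definition_lop

instantiation lop :: ring_1
begin
lift_definition zero_lop :: lop is "\<lambda>x i. 0" by auto
lift_definition one_lop :: lop is "\<lambda>x. x" by auto
lift_definition plus_lop :: "lop \<Rightarrow> lop \<Rightarrow> lop" is "\<lambda>f g x i. f x i + g x i"
  by (auto simp: fun_eq_iff algebra_simps)
lift_definition minus_lop :: "lop \<Rightarrow> lop \<Rightarrow> lop" is "\<lambda>f g x i. f x i - g x i"
  by (auto simp: fun_eq_iff algebra_simps)
lift_definition uminus_lop :: "lop \<Rightarrow> lop" is "\<lambda>f x i. - f x i"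
  by (auto simp: fun_eq_iff algebra_simps)
lift_definition times_lop :: "lop \<Rightarrow> lop \<Rightarrow> lop" is "\<lambda>f g x. f (g x)"
  by simp
lemma app_plus: "app f (\<lambda>i. x i + y i) = (\<lambda>i. app f x i + app f y i)"
  and app_scale: "app f (\<lambda>i. c * x i) = (\<lambda>i. c * app f x i)"
  using app[of f] by auto

instance
proof
  fix a b c :: lop
  have eqI: "S = T" if "app S = app T" for S T using that by (simp add: app_inject)
  note r = times_lop.rep_eq plus_lop.rep_eq minus_lop.rep_eq uminus_lop.rep_eq zero_lop.rep_eq one_lop.rep_eq
  show "a * b * c = a * (b * c)" "1 * a = a" "a * 1 = a" by (rule eqI, simp add: r)+
  show "a + b + c = a + (b + c)" "a + b = b + a" "0 + a = a" "- a + a = 0" "a - b = a + - b"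
    by (rule eqI, simp add: r algebra_simps)+
  show "(a + b) * c = a * c + b * c" by (rule eqI) (simp add: r)
  show "a * (b + c) = a * b + a * c" by (rule eqI) (simp add: r app_plus)
  show "(0::lop) \<noteq> 1"
  proof
    assume "(0::lop) = 1"
    then have "app 0 (\<lambda>i. 1) = app 1 (\<lambda>i. 1)" by simp
    then show False by (simp add: r fun_eq_iff)
  qed
qed
end

lift_definition cs :: "complex \<Rightarrow> lop" is "\<lambda>c x i. c * x i" by (auto simp: fun_eq_iff algebra_simps)
lift_definition un :: "nat \<Rightarrow> lop" is "\<lambda>n x i. if i < n then x i else 0" by (auto simp: fun_eq_iff)
lift_definition eu :: "nat \<Rightarrow> nat \<Rightarrow> lop" is "\<lambda>i j x k. if k = i then x j else 0" by (auto simp: fun_eq_iff)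
lift_definition lop_of :: "nat \<Rightarrow> nat \<Rightarrow> (nat \<Rightarrow> nat \<Rightarrow> complex) \<Rightarrow> lop" is
  "\<lambda>n m a x i. if i < n then \<Sum>j<m. a i j * x j else 0"
  by (auto simp: fun_eq_iff algebra_simps sum.distrib sum_distrib_left)

lemma cs_left: "T * (cs c * S) = cs c * (T * S)" by transfer auto
lemma cs_add: "cs (a + b) = cs a + cs b" by transfer (auto simp: algebra_simps)
lemma cs_mult: "cs (a * b) = cs a * cs b" by transfer (auto simp: algebra_simps)
lemma cs_diff: "cs (a - b) = cs a - cs b" by transfer (auto simp: algebra_simps)
lemma cs_0 [simp]: "cs 0 = 0" by transfer auto
lemma cs_1 [simp]: "cs 1 = 1" by transfer auto
lemma cs_minus: "cs (- a) = - cs a" by transfer auto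
lemma cs_sum: "cs (sum f A) = (\<Sum>x\<in>A. cs (f x))"
  by (induction A rule: infinite_finite_induct) (auto simp: cs_add)
lemma cs_cs: "cs a * (cs b * T) = cs (a * b) * T" by (simp add: cs_mult mult.assoc)
lemma cs_cancel: "c \<noteq> 0 \<Longrightarrow> cs (1 / c) * (cs c * T) = T" by (simp add: cs_cs)
lemma cs_of_nat: "cs (of_nat n) = of_nat n" by (induction n) (auto simp: cs_add)

text \<open>Products are kept nested to the right, where a known value of \<open>a * b\<close> is
  hidden inside \<open>a * (b * z)\<close>; these two forms make such an equation usable within a
  longer product.\<close>

lemma assoc2: fixes a :: "'a::semigroup_mult" shows "a * b = c \<Longrightarrow> a * (b * z) = c * z"
  by (simp add: mult.assoc[symmetric])
lemma assoc3: fixes a :: "'a::semigroup_mult" shows "a * (b * c) = e \<Longrightarrow> a * (b * (c * z)) = e * z"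
  by (simp add: mult.assoc[symmetric])

section \<open>Entries, and the passage between matrices and operators\<close>

definition ent :: "lop \<Rightarrow> nat \<Rightarrow> nat \<Rightarrow> complex" where
  "ent T i j = app T (\<lambda>k. if k = j then 1 else 0) i"

definition L :: "complex mat \<Rightarrow> lop" where
  "L A = lop_of (dim_row A) (dim_col A) (\<lambda>i j. A $$ (i, j))"

text \<open>An operator does not remember a size, so the way back to matrices needs the format. On
  operators with \<open>bt n m\<close> the maps \<open>L\<close> and \<open>Mt n m\<close> are
  inverse to each other.\<close>

definition Mt :: "nat \<Rightarrow> nat \<Rightarrow> lop \<Rightarrow> complex mat" where
  "Mt n m T = mat n m (\<lambda>(i, j). ent T i j)"

text \<open>\<open>bt n m T\<close> says that \<open>T\<close> is an \<open>n \<times> m\<close> matrix.\<close>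

definition bt :: "nat \<Rightarrow> nat \<Rightarrow> lop \<Rightarrow> bool" where
  "bt n m T \<longleftrightarrow> un n * T = T \<and> T * un m = T"

lemma bt_unl: "bt n m T \<Longrightarrow> un n * T = T" and bt_unr: "bt n m T \<Longrightarrow> T * un m = T"
  by (auto simp: bt_def)

lemma bt_unl': "bt n m T \<Longrightarrow> un n * (T * S) = T * S" and bt_unr': "bt n m T \<Longrightarrow> T * (un m * S) = T * S"
  by (auto simp: bt_def mult.assoc[symmetric])

lemma un_un: "un n * un m = un (min n m)" by transfer (auto simp: fun_eq_iff)

lemma un_0 [simp]: "un 0 = 0" by transfer auto

lemma bt_un [simp, intro]: "bt n n (un n)" by (simp add: bt_def un_un)
lemma bt_zero [simp, intro]: "bt n m 0" by (simp add: bt_def)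
lemma bt_add [intro]: "bt n m S \<Longrightarrow> bt n m T \<Longrightarrow> bt n m (S + T)" by (simp add: bt_def algebra_simps)
lemma bt_diff [intro]: "bt n m S \<Longrightarrow> bt n m T \<Longrightarrow> bt n m (S - T)" by (simp add: bt_def algebra_simps)
lemma bt_uminus [intro]: "bt n m T \<Longrightarrow> bt n m (- T)" by (simp add: bt_def)
lemma bt_mult [intro]: "bt n k S \<Longrightarrow> bt k m T \<Longrightarrow> bt n m (S * T)"
  unfolding bt_def by (metis mult.assoc)
lemma bt_sum [intro]: "(\<And>x. x \<in> A \<Longrightarrow> bt n m (f x)) \<Longrightarrow> bt n m (\<Sum>x\<in>A. f x)"
  by (induction A rule: infinite_finite_induct) auto
lemma bt_cs [intro]: "bt n m T \<Longrightarrow> bt n m (cs c * T)"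
  by (auto simp: bt_def cs_left[of "un n"] mult.assoc)
lemma bt_powl [intro]: "bt n n S \<Longrightarrow> bt n m T \<Longrightarrow> bt n m (S ^ i * T)"
  by (induction i) (auto simp: mult.assoc)
lemma bt_powr [intro]: "bt m m S \<Longrightarrow> bt n m T \<Longrightarrow> bt n m (T * S ^ i)"
  by (induction i) (auto simp: mult.assoc[symmetric] power_Suc2 simp del: power_Suc)
lemma bt_pow [intro]: "bt n n S \<Longrightarrow> 0 < i \<Longrightarrow> bt n n (S ^ i)"
  using bt_powl[of n S n S "i - 1"] by (cases i) (auto simp: power_Suc2 simp del: power_Suc)

lemma eu_eu: "eu i j * eu k l = (if j = k then eu i l else 0)"
  by transfer (auto simp: fun_eq_iff)
lemma un_eu: "un n * eu i j = (if i < n then eu i j else 0)" by transfer (auto simp: fun_eq_iff)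
lemma eu_un: "eu i j * un n = (if j < n then eu i j else 0)" by transfer (auto simp: fun_eq_iff)
lemma bt_eu [intro]: "i < n \<Longrightarrow> j < m \<Longrightarrow> bt n m (eu i j)" by (simp add: bt_def un_eu eu_un)
lemma un_Suc: "un (Suc n) = un n + eu n n" by transfer (auto simp: fun_eq_iff)
lemma un_sum: "un n = (\<Sum>i<n. eu i i)" by (induction n) (auto simp: un_Suc)

lemma app_sum: "app T (\<lambda>i. \<Sum>x\<in>A. c x * f x i) = (\<lambda>i. \<Sum>x\<in>A. c x * app T (f x) i)"
proof (induction A rule: infinite_finite_induct)
  case (insert a A)
  have "app T (\<lambda>i. \<Sum>x\<in>insert a A. c x * f x i) = app T (\<lambda>i. (\<lambda>i. c a * f a i) i + (\<lambda>i. \<Sum>x\<in>A. c x * f x i) i)"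
    using insert by simp
  also have "\<dots> = (\<lambda>i. app T (\<lambda>i. c a * f a i) i + app T (\<lambda>i. \<Sum>x\<in>A. c x * f x i) i)"
    by (rule app_plus)
  also have "app T (\<lambda>i. c a * f a i) = (\<lambda>i. c a * app T (f a) i)" by (rule app_scale)
  finally show ?case using insert by simp
next
  case empty
  have "app T (\<lambda>i. 0 * 0) = (\<lambda>i. 0 * app T (\<lambda>i. 0) i)" by (rule app_scale)
  then show ?case by simp
next
  case (infinite A)
  have "app T (\<lambda>i. 0 * 0) = (\<lambda>i. 0 * app T (\<lambda>i. 0) i)" by (rule app_scale)
  then show ?case using infinite by simp
qed

text \<open>The space of all sequences has no finite basis, but \<open>T * un m = T\<close> cuts the
  argument down to a finite combination of unit vectors, on which \<open>T\<close> is given by its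
  entries.\<close>

lemma app_expand:
  assumes "T * un m = T" shows "app T x i = (\<Sum>j<m. ent T i j * x j)"
proof -
  have e: "(\<lambda>i. if i < m then x i else 0) = (\<lambda>i. \<Sum>j<m. x j * (if i = j then 1 else 0))"
    by (auto simp: fun_eq_iff if_distrib cong: if_cong)
  have "app T x = app (T * un m) x" using assms by simp
  also have "\<dots> = app T (\<lambda>i. \<Sum>j<m. x j * (if i = j then 1 else 0))"
    by (simp add: times_lop.rep_eq un.rep_eq e)
  also have "\<dots> = (\<lambda>i. \<Sum>j<m. x j * ent T i j)"
    by (subst app_sum) (simp add: ent_def)
  finally show ?thesis by (simp add: mult.commute)
qed

lemma lop_eqI:
  assumes "bt n m S" "bt n m T" "\<And>i j. i < n \<Longrightarrow> j < m \<Longrightarrow> ent S i j = ent T i j"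
  shows "S = T"
proof -
  have "app S x i = app T x i" for x i
  proof (cases "i < n")
    case True then show ?thesis using assms by (simp add: app_expand[of _ m] bt_def)
  next
    case False
    have "app R x i = 0" if "bt n m R" for R
    proof -
      have "app R x i = app (un n * R) x i" using that by (simp add: bt_def)
      then show ?thesis using False by (simp add: times_lop.rep_eq un.rep_eq)
    qed
    then show ?thesis using assms by simp
  qed
  then show ?thesis by (metis app_inject ext)
qed

lemma ent_lop_of: "i < n \<Longrightarrow> j < m \<Longrightarrow> ent (lop_of n m a) i j = a i j"
  by (simp add: ent_def lop_of.rep_eq if_distrib cong: if_cong)
lemma ent_0: "ent 0 i j = 0" by (simp add: ent_def zero_lop.rep_eq)
lemma ent_add: "ent (S + T) i j = ent S i j + ent T i j" by (simp add: ent_def plus_lop.rep_eq)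
lemma ent_diff: "ent (S - T) i j = ent S i j - ent T i j" by (simp add: ent_def minus_lop.rep_eq)
lemma ent_uminus: "ent (- T) i j = - ent T i j" by (simp add: ent_def uminus_lop.rep_eq)
lemma ent_cs: "ent (cs c * T) i j = c * ent T i j" by (simp add: ent_def times_lop.rep_eq cs.rep_eq)
lemma ent_sum: "ent (sum f A) i j = (\<Sum>x\<in>A. ent (f x) i j)"
  by (induction A rule: infinite_finite_induct) (auto simp: ent_0 ent_add)
lemma ent_un: "ent (un n) i j = (if i < n \<and> i = j then 1 else 0)" by (auto simp: ent_def un.rep_eq)
lemma ent_eu: "ent (eu a b) i j = (if i = a \<and> j = b then 1 else 0)" by (auto simp: ent_def eu.rep_eq)
lemma ent_mult: "S * un m = S \<Longrightarrow> ent (S * T) i k = (\<Sum>j<m. ent S i j * ent T j k)"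
  by (simp add: ent_def[of "S * T"] times_lop.rep_eq app_expand[of S m]) (simp add: ent_def)
lemma ent_mult_eu: "ent (T * eu a b) i j = (if j = b then ent T i a else 0)"
proof -
  have z: "app T (\<lambda>k. 0) i = 0" using app_sum[of T "\<lambda>_. 0" "\<lambda>_ _. 0" "{}"] by (simp add: fun_eq_iff)
  show ?thesis
  proof (cases "j = b")
    case True then show ?thesis by (simp add: ent_def times_lop.rep_eq eu.rep_eq)
  next
    case False
    then have "(\<lambda>k. if k = a then (if b = j then 1 else 0) else (0::complex)) = (\<lambda>k. 0)" by auto
    then show ?thesis using False z by (simp add: ent_def times_lop.rep_eq eu.rep_eq)
  qed
qed
text \<open>Compression by matrix units isolates one entry as a scalar; this turns a nonzero entry
  into a pivot in the rank factorization.\<close>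

lemma eu_T_eu: "eu i j * (T * eu k l) = cs (ent T j k) * eu i l"
proof -
  have "app (eu i j * (T * eu k l)) x a = app (cs (ent T j k) * eu i l) x a" for x a
  proof -
    have "app T (\<lambda>m. if m = k then x l else 0) j = x l * ent T j k"
      using app_sum[of T "\<lambda>_. x l" "\<lambda>_ m. if m = k then 1 else 0" "{0::nat}"]
      by (simp add: fun_eq_iff ent_def if_distrib cong: if_cong)
    then show ?thesis by (simp add: times_lop.rep_eq eu.rep_eq cs.rep_eq)
  qed
  then show ?thesis by (metis app_inject ext)
qed

lemma bt_lop_of: "bt n m (lop_of n m a)"
  unfolding bt_def by transfer (auto simp: fun_eq_iff intro!: sum.cong)
lemma bt_L: "A \<in> carrier_mat n m \<Longrightarrow> bt n m (L A)"
  using bt_lop_of by (auto simp: L_def)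
lemma ent_L: "A \<in> carrier_mat n m \<Longrightarrow> i < n \<Longrightarrow> j < m \<Longrightarrow> ent (L A) i j = A $$ (i, j)"
  by (auto simp: L_def ent_lop_of)
lemma Mt_carrier [simp]: "Mt n m T \<in> carrier_mat n m" by (simp add: Mt_def)
lemma L_Mt: "bt n m T \<Longrightarrow> L (Mt n m T) = T"
  by (rule lop_eqI[of n m]) (auto intro: bt_L simp: ent_L[of _ n m] Mt_def)
lemma Mt_L: "A \<in> carrier_mat n m \<Longrightarrow> Mt n m (L A) = A"
  by (rule eq_matI) (auto simp: Mt_def ent_L[of _ n m])
lemma L_inj: "A \<in> carrier_mat n m \<Longrightarrow> B \<in> carrier_mat n m \<Longrightarrow> L A = L B \<longleftrightarrow> A = B"
  by (metis Mt_L)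
lemma L_mult:
  assumes "A \<in> carrier_mat n k" "B \<in> carrier_mat k m" shows "L (A * B) = L A * L B"
proof (rule lop_eqI[of n m])
  show "bt n m (L (A * B))" using assms by (auto intro: bt_L)
  show "bt n m (L A * L B)" using assms by (auto intro: bt_L)
  fix i j assume ij: "i < n" "j < m"
  have c: "A * B \<in> carrier_mat n m" using assms by simp
  show "ent (L (A * B)) i j = ent (L A * L B) i j"
    using assms ij bt_L[OF assms(1)]
    by (subst ent_mult[of _ k]) (auto simp: bt_def ent_L[OF c] ent_L[OF assms(1)] ent_L[OF assms(2)]
      scalar_prod_def lessThan_atLeast0)
qed
lemma L_add: "A \<in> carrier_mat n m \<Longrightarrow> B \<in> carrier_mat n m \<Longrightarrow> L (A + B) = L A + L B"
  by (rule lop_eqI[of n m]) (auto intro!: bt_L bt_add simp: ent_add ent_L[of _ n m])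
lemma L_diff: "A \<in> carrier_mat n m \<Longrightarrow> B \<in> carrier_mat n m \<Longrightarrow> L (A - B) = L A - L B"
  by (rule lop_eqI[of n m]) (auto intro!: bt_L bt_diff minus_carrier_mat simp: ent_diff ent_L[of _ n m] ent_L[OF minus_carrier_mat])
lemma L_uminus: "A \<in> carrier_mat n m \<Longrightarrow> L (- A) = - L A"
  by (rule lop_eqI[of n m]) (auto intro!: bt_L bt_uminus simp: ent_uminus ent_L[of _ n m])
lemma L_smult: "A \<in> carrier_mat n m \<Longrightarrow> L (c \<cdot>\<^sub>m A) = cs c * L A"
  by (rule lop_eqI[of n m]) (auto intro!: bt_L bt_cs simp: ent_cs ent_L[of _ n m])
lemma L_one: "L (1\<^sub>m n) = un n"
  by (rule lop_eqI[of n n]) (auto intro!: bt_L simp: ent_un ent_L[of _ n n])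
lemma L_zero: "L (0\<^sub>m n m) = 0"
  by (rule lop_eqI[of n m]) (auto intro!: bt_L simp: ent_0 ent_L[of _ n m])
lemma L_pow: "A \<in> carrier_mat n n \<Longrightarrow> L (A ^\<^sub>m k) = un n * L A ^ k"
proof (induction k)
  case 0 then show ?case using L_one[of n] by simp
next
  case (Suc k)
  then have "L (A ^\<^sub>m Suc k) = L (A ^\<^sub>m k) * L A" by (simp add: L_mult[of _ n n _ n])
  then show ?case using Suc by (simp add: mult.assoc power_Suc2 del: power_Suc)
qed
lemma un_pow: "bt n n T \<Longrightarrow> 0 < k \<Longrightarrow> un n * T ^ k = T ^ k"
  using bt_pow bt_unl by blast

section \<open>Traces of square operators\<close>

definition tr :: "nat \<Rightarrow> lop \<Rightarrow> complex" where "tr n T = (\<Sum>i<n. ent T i i)"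

lemma tr_L: "A \<in> carrier_mat n n \<Longrightarrow> tr n (L A) = mat_trace A"
  by (auto simp: tr_def mat_trace_def ent_L[of A n n] intro!: sum.cong)
lemma tr_comm: "bt n m S \<Longrightarrow> bt m n T \<Longrightarrow> tr n (S * T) = tr m (T * S)"
  by (simp add: tr_def ent_mult[of S m] ent_mult[of T n] bt_def) (subst sum.swap, simp add: mult.commute)
lemma tr_add: "tr n (S + T) = tr n S + tr n T" by (simp add: tr_def ent_add sum.distrib)
lemma tr_diff: "tr n (S - T) = tr n S - tr n T" by (simp add: tr_def ent_diff sum_subtractf)
lemma tr_cs: "tr n (cs c * T) = c * tr n T" by (simp add: tr_def ent_cs sum_distrib_left)
lemma tr_sum: "tr n (sum f A) = (\<Sum>x\<in>A. tr n (f x))"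
  by (simp add: tr_def ent_sum) (rule sum.swap)
lemma tr_0: "tr n 0 = 0" by (simp add: tr_def ent_0)
lemma tr_un: "tr n (un n) = of_nat n" by (simp add: tr_def ent_un)

text \<open>Induction on the number of nonzero columns, removing one pivot at a time. The one-sided
  inverses \<open>a'\<close> and \<open>b'\<close> express that \<open>a\<close> and
  \<open>b\<close> have full rank \<open>k\<close>; they stand in for bases and dimensions in what
  follows.\<close>

lemma rank_factorization:
  assumes "bt n m T"
  shows "\<exists>k a a' b b'. bt n k a \<and> bt k n a' \<and> bt k m b \<and> bt m k b' \<and> T = a * b \<and> a' * a = un k \<and> b * b' = un k"
  using assms
proof (induction "card {j\<in>{..<m}. T * eu j j \<noteq> 0}" arbitrary: T rule: less_induct)
  case less
  show ?case
  proof (cases "T = 0")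
    case True
    then show ?thesis by (intro exI[of _ 0]) auto
  next
    case False
    then obtain i j where ij: "i < n" "j < m" "ent T i j \<noteq> 0"
      using lop_eqI[OF less.prems bt_zero] by (auto simp: ent_0)
    \<comment> \<open>\<open>g\<close> is a generalized inverse at the pivot,
      \<open>g * T * g = g\<close>. The rank one correction \<open>T - T * g * T\<close> kills
      column \<open>j\<close> and keeps every zero column zero, so the number of nonzero columns
      drops.\<close>
    define g where "g = cs (1 / ent T i j) * eu j i"
    have btg: "bt m n g" using ij by (auto simp: g_def)
    define T1 where "T1 = T - T * g * T"
    have T1: "bt n m T1" using less.prems btg by (auto simp: T1_def)
    have gTe: "g * (T * eu j l) = eu j l" for l
      using ij by (simp add: g_def mult.assoc eu_T_eu cs_cs)
    have Tg: "T1 * eu j j = 0" by (simp add: T1_def algebra_simps gTe)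
    have zero: "T1 * eu l l = 0" if "T * eu l l = 0" for l
      using that by (simp add: T1_def algebra_simps)
    have ne: "T * eu j j \<noteq> 0"
    proof
      assume "T * eu j j = 0"
      then have "ent (T * eu j j) i j = 0" by (simp add: ent_0)
      then show False using ij by (simp add: ent_mult_eu)
    qed
    have "card {j\<in>{..<m}. T1 * eu j j \<noteq> 0} < card {j\<in>{..<m}. T * eu j j \<noteq> 0}"
      using zero ne Tg ij by (intro psubset_card_mono) auto
    from less.hyps[OF this T1] obtain k a a' b b' where IH: "bt n k a" "bt k n a'" "bt k m b" "bt m k b'"
      "T1 = a * b" "a' * a = un k" "b * b' = un k" by blast
    \<comment> \<open>Since \<open>x * y = g\<close>, the removed part splits as
      \<open>(T * x) * (y * T)\<close>: the new column of \<open>a\<close> and the new row of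
      \<open>b\<close>, in position \<open>k\<close>.\<close>
    define x where "x = eu j k"
    define y where "y = cs (1 / ent T i j) * eu k i"
    have xy: "x * y = g" by (simp add: x_def y_def g_def cs_left[of "eu j k"] eu_eu)
    have yTx: "y * (T * x) = eu k k" using ij by (simp add: x_def y_def mult.assoc eu_T_eu cs_cs)
    have gTx: "g * (T * x) = x" using gTe by (simp add: x_def)
    have yTg: "y * (T * g) = y"
      using ij by (simp add: g_def y_def mult.assoc cs_left[of T] cs_left[of "eu k i"] eu_T_eu cs_cs)
    have gTg: "g * (T * g) = g"
      using ij by (simp add: g_def mult.assoc cs_left[of T] cs_left[of "eu j i"] eu_T_eu cs_cs)
    have xk: "x * un k = 0" "un k * y = 0" by (auto simp: x_def y_def eu_un cs_left[of "un k"] un_eu)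
    have ga: "T1 * g = 0" "g * T1 = 0" "y * T1 = 0" "T1 * x = 0"
      by (auto simp: T1_def algebra_simps gTg gTx yTg assoc3[OF gTg] assoc3[OF yTg])
    have a: "a = T1 * b'" and b: "b = a' * T1" using IH by (auto simp: mult.assoc bt_unr assoc2[OF IH(6)] bt_unl)
    have z: "g * a = 0" "y * a = 0" "b * g = 0" "b * x = 0" using ga by (simp_all add: a b mult.assoc assoc2[OF ga(2)] assoc2[OF ga(3)])
    have "a * (un k * y) = 0" "(x * un k) * b = 0" using xk by auto
    then have z2: "a * y = 0" "x * b = 0" using IH by (auto simp: mult.assoc bt_unr' bt_unl)
    have btx: "bt m (Suc k) x" "bt (Suc k) n y" using ij by (auto simp: x_def y_def)
    have up: "bt n (Suc k) a" "bt (Suc k) n a'" "bt (Suc k) m b" "bt m (Suc k) b'"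
    proof -
      have "un (Suc k) * un k = un k" "un k * un (Suc k) = un k" by (auto simp: un_un)
      then show "bt n (Suc k) a" "bt (Suc k) n a'" "bt (Suc k) m b" "bt m (Suc k) b'"
        using IH(1-4) unfolding bt_def by (metis mult.assoc)+
    qed
    have r1: "bt n (Suc k) (a + T * x)" and r3: "bt (Suc k) m (b + y * T)" using up btx less.prems by auto
    \<comment> \<open>The old inverses are corrected by \<open>1 - T * g\<close> and
      \<open>1 - g * T\<close>, which annihilate the new column and the new row.\<close>
    have "bt (Suc k) n (a' - a' * T * g + y)" "bt m (Suc k) (b' - g * T * b' + x)"
      using up btx less.prems btg by auto
    then have r2: "bt (Suc k) n (a' * (1 - T * g) + y)" and r4: "bt m (Suc k) ((1 - g * T) * b' + x)"
      by (auto simp: algebra_simps)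
    have "a * b + T * g * T = T" by (simp add: IH(5)[symmetric] T1_def)
    then have r5: "T = (a + T * x) * (b + y * T)"
      by (simp add: algebra_simps assoc2[OF xy] z2 assoc2[OF z2(1)])
    have r6: "(a' * (1 - T * g) + y) * (a + T * x) = un (Suc k)"
      by (simp add: algebra_simps z gTx yTx IH(6) un_Suc)
    have yTb: "y * (T * b') - y * (T * (g * (T * b'))) = 0" by (simp add: assoc3[OF yTg])
    have r7: "(b + y * T) * ((1 - g * T) * b' + x) = un (Suc k)"
      using yTb by (simp add: algebra_simps z yTx IH(7) un_Suc assoc2[OF z(3)])
    show ?thesis using r1 r2 r3 r4 r5 r6 r7 by blast
  qed
qed

text \<open>Injectivity is tested on square matrices instead of vectors, which keeps the argument in
  the ring: \<open>un m - b' * b\<close> is annihilated by \<open>T = a * b\<close>, so it vanishes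
  and \<open>b' * a'\<close> is a left inverse.\<close>

lemma left_inverse_if_cancel:
  assumes T: "bt n m T" and c: "\<And>N. bt m m N \<Longrightarrow> T * N = 0 \<Longrightarrow> N = 0"
  shows "\<exists>R. bt m n R \<and> R * T = un m"
proof -
  obtain k a a' b b' where f: "bt n k a" "bt k n a'" "bt k m b" "bt m k b'"
    "T = a * b" "a' * a = un k" "b * b' = un k" using rank_factorization[OF T] by blast
  have "T * (un m - b' * b) = 0"
    using f by (simp add: algebra_simps bt_unr assoc2[OF f(7)] bt_unl)
  then have "un m - b' * b = 0" using c f by blast
  then have "b' * a' * T = un m" using f by (simp add: mult.assoc assoc2[OF f(6)] bt_unl)
  then show ?thesis using f by blast
qed

lemma right_inverse_if_cancel:
  assumes T: "bt n m T" and c: "\<And>N. bt n n N \<Longrightarrow> N * T = 0 \<Longrightarrow> N = 0"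
  shows "\<exists>S. bt m n S \<and> T * S = un n"
proof -
  obtain k a a' b b' where f: "bt n k a" "bt k n a'" "bt k m b" "bt m k b'"
    "T = a * b" "a' * a = un k" "b * b' = un k" using rank_factorization[OF T] by blast
  have "(un n - a * a') * T = 0"
    using f by (simp add: algebra_simps bt_unl' assoc2[OF f(6)] bt_unl)
  then have "un n - a * a' = 0" using c f by blast
  then have "T * (b' * a') = un n" using f by (simp add: mult.assoc assoc2[OF f(7)] bt_unl)
  then show ?thesis using f by blast
qed

text \<open>Cancelling \<open>a'\<close> on the left and \<open>b'\<close> on the right of
  \<open>T * T = T\<close> leaves \<open>b * a = un k\<close>. This gives coordinates on the image
  of \<open>T\<close>, in which modules will be compressed to submodules and quotients.\<close>

lemma idempotent_factorization:
  assumes T: "bt n n T" and "T * T = T"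
  shows "\<exists>k a b. bt n k a \<and> bt k n b \<and> T = a * b \<and> b * a = un k"
proof -
  obtain k a a' b b' where f: "bt n k a" "bt k n a'" "bt k n b" "bt n k b'"
    "T = a * b" "a' * a = un k" "b * b' = un k" using rank_factorization[OF T] by blast
  have "a' * (T * T) * b' = a' * T * b'" using assms by simp
  then have "b * a = un k"
    using f by (simp add: mult.assoc assoc2[OF f(6)] bt_unl bt_unr bt_unl' bt_unr')
  then show ?thesis using f by blast
qed

section \<open>Modules as operators\<close>

definition ac :: "'g fdmod \<Rightarrow> 'g \<Rightarrow> lop" where "ac X g = L (act X g)"

definition fdwf :: "'g fdmod \<Rightarrow> bool" where
  "fdwf X \<longleftrightarrow> (\<forall>g. act X g \<in> carrier_mat (vdim X) (vdim X))"

abbreviation idn :: "'g fdmod \<Rightarrow> lop" where "idn X \<equiv> un (vdim X)"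

text \<open>The set \<open>G\<close> of generators to be respected is a parameter, so that one
  notion covers the maps over the double (\<open>UNIV\<close>), over \<open>E\<close>,
  \<open>K\<close>, \<open>z\<close>, and over the group generated by \<open>K\<close> and
  \<open>z\<close>.\<close>

definition H :: "'g set \<Rightarrow> 'g fdmod \<Rightarrow> 'g fdmod \<Rightarrow> lop \<Rightarrow> bool" where
  "H G X Y T \<longleftrightarrow> bt (vdim Y) (vdim X) T \<and> (\<forall>g\<in>G. T * ac X g = ac Y g * T)"

lemma H_bt: "H G X Y T \<Longrightarrow> bt (vdim Y) (vdim X) T" by (simp add: H_def)
lemma H_ac: "H G X Y T \<Longrightarrow> g \<in> G \<Longrightarrow> T * ac X g = ac Y g * T" by (simp add: H_def)
lemma H_ac2: "H G X Y T \<Longrightarrow> g \<in> G \<Longrightarrow> T * (ac X g * S) = ac Y g * (T * S)"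
  by (simp add: H_def mult.assoc[symmetric])
lemma H_mono: "H G X Y T \<Longrightarrow> G' \<subseteq> G \<Longrightarrow> H G' X Y T" by (auto simp: H_def)
lemma H_mult: "H G Y Z S \<Longrightarrow> H G X Y T \<Longrightarrow> H G X Z (S * T)"
  unfolding H_def by (auto) (metis mult.assoc)
lemma H_add: "H G X Y S \<Longrightarrow> H G X Y T \<Longrightarrow> H G X Y (S + T)" by (auto simp: H_def algebra_simps)
lemma H_diff: "H G X Y S \<Longrightarrow> H G X Y T \<Longrightarrow> H G X Y (S - T)" by (auto simp: H_def algebra_simps)
lemma H_uminus: "H G X Y T \<Longrightarrow> H G X Y (- T)" by (auto simp: H_def)
lemma H_0: "H G X Y 0" by (auto simp: H_def)
lemma bt_ac: "fdwf X \<Longrightarrow> bt (vdim X) (vdim X) (ac X g)" by (simp add: ac_def bt_L fdwf_def)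
lemma H_idn: "fdwf X \<Longrightarrow> H G X X (idn X)" using bt_ac[of X] by (auto simp: H_def bt_def un_un)

lemma H_unl: "H G X Y T \<Longrightarrow> idn Y * T = T" and H_unr: "H G X Y T \<Longrightarrow> T * idn X = T"
  by (auto simp: H_def bt_def)

lemma H_pow: "H G X Y T \<Longrightarrow> g \<in> G \<Longrightarrow> T * ac X g ^ i = ac Y g ^ i * T"
proof (induction i)
  case (Suc i)
  have "T * ac X g ^ Suc i = (T * ac X g) * ac X g ^ i" by (simp add: mult.assoc)
  also have "\<dots> = ac Y g * (ac Y g ^ i * T)" using Suc by (simp add: H_ac mult.assoc)
  finally show ?case by (simp add: mult.assoc)
qed simp

lemma fd_hom_iff:
  assumes "fdwf X" "fdwf Y"
  shows "fd_hom X Y f \<longleftrightarrow> f \<in> carrier_mat (vdim Y) (vdim X) \<and> H UNIV X Y (L f)"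
proof (cases "f \<in> carrier_mat (vdim Y) (vdim X)")
  case True
  have "f * act X g = act Y g * f \<longleftrightarrow> L f * ac X g = ac Y g * L f" for g
  proof -
    have a: "act X g \<in> carrier_mat (vdim X) (vdim X)" "act Y g \<in> carrier_mat (vdim Y) (vdim Y)"
      using assms by (auto simp: fdwf_def)
    then have "L (f * act X g) = L f * ac X g" "L (act Y g * f) = ac Y g * L f"
      using True by (auto simp: ac_def intro!: L_mult)
    moreover have "f * act X g \<in> carrier_mat (vdim Y) (vdim X)" "act Y g * f \<in> carrier_mat (vdim Y) (vdim X)"
      using True a by auto
    ultimately show ?thesis using L_inj by metis
  qed
  then show ?thesis using True by (simp add: fd_hom_def H_def bt_L)
qed (simp add: fd_hom_def)

lemma fd_hom_Mt:
  "fdwf X \<Longrightarrow> fdwf Y \<Longrightarrow> H UNIV X Y T \<Longrightarrow> fd_hom X Y (Mt (vdim Y) (vdim X) T)"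
  by (simp add: fd_hom_iff L_Mt H_def)

section \<open>Injectivity, surjectivity and exactness read off from operators\<close>

lemma L_mult_eq_iff:
  assumes "A \<in> carrier_mat n k" "B \<in> carrier_mat k m" "D \<in> carrier_mat n m"
  shows "A * B = D \<longleftrightarrow> L A * L B = L D"
  using L_inj[OF mult_carrier_mat[OF assms(1,2)] assms(3)] L_mult[OF assms(1,2)] by simp

lemma zero_mat_mult_vec: "x \<in> carrier_vec m \<Longrightarrow> 0\<^sub>m n m *\<^sub>v (x :: complex vec) = 0\<^sub>v n"
  by (rule eq_vecI) auto

lemma mat_zero_if_mult_vec:
  fixes A :: "complex mat"
  assumes "A \<in> carrier_mat n m" "\<And>x. x \<in> carrier_vec m \<Longrightarrow> A *\<^sub>v x = 0\<^sub>v n"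
  shows "A = 0\<^sub>m n m"
proof (rule eq_matI)
  fix i j assume "i < dim_row (0\<^sub>m n m :: complex mat)" "j < dim_col (0\<^sub>m n m :: complex mat)"
  then have ij: "i < n" "j < m" by auto
  have "A *\<^sub>v unit_vec m j = 0\<^sub>v n" using assms(2)[of "unit_vec m j"] by simp
  then have "(A *\<^sub>v unit_vec m j) $ i = 0" using ij by simp
  then show "A $$ (i, j) = 0\<^sub>m n m $$ (i, j)" using ij assms(1) by simp
qed (use assms in auto)

lemma inj_iff_left_inverse:
  assumes f: "f \<in> carrier_mat n m"
  shows "inj_on (\<lambda>x. f *\<^sub>v x) (carrier_vec m) \<longleftrightarrow> (\<exists>R. bt m n R \<and> R * L f = un m)"
proof
  assume inj: "inj_on (\<lambda>x. f *\<^sub>v x) (carrier_vec m)"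
  show "\<exists>R. bt m n R \<and> R * L f = un m"
  proof (rule left_inverse_if_cancel[OF bt_L[OF f]])
    fix N assume N: "bt m m N" "L f * N = 0"
    let ?N = "Mt m m N"
    have z: "f * ?N = 0\<^sub>m n m" using N by (simp add: L_mult_eq_iff[OF f Mt_carrier zero_carrier_mat] L_Mt L_zero)
    have "?N = 0\<^sub>m m m"
    proof (rule mat_zero_if_mult_vec[OF Mt_carrier])
      fix x :: "complex vec" assume x: "x \<in> carrier_vec m"
      have "f *\<^sub>v (?N *\<^sub>v x) = 0\<^sub>m n m *\<^sub>v x"
        using f x by (simp add: assoc_mult_mat_vec[symmetric, OF f Mt_carrier x] z)
      also have "\<dots> = f *\<^sub>v 0\<^sub>v m" using f x by auto
      finally show "?N *\<^sub>v x = 0\<^sub>v m"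
        using inj x mult_mat_vec_carrier[OF Mt_carrier x] by (auto dest!: inj_onD)
    qed
    then show "N = 0" using L_Mt[OF N(1)] L_zero by metis
  qed
next
  assume "\<exists>R. bt m n R \<and> R * L f = un m"
  then obtain R where R: "bt m n R" "R * L f = un m" by blast
  have e: "Mt m n R * f = 1\<^sub>m m" using R by (simp add: L_mult_eq_iff[OF Mt_carrier f one_carrier_mat] L_Mt L_one)
  show "inj_on (\<lambda>x. f *\<^sub>v x) (carrier_vec m)"
  proof (rule inj_on_inverseI[where g = "\<lambda>y. Mt m n R *\<^sub>v y"])
    fix x :: "complex vec" assume x: "x \<in> carrier_vec m"
    then show "Mt m n R *\<^sub>v (f *\<^sub>v x) = x" by (simp add: assoc_mult_mat_vec[symmetric, OF Mt_carrier f x] e)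
  qed
qed

lemma surj_iff_right_inverse:
  assumes f: "f \<in> carrier_mat n m"
  shows "(\<lambda>x. f *\<^sub>v x) ` carrier_vec m = carrier_vec n \<longleftrightarrow> (\<exists>S. bt m n S \<and> L f * S = un n)"
proof
  assume surj: "(\<lambda>x. f *\<^sub>v x) ` carrier_vec m = carrier_vec n"
  show "\<exists>S. bt m n S \<and> L f * S = un n"
  proof (rule right_inverse_if_cancel[OF bt_L[OF f]])
    fix N assume N: "bt n n N" "N * L f = 0"
    let ?N = "Mt n n N"
    have z: "?N * f = 0\<^sub>m n m" using N by (simp add: L_mult_eq_iff[OF Mt_carrier f zero_carrier_mat] L_Mt L_zero)
    have "?N = 0\<^sub>m n n"
    proof (rule mat_zero_if_mult_vec[OF Mt_carrier])
      fix y :: "complex vec" assume "y \<in> carrier_vec n"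
      then obtain x where x: "x \<in> carrier_vec m" "y = f *\<^sub>v x" using surj by blast
      have "?N *\<^sub>v (f *\<^sub>v x) = 0\<^sub>m n m *\<^sub>v x"
        by (simp add: assoc_mult_mat_vec[symmetric, OF Mt_carrier f x(1)] z)
      then show "?N *\<^sub>v y = 0\<^sub>v n" using x by (simp add: zero_mat_mult_vec)
    qed
    then show "N = 0" using L_Mt[OF N(1)] L_zero by metis
  qed
next
  assume "\<exists>S. bt m n S \<and> L f * S = un n"
  then obtain S where S: "bt m n S" "L f * S = un n" by blast
  have e: "f * Mt m n S = 1\<^sub>m n" using S by (simp add: L_mult_eq_iff[OF f Mt_carrier one_carrier_mat] L_Mt L_one)
  have "y \<in> (\<lambda>x. f *\<^sub>v x) ` carrier_vec m" if y: "y \<in> carrier_vec n" for y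
  proof (rule image_eqI[of _ _ "Mt m n S *\<^sub>v y"])
    show "y = f *\<^sub>v (Mt m n S *\<^sub>v y)" using y by (simp add: assoc_mult_mat_vec[symmetric, OF f Mt_carrier y] e)
    show "Mt m n S *\<^sub>v y \<in> carrier_vec m" using mult_mat_vec_carrier[OF Mt_carrier y] .
  qed
  moreover have "f *\<^sub>v x \<in> carrier_vec n" if "x \<in> carrier_vec m" for x
    using mult_mat_vec_carrier[OF f that] .
  ultimately show "(\<lambda>x. f *\<^sub>v x) ` carrier_vec m = carrier_vec n" by auto
qed

lemma fd_mono_iff: "fd_mono X Y f \<longleftrightarrow> fd_hom X Y f \<and> (\<exists>R. bt (vdim X) (vdim Y) R \<and> R * L f = idn X)"
  using inj_iff_left_inverse[of f "vdim Y" "vdim X"] by (auto simp: fd_mono_def fd_hom_def)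

lemma fd_epi_iff: "fd_epi X Y f \<longleftrightarrow> fd_hom X Y f \<and> (\<exists>S. bt (vdim X) (vdim Y) S \<and> L f * S = idn Y)"
  using surj_iff_right_inverse[of f "vdim Y" "vdim X"] by (auto simp: fd_epi_def fd_hom_def)

text \<open>With the retraction \<open>R\<close> the condition on the kernel becomes an identity for
  square matrices \<open>N\<close>: columns killed by \<open>v\<close> are reproduced by
  \<open>u\<close> after \<open>R\<close>. Later arguments on exactness can then do without
  vectors.\<close>

lemma image_eq_kernel_iff:
  assumes u: "u \<in> carrier_mat n m" and v: "v \<in> carrier_mat k n"
    and R: "bt m n R" "R * L u = un m"
  shows "(\<lambda>x. u *\<^sub>v x) ` carrier_vec m = {y \<in> carrier_vec n. v *\<^sub>v y = 0\<^sub>v k} \<longleftrightarrow>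
    L v * L u = 0 \<and> (\<forall>N. bt n n N \<and> L v * N = 0 \<longrightarrow> L u * (R * N) = N)"
proof -
  let ?r = "Mt m n R"
  have Lr: "L ?r = R" using R L_Mt by blast
  have ru: "?r * u = 1\<^sub>m m"
    using R by (simp add: L_mult_eq_iff[OF Mt_carrier u one_carrier_mat] Lr L_one)
  have vu: "L v * L u = 0 \<longleftrightarrow> v * u = 0\<^sub>m k m"
    by (simp add: L_mult_eq_iff[OF v u zero_carrier_mat] L_zero)
  show ?thesis
  proof (intro iffI conjI allI impI)
    assume im: "(\<lambda>x. u *\<^sub>v x) ` carrier_vec m = {y \<in> carrier_vec n. v *\<^sub>v y = 0\<^sub>v k}"
    have "v * u = 0\<^sub>m k m"
    proof (rule mat_zero_if_mult_vec)
      fix x :: "complex vec" assume x: "x \<in> carrier_vec m"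
      then have "v *\<^sub>v (u *\<^sub>v x) = 0\<^sub>v k" using im by auto
      then show "v * u *\<^sub>v x = 0\<^sub>v k" by (simp add: assoc_mult_mat_vec[OF v u x])
    qed (use u v in auto)
    then show "L v * L u = 0" using vu by simp
    fix N assume N: "bt n n N \<and> L v * N = 0"
    let ?N = "Mt n n N"
    have LN: "L ?N = N" using N L_Mt by blast
    have z: "v * ?N = 0\<^sub>m k n"
      using N by (simp add: L_mult_eq_iff[OF v Mt_carrier zero_carrier_mat] LN L_zero)
    have rN: "?r * ?N \<in> carrier_mat m n" by (rule mult_carrier_mat[OF Mt_carrier Mt_carrier])
    have uc: "u * (?r * ?N) \<in> carrier_mat n n" by (rule mult_carrier_mat[OF u rN])
    have "u * (?r * ?N) - ?N = 0\<^sub>m n n"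
    proof (rule mat_zero_if_mult_vec)
      fix x :: "complex vec" assume x: "x \<in> carrier_vec n"
      have Nx: "?N *\<^sub>v x \<in> carrier_vec n" by (rule mult_mat_vec_carrier[OF Mt_carrier x])
      have "v *\<^sub>v (?N *\<^sub>v x) = 0\<^sub>v k" using x by (simp add: assoc_mult_mat_vec[symmetric, OF v Mt_carrier x] z zero_mat_mult_vec)
      then obtain y where y: "y \<in> carrier_vec m" "?N *\<^sub>v x = u *\<^sub>v y" using im Nx by blast
      have "u * (?r * ?N) *\<^sub>v x = u *\<^sub>v (?r *\<^sub>v (?N *\<^sub>v x))"
        by (simp add: assoc_mult_mat_vec[OF u rN x] assoc_mult_mat_vec[OF Mt_carrier Mt_carrier x])
      also have "?r *\<^sub>v (?N *\<^sub>v x) = y"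
        using y by (simp add: assoc_mult_mat_vec[symmetric, OF Mt_carrier u y(1)] ru)
      finally have "u * (?r * ?N) *\<^sub>v x = ?N *\<^sub>v x" using y by simp
      then show "(u * (?r * ?N) - ?N) *\<^sub>v x = 0\<^sub>v n"
        using Nx by (simp add: minus_mult_distrib_mat_vec[OF uc Mt_carrier x])
    qed (rule minus_carrier_mat[OF Mt_carrier])
    then have "L (u * (?r * ?N)) - L ?N = 0" using L_diff[OF uc Mt_carrier[of n n N]] L_zero by metis
    then show "L u * (R * N) = N" by (simp add: L_mult[OF u rN] L_mult[OF Mt_carrier Mt_carrier] Lr LN)
  next
    assume a: "L v * L u = 0 \<and> (\<forall>N. bt n n N \<and> L v * N = 0 \<longrightarrow> L u * (R * N) = N)"
    then have z: "v * u = 0\<^sub>m k m" using vu by simp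
    have "v *\<^sub>v (u *\<^sub>v x) = 0\<^sub>v k" if x: "x \<in> carrier_vec m" for x
      using x by (simp add: assoc_mult_mat_vec[symmetric, OF v u x] z zero_mat_mult_vec)
    moreover have "y \<in> (\<lambda>x. u *\<^sub>v x) ` carrier_vec m" if y: "y \<in> carrier_vec n" "v *\<^sub>v y = 0\<^sub>v k" for y
    proof (cases "n = 0")
      case True
      then have "y = u *\<^sub>v 0\<^sub>v m" using u y by (intro eq_vecI) auto
      then show ?thesis by (rule image_eqI) simp
    next
      case False
      \<comment> \<open>A single vector is made the first column of a square matrix, to which the
        hypothesis applies. This needs \<open>n > 0\<close>, hence the case distinction.\<close>
      let ?N = "mat n n (\<lambda>(i, j). if j = 0 then y $ i else 0)"
      have N: "?N \<in> carrier_mat n n" by simp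
      have Ny: "?N *\<^sub>v unit_vec n 0 = y" using y False by (intro eq_vecI) (auto simp: scalar_prod_def if_distrib sum.delta cong: if_cong)
      have "v * ?N = 0\<^sub>m k n"
      proof (rule eq_matI)
        fix i j assume "i < dim_row (0\<^sub>m k n :: complex mat)" "j < dim_col (0\<^sub>m k n :: complex mat)"
        then have ij: "i < k" "j < n" by auto
        have "(v *\<^sub>v y) $ i = 0" using y ij by simp
        then have "row v i \<bullet> y = 0" using v ij by simp
        then show "(v * ?N) $$ (i, j) = 0\<^sub>m k n $$ (i, j)" using ij v y
          by (cases "j = 0") (simp_all add: scalar_prod_def)
      qed (use v in auto)
      then have "L v * L ?N = 0" by (metis L_mult[OF v N] L_zero)
      then have "L u * (R * L ?N) = L ?N" using a bt_L[OF N] by blast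
      then have "L (u * (?r * ?N)) = L ?N"
        using L_mult[OF u mult_carrier_mat[OF Mt_carrier N]] L_mult[OF Mt_carrier N] Lr by metis
      then have e: "u * (?r * ?N) = ?N"
        using L_inj[OF mult_carrier_mat[OF u mult_carrier_mat[OF Mt_carrier N]] N] by blast
      have uv: "unit_vec n 0 \<in> carrier_vec n" by simp
      have rN: "?r * ?N \<in> carrier_mat m n" by (rule mult_carrier_mat[OF Mt_carrier N])
      have "y = u *\<^sub>v (?r * ?N *\<^sub>v unit_vec n 0)"
        using Ny e by (simp add: assoc_mult_mat_vec[symmetric, OF u rN uv])
      moreover have "?r * ?N *\<^sub>v unit_vec n 0 \<in> carrier_vec m" by (rule mult_mat_vec_carrier[OF rN uv])
      ultimately show ?thesis by (rule image_eqI)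
    qed
    moreover have "u *\<^sub>v x \<in> carrier_vec n" if "x \<in> carrier_vec m" for x
      using mult_mat_vec_carrier[OF u that] .
    ultimately show "(\<lambda>x. u *\<^sub>v x) ` carrier_vec m = {y \<in> carrier_vec n. v *\<^sub>v y = 0\<^sub>v k}" by auto
  qed
qed

section \<open>Averaging over a cyclic group\<close>

definition av :: "nat \<Rightarrow> lop \<Rightarrow> lop \<Rightarrow> lop \<Rightarrow> lop" where
  "av d k' k t = cs (1 / of_nat d) * (\<Sum>a<d. k' ^ a * t * k ^ (d - a))"

text \<open>Multiplication by \<open>k'\<close> on the left or by \<open>k\<close> on the right
  shifts the summation index by one, up to the two boundary terms, which agree by the hypotheses.
  The exponent \<open>d - a\<close> in \<open>av\<close> stands for \<open>-a\<close>, since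
  \<open>k ^ d\<close> acts trivially.\<close>

lemma av_commute:
  assumes "k' ^ d * t = t" "t * k ^ d = t"
  shows "k' * av d k' k t = av d k' k t * k"
proof -
  define g where "g a = k' ^ a * t * k ^ (Suc d - a)" for a
  have "k' * (\<Sum>a<d. k' ^ a * t * k ^ (d - a)) = (\<Sum>a<d. g (Suc a))"
    by (simp add: g_def sum_distrib_left mult.assoc)
  moreover have "(\<Sum>a<d. k' ^ a * t * k ^ (d - a)) * k = (\<Sum>a<d. g a)"
    by (simp add: g_def sum_distrib_right mult.assoc Suc_diff_le power_Suc2 del: power_Suc)
  moreover have "g d = g 0" using assms
    by (simp add: g_def power_Suc2 mult.assoc[symmetric] del: power_Suc)
  moreover have "(\<Sum>a<d. g (Suc a)) + g 0 = (\<Sum>a<d. g a) + g d"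
    using sum.lessThan_Suc_shift[of g d] by (simp add: add.commute)
  ultimately have "k' * (\<Sum>a<d. k' ^ a * t * k ^ (d - a)) = (\<Sum>a<d. k' ^ a * t * k ^ (d - a)) * k" by simp
  then show ?thesis by (simp add: av_def cs_left[of k'] mult.assoc)
qed

lemma av_const:
  assumes "d > 0" "k' * t = t * k" "t * k ^ d = t" shows "av d k' k t = t"
proof -
  have "k' ^ a * t = t * k ^ a" for a
    by (induction a) (auto simp: mult.assoc assms(2), simp add: mult.assoc[symmetric] assms(2))
  then have "(\<Sum>a<d. k' ^ a * t * k ^ (d - a)) = (\<Sum>a<d. t)"
    using assms by (intro sum.cong) (auto simp: mult.assoc power_add[symmetric])
  also have "\<dots> = cs (of_nat d) * t" by (simp add: cs_of_nat)
  finally show ?thesis using \<open>d > 0\<close> by (simp add: av_def cs_cs)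
qed

lemma av_left:
  assumes "g * k' = k'' * g" shows "g * av d k' k t = av d k'' k (g * t)"
proof -
  have "g * k' ^ a = k'' ^ a * g" for a
    by (induction a) (auto, metis assms mult.assoc)
  then have "g * (k' ^ a * t * k ^ b) = k'' ^ a * (g * t) * k ^ b" for a b
    by (metis mult.assoc)
  then show ?thesis by (simp add: av_def cs_left[of g] sum_distrib_left)
qed

lemma av_right:
  assumes "k * g = g * k''" shows "av d k' k t * g = av d k' k'' (t * g)"
proof -
  have "k ^ a * g = g * k'' ^ a" for a
    by (induction a) (auto simp: mult.assoc, metis assms mult.assoc)
  then have "(k' ^ a * t * k ^ b) * g = k' ^ a * (t * g) * k'' ^ b" for a b
    by (metis mult.assoc)
  then show ?thesis by (simp add: av_def mult.assoc sum_distrib_right)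
qed

lemma av_bt: "bt n n k' \<Longrightarrow> bt m m k \<Longrightarrow> bt n m t \<Longrightarrow> bt n m (av d k' k t)"
  by (auto simp: av_def mult.assoc intro!: bt_cs bt_sum bt_powl bt_powr)

section \<open>Modules of the double as quadruples of operators\<close>

locale dbl =
  fixes d :: nat and \<zeta> :: complex
  assumes d2: "d \<ge> 2" and zd: "\<zeta> ^ d = 1" and prim: "\<forall>k. 0 < k \<and> k < d \<longrightarrow> \<zeta> ^ k \<noteq> 1"
begin

abbreviation "C \<equiv> double_modules d \<zeta>"

lemma z0: "\<zeta> \<noteq> 0" using zd d2 by (auto simp: power_0_left)
lemma d0: "d > 0" using d2 by simp

definition isD :: "nat \<Rightarrow> lop \<Rightarrow> lop \<Rightarrow> lop \<Rightarrow> lop \<Rightarrow> bool" where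
  "isD n e f k z \<longleftrightarrow> bt n n e \<and> bt n n f \<and> bt n n k \<and> bt n n z \<and> k ^ d = un n \<and> z ^ d = un n \<and> e ^ d = 0 \<and> f ^ d = 0
    \<and> z * e = e * z \<and> z * f = f * z \<and> z * k = k * z \<and> k * e = cs \<zeta> * (e * k) \<and> k * f = cs (inverse \<zeta>) * (f * k)
    \<and> e * f - f * e = k - z * k ^ (d - 1)"

abbreviation "isM X \<equiv> isD (vdim X) (ac X DE) (ac X DF) (ac X DK) (ac X DZ)"

lemma double_gen_all: "(\<forall>g. P g) \<longleftrightarrow> P DE \<and> P DF \<and> P DK \<and> P DZ"
  by (metis double_gen.exhaust)

lemma C_iff: "X \<in> C \<longleftrightarrow> fdwf X \<and> isM X"
proof (cases "fdwf X")
  case True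
  define n where "n = vdim X"
  have c: "act X g \<in> carrier_mat n n" for g using True by (auto simp: fdwf_def n_def)
  note bt = bt_ac[OF True, folded n_def]
  have LM: "L (A * B) = L A * L B" if "A \<in> carrier_mat n n" "B \<in> carrier_mat n n" for A B
    using that by (rule L_mult)
  have LP: "L (act X g ^\<^sub>m k) = ac X g ^ k" if "k > 0" for g k
    using bt[of g] that by (simp add: L_pow[OF c] un_pow[of n] ac_def)
  have d1: "d - 1 > 0" using d2 by simp
  have cc: "A * B \<in> carrier_mat n n" if "A \<in> carrier_mat n n" "B \<in> carrier_mat n n" for A B :: "complex mat" using that by simp
  have pc: "act X g ^\<^sub>m k \<in> carrier_mat n n" for g k using c by simp
  have inj: "A = B \<longleftrightarrow> L A = L B" if "A \<in> carrier_mat n n" "B \<in> carrier_mat n n" for A B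
    using L_inj that by blast
  have comm: "act X g * act X h = act X h * act X g \<longleftrightarrow> ac X g * ac X h = ac X h * ac X g" for g h
    using c cc[OF c c] by (subst inj) (auto simp: LM ac_def)
  have qcomm: "act X g * act X h = q \<cdot>\<^sub>m (act X h * act X g) \<longleftrightarrow> ac X g * ac X h = cs q * (ac X h * ac X g)" for g h q
    using c cc[OF c c] by (subst inj) (auto simp: LM ac_def L_smult[of _ n n])
  have pw1: "act X g ^\<^sub>m d = 1\<^sub>m n \<longleftrightarrow> ac X g ^ d = un n" for g
    using pc by (subst inj) (auto simp: LP d0 L_one)
  have pw0: "act X g ^\<^sub>m d = 0\<^sub>m n n \<longleftrightarrow> ac X g ^ d = 0" for g
    using pc by (subst inj) (auto simp: LP d0 L_zero)
  have br: "act X DE * act X DF - act X DF * act X DE = act X DK - act X DZ * act X DK ^\<^sub>m (d - 1)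
    \<longleftrightarrow> ac X DE * ac X DF - ac X DF * ac X DE = ac X DK - ac X DZ * ac X DK ^ (d - 1)"
  proof -
    have "L (act X DE * act X DF - act X DF * act X DE) = ac X DE * ac X DF - ac X DF * ac X DE"
      by (subst L_diff[OF cc[OF c c] cc[OF c c]]) (simp add: LM[OF c c] ac_def)
    moreover have "L (act X DK - act X DZ * act X DK ^\<^sub>m (d - 1)) = ac X DK - ac X DZ * ac X DK ^ (d - 1)"
      by (subst L_diff[OF c cc[OF c pc]]) (simp only: LM[OF c pc] LP[OF d1], simp only: ac_def)
    ultimately show ?thesis
      using inj[OF minus_carrier_mat[OF cc[OF c c]] minus_carrier_mat[OF cc[OF c pc]]] by metis
  qed
  show ?thesis using True c bt unfolding double_modules_def isD_def Let_def mem_Collect_eq n_def[symmetric]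
    by (simp add: comm qcomm pw1 pw0 br[unfolded One_nat_def])
next
  case False
  then show ?thesis by (auto simp: double_modules_def Let_def fdwf_def double_gen_all)
qed

lemma C_wf: "X \<in> C \<Longrightarrow> fdwf X" by (simp add: C_iff)
lemma C_isM: "X \<in> C \<Longrightarrow> isM X" by (simp add: C_iff)

definition mk :: "nat \<Rightarrow> lop \<Rightarrow> lop \<Rightarrow> lop \<Rightarrow> lop \<Rightarrow> double_gen fdmod" where
  "mk n e f k z = FDMod n (\<lambda>g. case g of DE \<Rightarrow> Mt n n e | DF \<Rightarrow> Mt n n f | DK \<Rightarrow> Mt n n k | DZ \<Rightarrow> Mt n n z)"

lemma mk:
  assumes "isD n e f k z"
  shows "mk n e f k z \<in> C" "vdim (mk n e f k z) = n" "ac (mk n e f k z) DE = e" "ac (mk n e f k z) DF = f"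
    "ac (mk n e f k z) DK = k" "ac (mk n e f k z) DZ = z"
proof -
  show a: "vdim (mk n e f k z) = n" "ac (mk n e f k z) DE = e" "ac (mk n e f k z) DF = f"
    "ac (mk n e f k z) DK = k" "ac (mk n e f k z) DZ = z"
    using assms by (simp_all add: mk_def ac_def isD_def L_Mt)
  show "mk n e f k z \<in> C" unfolding C_iff a using assms
    by (auto simp: fdwf_def double_gen_all mk_def)
qed

abbreviation "GK \<equiv> {DK, DZ}"
abbreviation "GA \<equiv> {DE, DK, DZ}"

lemma gm_right_kz: assumes X: "X \<in> C" shows "ac X DK ^ d = idn X" "ac X DZ ^ d = idn X"
  "ac X DZ * ac X DK = ac X DK * ac X DZ"
  using C_isM[OF X] by (auto simp: isD_def)

definition avg :: "double_gen fdmod \<Rightarrow> double_gen fdmod \<Rightarrow> lop \<Rightarrow> lop" where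
  "avg X Y t = av d (ac Y DK) (ac X DK) (av d (ac Y DZ) (ac X DZ) t)"

text \<open>The second average, over \<open>K\<close>, keeps the commutation with \<open>z\<close>
  gained by the first, because \<open>z\<close> and \<open>K\<close> commute on both
  modules.\<close>

lemma avg_gm:
  assumes X: "X \<in> C" and Y: "Y \<in> C" and t: "bt (vdim Y) (vdim X) t"
  shows "H GK X Y (avg X Y t)"
proof -
  let ?s = "av d (ac Y DZ) (ac X DZ) t"
  have s: "bt (vdim Y) (vdim X) ?s" using t X Y by (auto intro!: av_bt bt_ac C_wf)
  have b: "bt (vdim Y) (vdim X) (avg X Y t)" unfolding avg_def using s X Y by (auto intro!: av_bt[where t = ?s] bt_ac C_wf)
  have z: "ac Y DZ * ?s = ?s * ac X DZ"
    using X Y t by (intro av_commute) (simp_all add: gm_right_kz bt_def)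
  have k: "ac Y DK * avg X Y t = avg X Y t * ac X DK"
    unfolding avg_def using X Y s by (intro av_commute) (simp_all add: gm_right_kz bt_def)
  have "ac Y DZ * avg X Y t = av d (ac Y DK) (ac X DK) (ac Y DZ * ?s)"
    unfolding avg_def using Y by (intro av_left) (simp add: gm_right_kz)
  also have "\<dots> = avg X Y t * ac X DZ"
    unfolding avg_def z using X by (intro av_right[symmetric]) (simp add: gm_right_kz)
  finally show ?thesis using b k by (simp add: H_def)
qed

lemma avg_const: "X \<in> C \<Longrightarrow> Y \<in> C \<Longrightarrow> H GK X Y t \<Longrightarrow> avg X Y t = t"
  unfolding avg_def by (subst (2) av_const) (auto simp: gm_right_kz d0 H_def bt_def intro!: av_const)

lemma avg_left: "H GK Y Z g \<Longrightarrow> g * avg X Y t = avg X Z (g * t)"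
  unfolding avg_def by (simp add: av_left[of g _ "ac Z DK"] av_left[of g _ "ac Z DZ"] H_def)

lemma avg_right: "H GK W X g \<Longrightarrow> avg X Y t * g = avg W Y (t * g)"
  unfolding avg_def by (simp add: av_right[of _ g "ac W DK"] av_right[of _ g "ac W DZ"] H_def)

text \<open>Maschke's argument: averaging an arbitrary linear retraction keeps
  \<open>R * i = idn X\<close>, since \<open>i\<close> commutes with \<open>K\<close> and
  \<open>z\<close> and the identity is its own average.\<close>

lemma retraction_gm:
  assumes "X \<in> C" "Y \<in> C" "H UNIV X Y i" "bt (vdim X) (vdim Y) R" "R * i = idn X"
  shows "\<exists>r. H GK Y X r \<and> r * i = idn X"
proof (intro exI conjI)
  show "H GK Y X (avg Y X R)" using assms by (intro avg_gm)
  show "avg Y X R * i = idn X" using assms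
    by (subst avg_right[of X]) (auto intro: H_mono avg_const H_idn C_wf)
qed

lemma section_gm:
  assumes "X \<in> C" "Y \<in> C" "H UNIV X Y p" "bt (vdim X) (vdim Y) S" "p * S = idn Y"
  shows "\<exists>s. H GK Y X s \<and> p * s = idn Y"
proof (intro exI conjI)
  show "H GK Y X (avg Y X S)" using assms by (intro avg_gm)
  show "p * avg Y X S = idn Y" using assms
    by (subst avg_left[of _ Y]) (auto intro: H_mono avg_const H_idn C_wf)
qed

text \<open>Surjectivity is recorded as a splitting over \<open>K\<close> and \<open>z\<close>. This
  is the form in which it is used: a relative trace is lifted by composing its argument with
  \<open>s\<close>.\<close>

definition epi :: "double_gen fdmod \<Rightarrow> double_gen fdmod \<Rightarrow> lop \<Rightarrow> bool" where
  "epi X Y p \<longleftrightarrow> X \<in> C \<and> Y \<in> C \<and> H UNIV X Y p \<and> (\<exists>s. H GK Y X s \<and> p * s = idn Y)"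
definition mono :: "double_gen fdmod \<Rightarrow> double_gen fdmod \<Rightarrow> lop \<Rightarrow> bool" where
  "mono X Y i \<longleftrightarrow> X \<in> C \<and> Y \<in> C \<and> H UNIV X Y i \<and> (\<exists>r. H GK Y X r \<and> r * i = idn X)"

text \<open>The splittings exist for every short exact sequence, by averaging over \<open>\<langle>K, z\<rangle>\<close>.\<close>

definition ses :: "double_gen fdmod \<Rightarrow> double_gen fdmod \<Rightarrow> double_gen fdmod \<Rightarrow> lop \<Rightarrow> lop \<Rightarrow> bool" where
  "ses X Y Z u v \<longleftrightarrow> X \<in> C \<and> Y \<in> C \<and> Z \<in> C \<and> H UNIV X Y u \<and> H UNIV Y Z v \<and>
     (\<exists>r s. H GK Y X r \<and> H GK Z Y s \<and> r * u = idn X \<and> v * s = idn Z \<and> u * r + s * v = idn Y)"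

lemma fd_epi_iff': "X \<in> C \<Longrightarrow> Y \<in> C \<Longrightarrow> fd_epi X Y f \<longleftrightarrow> f \<in> carrier_mat (vdim Y) (vdim X) \<and> epi X Y (L f)"
  unfolding epi_def fd_epi_iff using section_gm[of X Y "L f"] H_bt[of GK Y X] fd_hom_iff[OF C_wf C_wf, of X Y f] by metis

lemma fd_mono_iff': "X \<in> C \<Longrightarrow> Y \<in> C \<Longrightarrow> fd_mono X Y f \<longleftrightarrow> f \<in> carrier_mat (vdim Y) (vdim X) \<and> mono X Y (L f)"
  unfolding mono_def fd_mono_iff using retraction_gm[of X Y "L f"] H_bt[of GK Y X] fd_hom_iff[OF C_wf C_wf, of X Y f] by metis

lemma ses_vu: assumes "ses X Y Z u v" shows "v * u = 0"
proof -
  obtain r s where a: "H GK Y X r" "H GK Z Y s" "r * u = idn X" "v * s = idn Z" "u * r + s * v = idn Y" "H UNIV Y Z v"  "H UNIV X Y u"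
    using assms by (auto simp: ses_def)
  have "v * (u * r + s * v) = v" using a H_unr by metis
  then have "v * u * r = 0" using a(4,6) by (simp add: algebra_simps assoc2[OF a(4)] H_unl)
  then have "v * u * r * u = 0" by simp
  then show ?thesis using a by (simp add: mult.assoc H_unr)
qed

lemma ses_iff: "short_exact C X Y Z u v \<longleftrightarrow>
  u \<in> carrier_mat (vdim Y) (vdim X) \<and> v \<in> carrier_mat (vdim Z) (vdim Y) \<and> ses X Y Z (L u) (L v)"
proof
  assume se: "short_exact C X Y Z u v"
  then have o: "X \<in> C" "Y \<in> C" "Z \<in> C" and m: "mono X Y (L u)" "epi Y Z (L v)"
    and c: "u \<in> carrier_mat (vdim Y) (vdim X)" "v \<in> carrier_mat (vdim Z) (vdim Y)"
    by (auto simp: short_exact_def fd_epi_iff' fd_mono_iff')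
  obtain r s where rs: "H GK Y X r" "r * L u = idn X" "H GK Z Y s" "L v * s = idn Z"
    and h: "H UNIV X Y (L u)" "H UNIV Y Z (L v)" using m by (auto simp: mono_def epi_def)
  have im: "L v * L u = 0" "\<And>N. bt (vdim Y) (vdim Y) N \<Longrightarrow> L v * N = 0 \<Longrightarrow> L u * (r * N) = N"
    using image_eq_kernel_iff[OF c H_bt[OF rs(1)] rs(2)] se by (auto simp: short_exact_def)
  \<comment> \<open>The section is changed by a map into the image of \<open>u\<close> so that
    \<open>r * s' = 0\<close>; only then do \<open>L u * r\<close> and \<open>s' * L v\<close> add
    up to the identity.\<close>
  define s' where "s' = s - L u * (r * s)"
  have u': "H GK X Y (L u)" using h H_mono by blast
  have s': "H GK Z Y s'" unfolding s'_def by (intro H_diff H_mult[OF u'] H_mult[OF rs(1)] rs)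
  have vs: "L v * s' = idn Z" by (simp add: s'_def algebra_simps rs assoc2[OF im(1)])
  have rs': "r * s' = 0" using rs by (simp add: s'_def algebra_simps assoc2[OF rs(2)] H_unl bt_unl'[OF H_bt[OF rs(1)]])
  \<comment> \<open>The defect of that identity is killed by \<open>L v\<close> and by
    \<open>r\<close>; exactness puts its columns in the image of \<open>u\<close>, where
    \<open>r\<close> is injective.\<close>
  let ?N = "idn Y - L u * r - s' * L v"
  have "L u * (r * ?N) = ?N"
  proof (rule im(2))
    show "bt (vdim Y) (vdim Y) ?N" using H_bt[OF u'] H_bt[OF rs(1)] H_bt[OF s'] H_bt[OF h(2)] by auto
    show "L v * ?N = 0" using h by (simp add: algebra_simps assoc2[OF im(1)] assoc2[OF vs] H_unl H_unr)
  qed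
  moreover have "r * ?N = 0" using rs
    by (simp add: algebra_simps assoc2[OF rs(2)] assoc2[OF rs'] H_unl H_unr)
  ultimately have "?N = 0" by simp
  then have "L u * r + s' * L v = idn Y" by (simp add: algebra_simps)
  then show "u \<in> carrier_mat (vdim Y) (vdim X) \<and> v \<in> carrier_mat (vdim Z) (vdim Y) \<and> ses X Y Z (L u) (L v)"
    unfolding ses_def using c o h rs s' vs by blast
next
  assume a: "u \<in> carrier_mat (vdim Y) (vdim X) \<and> v \<in> carrier_mat (vdim Z) (vdim Y) \<and> ses X Y Z (L u) (L v)"
  then have c: "u \<in> carrier_mat (vdim Y) (vdim X)" "v \<in> carrier_mat (vdim Z) (vdim Y)" and se: "ses X Y Z (L u) (L v)" by auto
  obtain r s where o: "X \<in> C" "Y \<in> C" "Z \<in> C" and h: "H UNIV X Y (L u)" "H UNIV Y Z (L v)" and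
    rs: "H GK Y X r" "H GK Z Y s" "r * L u = idn X" "L v * s = idn Z" "L u * r + s * L v = idn Y"
    using se by (auto simp: ses_def)
  have "L u * (r * N) = N" if "bt (vdim Y) (vdim Y) N" "L v * N = 0" for N
  proof -
    have "(L u * r + s * L v) * N = N" using rs that bt_unl by metis
    then show ?thesis using that by (simp add: algebra_simps)
  qed
  then have "(\<lambda>x. u *\<^sub>v x) ` carrier_vec (vdim X) = {y \<in> carrier_vec (vdim Y). v *\<^sub>v y = 0\<^sub>v (vdim Z)}"
    using image_eq_kernel_iff[OF c H_bt[OF rs(1)] rs(3)] ses_vu[OF se] by auto
  moreover have "fd_mono X Y u" "fd_epi Y Z v" using o c h rs by (auto simp: fd_mono_iff' fd_epi_iff' mono_def epi_def)
  ultimately show "short_exact C X Y Z u v" using o by (simp add: short_exact_def)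
qed

end

section \<open>Traces\<close>

lemma sum_lessThan_add: "sum f {..<a + n} = sum f {..<a} + (\<Sum>j<n. f (a + j :: nat) :: 'a::comm_monoid_add)"
  by (induction n) (auto simp: add.assoc)

lemma sum_lessThan_mult: "sum f {..<m * n} = (\<Sum>i<m. \<Sum>j<n. f (i * n + j :: nat) :: 'a::comm_monoid_add)"
proof (induction m)
  case (Suc m)
  have "sum f {..<Suc m * n} = sum f {..<m * n + n}" by (simp add: add.commute)
  then show ?case using Suc by (simp add: sum_lessThan_add)
qed simp

text \<open>The relations of the double with \<open>k'\<close> in place of \<open>z K^(-1)\<close>,
  without the conditions on \<open>d\<close>-th powers. In this form they apply to modules and also
  to the induced operators before these are known to form a module.\<close>

locale uq =
  fixes q :: complex and e f k k' :: lop
  assumes q0: "q \<noteq> 0" and ke: "k * e = cs q * (e * k)" and kf: "k * f = cs (1 / q) * (f * k)"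
    and k'e: "k' * e = cs (1 / q) * (e * k')" and k'f: "k' * f = cs q * (f * k')"
    and ef: "e * f - f * e = k - k'"
begin

text \<open>The operator form of a quantum integer: the commutator of \<open>e ^ n\<close> with
  \<open>f\<close> is \<open>e ^ (n - 1) * c n\<close>. The counterpart for powers of
  \<open>f\<close> is \<open>cm n\<close>.\<close>

definition c :: "nat \<Rightarrow> lop" where "c n = (\<Sum>a<n. cs (q ^ a) * k - cs ((1 / q) ^ a) * k')"
definition cm :: "nat \<Rightarrow> lop" where "cm n = (\<Sum>a<n. cs ((1 / q) ^ a) * k - cs (q ^ a) * k')"

lemma fe: "f * e = e * f - (k - k')" using ef by (simp add: algebra_simps)

lemma kk_e: "(cs a * k - cs b * k') * e = e * (cs (a * q) * k - cs (b / q) * k')"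
  by (simp add: left_diff_distrib right_diff_distrib mult.assoc ke k'e cs_left[of e] cs_cs)

lemma kk_f: "(cs a * k - cs b * k') * f = f * (cs (a / q) * k - cs (b * q) * k')"
  by (simp add: left_diff_distrib right_diff_distrib mult.assoc kf k'f cs_left[of f] cs_cs)

lemma c_e: "c n * e = e * c (Suc n) - e * (k - k')"
proof -
  have "c n * e = (\<Sum>a<n. e * (cs (q ^ Suc a) * k - cs ((1 / q) ^ Suc a) * k'))"
    by (simp add: c_def sum_distrib_right kk_e mult.commute)
  moreover have "c (Suc n) = (k - k') + (\<Sum>a<n. cs (q ^ Suc a) * k - cs ((1 / q) ^ Suc a) * k')"
    by (simp only: c_def sum.lessThan_Suc_shift power_0 cs_1 mult_1)
  ultimately show ?thesis by (simp add: distrib_left sum_distrib_left)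
qed

lemma cm_f: "cm n * f = f * cm (Suc n) - f * (k - k')"
proof -
  have "cm n * f = (\<Sum>a<n. f * (cs ((1 / q) ^ Suc a) * k - cs (q ^ Suc a) * k'))"
    by (simp add: cm_def sum_distrib_right kk_f mult.commute)
  moreover have "cm (Suc n) = (k - k') + (\<Sum>a<n. cs ((1 / q) ^ Suc a) * k - cs (q ^ Suc a) * k')"
    by (simp only: cm_def sum.lessThan_Suc_shift power_0 cs_1 mult_1)
  ultimately show ?thesis by (simp add: distrib_left sum_distrib_left)
qed

lemma f_e_pow: "f * e ^ Suc i = e ^ Suc i * f - e ^ i * c (Suc i)"
proof (induction i)
  case 0 then show ?case by (simp add: c_def fe)
next
  case (Suc i)
  have "f * e ^ Suc (Suc i) = (f * e ^ Suc i) * e" by (simp only: power_Suc2 mult.assoc)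
  also have "\<dots> = e ^ Suc i * (f * e) - e ^ i * (c (Suc i) * e)"
    unfolding Suc by (simp add: left_diff_distrib mult.assoc)
  also have "\<dots> = e ^ Suc (Suc i) * f - e ^ Suc i * c (Suc (Suc i))"
    unfolding fe c_e by (simp only: right_diff_distrib power_Suc2 mult.assoc) (simp add: algebra_simps)
  finally show ?case .
qed

lemma e_f_pow: "e * f ^ Suc i = f ^ Suc i * e + f ^ i * cm (Suc i)"
proof (induction i)
  case 0 then show ?case by (simp add: cm_def fe)
next
  case (Suc i)
  have "e * f ^ Suc (Suc i) = (e * f ^ Suc i) * f" by (simp only: power_Suc2 mult.assoc)
  also have "\<dots> = f ^ Suc i * (e * f) + f ^ i * (cm (Suc i) * f)"
    unfolding Suc by (simp add: distrib_right mult.assoc)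
  also have "e * f = f * e + (k - k')" using ef by (simp add: algebra_simps)
  also have "f ^ Suc i * (f * e + (k - k')) + f ^ i * (cm (Suc i) * f) = f ^ Suc (Suc i) * e + f ^ Suc i * cm (Suc (Suc i))"
    unfolding cm_f by (simp only: right_diff_distrib distrib_left power_Suc2 mult.assoc) (simp add: algebra_simps)
  finally show ?case .
qed

lemma geometric_zero: "x ^ d = 1 \<Longrightarrow> x \<noteq> 1 \<Longrightarrow> (\<Sum>a<d. x ^ a) = (0::complex)"
  using geometric_sum[of x d] by simp

lemma c_eq: "c n = cs (\<Sum>a<n. q ^ a) * k - cs (\<Sum>a<n. (1 / q) ^ a) * k'"
  by (simp add: c_def cs_sum sum_subtractf sum_distrib_right)
lemma cm_eq: "cm n = cs (\<Sum>a<n. (1 / q) ^ a) * k - cs (\<Sum>a<n. q ^ a) * k'"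
  by (simp add: cm_def cs_sum sum_subtractf sum_distrib_right)

text \<open>At a root of unity both geometric sums vanish; by \<open>f_e_pow\<close> and
  \<open>e_f_pow\<close> this makes \<open>e ^ d\<close> commute with \<open>f\<close> and
  \<open>f ^ d\<close> with \<open>e\<close>.\<close>

lemma c_zero: assumes "q ^ d = 1" "q \<noteq> 1" shows "c d = 0" and "cm d = 0"
proof -
  have "(1 / q) ^ d = 1" "1 / q \<noteq> 1" using assms by (auto simp: power_divide)
  then have z: "(\<Sum>a<d. q ^ a) = 0" "(\<Sum>a<d. (1 / q) ^ a) = 0"
    using geometric_zero[OF assms] geometric_zero[of "1 / q" d] by blast+
  show "c d = 0" "cm d = 0" unfolding c_eq cm_eq z by simp_all
qed

end

lemma cs_pow_comm:
  assumes "k' * e = cs q * (e * k)" shows "k' ^ m * e = cs (q ^ m) * (e * k ^ m)"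
proof (induction m)
  case (Suc m)
  have "k' ^ Suc m * e = k' ^ m * (k' * e)" by (simp only: power_Suc2 mult.assoc)
  also have "\<dots> = cs q * ((k' ^ m * e) * k)" unfolding assms by (simp only: cs_left[of "k' ^ m"] mult.assoc)
  also have "\<dots> = cs (q ^ Suc m) * (e * k ^ Suc m)"
    unfolding Suc.IH by (simp only: cs_cs mult.assoc power_Suc2[of k] power_Suc[of q])
  finally show ?case .
qed simp

lemma cs_comm_pow:
  assumes "k * e = cs q * (e * k)" shows "k * e ^ m = cs (q ^ m) * (e ^ m * k)"
proof (induction m)
  case (Suc m)
  have "k * e ^ Suc m = (k * e) * e ^ m" by (simp only: power_Suc mult.assoc)
  also have "\<dots> = cs q * (e * (k * e ^ m))"
    unfolding assms by (simp only: mult.assoc)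
  also have "\<dots> = cs (q ^ Suc m) * (e ^ Suc m * k)"
    unfolding Suc.IH by (simp only: cs_left[of e] cs_cs mult.assoc power_Suc)
  finally show ?case .
qed simp

section \<open>Relative traces along a pair of operators\<close>

definition trp :: "nat \<Rightarrow> lop \<Rightarrow> lop \<Rightarrow> lop \<Rightarrow> lop" where
  "trp d y x S = (\<Sum>i<d. y ^ i * (S * x ^ (d - 1 - i)))"

text \<open>\<open>trp\<close> is the noncommutative form of \<open>(y^d - x^d) / (y - x)\<close>:
  multiplying by \<open>y\<close> on the left and by \<open>x\<close> on the right, the difference
  telescopes to \<open>y^d S - S x^d\<close>. It is the relative trace for truncated polynomials,
  with dual bases \<open>x^i\<close> and \<open>x^(d-1-i)\<close>.\<close>

lemma trp_commute:
  assumes "y ^ d * S = S * x ^ d" shows "y * trp d y x S = trp d y x S * x"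
proof (cases d)
  case (Suc n)
  define g where "g i = y ^ i * (S * x ^ (d - i))" for i
  have "y * trp d y x S = (\<Sum>i<d. g (Suc i))"
    by (simp add: trp_def g_def sum_distrib_left mult.assoc)
  moreover have "trp d y x S * x = (\<Sum>i<d. g i)"
    by (simp add: trp_def g_def sum_distrib_right mult.assoc Suc Suc_diff_le power_Suc2 del: power_Suc sum.lessThan_Suc)
  moreover have "(\<Sum>i<d. g (Suc i)) + g 0 = (\<Sum>i<d. g i) + g d"
    using sum.lessThan_Suc_shift[of g d] by (simp add: add.commute)
  moreover have "g d = g 0" using assms by (simp add: g_def)
  ultimately show ?thesis by simp
qed (simp add: trp_def)

text \<open>Each term has \<open>d - 1\<close> factors from \<open>y\<close> and \<open>x\<close>
  together, so all terms carry the same scalar \<open>r * p ^ (d - 1)\<close>, whatever the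
  split.\<close>

lemma trp_scale:
  assumes "ky * S = cs r * (S * kx)" "ky * y = cs p * (y * ky)" "kx * x = cs p * (x * kx)"
  shows "ky * trp d y x S = cs (r * p ^ (d - 1)) * (trp d y x S * kx)"
proof -
  have "ky * (y ^ i * (S * x ^ (d - 1 - i))) = cs (r * p ^ (d - 1)) * (y ^ i * (S * x ^ (d - 1 - i)) * kx)" if "i < d" for i
  proof -
    have p: "p ^ (d - 1) = p ^ i * p ^ (d - 1 - i)" using that by (simp add: power_add[symmetric])
    have "ky * (y ^ i * (S * x ^ (d - 1 - i))) = (ky * y ^ i) * (S * x ^ (d - 1 - i))" by (simp only: mult.assoc)
    also have "\<dots> = cs (p ^ i) * (y ^ i * (ky * S * x ^ (d - 1 - i)))"
      unfolding cs_comm_pow[OF assms(2)] by (simp only: mult.assoc)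
    also have "ky * S * x ^ (d - 1 - i) = cs r * (S * (kx * x ^ (d - 1 - i)))"
      unfolding assms(1) by (simp only: mult.assoc)
    also have "\<dots> = cs (r * p ^ (d - 1 - i)) * (S * x ^ (d - 1 - i) * kx)"
      unfolding cs_comm_pow[OF assms(3)] by (simp only: mult.assoc cs_left[of S] cs_cs)
    also have "cs (p ^ i) * (y ^ i * \<dots>) = cs (r * p ^ (d - 1)) * (y ^ i * (S * x ^ (d - 1 - i)) * kx)"
      unfolding p by (simp only: mult.assoc cs_left[of "y ^ i"] cs_cs) (simp add: mult.assoc mult.left_commute)
    finally show ?thesis .
  qed
  then show ?thesis by (simp add: trp_def sum_distrib_left sum_distrib_right)
qed

lemma trp_left: "g * y = y' * g \<Longrightarrow> g * trp d y x S = trp d y' x (g * S)"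
proof -
  assume a: "g * y = y' * g"
  have "g * y ^ i = y' ^ i * g" for i by (induction i) (auto, metis a mult.assoc)
  then have "g * (y ^ i * T) = y' ^ i * (g * T)" for i T by (metis mult.assoc)
  then show ?thesis by (simp add: trp_def sum_distrib_left mult.assoc)
qed

lemma trp_right: "x * g = g * x' \<Longrightarrow> trp d y x S * g = trp d y x' (S * g)"
proof -
  assume a: "x * g = g * x'"
  have "x ^ i * g = g * x' ^ i" for i by (induction i) (auto simp: mult.assoc, metis a mult.assoc)
  then show ?thesis by (simp add: trp_def sum_distrib_right mult.assoc)
qed

lemma trp_add: "trp d y x (S + T) = trp d y x S + trp d y x T"
  by (simp add: trp_def algebra_simps sum.distrib)
lemma trp_uminus: "trp d y x (- S) = - trp d y x S" by (simp add: trp_def sum_negf)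
lemma trp_0: "trp d y x 0 = 0" by (simp add: trp_def)
lemma trp_bt: "bt n n y \<Longrightarrow> bt m m x \<Longrightarrow> bt n m S \<Longrightarrow> bt n m (trp d y x S)"
  by (auto simp: trp_def intro!: bt_sum bt_powl bt_powr)

text \<open>The commutators of \<open>f\<close> with the powers of \<open>e\<close> on both sides of \<open>S\<close> combine to a complete sum over
  the \<open>d\<close>-th roots of unity.\<close>

lemma trp_commute_f:
  assumes Y: "uq q ey fy ky ky'" and X: "uq q ex fx kx kx'"
    and q: "q ^ d = 1" "q \<noteq> 1" and d: "d > 0"
    and kS: "ky * S = cs q * (S * kx)" and kS': "ky' * S = cs (1 / q) * (S * kx')" and fS: "fy * S = S * fx"
  shows "fy * trp d ey ex S = trp d ey ex S * fx"
proof -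
  interpret Y: uq q ey fy ky ky' by (rule Y)
  interpret X: uq q ex fx kx kx' by (rule X)
  obtain n where n: "d = Suc n" using d by (cases d) auto
  let ?t = "\<lambda>i. ey ^ i * (fy * (S * ex ^ (n - i)))"
  \<comment> \<open>\<open>fy\<close> is moved to the right past the powers of \<open>ey\<close>
    and, in \<open>r\<close> below, \<open>fx\<close> to the left past those of \<open>ex\<close>.
    Both meet in the terms \<open>?t i\<close>, so that the difference consists of commutators
    only.\<close>
  have l: "fy * trp d ey ex S = (\<Sum>i<Suc n. ?t i) - (\<Sum>i<n. ey ^ i * (Y.c (Suc i) * (S * ex ^ (n - 1 - i))))"
  proof -
    have "fy * trp d ey ex S = (\<Sum>i<Suc n. fy * (ey ^ i * (S * ex ^ (n - i))))"
      by (simp add: trp_def n sum_distrib_left del: sum.lessThan_Suc)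
    also have "\<dots> = ?t 0 + (\<Sum>i<n. fy * (ey ^ Suc i * (S * ex ^ (n - Suc i))))"
      by (subst sum.lessThan_Suc_shift) simp
    also have "(\<Sum>i<n. fy * (ey ^ Suc i * (S * ex ^ (n - Suc i)))) =
      (\<Sum>i<n. ?t (Suc i) - ey ^ i * (Y.c (Suc i) * (S * ex ^ (n - 1 - i))))"
    proof (rule sum.cong[OF refl])
      fix i
      have "fy * (ey ^ Suc i * (S * ex ^ (n - Suc i))) = (fy * ey ^ Suc i) * (S * ex ^ (n - Suc i))" by (simp only: mult.assoc)
      then show "fy * (ey ^ Suc i * (S * ex ^ (n - Suc i))) = ?t (Suc i) - ey ^ i * (Y.c (Suc i) * (S * ex ^ (n - 1 - i)))"
        unfolding Y.f_e_pow by (simp add: left_diff_distrib mult.assoc)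
    qed
    finally show ?thesis by (subst sum.lessThan_Suc_shift) (simp add: sum_subtractf)
  qed
  have r: "trp d ey ex S * fx = (\<Sum>i<Suc n. ?t i) + (\<Sum>i<n. ey ^ i * (S * (ex ^ (n - 1 - i) * X.c (Suc (n - 1 - i)))))"
  proof -
    have "trp d ey ex S * fx = (\<Sum>i<Suc n. ey ^ i * (S * (ex ^ (n - i) * fx)))"
      by (simp add: trp_def n sum_distrib_right mult.assoc del: sum.lessThan_Suc)
    also have "\<dots> = (\<Sum>i<n. ey ^ i * (S * (ex ^ (n - i) * fx))) + ?t n" by (simp add: fS)
    also have "(\<Sum>i<n. ey ^ i * (S * (ex ^ (n - i) * fx))) =
       (\<Sum>i<n. ?t i + ey ^ i * (S * (ex ^ (n - 1 - i) * X.c (Suc (n - 1 - i)))))"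
    proof (rule sum.cong[OF refl])
      fix i assume "i \<in> {..<n}"
      then have m: "n - i = Suc (n - 1 - i)" by auto
      have "ex ^ (n - i) * fx = fx * ex ^ (n - i) + ex ^ (n - 1 - i) * X.c (Suc (n - 1 - i))"
        unfolding m X.f_e_pow by simp
      then show "ey ^ i * (S * (ex ^ (n - i) * fx)) = ?t i + ey ^ i * (S * (ex ^ (n - 1 - i) * X.c (Suc (n - 1 - i))))"
        by (simp add: distrib_left assoc2[OF fS] mult.assoc)
    qed
    finally show ?thesis by (simp add: sum.distrib)
  qed
  \<comment> \<open>Moved to the left across \<open>S * ex ^ m\<close>, the terms of
    \<open>X.c (Suc m)\<close> have their exponents shifted by \<open>Suc i\<close>. They continue
    the sum \<open>Y.c (Suc i)\<close> to \<open>Y.c d\<close>, which vanishes.\<close>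
  have "Y.c (Suc i) * (S * ex ^ m) + S * (ex ^ m * X.c (Suc m)) = 0" if im: "Suc i + Suc m = d" for i m
  proof -
    let ?W = "S * ex ^ m"
    have qm: "q ^ Suc i * q ^ Suc m = 1" using q im by (metis power_add)
    have "ky * ?W = cs (q ^ Suc m) * (?W * kx)"
    proof -
      have "ky * ?W = cs q * (S * (kx * ex ^ m))" by (simp add: mult.assoc[symmetric] kS)
      then show ?thesis unfolding cs_comm_pow[OF X.ke] by (simp only: cs_left[of S] cs_cs mult.assoc power_Suc)
    qed
    then have "cs (q ^ Suc i) * (ky * ?W) = cs (q ^ Suc i * q ^ Suc m) * (?W * kx)" by (simp only: cs_cs)
    then have W: "?W * kx = cs (q ^ Suc i) * (ky * ?W)" unfolding qm by simp
    have "ky' * ?W = cs ((1 / q) ^ Suc m) * (?W * kx')"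
    proof -
      have "ky' * ?W = cs (1 / q) * (S * (kx' * ex ^ m))" by (simp add: mult.assoc[symmetric] kS')
      then show ?thesis unfolding cs_comm_pow[OF X.k'e] by (simp only: cs_left[of S] cs_cs mult.assoc power_Suc)
    qed
    moreover have qm': "(1 / q) ^ Suc i * (1 / q) ^ Suc m = 1"
    proof -
      have "(1 / q) ^ Suc i * (1 / q) ^ Suc m = 1 / (q ^ Suc i * q ^ Suc m)" by (simp add: power_divide)
      then show ?thesis unfolding qm by simp
    qed
    ultimately have "cs ((1 / q) ^ Suc i) * (ky' * ?W) = 1 * (?W * kx')" by (simp only: cs_cs qm' cs_1)
    then have W': "?W * kx' = cs ((1 / q) ^ Suc i) * (ky' * ?W)" by simp
    have "?W * X.c (Suc m) = (\<Sum>a<Suc m. cs (q ^ a) * (?W * kx) - cs ((1 / q) ^ a) * (?W * kx'))"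
      unfolding X.c_def sum_distrib_left right_diff_distrib cs_left[of ?W] ..
    also have "\<dots> = (\<Sum>a<Suc m. cs (q ^ (Suc i + a)) * ky - cs ((1 / q) ^ (Suc i + a)) * ky') * ?W"
      unfolding W W' sum_distrib_right
      by (rule sum.cong[OF refl]) (simp add: left_diff_distrib cs_cs power_add ac_simps)
    finally have "Y.c (Suc i) * ?W + ?W * X.c (Suc m) = Y.c (Suc i + Suc m) * ?W"
      unfolding Y.c_def sum_lessThan_add distrib_right by simp
    then show ?thesis unfolding im Y.c_zero(1)[OF q] by (simp add: mult.assoc)
  qed
  then have z: "Y.c (Suc i) * (S * ex ^ (n - 1 - i)) + S * (ex ^ (n - 1 - i) * X.c (Suc (n - 1 - i))) = 0" if "i < n" for i
    using that n by auto
  have "fy * trp d ey ex S - trp d ey ex S * fx =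
    - (\<Sum>i<n. ey ^ i * (Y.c (Suc i) * (S * ex ^ (n - 1 - i)) + S * (ex ^ (n - 1 - i) * X.c (Suc (n - 1 - i)))))"
    unfolding l r distrib_left sum.distrib by simp
  also have "\<dots> = 0" using z by simp
  finally show ?thesis by simp
qed

context dbl begin

lemma zeta_ne_1: "\<zeta> \<noteq> 1" using prim[rule_format, of 1] d2 by simp

lemma zeta_pred: "\<zeta> ^ (d - 1) = 1 / \<zeta>"
  using power_minus_mult[OF d0, of \<zeta>] zd z0 by (simp add: eq_divide_eq)

lemma zeta_inv_pred: "inverse \<zeta> ^ (d - 1) = \<zeta>"
  by (simp only: power_inverse zeta_pred) simp

lemma ac_idn: "X \<in> C \<Longrightarrow> ac X g * idn X = ac X g" "X \<in> C \<Longrightarrow> idn X * ac X g = ac X g"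
  using bt_ac[OF C_wf] by (auto simp: bt_def)

lemma uq_rel:
  assumes "k * e = cs \<zeta> * (e * k)" "k * f = cs (inverse \<zeta>) * (f * k)" "z * e = e * z" "z * f = f * z"
    "e * f - f * e = k - z * k ^ (d - 1)"
  shows "uq \<zeta> e f k (z * k ^ (d - 1))"
proof
  show "\<zeta> \<noteq> 0" by (rule z0)
  show "k * e = cs \<zeta> * (e * k)" "k * f = cs (1 / \<zeta>) * (f * k)" "e * f - f * e = k - z * k ^ (d - 1)"
    using assms by (auto simp: inverse_eq_divide)
  show "z * k ^ (d - 1) * e = cs (1 / \<zeta>) * (e * (z * k ^ (d - 1)))"
    by (simp only: mult.assoc cs_pow_comm[OF assms(1)] zeta_pred cs_left[of z] assoc2[OF assms(3)])
  show "z * k ^ (d - 1) * f = cs \<zeta> * (f * (z * k ^ (d - 1)))"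
    by (simp only: mult.assoc cs_pow_comm[OF assms(2)] zeta_inv_pred cs_left[of z] assoc2[OF assms(4)])
qed

lemma isD_uq: "isD n e f k z \<Longrightarrow> uq \<zeta> e f k (z * k ^ (d - 1))"
  by (rule uq_rel) (auto simp: isD_def)

section \<open>Relative traces between modules of the double\<close>

definition TrE :: "double_gen fdmod \<Rightarrow> double_gen fdmod \<Rightarrow> lop \<Rightarrow> lop" where
  "TrE X Y T = trp d (ac Y DE) (ac X DE) T"
definition TrF :: "double_gen fdmod \<Rightarrow> double_gen fdmod \<Rightarrow> lop \<Rightarrow> lop" where
  "TrF X Y T = trp d (ac Y DF) (ac X DF) T"
text \<open>The relative trace from the group generated by \<open>K\<close> and \<open>z\<close> to
  the whole double, taken in two stages; its terms are indexed by the \<open>d^2\<close> products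
  \<open>E^i F^j\<close>.\<close>

definition Tr :: "double_gen fdmod \<Rightarrow> double_gen fdmod \<Rightarrow> lop \<Rightarrow> lop" where
  "Tr X Y T = TrE X Y (TrF X Y T)"

text \<open>The weight \<open>\<zeta>\<close> is the one for which \<open>TrE X Y T\<close> commutes with \<open>K\<close>.\<close>

definition gw :: "double_gen fdmod \<Rightarrow> double_gen fdmod \<Rightarrow> lop \<Rightarrow> bool" where
  "gw X Y T \<longleftrightarrow> bt (vdim Y) (vdim X) T \<and> ac Y DZ * T = T * ac X DZ \<and> ac Y DK * T = cs \<zeta> * (T * ac X DK)"

lemma gw_bt: "gw X Y T \<Longrightarrow> bt (vdim Y) (vdim X) T" by (simp add: gw_def)

lemma gw_left:
  assumes g: "H GK Y Z g" and T: "gw X Y T" shows "gw X Z (g * T)"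
proof -
  have a: "ac Z DK * g = g * ac Y DK" "ac Z DZ * g = g * ac Y DZ" using g by (auto simp: H_def)
  have b: "ac Y DZ * T = T * ac X DZ" "ac Y DK * T = cs \<zeta> * (T * ac X DK)" using T by (auto simp: gw_def)
  have "ac Z DZ * (g * T) = g * T * ac X DZ" by (simp only: assoc2[OF a(2)] mult.assoc b)
  moreover have "ac Z DK * (g * T) = cs \<zeta> * (g * T * ac X DK)"
    by (simp only: assoc2[OF a(1)] mult.assoc b cs_left[of g])
  ultimately show ?thesis using H_bt[OF g] gw_bt[OF T] by (auto simp: gw_def)
qed

lemma gw_right:
  assumes g: "H GK W X g" and T: "gw X Y T" shows "gw W Y (T * g)"
proof -
  have a: "ac X DK * g = g * ac W DK" "ac X DZ * g = g * ac W DZ" using g by (auto simp: H_def)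
  have b: "ac Y DZ * T = T * ac X DZ" "ac Y DK * T = cs \<zeta> * (T * ac X DK)" using T by (auto simp: gw_def)
  have "ac Y DZ * (T * g) = T * g * ac W DZ" by (simp only: assoc2[OF b(1)] mult.assoc a)
  moreover have "ac Y DK * (T * g) = cs \<zeta> * (T * g * ac W DK)"
    by (simp only: assoc2[OF b(2)] mult.assoc a)
  ultimately show ?thesis using H_bt[OF g] gw_bt[OF T] by (auto simp: gw_def)
qed

lemma gw_add: "gw X Y S \<Longrightarrow> gw X Y T \<Longrightarrow> gw X Y (S + T)"
  unfolding gw_def by (auto simp: algebra_simps)
lemma gw_uminus: "gw X Y S \<Longrightarrow> gw X Y (- S)"
  unfolding gw_def by (auto simp: algebra_simps)
lemma gw_0: "gw X Y 0" unfolding gw_def by auto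

lemma C_rel:
  assumes "X \<in> C"
  shows "ac X DE ^ d = 0" "ac X DF ^ d = 0" "ac X DZ * ac X DE = ac X DE * ac X DZ"
    "ac X DZ * ac X DF = ac X DF * ac X DZ" "ac X DK * ac X DE = cs \<zeta> * (ac X DE * ac X DK)"
    "ac X DK * ac X DF = cs (inverse \<zeta>) * (ac X DF * ac X DK)"
  using C_isM[OF assms] by (auto simp: isD_def)

text \<open>The \<open>d - 1\<close> factors \<open>F\<close> in each term carry the weight
  \<open>inverse \<zeta> ^ (d - 1) = \<zeta>\<close>. This is the twist that the
  \<open>d - 1\<close> factors \<open>E\<close> of \<open>TrE\<close> undo.\<close>

lemma TrF_gw:
  assumes X: "X \<in> C" and Y: "Y \<in> C" and T: "H GK X Y T"
  shows "gw X Y (TrF X Y T)" "ac Y DF * TrF X Y T = TrF X Y T * ac X DF"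
proof -
  have T': "bt (vdim Y) (vdim X) T" "ac Y DK * T = cs 1 * (T * ac X DK)" "ac Y DZ * T = cs 1 * (T * ac X DZ)"
    using T by (auto simp: H_def)
  show "ac Y DF * TrF X Y T = TrF X Y T * ac X DF"
    unfolding TrF_def using X Y by (intro trp_commute) (simp add: C_rel)
  have "ac Y DK * TrF X Y T = cs (1 * inverse \<zeta> ^ (d - 1)) * (TrF X Y T * ac X DK)"
    unfolding TrF_def by (rule trp_scale[OF T'(2) C_rel(6)[OF Y] C_rel(6)[OF X]])
  moreover note zeta_inv_pred
  moreover have "ac Y DZ * TrF X Y T = cs (1 * 1 ^ (d - 1)) * (TrF X Y T * ac X DZ)"
    unfolding TrF_def by (rule trp_scale[OF T'(3)]) (simp_all add: C_rel X Y)
  ultimately show "gw X Y (TrF X Y T)" using trp_bt[OF bt_ac bt_ac T'(1)] X Y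
    by (simp add: gw_def TrF_def C_wf)
qed

lemma TrE_H:
  assumes X: "X \<in> C" and Y: "Y \<in> C" and T: "gw X Y T"
  shows "H GA X Y (TrE X Y T)"
proof -
  have T': "bt (vdim Y) (vdim X) T" "ac Y DK * T = cs \<zeta> * (T * ac X DK)" "ac Y DZ * T = cs 1 * (T * ac X DZ)"
    using T by (auto simp: gw_def)
  have "ac Y DE * TrE X Y T = TrE X Y T * ac X DE"
    unfolding TrE_def using X Y by (intro trp_commute) (simp add: C_rel)
  moreover have "ac Y DK * TrE X Y T = cs (\<zeta> * \<zeta> ^ (d - 1)) * (TrE X Y T * ac X DK)"
    unfolding TrE_def by (rule trp_scale[OF T'(2) C_rel(5)[OF Y] C_rel(5)[OF X]])
  moreover have "\<zeta> * \<zeta> ^ (d - 1) = 1" using zeta_pred z0 by simp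
  moreover have "ac Y DZ * TrE X Y T = cs (1 * 1 ^ (d - 1)) * (TrE X Y T * ac X DZ)"
    unfolding TrE_def by (rule trp_scale[OF T'(3)]) (simp_all add: C_rel X Y)
  ultimately show ?thesis using trp_bt[OF bt_ac bt_ac T'(1)] X Y
    by (simp add: H_def TrE_def C_wf)
qed

text \<open>Commutation with \<open>E\<close>, \<open>K\<close>, \<open>z\<close> is a property of
  the outer trace. For \<open>F\<close> the inner trace supplies what \<open>trp_commute_f\<close>
  asks for: it commutes with \<open>F\<close> and has weight \<open>\<zeta>\<close>.\<close>

lemma Tr_H:
  assumes X: "X \<in> C" and Y: "Y \<in> C" and T: "H GK X Y T"
  shows "H UNIV X Y (Tr X Y T)"
proof -
  let ?S = "TrF X Y T"
  note S = TrF_gw[OF X Y T]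
  have kS: "ac Y DK * ?S = cs \<zeta> * (?S * ac X DK)" and zS: "ac Y DZ * ?S = ?S * ac X DZ" using S by (auto simp: gw_def)
  have "ac Y DZ * ac Y DK ^ (d - 1) * ?S = cs (1 / \<zeta>) * (?S * (ac X DZ * ac X DK ^ (d - 1)))"
    by (simp only: mult.assoc cs_pow_comm[OF kS] zeta_pred cs_left[of "ac Y DZ"] assoc2[OF zS])
  then have "ac Y DF * Tr X Y T = Tr X Y T * ac X DF"
    unfolding Tr_def TrE_def
    by (rule trp_commute_f[OF isD_uq[OF C_isM[OF Y]] isD_uq[OF C_isM[OF X]] zd zeta_ne_1 d0 kS _ S(2)])
  then show ?thesis using TrE_H[OF X Y S(1)] by (simp add: H_def Tr_def double_gen_all)
qed

lemma TrE_left: "H GA Y Z g \<Longrightarrow> g * TrE X Y T = TrE X Z (g * T)"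
  unfolding TrE_def by (rule trp_left) (simp add: H_def)
lemma TrE_right: "H GA W X g \<Longrightarrow> TrE X Y T * g = TrE W Y (T * g)"
  unfolding TrE_def by (rule trp_right) (simp add: H_def)
lemma Tr_left:
  assumes g: "H UNIV Y Z g" shows "g * Tr X Y T = Tr X Z (g * T)"
proof -
  have "g * TrF X Y T = TrF X Z (g * T)" unfolding TrF_def by (rule trp_left) (simp add: H_ac[OF g])
  then show ?thesis unfolding Tr_def using TrE_left[OF H_mono[OF g]] by simp
qed

lemma Tr_right:
  assumes g: "H UNIV W X g" shows "Tr X Y T * g = Tr W Y (T * g)"
proof -
  have "TrF X Y T * g = TrF W Y (T * g)" unfolding TrF_def by (rule trp_right) (simp add: H_ac[OF g])
  then show ?thesis unfolding Tr_def using TrE_right[OF H_mono[OF g]] by simp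
qed

definition nE :: "double_gen fdmod \<Rightarrow> double_gen fdmod \<Rightarrow> lop \<Rightarrow> bool" where
  "nE X Y f \<longleftrightarrow> (\<exists>T. gw X Y T \<and> f = TrE X Y T)"
definition nD :: "double_gen fdmod \<Rightarrow> double_gen fdmod \<Rightarrow> lop \<Rightarrow> bool" where
  "nD X Y f \<longleftrightarrow> (\<exists>T. H GK X Y T \<and> f = Tr X Y T)"

lemma nD_nE: "X \<in> C \<Longrightarrow> Y \<in> C \<Longrightarrow> nD X Y f \<Longrightarrow> nE X Y f"
  unfolding nD_def nE_def Tr_def using TrF_gw by blast

end

text \<open>The maps \<open>nE\<close> are those that vanish in the stable category of the Taft algebra, with \<open>z\<close>
  adjoined, and \<open>nD\<close> those that vanish in the stable category of the double. Both are ideals with the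
  following lifting properties.\<close>

locale idl = dbl d \<zeta> for d \<zeta> +
  fixes G :: "double_gen set" and N :: "double_gen fdmod \<Rightarrow> double_gen fdmod \<Rightarrow> lop \<Rightarrow> bool"
  assumes GKG: "GK \<subseteq> G"
    and N_H: "X \<in> C \<Longrightarrow> Y \<in> C \<Longrightarrow> N X Y f \<Longrightarrow> H G X Y f"
    and N_add: "N X Y f \<Longrightarrow> N X Y g \<Longrightarrow> N X Y (f + g)"
    and N_uminus: "N X Y f \<Longrightarrow> N X Y (- f)"
    and N_0: "N X Y 0"
    and N_left: "H G Y Z g \<Longrightarrow> N X Y f \<Longrightarrow> N X Z (g * f)"
    and N_right: "H G W X g \<Longrightarrow> N X Y f \<Longrightarrow> N W Y (f * g)"
    and N_lift: "epi Y Z p \<Longrightarrow> N W Z f \<Longrightarrow> \<exists>h. N W Y h \<and> p * h = f"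
    and N_ext: "mono X Y i \<Longrightarrow> N X W f \<Longrightarrow> \<exists>h. N Y W h \<and> h * i = f"
begin

lemma N_diff: "N X Y f \<Longrightarrow> N X Y g \<Longrightarrow> N X Y (f - g)"
  using N_add[of X Y f "- g"] N_uminus by simp

lemma N_idn_left: "N Y Y (idn Y) \<Longrightarrow> H G X Y f \<Longrightarrow> N X Y f"
  using N_right[of X Y f Y "idn Y"] by (simp add: H_unl)
lemma N_idn_right: "N X X (idn X) \<Longrightarrow> H G X Y f \<Longrightarrow> N X Y f"
  using N_left[of X Y f X "idn X"] by (simp add: H_unr)

text \<open>The candidate \<open>f * t\<close> uses a section \<open>t\<close> over \<open>K\<close>
  and \<open>z\<close> only. It still commutes with every generator in \<open>G\<close>, because
  this can be tested after composing with \<open>v\<close>, which has the right inverse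
  \<open>t\<close>.\<close>

lemma quot_factor:
  assumes s: "ses X Y Z u v" and f: "H G Y W f" "f * u = 0"
  shows "\<exists>h. H G Z W h \<and> h * v = f"
proof -
  obtain r t where a: "H GK Y X r" "H GK Z Y t" "r * u = idn X" "v * t = idn Z" "u * r + t * v = idn Y" "H UNIV Y Z v"
    using s by (auto simp: ses_def)
  have "f * (u * r + t * v) = f" using a f H_unr by metis
  then have ftv: "f * t * v = f" using f by (simp add: distrib_left assoc2[OF f(2)] mult.assoc)
  have "f * t * ac Z g = ac W g * (f * t)" if g: "g \<in> G" for g
  proof -
    have "f * t * (ac Z g * v) = ac W g * (f * t) * v"
      using H_ac[OF a(6), of g] H_ac[OF f(1) g] ftv by (metis UNIV_I mult.assoc)
    then have "f * t * ac Z g * (v * t) = ac W g * (f * t) * (v * t)" by (metis mult.assoc)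
    moreover have "ac Z g * idn Z = ac Z g" using ac_idn s by (auto simp: ses_def)
    ultimately show ?thesis using a by (simp add: mult.assoc H_unr)
  qed
  moreover have "bt (vdim W) (vdim Z) (f * t)" using H_bt[OF f(1)] H_bt[OF a(2)] by blast
  ultimately show ?thesis using ftv by (auto simp: H_def)
qed

lemma ker_factor:
  assumes s: "ses X Y Z u v" and f: "H G W Y f" "v * f = 0"
  shows "\<exists>h. H G W X h \<and> u * h = f"
proof -
  obtain r t where a: "H GK Y X r" "H GK Z Y t" "r * u = idn X" "v * t = idn Z" "u * r + t * v = idn Y" "H UNIV X Y u"
    using s by (auto simp: ses_def)
  have "(u * r + t * v) * f = f" using a f H_unl by metis
  then have urf: "u * (r * f) = f" using f by (simp add: distrib_right mult.assoc)
  have "r * f * ac W g = ac X g * (r * f)" if g: "g \<in> G" for g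
  proof -
    have "u * (r * f * ac W g) = u * (ac X g * (r * f))"
      using H_ac[OF a(6), of g] H_ac[OF f(1) g] urf by (metis UNIV_I mult.assoc)
    then have "(r * u) * (r * f * ac W g) = (r * u) * (ac X g * (r * f))" by (metis mult.assoc)
    moreover have "idn X * ac X g = ac X g" using ac_idn s by (auto simp: ses_def)
    ultimately show ?thesis using a by (simp add: mult.assoc[symmetric] H_unl)
  qed
  moreover have "bt (vdim X) (vdim W) (r * f)" using H_bt[OF f(1)] H_bt[OF a(1)] by blast
  ultimately show ?thesis using urf by (auto simp: H_def)
qed

lemma ses_mono: "ses X Y Z u v \<Longrightarrow> mono X Y u" and ses_epi: "ses X Y Z u v \<Longrightarrow> epi Y Z v"
  by (auto simp: ses_def mono_def epi_def)

lemma epi_cancel: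
  assumes "epi Y Z v" "H G Z W f" "H G Z W g" "f * v = g * v" shows "f = g"
proof -
  obtain s where "H GK Z Y s" "v * s = idn Z" using assms by (auto simp: epi_def)
  then show ?thesis using assms(2-4) H_unr by (metis mult.assoc)
qed

lemma mono_cancel:
  assumes "mono X Y u" "H G W X f" "H G W X g" "u * f = u * g" shows "f = g"
proof -
  obtain r where "H GK Y X r" "r * u = idn X" using assms by (auto simp: mono_def)
  then show ?thesis using assms(2-4) H_unl by (metis mult.assoc)
qed

text \<open>A null \<open>f\<close> extends to a null map \<open>k\<close> from \<open>I\<close> to
  \<open>X'\<close>. Then \<open>h - i' * k\<close> vanishes on \<open>X\<close> and descends to
  \<open>m\<close> on \<open>S\<close>, so \<open>g = p' * m\<close> passes through the null object
  \<open>I'\<close>. This makes the shift of a morphism well defined modulo null maps.\<close>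

lemma shift_nul:
  assumes s: "ses X I S i p" and s': "ses X' I' S' i' p'" and I: "N I' I' (idn I')"
    and f: "N X X' f" and h: "H G I I' h" "h * i = i' * f" and g: "H G S S' g" "g * p = p' * h"
  shows "N S S' g"
proof -
  obtain k where k: "N I X' k" "k * i = f" using N_ext[OF ses_mono[OF s] f] by blast
  have o: "X' \<in> C" "I' \<in> C" "S' \<in> C" "I \<in> C" "H G X' I' i'" "H G I' S' p'"
    using s s' H_mono[of UNIV] by (auto simp: ses_def)
  have "H G I I' (h - i' * k)" using o h N_H[OF _ _ k(1)] by (intro H_diff H_mult[of G X']) auto
  moreover have "(h - i' * k) * i = 0" using h k by (simp add: left_diff_distrib mult.assoc)
  ultimately obtain m where m: "H G S I' m" "m * p = h - i' * k" using quot_factor[OF s] by blast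
  have "p' * i' = 0" by (rule ses_vu[OF s'])
  then have "g * p = p' * m * p" using g m by (simp add: right_diff_distrib mult.assoc[symmetric] mult.assoc[of p' m])
  then have "g = p' * m" using epi_cancel[OF ses_epi[OF s] g(1)] H_mult[OF o(6) m(1)] by blast
  then show ?thesis using N_left[OF o(6) N_idn_left[OF I m(1)]] by simp
qed

end

context dbl begin

text \<open>Lifting and extension are done on the argument of the trace: if \<open>s\<close> is a
  section of \<open>p\<close> over \<open>K\<close> and \<open>z\<close>, the trace of
  \<open>s * T\<close> lifts the trace of \<open>T\<close>, since \<open>p\<close> commutes with
  \<open>E\<close>; retractions serve dually. The same works for \<open>nD\<close>.\<close>

lemma nE_idl: "idl d \<zeta> GA nE"
proof (unfold_locales, goal_cases)
  case 1 then show ?case by auto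
next
  case (2 X Y f) then show ?case unfolding nE_def using TrE_H by blast
next
  case (3 X Y f g) then show ?case unfolding nE_def by (metis gw_add trp_add TrE_def)
next
  case (4 X Y f) then show ?case unfolding nE_def by (metis gw_uminus trp_uminus TrE_def)
next
  case (5 X Y) then show ?case unfolding nE_def by (metis gw_0 trp_0 TrE_def)
next
  case (6 Y Z g X f) then show ?case unfolding nE_def by (metis TrE_left gw_left H_mono insert_mono subset_insertI)
next
  case (7 W X g Y f) then show ?case unfolding nE_def by (metis TrE_right gw_right H_mono insert_mono subset_insertI)
next
  case (8 Y Z p W f)
  then obtain T s where a: "gw W Z T" "f = TrE W Z T" "H UNIV Y Z p" "H GK Z Y s" "p * s = idn Z" by (auto simp: nE_def epi_def)
  have "p * TrE W Y (s * T) = TrE W Z T"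
    using TrE_left[of Y Z p W "s * T"] H_mono[OF a(3)] a(1,5) by (simp add: mult.assoc[symmetric] gw_def bt_def)
  then show ?case unfolding nE_def using gw_left[OF a(4,1)] a(2) by blast
next
  case (9 X Y i W f)
  then obtain T r where a: "gw X W T" "f = TrE X W T" "H UNIV X Y i" "H GK Y X r" "r * i = idn X" by (auto simp: nE_def mono_def)
  have "TrE Y W (T * r) * i = TrE X W T"
    using TrE_right[of X Y i W "T * r"] H_mono[OF a(3)] a(1,5) by (simp add: mult.assoc gw_def bt_def)
  then show ?case unfolding nE_def using gw_right[OF a(4,1)] a(2) by blast
qed

lemma Tr_add: "Tr X Y (S + T) = Tr X Y S + Tr X Y T" by (simp add: Tr_def TrE_def TrF_def trp_add)
lemma Tr_uminus: "Tr X Y (- S) = - Tr X Y S" by (simp add: Tr_def TrE_def TrF_def trp_uminus)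
lemma Tr_0: "Tr X Y 0 = 0" by (simp add: Tr_def TrE_def TrF_def trp_0)

lemma nD_idl: "idl d \<zeta> UNIV nD"
proof (unfold_locales, goal_cases)
  case 1 then show ?case by auto
next
  case (2 X Y f) then show ?case unfolding nD_def using Tr_H by blast
next
  case (3 X Y f g) then show ?case unfolding nD_def by (metis H_add Tr_add)
next
  case (4 X Y f) then show ?case unfolding nD_def by (metis H_uminus Tr_uminus)
next
  case (5 X Y) then show ?case unfolding nD_def by (metis H_0 Tr_0)
next
  case (6 Y Z g X f) then show ?case unfolding nD_def by (metis Tr_left H_mult H_mono subset_UNIV)
next
  case (7 W X g Y f) then show ?case unfolding nD_def by (metis Tr_right H_mult H_mono subset_UNIV)
next
  case (8 Y Z p W f)
  then obtain T s where a: "H GK W Z T" "f = Tr W Z T" "H UNIV Y Z p" "H GK Z Y s" "p * s = idn Z" by (auto simp: nD_def epi_def)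
  have "p * Tr W Y (s * T) = Tr W Z T"
    using Tr_left[of Y Z p W "s * T"] a(1,3,5) by (simp add: mult.assoc[symmetric] H_unl)
  then show ?case unfolding nD_def using H_mult[OF a(4,1)] a(2) by blast
next
  case (9 X Y i W f)
  then obtain T r where a: "H GK X W T" "f = Tr X W T" "H UNIV X Y i" "H GK Y X r" "r * i = idn X" by (auto simp: nD_def mono_def)
  have "Tr Y W (T * r) * i = Tr X W T"
    using Tr_right[of X Y i W "T * r"] a(1,3,5) by (simp add: mult.assoc H_unr)
  then show ?case unfolding nD_def using H_mult[OF a(1,4)] a(2) by blast
qed

sublocale A: idl d \<zeta> GA nE by (rule nE_idl)
sublocale D: idl d \<zeta> UNIV nD by (rule nD_idl)

end

section \<open>Induced modules\<close>

text \<open>Inclusion of the block number \<open>t\<close> of size \<open>n\<close>;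
  \<open>blk'\<close> is the projection onto it. The blocks will carry the copies of the inducing
  representation.\<close>

definition blk :: "nat \<Rightarrow> nat \<Rightarrow> lop" where "blk n t = (\<Sum>l<n. eu (t * n + l) l)"
definition blk' :: "nat \<Rightarrow> nat \<Rightarrow> lop" where "blk' n t = (\<Sum>l<n. eu l (t * n + l))"

lemma blk'_blk: "blk' n s * blk n t = (if s = t then un n else 0)"
proof -
  have e: "s * n + l = t * n + l' \<longleftrightarrow> s = t \<and> l = l'" if "l < n" "l' < n" for l l'
  proof
    assume a: "s * n + l = t * n + l'"
    have "(s * n + l) div n = s" "(t * n + l') div n = t" using that by (auto simp: add.commute)
    then show "s = t \<and> l = l'" using a by simp
  qed simp
  have "blk' n s * blk n t = (\<Sum>l<n. \<Sum>l'<n. eu l (s * n + l) * eu (t * n + l') l')"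
    by (simp add: blk_def blk'_def sum_product)
  also have "\<dots> = (\<Sum>l<n. \<Sum>l'<n. if l = l' then (if s = t then eu l l' else 0) else 0)"
    by (intro sum.cong refl) (auto simp: eu_eu e)
  also have "\<dots> = (\<Sum>l<n. if s = t then eu l l else 0)" by (intro sum.cong refl) simp
  finally show ?thesis by (simp add: un_sum)
qed

lemma blk_blk': "blk n t * blk' n t = (\<Sum>l<n. eu (t * n + l) (t * n + l))"
  by (simp add: blk_def blk'_def sum_product eu_eu)

lemma bt_blk: assumes "t < m" shows "bt (m * n) n (blk n t)" and "bt n (m * n) (blk' n t)"
proof -
  have "t * n + l < m * n" if "l < n" for l
  proof -
    have "t * n + l < Suc t * n" using that by simp
    also have "\<dots> \<le> m * n" using assms by (intro mult_le_mono1) simp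
    finally show ?thesis .
  qed
  then show "bt (m * n) n (blk n t)" "bt n (m * n) (blk' n t)" by (auto simp: blk_def blk'_def)
qed

context dbl begin

lemma zeta_sums: "(\<Sum>a<d. \<zeta> ^ a) = 0" "(\<Sum>a<d. (1 / \<zeta>) ^ a) = 0"
proof -
  have "1 / \<zeta> \<noteq> 1" "(1 / \<zeta>) ^ d = 1" using zeta_ne_1 zd by (auto simp: power_divide)
  then show "(\<Sum>a<d. \<zeta> ^ a) = 0" "(\<Sum>a<d. (1 / \<zeta>) ^ a) = 0"
    using geometric_sum[OF zeta_ne_1, of d] geometric_sum[of "1 / \<zeta>" d] zd by simp_all
qed

end

text \<open>The module induced from a representation of \<open>\<langle>K, z\<rangle>\<close>; the block with index \<open>(i, j)\<close> is the image
  of \<open>E\<^sup>i F\<^sup>j\<close>.\<close>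

locale induced = dbl d \<zeta> for d \<zeta> +
  fixes n :: nat and k z :: lop
  assumes bk: "bt n n k" and bz: "bt n n z" and kd: "k ^ d = un n" and zzd: "z ^ d = un n" and zk: "z * k = k * z"
begin

text \<open>The value 0 outside the range builds in that \<open>E ^ d\<close> vanishes and that
  \<open>F ^ d\<close> does so on the blocks \<open>b 0 j\<close>; the rules for \<open>EE\<close>,
  \<open>FF\<close>, \<open>KK\<close>, \<open>ZZ\<close> then hold for all indices.\<close>

definition b :: "nat \<Rightarrow> nat \<Rightarrow> lop" where "b i j = (if i < d \<and> j < d then blk n (i * d + j) else 0)"
definition a :: "nat \<Rightarrow> nat \<Rightarrow> lop" where "a i j = blk' n (i * d + j)"
abbreviation "M \<equiv> d * d * n"

lemma idx: "i < d \<Longrightarrow> j < d \<Longrightarrow> i * d + j < d * d"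
proof -
  assume "i < d" "j < d"
  then have "i * d + j < Suc i * d" by simp
  also have "\<dots> \<le> d * d" using \<open>i < d\<close> by (intro mult_le_mono1) simp
  finally show ?thesis .
qed

lemma idx_eq: "j < d \<Longrightarrow> j' < d \<Longrightarrow> i * d + j = i' * d + j' \<longleftrightarrow> i = i' \<and> j = j'"
proof
  assume j: "j < d" "j' < d" and e: "i * d + j = i' * d + j'"
  have "(i * d + j) div d = i" "(i' * d + j') div d = i'" using j by (auto simp: add.commute)
  then show "i = i' \<and> j = j'" using e by simp
qed simp

lemma ab: "i < d \<Longrightarrow> j < d \<Longrightarrow> i' < d \<Longrightarrow> j' < d \<Longrightarrow> a i j * b i' j' = (if i = i' \<and> j = j' then un n else 0)"
  by (auto simp: a_def b_def blk'_blk idx_eq)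

lemma sum_ba: "(\<Sum>i<d. \<Sum>j<d. b i j * a i j) = un M"
proof -
  have "un M = (\<Sum>t<d * d. \<Sum>l<n. eu (t * n + l) (t * n + l))" by (simp add: un_sum sum_lessThan_mult)
  also have "\<dots> = (\<Sum>t<d * d. blk n t * blk' n t)" by (simp add: blk_blk')
  also have "\<dots> = (\<Sum>i<d. \<Sum>j<d. blk n (i * d + j) * blk' n (i * d + j))" by (rule sum_lessThan_mult)
  also have "\<dots> = (\<Sum>i<d. \<Sum>j<d. b i j * a i j)" by (intro sum.cong refl) (simp add: a_def b_def)
  finally show ?thesis by simp
qed

lemma bt_b: "bt M n (b i j)" by (simp add: b_def bt_blk idx)
lemma bt_a: "i < d \<Longrightarrow> j < d \<Longrightarrow> bt n M (a i j)" by (simp add: a_def bt_blk idx)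

lemma ext:
  assumes "bt r M S" "bt r M T" "\<And>i j. i < d \<Longrightarrow> j < d \<Longrightarrow> S * b i j = T * b i j" shows "S = T"
proof -
  have "S * un M = T * un M"
    unfolding sum_ba[symmetric] sum_distrib_left using assms(3) by (intro sum.cong refl) (simp add: mult.assoc[symmetric])
  then show ?thesis using assms by (simp add: bt_def)
qed

definition op_of :: "(nat \<Rightarrow> nat \<Rightarrow> lop) \<Rightarrow> lop" where "op_of g = (\<Sum>i<d. \<Sum>j<d. g i j * a i j)"

lemma op_of_b: assumes "i < d" "j < d" shows "op_of g * b i j = g i j * un n"
proof -
  have "op_of g * b i j = (\<Sum>i'<d. \<Sum>j'<d. g i' j' * (a i' j' * b i j))"
    by (simp add: op_of_def sum_distrib_right mult.assoc)
  also have "\<dots> = (\<Sum>i'<d. \<Sum>j'<d. if j = j' then (if i = i' then g i' j' * un n else 0) else 0)"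
    using assms by (intro sum.cong refl) (auto simp: ab)
  also have "\<dots> = (\<Sum>i'<d. if i = i' then g i' j * un n else 0)" using assms by (intro sum.cong refl) simp
  finally show ?thesis using assms by simp
qed

lemma bt_op_of: "(\<And>i j. i < d \<Longrightarrow> j < d \<Longrightarrow> bt M n (g i j)) \<Longrightarrow> bt M M (op_of g)"
  unfolding op_of_def by (intro bt_sum bt_mult[of M n]) (auto simp: bt_a)

text \<open>\<open>w i j\<close> is the weight of \<open>E^i F^j\<close> under \<open>K\<close>. The
  operator \<open>cc i j\<close> below is the commutator term \<open>c i\<close> of \<open>F\<close>
  with \<open>E^i\<close>, pushed through \<open>F^j\<close> down to the inducing
  representation.\<close>

definition w :: "nat \<Rightarrow> nat \<Rightarrow> complex" where "w i j = \<zeta> ^ i * (1 / \<zeta>) ^ j"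
definition cc :: "nat \<Rightarrow> nat \<Rightarrow> lop" where
  "cc i j = (\<Sum>a<i. cs (\<zeta> ^ a * (1 / \<zeta>) ^ j) * k - cs ((1 / \<zeta>) ^ a * \<zeta> ^ j) * (z * k ^ (d - 1)))"

lemma cc_d: "cc d j = 0"
proof -
  have "cc d j = cs ((\<Sum>a<d. \<zeta> ^ a) * (1 / \<zeta>) ^ j) * k - cs ((\<Sum>a<d. (1 / \<zeta>) ^ a) * \<zeta> ^ j) * (z * k ^ (d - 1))"
    unfolding cc_def sum_subtractf by (simp only: cs_sum sum_distrib_right)
  then show ?thesis unfolding zeta_sums by simp
qed

lemma cc_0 [simp]: "cc 0 j = 0" by (simp add: cc_def)

lemma bt_k': "bt n n (z * k ^ (d - 1))" using bk bz d2 by (intro bt_mult[of n n] bt_pow) auto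
lemma bt_cc: "bt n n (cc i j)" unfolding cc_def using bk bt_k' by (auto intro!: bt_sum)

lemma cc_k: "cc i j * k = k * cc i j"
proof -
  have "k * (z * k ^ (d - 1)) = z * k ^ (d - 1) * k"
    by (simp only: zk[symmetric] mult.assoc[symmetric]) (simp only: mult.assoc power_Suc[symmetric] power_Suc2[symmetric])
  then show ?thesis by (simp add: cc_def sum_distrib_left sum_distrib_right right_diff_distrib left_diff_distrib
        mult.assoc cs_left[of k])
qed

lemma cc_z: "cc i j * z = z * cc i j"
proof -
  have "k ^ (d - 1) * z = z * k ^ (d - 1)" by (rule power_commuting_commutes) (simp add: zk)
  then show ?thesis by (simp add: cc_def sum_distrib_left sum_distrib_right right_diff_distrib left_diff_distrib
        mult.assoc cs_left[of z] zk)
qed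

definition EE :: lop where "EE = op_of (\<lambda>i j. b (Suc i) j)"
definition KK :: lop where "KK = op_of (\<lambda>i j. cs (w i j) * (b i j * k))"
definition ZZ :: lop where "ZZ = op_of (\<lambda>i j. b i j * z)"
definition FF :: lop where "FF = op_of (\<lambda>i j. b i (Suc j) - (if i = 0 then 0 else b (i - 1) j * cc i j))"

lemma b_un: "b i j * un n = b i j" using bt_b by (simp add: bt_def)
lemma k_un: "k * un n = k" "z * un n = z" using bk bz by (auto simp: bt_def)
lemma b_out: "\<not> (i < d \<and> j < d) \<Longrightarrow> b i j = 0" by (auto simp: b_def)

lemma Eb: "EE * b i j = b (Suc i) j"
proof (cases "i < d \<and> j < d")
  case True then show ?thesis by (simp add: EE_def op_of_b b_un)
next
  case False then show ?thesis by (simp add: b_out)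
qed
lemma Kb: "KK * b i j = cs (w i j) * (b i j * k)"
proof (cases "i < d \<and> j < d")
  case True then show ?thesis by (simp add: KK_def op_of_b k_un mult.assoc)
next
  case False then show ?thesis by (simp add: b_out)
qed
lemma Zb: "ZZ * b i j = b i j * z"
proof (cases "i < d \<and> j < d")
  case True then show ?thesis by (simp add: ZZ_def op_of_b k_un mult.assoc)
next
  case False then show ?thesis by (simp add: b_out)
qed
lemma F0: "FF * b 0 j = b 0 (Suc j)"
proof (cases "j < d")
  case True then show ?thesis using d0 by (simp add: FF_def op_of_b b_un)
next
  case False then show ?thesis by (simp add: b_out)
qed
lemma FS: "FF * b (Suc i) j = b (Suc i) (Suc j) - b i j * cc (Suc i) j"
proof (cases "Suc i < d \<and> j < d")
  case True then show ?thesis using bt_cc[of "Suc i" j] by (simp add: FF_def op_of_b b_un left_diff_distrib mult.assoc bt_def)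
next
  case False
  show ?thesis
  proof (cases "Suc i = d")
    \<comment> \<open>At \<open>Suc i = d\<close> the left side is 0, and the right side is so
      because \<open>cc d j\<close> vanishes: here \<open>F\<close> is seen to be compatible with
      \<open>E ^ d = 0\<close>.\<close>
    case True then show ?thesis using cc_d[of j] by (simp add: b_out)
  next
    case F: False then show ?thesis using False by (auto simp: b_out)
  qed
qed

lemma bts: "bt M M EE" "bt M M FF" "bt M M KK" "bt M M ZZ"
  unfolding EE_def FF_def KK_def ZZ_def
  by (rule bt_op_of, auto intro!: bt_b bt_cs bt_mult[OF bt_b bk] bt_mult[OF bt_b bz] bt_diff bt_mult[OF bt_b bt_cc])+

lemma w_Suc: "w (Suc i) j = \<zeta> * w i j" "w i (Suc j) = (1 / \<zeta>) * w i j" by (auto simp: w_def)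

lemma w_d: "w i j ^ d = 1"
proof -
  have "w i j ^ d = (\<zeta> ^ d) ^ i * (1 / \<zeta> ^ d) ^ j"
    by (simp add: w_def power_mult_distrib power_mult[symmetric] mult.commute power_divide)
  then show ?thesis by (simp add: zd)
qed

lemma w_pred: "w i j ^ (d - 1) = (1 / \<zeta>) ^ i * \<zeta> ^ j"
proof -
  have "w i j ^ (d - 1) * w i j = 1" using power_minus_mult[OF d0, of "w i j"] w_d by simp
  moreover have "(1 / \<zeta>) ^ i * \<zeta> ^ j * w i j = 1" using z0 by (simp add: w_def power_divide)
  moreover have "w i j \<noteq> 0" using z0 by (simp add: w_def)
  ultimately show ?thesis by (metis mult_right_cancel)
qed

lemma E_pow_b: "EE ^ m * b i j = b (i + m) j"
  by (induction m arbitrary: i) (auto simp: power_Suc2 mult.assoc Eb simp del: power_Suc)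
lemma F_pow_b: "FF ^ m * b 0 j = b 0 (j + m)"
  by (induction m arbitrary: j) (auto simp: power_Suc2 mult.assoc F0 simp del: power_Suc)
lemma K_pow_b: "KK ^ m * b i j = cs (w i j ^ m) * (b i j * k ^ m)"
proof (induction m)
  case (Suc m)
  have "KK ^ Suc m * b i j = KK * (cs (w i j ^ m) * (b i j * k ^ m))" by (simp add: mult.assoc Suc)
  also have "\<dots> = cs (w i j ^ m) * ((KK * b i j) * k ^ m)" by (simp only: cs_left[of KK] mult.assoc)
  finally show ?case unfolding Kb by (simp add: mult.assoc cs_cs mult.commute)
qed simp
lemma Z_pow_b: "ZZ ^ m * b i j = b i j * z ^ m"
  by (induction m) (auto simp: mult.assoc, simp add: mult.assoc[symmetric] Zb)

lemma ind_rel: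
  "ZZ * EE = EE * ZZ" "ZZ * FF = FF * ZZ" "ZZ * KK = KK * ZZ" "KK * EE = cs \<zeta> * (EE * KK)"
  "KK * FF = cs (inverse \<zeta>) * (FF * KK)" "EE * FF - FF * EE = KK - ZZ * KK ^ (d - 1)"
proof -
  have d1: "d - 1 > 0" using d2 by simp
  note bt = bts bt_mult[of M M _ M] bt_cs bt_diff bt_pow[OF bts(3) d1]
  show "ZZ * EE = EE * ZZ"
    by (rule ext[of M], intro bt, intro bt) (simp add: mult.assoc Eb Zb assoc2[OF Eb])
  show "ZZ * KK = KK * ZZ"
    by (rule ext[of M], intro bt, intro bt) (simp add: mult.assoc Kb Zb assoc2[OF Kb] assoc2[OF Zb] cs_left[of ZZ] zk)
  show "KK * EE = cs \<zeta> * (EE * KK)"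
    by (rule ext[of M], intro bt, intro bt) (simp add: mult.assoc Kb Eb assoc2[OF Eb] cs_left[of EE] cs_cs w_Suc)
  show "ZZ * FF = FF * ZZ"
  proof (rule ext[of M])
    show "ZZ * FF * b i j = FF * ZZ * b i j" for i j
      by (cases i) (simp_all add: mult.assoc F0 FS Zb assoc2[OF F0] assoc2[OF FS] assoc2[OF Zb] right_diff_distrib
        left_diff_distrib cc_z)
  qed (auto intro!: bt)
  show "KK * FF = cs (inverse \<zeta>) * (FF * KK)"
  proof (rule ext[of M])
    show "KK * FF * b i j = cs (inverse \<zeta>) * (FF * KK) * b i j" for i j
      using z0 by (cases i) (simp_all add: mult.assoc F0 FS Kb assoc2[OF F0] assoc2[OF FS] assoc2[OF Kb] right_diff_distrib
        left_diff_distrib cc_k cs_left[of FF] cs_cs w_Suc inverse_eq_divide)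
  qed (auto intro!: bt)
  show "EE * FF - FF * EE = KK - ZZ * KK ^ (d - 1)"
  proof (rule ext[of M])
    fix i j
    have r: "(KK - ZZ * KK ^ (d - 1)) * b i j = b i j * (cs (w i j) * k - cs ((1 / \<zeta>) ^ i * \<zeta> ^ j) * (z * k ^ (d - 1)))"
      by (simp only: left_diff_distrib right_diff_distrib mult.assoc Kb K_pow_b cs_left[of ZZ] cs_left[of "b i j"]
        assoc2[OF Zb] w_pred)
    have "(EE * FF - FF * EE) * b i j = b i j * (cc (Suc i) j - cc i j)"
      by (cases i) (simp_all add: mult.assoc F0 FS Eb assoc2[OF Eb] right_diff_distrib left_diff_distrib)
    then show "(EE * FF - FF * EE) * b i j = (KK - ZZ * KK ^ (d - 1)) * b i j"
      unfolding r by (simp add: cc_def w_def)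
  qed (auto intro!: bt simp del: One_nat_def)
qed

lemma ind_D: "isD M EE FF KK ZZ"
proof -
  interpret uq \<zeta> EE FF KK "ZZ * KK ^ (d - 1)" by (rule uq_rel[OF ind_rel(4,5,1,2,6)])
  \<comment> \<open>Powers of \<open>FF\<close> are explicit only on the blocks
    \<open>b 0 j\<close>; commutation with \<open>EE\<close> carries the vanishing of
    \<open>FF ^ d\<close> to all other blocks.\<close>
  have "EE * FF ^ d = FF ^ d * EE"
  proof -
    have "d = Suc (d - 1)" using d0 by simp
    then show ?thesis using e_f_pow[of "d - 1"] c_zero(2)[OF zd zeta_ne_1] by simp
  qed
  then have FE: "FF ^ d * EE ^ m = EE ^ m * FF ^ d" for m
    by (metis power_commuting_commutes)
  have "FF ^ d = 0"
  proof (rule ext[of M])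
    fix i j
    have "FF ^ d * b i j = FF ^ d * (EE ^ i * b 0 j)" by (simp add: E_pow_b)
    also have "\<dots> = EE ^ i * (FF ^ d * b 0 j)" by (simp only: mult.assoc[symmetric] FE)
    also have "\<dots> = 0" by (simp add: F_pow_b b_out)
    finally show "FF ^ d * b i j = 0 * b i j" by simp
  qed (auto intro!: bts bt_pow d0)
  moreover have "EE ^ d = 0" by (rule ext[of M]) (auto intro!: bts bt_pow d0 simp: E_pow_b b_out)
  moreover have "KK ^ d = un M"
    by (rule ext[of M]) (auto intro!: bts bt_pow d0 simp: K_pow_b w_d kd b_un bt_unl[OF bt_b])
  moreover have "ZZ ^ d = un M"
    by (rule ext[of M]) (auto intro!: bts bt_pow d0 simp: Z_pow_b zzd b_un bt_unl[OF bt_b])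
  ultimately show ?thesis using ind_rel bts by (simp add: isD_def)
qed

lemma aE: assumes "Suc i < d" "j < d" shows "a (Suc i) j * EE = a i j"
proof (rule ext[of n])
  fix i' j' assume "i' < d" "j' < d"
  then show "a (Suc i) j * EE * b i' j' = a i j * b i' j'"
    using assms by (cases "Suc i' < d") (auto simp: mult.assoc Eb ab b_out)
qed (use assms bts in \<open>auto intro!: bt_a bt_mult[OF bt_a]\<close>)

text \<open>In the top degree in \<open>E\<close> the correction term of \<open>FF\<close> does not
  contribute, since it lies in a lower degree. So \<open>F\<close> acts on these coordinates by a
  pure shift.\<close>

lemma aF: assumes "Suc j < d" shows "a (d - 1) (Suc j) * FF = a (d - 1) j"
proof (rule ext[of n])
  fix i' j' assume i': "i' < d" "j' < d"
  show "a (d - 1) (Suc j) * FF * b i' j' = a (d - 1) j * b i' j'"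
  proof (cases i')
    case 0
    then show ?thesis using assms i' d2 by (cases "Suc j' < d") (auto simp: mult.assoc F0 ab b_out)
  next
    case (Suc l)
    then have l: "l < d" "l \<noteq> d - 1" using i' by auto
    have "a (d - 1) (Suc j) * (b l j' * cc (Suc l) j') = 0"
      using assms i' l by (simp add: mult.assoc[symmetric] ab)
    moreover have "a (d - 1) (Suc j) * b (Suc l) (Suc j') = a (d - 1) j * b (Suc l) j'"
      using assms i' Suc by (cases "Suc j' < d") (auto simp: ab b_out)
    ultimately show ?thesis using Suc by (simp add: mult.assoc FS right_diff_distrib)
  qed
qed (use assms bts in \<open>auto intro!: bt_a bt_mult[OF bt_a]\<close>)

text \<open>The Frobenius form of the construction: the coefficient of the top product
  \<open>E^(d-1) F^(d-1)\<close>.\<close>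

abbreviation "aa \<equiv> a (d - 1) (d - 1)"

lemma aF_pow: "m < d \<Longrightarrow> aa * FF ^ m = a (d - 1) (d - 1 - m)"
proof (induction m)
  case (Suc m)
  have "aa * FF ^ Suc m = (aa * FF ^ m) * FF" by (simp only: power_Suc2 mult.assoc)
  also have "\<dots> = a (d - 1) (Suc (d - 1 - Suc m)) * FF" using Suc by (simp add: Suc_diff_Suc)
  also have "\<dots> = a (d - 1) (d - 1 - Suc m)" using Suc by (intro aF) simp
  finally show ?case .
qed simp

lemma aE_pow: "m < d \<Longrightarrow> j < d \<Longrightarrow> a (d - 1) j * EE ^ m = a (d - 1 - m) j"
proof (induction m)
  case (Suc m)
  have "a (d - 1) j * EE ^ Suc m = (a (d - 1) j * EE ^ m) * EE" by (simp only: power_Suc2 mult.assoc)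
  also have "\<dots> = a (Suc (d - 1 - Suc m)) j * EE" using Suc by (simp add: Suc_diff_Suc)
  also have "\<dots> = a (d - 1 - Suc m) j" using Suc by (intro aE) simp_all
  finally show ?case .
qed simp

text \<open>Multiplying the form \<open>aa\<close> by complementary powers of \<open>FF\<close> and
  \<open>EE\<close> recovers every coordinate \<open>a i j\<close>, which is the dual basis
  property. The trace thus becomes the map that sends the block \<open>(i, j)\<close> to
  \<open>E^i F^j S\<close>, formed with the action in the target.\<close>

lemma trace_left: "trp d y EE (trp d x FF (S * aa)) = (\<Sum>i<d. \<Sum>j<d. y ^ i * (x ^ j * (S * a i j)))"
proof -
  have "aa * (FF ^ (d - 1 - j) * EE ^ (d - 1 - i)) = a i j" if "i < d" "j < d" for i j
    using that aF_pow[of "d - 1 - j"] aE_pow[of "d - 1 - i" j] by (simp add: mult.assoc[symmetric])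
  then show ?thesis
    by (simp add: trp_def sum_distrib_right sum_distrib_left mult.assoc)
qed

lemma trace_right: "trp d EE y (trp d FF x (b 0 0 * S)) = (\<Sum>i<d. \<Sum>j<d. b i j * (S * (x ^ (d - 1 - j) * y ^ (d - 1 - i))))"
proof -
  have "EE ^ i * (FF ^ j * (b 0 0 * T)) = b i j * T" for i j T
    by (simp add: mult.assoc[symmetric]) (simp add: mult.assoc F_pow_b E_pow_b)
  then show ?thesis
    by (simp add: trp_def sum_distrib_right sum_distrib_left mult.assoc)
qed

text \<open>With both actions taken inside the induced operators the terms are the projections onto
  the blocks. The identity of the induced module is therefore a relative trace.\<close>

lemma trace_one: "trp d EE EE (trp d FF FF (b 0 0 * aa)) = un M"
proof -
  have "EE ^ i * (FF ^ j * (b 0 0 * a i j)) = b i j * a i j" for i j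
    by (simp add: mult.assoc[symmetric]) (simp add: mult.assoc F_pow_b E_pow_b)
  then show ?thesis unfolding trace_left by (simp add: sum_ba)
qed

text \<open>The top product has weight
  \<open>\<zeta> ^ (d - 1) * (1 / \<zeta>) ^ (d - 1) = 1\<close>, so that its coefficient is
  equivariant without any twist by a character.\<close>

lemma aaK: "aa * KK = k * aa" "aa * ZZ = z * aa"
proof -
  have w: "w (d - 1) (d - 1) = 1" using z0 by (simp add: w_def power_mult_distrib[symmetric])
  show "aa * KK = k * aa"
  proof (rule ext[of n])
    fix i j assume "i < d" "j < d"
    then show "aa * KK * b i j = k * aa * b i j" using d0 w bt_unl[OF bk] bt_unr[OF bk]
      by (auto simp: mult.assoc Kb cs_left[of "a (d - Suc 0) (d - Suc 0)"] assoc2[OF ab] ab)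
  qed (use bts bk d0 in \<open>auto intro!: bt_a bt_mult[OF bt_a] bt_mult[OF bk]\<close>)
  show "aa * ZZ = z * aa"
  proof (rule ext[of n])
    fix i j assume "i < d" "j < d"
    then show "aa * ZZ * b i j = z * aa * b i j" using d0 bt_unl[OF bz] bt_unr[OF bz]
      by (auto simp: mult.assoc Zb assoc2[OF ab] ab)
  qed (use bts bz d0 in \<open>auto intro!: bt_a bt_mult[OF bt_a] bt_mult[OF bz]\<close>)
qed

end

context dbl begin

text \<open>Induction and coinduction coincide here. The trace of the form \<open>aa\<close> maps
  the induced module onto \<open>X\<close>, split by the block \<open>b 0 0\<close>, and the trace
  of \<open>b 0 0\<close> embeds \<open>X\<close> in the same module, with retraction
  \<open>aa\<close>.\<close>

lemma induced_module:
  assumes X: "X \<in> C"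
  shows "\<exists>Q e i. epi Q X e \<and> mono X Q i \<and> nD Q Q (idn Q)"
proof -
  interpret I: induced d \<zeta> "vdim X" "ac X DK" "ac X DZ"
    using C_isM[OF X] by unfold_locales (auto simp: isD_def)
  define Q where "Q = mk I.M I.EE I.FF I.KK I.ZZ"
  note Q = mk[OF I.ind_D, folded Q_def]
  let ?A = I.aa and ?B = "I.b 0 0"
  have A: "H GK Q X ?A" using I.aaK I.bt_a d0 by (simp add: H_def Q)
  have w: "I.w 0 0 = 1" by (simp add: I.w_def)
  have B: "H GK X Q ?B" using I.Kb[of 0 0] I.Zb[of 0 0] I.bt_b w by (simp add: H_def Q)
  have BA: "H GK Q Q (?B * ?A)" by (rule H_mult[OF B A])
  have "Tr Q Q (?B * ?A) = idn Q" using I.trace_one by (simp add: Tr_def TrE_def TrF_def Q)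
  then have "nD Q Q (idn Q)" using BA unfolding nD_def by metis
  moreover have "epi Q X (Tr Q X ?A)"
  proof -
    have "Tr Q X ?A * ?B = (\<Sum>i<d. \<Sum>j<d. ac X DE ^ i * (ac X DF ^ j * (I.a i j * ?B)))"
      using I.trace_left[of "ac X DE" "ac X DF" 1] by (simp add: Tr_def TrE_def TrF_def Q sum_distrib_right mult.assoc)
    also have "\<dots> = (\<Sum>i<d. \<Sum>j<d. if j = 0 then (if i = 0 then idn X else 0) else 0)"
      using d0 by (intro sum.cong refl) (auto simp: I.ab)
    also have "\<dots> = idn X" using d0 by simp
    finally show ?thesis unfolding epi_def using Tr_H[OF Q(1) X A] B Q(1) X by blast
  qed
  moreover have "mono X Q (Tr X Q ?B)"
  proof -
    have "?A * Tr X Q ?B = (\<Sum>i<d. \<Sum>j<d. ?A * I.b i j * (ac X DF ^ (d - 1 - j) * ac X DE ^ (d - 1 - i)))"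
      using I.trace_right[of "ac X DE" "ac X DF" 1] by (simp add: Tr_def TrE_def TrF_def Q sum_distrib_left mult.assoc)
    also have "\<dots> = (\<Sum>i<d. \<Sum>j<d. if j = d - 1 then (if i = d - 1 then idn X else 0) else 0)"
      using d0 by (intro sum.cong refl) (auto simp: I.ab)
    also have "\<dots> = (\<Sum>i<d. if i = d - 1 then idn X else 0)" using d0 by (intro sum.cong refl) simp
    also have "\<dots> = idn X" using d0 by simp
    finally show ?thesis unfolding mono_def using Tr_H[OF X Q(1) B] A Q(1) X by blast
  qed
  ultimately show ?thesis by blast
qed

end

section \<open>Kernels, cokernels and direct sums\<close>

context dbl begin

text \<open>The first alternative says that the image of \<open>p\<close> is a submodule, the second
  that its kernel is one, so that the image represents the quotient. In both cases the compressions
  \<open>b * (T * a)\<close> of the generators inherit the relations of \<open>Y\<close>.\<close>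

lemma compressed_module:
  assumes Y: "Y \<in> C" and p: "H GK Y Y p" "p * p = p"
    and inv: "(\<forall>g. p * (ac Y g * p) = ac Y g * p) \<or> (\<forall>g. p * (ac Y g * p) = p * ac Y g)"
  shows "\<exists>X a b. X \<in> C \<and> H GK X Y a \<and> H GK Y X b \<and> p = a * b \<and> b * a = idn X \<and> (\<forall>g. ac X g = b * (ac Y g * a))"
proof -
  obtain k a b where ab: "bt (vdim Y) k a" "bt k (vdim Y) b" "p = a * b" "b * a = un k"
    using idempotent_factorization[OF H_bt[OF p(1)] p(2)] by blast
  have pa: "p * a = a" "b * p = b" using ab by (simp_all add: mult.assoc bt_unr assoc2[OF ab(4)] bt_unl)
  \<comment> \<open>Compression is not multiplicative on all operators. \<open>W\<close> is a
    multiplicatively closed set that contains the generators and on which it is; this covers the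
    powers that occur in the relations.\<close>
  obtain W where gW: "\<And>g. ac Y g \<in> W" and mW: "\<And>S T. S \<in> W \<Longrightarrow> T \<in> W \<Longrightarrow> S * T \<in> W"
    and bb: "\<And>S T. S \<in> W \<Longrightarrow> T \<in> W \<Longrightarrow> (b * (S * a)) * (b * (T * a)) = b * (S * T * a)"
  proof (cases "\<forall>g. p * (ac Y g * p) = ac Y g * p")
    case True
    have c: "p * (T * a) = T * a" if "p * (T * p) = T * p" for T
    proof -
      have "p * (T * p) * a = T * p * a" using that by simp
      then show ?thesis by (simp add: mult.assoc pa)
    qed
    show ?thesis
    proof (rule that[of "{T. p * (T * p) = T * p}"])
      fix S T assume a: "S \<in> {T. p * (T * p) = T * p}" "T \<in> {T. p * (T * p) = T * p}"
      then have S: "p * (S * p) = S * p" and T: "p * (T * p) = T * p" by auto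
      have "p * (S * T * p) = p * (S * p) * (T * p)" using T by (simp add: mult.assoc)
      also have "\<dots> = S * T * p" using S T by (simp add: mult.assoc)
      finally show "S * T \<in> {T. p * (T * p) = T * p}" by simp
      have "(b * (S * a)) * (b * (T * a)) = b * (S * (p * (T * a)))" by (simp add: ab(3) mult.assoc)
      then show "(b * (S * a)) * (b * (T * a)) = b * (S * T * a)" using c[OF T] by (simp add: mult.assoc)
    qed (use True in auto)
  next
    case False
    then have inv': "\<And>g. p * (ac Y g * p) = p * ac Y g" using inv by blast
    have c: "b * (T * p) = b * T" if "p * (T * p) = p * T" for T
    proof -
      have "b * (p * (T * p)) = b * (p * T)" using that by simp
      then show ?thesis by (simp add: mult.assoc[symmetric] pa)
    qed
    show ?thesis
    proof (rule that[of "{T. p * (T * p) = p * T}"])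
      fix S T assume a: "S \<in> {T. p * (T * p) = p * T}" "T \<in> {T. p * (T * p) = p * T}"
      then have S: "p * (S * p) = p * S" and T: "p * (T * p) = p * T" by auto
      have "p * (S * T * p) = p * S * (p * (T * p))" using S by (simp add: mult.assoc[symmetric])
      also have "\<dots> = p * (S * p) * T" using T by (simp add: mult.assoc)
      also have "\<dots> = p * (S * T)" using S by (simp add: mult.assoc[symmetric])
      finally show "S * T \<in> {T. p * (T * p) = p * T}" by simp
      have "(b * (S * a)) * (b * (T * a)) = (b * (S * p)) * (T * a)" by (simp add: ab(3) mult.assoc)
      then show "(b * (S * a)) * (b * (T * a)) = b * (S * T * a)" unfolding c[OF S] by (simp add: mult.assoc)
    qed (use inv' in auto)
  qed
  define \<phi> where "\<phi> T = b * (T * a)" for T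
  have m: "\<phi> S * \<phi> T = \<phi> (S * T)" if "S \<in> W" "T \<in> W" for S T using bb[OF that] by (simp add: \<phi>_def)
  have pw: "T ^ Suc i \<in> W \<and> \<phi> T ^ Suc i = \<phi> (T ^ Suc i)" if "T \<in> W" for T i
  proof (induction i)
    case 0 then show ?case using that by simp
  next
    case (Suc i)
    then show ?case using mW[OF that, of "T ^ Suc i"] m[OF that, of "T ^ Suc i"] by simp
  qed
  have pw': "T ^ i \<in> W \<and> \<phi> T ^ i = \<phi> (T ^ i)" if "T \<in> W" "i > 0" for T i
    using pw[OF that(1), of "i - 1"] that(2) by simp
  have d1: "d - 1 > 0" using d2 by simp
  have btp: "bt k k (\<phi> (ac Y g))" for g using ab bt_ac[OF C_wf[OF Y]] by (auto simp: \<phi>_def)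
  have add: "\<phi> S - \<phi> T = \<phi> (S - T)" for S T by (simp add: \<phi>_def algebra_simps)
  have sc: "\<phi> (cs c * T) = cs c * \<phi> T" for c T by (simp add: \<phi>_def mult.assoc cs_left[of b])
  have un: "\<phi> (idn Y) = un k" using ab by (simp add: \<phi>_def bt_unl)
  have z: "\<phi> 0 = 0" by (simp add: \<phi>_def)
  note r = C_isM[OF Y, unfolded isD_def]
  have D: "isD k (\<phi> (ac Y DE)) (\<phi> (ac Y DF)) (\<phi> (ac Y DK)) (\<phi> (ac Y DZ))"
    unfolding isD_def using d0 d1 by (simp add: btp m add sc un z r gW pw')
  define X where "X = mk k (\<phi> (ac Y DE)) (\<phi> (ac Y DF)) (\<phi> (ac Y DK)) (\<phi> (ac Y DZ))"
  note X = mk[OF D, folded X_def]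
  have acX: "ac X g = b * (ac Y g * a)" for g by (cases g) (simp_all add: X \<phi>_def)
  have pK: "p * ac Y g = ac Y g * p" if "g \<in> GK" for g using H_ac[OF p(1) that] .
  have "a * ac X g = ac Y g * a" "b * ac Y g = ac X g * b" if "g \<in> GK" for g
  proof -
    have "a * ac X g = p * ac Y g * a" by (simp add: acX ab(3) mult.assoc)
    then show "a * ac X g = ac Y g * a" by (simp add: pK[OF that] mult.assoc pa)
    have "ac X g * b = b * (ac Y g * p)" by (simp add: acX ab(3) mult.assoc)
    also have "\<dots> = b * p * ac Y g" by (simp add: pK[OF that, symmetric] mult.assoc)
    finally show "b * ac Y g = ac X g * b" by (simp add: pa)
  qed
  then have "H GK X Y a" "H GK Y X b" using ab by (auto simp: H_def X)
  then show ?thesis using X(1,2) ab(3,4) acX by metis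
qed

text \<open>\<open>idn Y - s * v\<close> projects onto the kernel of \<open>v\<close>. The kernel is
  a submodule, so the first alternative of \<open>compressed_module\<close> applies, although
  \<open>s\<close> respects only \<open>K\<close> and \<open>z\<close>.\<close>

lemma kernel_ex:
  assumes v: "epi Y Z v" shows "\<exists>X u. ses X Y Z u v"
proof -
  obtain s where o: "Y \<in> C" "Z \<in> C" "H UNIV Y Z v" and s: "H GK Z Y s" "v * s = idn Z" using v by (auto simp: epi_def)
  define p where "p = idn Y - s * v"
  have v': "H GK Y Z v" using o H_mono by blast
  have p: "H GK Y Y p" unfolding p_def by (intro H_diff H_idn C_wf o H_mult[OF s(1) v'])
  have vp: "v * p = 0" using o by (simp add: p_def right_diff_distrib assoc2[OF s(2)] H_unl H_unr)
  have pp: "p * T = T - s * (v * T)" if "idn Y * T = T" for T using that by (simp add: p_def left_diff_distrib mult.assoc)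
  have pu: "idn Y * p = p" using H_unl[OF p] .
  have "p * p = p" using pp[OF pu] vp by simp
  moreover have inv: "p * (ac Y g * p) = ac Y g * p" for g
  proof -
    have "v * (ac Y g * p) = 0" by (simp add: H_ac2[OF o(3)] vp)
    then show ?thesis using pp[of "ac Y g * p"] o by (simp add: mult.assoc[symmetric] ac_idn)
  qed
  ultimately obtain X a b where X: "X \<in> C" "H GK X Y a" "H GK Y X b" "p = a * b" "b * a = idn X" "\<And>g. ac X g = b * (ac Y g * a)"
    using compressed_module[OF o(1) p] by blast
  have pa: "p * a = a" using X by (simp add: mult.assoc H_unr)
  have "a * ac X g = ac Y g * a" for g
  proof -
    have "a * ac X g = p * (ac Y g * p) * a" using pa by (simp add: X(6) X(4) mult.assoc assoc2[OF X(5)] H_unl[OF X(3)])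
      (simp add: X(4)[symmetric] mult.assoc[symmetric])?
    then show ?thesis unfolding inv by (simp add: mult.assoc pa)
  qed
  then have "H UNIV X Y a" using H_bt[OF X(2)] by (simp add: H_def)
  moreover have "a * b + s * v = idn Y" unfolding X(4)[symmetric] p_def by simp
  ultimately show ?thesis unfolding ses_def using X o s by blast
qed

text \<open>The kernel of the projection \<open>idn Y - i * r\<close> is the image of
  \<open>i\<close>, a submodule: the second alternative of \<open>compressed_module\<close>.\<close>

lemma cokernel_ex:
  assumes i: "mono X Y i" shows "\<exists>Z v. ses X Y Z i v"
proof -
  obtain r where o: "X \<in> C" "Y \<in> C" "H UNIV X Y i" and r: "H GK Y X r" "r * i = idn X" using i by (auto simp: mono_def)
  define p where "p = idn Y - i * r"
  have i': "H GK X Y i" using o H_mono by blast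
  have p: "H GK Y Y p" unfolding p_def by (intro H_diff H_idn C_wf o H_mult[OF i' r(1)])
  have pi: "p * i = 0" using o r by (simp add: p_def left_diff_distrib mult.assoc H_unl H_unr)
  have pp: "T * p = T - T * (i * r)" if "T * idn Y = T" for T using that by (simp add: p_def right_diff_distrib mult.assoc)
  have "p * p = p" using pp[OF H_unr[OF p]] by (simp add: assoc2[OF pi])
  moreover have inv: "p * (ac Y g * p) = p * ac Y g" for g
  proof -
    have "p * ac Y g * (i * r) = p * (i * (ac X g * r))" by (simp add: mult.assoc H_ac2[OF o(3)])
    then have "p * ac Y g * (i * r) = 0" by (simp add: assoc2[OF pi])
    then show ?thesis using pp[of "p * ac Y g"] o by (simp add: mult.assoc ac_idn)
  qed
  ultimately obtain Z a b where X: "Z \<in> C" "H GK Z Y a" "H GK Y Z b" "p = a * b" "b * a = idn Z" "\<And>g. ac Z g = b * (ac Y g * a)"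
    using compressed_module[OF o(2) p] by blast
  have bp: "b * p = b" using X by (simp add: assoc2[OF X(5)] H_unl)
  have "b * ac Y g = ac Z g * b" for g
  proof -
    have "ac Z g * b = b * (ac Y g * p)" by (simp add: X(6) X(4) mult.assoc)
    also have "\<dots> = b * (p * (ac Y g * p))" by (metis bp mult.assoc)
    also have "\<dots> = b * ac Y g" unfolding inv by (metis bp mult.assoc)
    finally show ?thesis by simp
  qed
  then have "H UNIV Y Z b" using H_bt[OF X(3)] by (simp add: H_def)
  moreover have "i * r + a * b = idn Y" unfolding X(4)[symmetric] p_def by simp
  ultimately show ?thesis unfolding ses_def using X o r by blast
qed

lemma direct_sum_ex:
  assumes X: "X \<in> C" and Y: "Y \<in> C"
  shows "\<exists>S i j p q. S \<in> C \<and> H UNIV X S i \<and> H UNIV Y S j \<and> H UNIV S X p \<and> H UNIV S Y q \<and>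
    p * i = idn X \<and> q * j = idn Y \<and> p * j = 0 \<and> q * i = 0 \<and> i * p + j * q = idn S"
proof -
  let ?n = "vdim X" and ?m = "vdim Y"
  define i p where "i = un ?n" and "p = un ?n"
  define j q where "j = (\<Sum>l<?m. eu (?n + l) l)" and "q = (\<Sum>l<?m. eu l (?n + l))"
  have bt: "bt (?n + ?m) ?n i" "bt ?n (?n + ?m) p" "bt (?n + ?m) ?m j" "bt ?m (?n + ?m) q"
    by (auto simp: i_def p_def j_def q_def) (simp_all add: bt_def un_un sum_distrib_left sum_distrib_right un_eu eu_un)
  have "q * j = (\<Sum>l<?m. \<Sum>l'<?m. if l = l' then eu l l' else 0)"
    by (simp add: q_def j_def sum_product eu_eu)
  also have "\<dots> = un ?m" by (simp add: un_sum)
  finally have qj: "q * j = un ?m" .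
  have pi: "p * i = un ?n" "p * j = 0" "q * i = 0"
    by (simp_all add: p_def i_def j_def q_def un_un sum_distrib_left sum_distrib_right un_eu eu_un)
  have s: "i * p + j * q = un (?n + ?m)"
    by (simp add: i_def p_def j_def q_def un_un sum_product eu_eu un_sum[of "?n + ?m"] sum_lessThan_add)
      (simp add: un_sum)
  define \<phi> where "\<phi> S T = i * (S * p) + j * (T * q)" for S T
  have m: "\<phi> S T * \<phi> S' T' = \<phi> (S * S') (T * T')" if "bt ?n ?n S'" "bt ?m ?m T'" for S T S' T'
    using that by (simp add: \<phi>_def algebra_simps assoc2[OF pi(1)] assoc2[OF pi(2)] assoc2[OF pi(3)] assoc2[OF qj] bt_unl' bt_unl)
  have add: "\<phi> S T - \<phi> S' T' = \<phi> (S - S') (T - T')" for S T S' T' by (simp add: \<phi>_def algebra_simps)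
  have sc: "\<phi> (cs c * S) (cs c * T) = cs c * \<phi> S T" for c S T
    by (simp add: \<phi>_def distrib_left mult.assoc cs_left[of i] cs_left[of j])
  have un: "\<phi> (un ?n) (un ?m) = un (?n + ?m)" using s bt by (simp add: \<phi>_def bt_unl)
  have z: "\<phi> 0 0 = 0" by (simp add: \<phi>_def)
  have btp: "bt (?n + ?m) (?n + ?m) (\<phi> S T)" if "bt ?n ?n S" "bt ?m ?m T" for S T
    using that bt unfolding \<phi>_def by (intro bt_add bt_mult[of _ ?n i] bt_mult[of _ ?n S] bt_mult[of _ ?m j] bt_mult[of _ ?m T])
  have btX: "bt ?n ?n (ac X g)" "bt ?m ?m (ac Y g)" for g using X Y by (auto intro: bt_ac C_wf)
  have pw: "\<phi> S T ^ Suc l = \<phi> (S ^ Suc l) (T ^ Suc l)" if "bt ?n ?n S" "bt ?m ?m T" for S T l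
  proof (induction l)
    case (Suc l)
    have "\<phi> S T ^ Suc (Suc l) = \<phi> S T * \<phi> (S ^ Suc l) (T ^ Suc l)"
      unfolding power_Suc[of "\<phi> S T" "Suc l"] Suc.IH ..
    also have "\<dots> = \<phi> (S * S ^ Suc l) (T * T ^ Suc l)" using that by (intro m bt_pow) auto
    finally show ?case by (simp only: power_Suc)
  qed simp
  have pw': "\<phi> S T ^ l = \<phi> (S ^ l) (T ^ l)" if "bt ?n ?n S" "bt ?m ?m T" "l > 0" for S T l
    using pw[OF that(1,2), of "l - 1"] that(3) by simp
  have d1: "d - 1 > 0" using d2 by simp
  note r = C_isM[OF X, unfolded isD_def] C_isM[OF Y, unfolded isD_def]
  have D: "isD (?n + ?m) (\<phi> (ac X DE) (ac Y DE)) (\<phi> (ac X DF) (ac Y DF)) (\<phi> (ac X DK) (ac Y DK)) (\<phi> (ac X DZ) (ac Y DZ))"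
    unfolding isD_def using d1 d0 by (simp add: btp m pw' add sc un z bt_pow r)
  define S where "S = mk (?n + ?m) (\<phi> (ac X DE) (ac Y DE)) (\<phi> (ac X DF) (ac Y DF)) (\<phi> (ac X DK) (ac Y DK)) (\<phi> (ac X DZ) (ac Y DZ))"
  note S = mk[OF D, folded S_def]
  have acS: "ac S g = \<phi> (ac X g) (ac Y g)" for g by (cases g) (simp_all add: S)
  have "i * ac X g = ac S g * i" "j * ac Y g = ac S g * j" "p * ac S g = ac X g * p" "q * ac S g = ac Y g * q" for g
    using X Y by (simp_all add: acS \<phi>_def distrib_left distrib_right mult.assoc pi qj assoc2[OF pi(1)] assoc2[OF pi(2)]
      assoc2[OF pi(3)] assoc2[OF qj] ac_idn bt_unl'[OF btX(1)] bt_unl'[OF btX(2)])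
  then have "H UNIV X S i" "H UNIV Y S j" "H UNIV S X p" "H UNIV S Y q" using bt by (auto simp: H_def S)
  moreover have "i * p + j * q = idn S" using s S by simp
  ultimately show ?thesis using S(1) pi qj by blast
qed

end

section \<open>Calculus of fractions\<close>

text \<open>The properties of the maps with cone in \<open>N\<close> that make roofs composable:
  identities, composition, cancellation, \<open>Ore\<close> squares and \<open>Canc\<close>,
  together with compatibility with the shift. They are isolated so that the Verdier quotient can be
  treated without reference to modules.\<close>

locale fractions =
  fixes T :: "('o, 'm) shift_category" and \<Delta> :: "('o, 'm) triangle set" and N :: "'o set"
  assumes Id_mor: "X \<in> Ob T \<Longrightarrow> Id T X \<in> Mor T X X"
    and comp_mor: "X \<in> Ob T \<Longrightarrow> Y \<in> Ob T \<Longrightarrow> Z \<in> Ob T \<Longrightarrow> f \<in> Mor T X Y \<Longrightarrow> g \<in> Mor T Y Z \<Longrightarrow> Comp T X Y Z g f \<in> Mor T X Z"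
    and comp_assoc: "W \<in> Ob T \<Longrightarrow> X \<in> Ob T \<Longrightarrow> Y \<in> Ob T \<Longrightarrow> Z \<in> Ob T \<Longrightarrow> f \<in> Mor T W X \<Longrightarrow> g \<in> Mor T X Y \<Longrightarrow> h \<in> Mor T Y Z \<Longrightarrow>
      Comp T W X Z (Comp T X Y Z h g) f = Comp T W Y Z h (Comp T W X Y g f)"
    and Id_left: "X \<in> Ob T \<Longrightarrow> Y \<in> Ob T \<Longrightarrow> f \<in> Mor T X Y \<Longrightarrow> Comp T X Y Y (Id T Y) f = f"
    and Id_right: "X \<in> Ob T \<Longrightarrow> Y \<in> Ob T \<Longrightarrow> f \<in> Mor T X Y \<Longrightarrow> Comp T X X Y f (Id T X) = f"
    and S_id: "X \<in> Ob T \<Longrightarrow> cone_in \<Delta> N X X (Id T X)"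
    and S_comp: "X \<in> Ob T \<Longrightarrow> Y \<in> Ob T \<Longrightarrow> Z \<in> Ob T \<Longrightarrow> f \<in> Mor T X Y \<Longrightarrow> g \<in> Mor T Y Z \<Longrightarrow> cone_in \<Delta> N X Y f \<Longrightarrow>
      cone_in \<Delta> N Y Z g \<Longrightarrow> cone_in \<Delta> N X Z (Comp T X Y Z g f)"
    and S_cancel: "X \<in> Ob T \<Longrightarrow> Y \<in> Ob T \<Longrightarrow> Z \<in> Ob T \<Longrightarrow> f \<in> Mor T X Y \<Longrightarrow> g \<in> Mor T Y Z \<Longrightarrow>
      cone_in \<Delta> N X Z (Comp T X Y Z g f) \<Longrightarrow> cone_in \<Delta> N Y Z g \<Longrightarrow> cone_in \<Delta> N X Y f"
    and Ore: "W \<in> Ob T \<Longrightarrow> W' \<in> Ob T \<Longrightarrow> Y \<in> Ob T \<Longrightarrow> f \<in> Mor T W Y \<Longrightarrow> t \<in> Mor T W' Y \<Longrightarrow> cone_in \<Delta> N W' Y t \<Longrightarrow>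
      \<exists>V\<in>Ob T. \<exists>a\<in>Mor T V W. \<exists>b\<in>Mor T V W'. cone_in \<Delta> N V W a \<and> Comp T V W Y f a = Comp T V W' Y t b"
    and Canc: "X \<in> Ob T \<Longrightarrow> Y \<in> Ob T \<Longrightarrow> Z \<in> Ob T \<Longrightarrow> f \<in> Mor T X Y \<Longrightarrow> g \<in> Mor T X Y \<Longrightarrow> t \<in> Mor T Y Z \<Longrightarrow> cone_in \<Delta> N Y Z t \<Longrightarrow>
      Comp T X Y Z t f = Comp T X Y Z t g \<Longrightarrow> \<exists>V\<in>Ob T. \<exists>a\<in>Mor T V X. cone_in \<Delta> N V X a \<and> Comp T V X Y f a = Comp T V X Y g a"
    and Sh_ob: "X \<in> Ob T \<Longrightarrow> Sh T X \<in> Ob T"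
    and ShM_mor: "X \<in> Ob T \<Longrightarrow> Y \<in> Ob T \<Longrightarrow> f \<in> Mor T X Y \<Longrightarrow> ShM T X Y f \<in> Mor T (Sh T X) (Sh T Y)"
    and ShM_id: "X \<in> Ob T \<Longrightarrow> ShM T X X (Id T X) = Id T (Sh T X)"
    and ShM_comp: "X \<in> Ob T \<Longrightarrow> Y \<in> Ob T \<Longrightarrow> Z \<in> Ob T \<Longrightarrow> f \<in> Mor T X Y \<Longrightarrow> g \<in> Mor T Y Z \<Longrightarrow>
      ShM T X Z (Comp T X Y Z g f) = Comp T (Sh T X) (Sh T Y) (Sh T Z) (ShM T Y Z g) (ShM T X Y f)"
    and ShM_S: "X \<in> Ob T \<Longrightarrow> Y \<in> Ob T \<Longrightarrow> f \<in> Mor T X Y \<Longrightarrow> cone_in \<Delta> N X Y f \<Longrightarrow> cone_in \<Delta> N (Sh T X) (Sh T Y) (ShM T X Y f)"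
begin

text \<open>Arrows as triples (source, target, morphism), so that the objects of a composite can be inferred.\<close>

definition ar :: "'o \<Rightarrow> 'o \<Rightarrow> 'm \<Rightarrow> bool" where "ar X Y f \<longleftrightarrow> X \<in> Ob T \<and> Y \<in> Ob T \<and> f \<in> Mor T X Y"
definition we :: "'o \<Rightarrow> 'o \<Rightarrow> 'm \<Rightarrow> bool" where "we X Y f \<longleftrightarrow> ar X Y f \<and> cone_in \<Delta> N X Y f"
definition cp :: "'o \<times> 'o \<times> 'm \<Rightarrow> 'o \<times> 'o \<times> 'm \<Rightarrow> 'o \<times> 'o \<times> 'm" (infixr "\<cdot>" 75) where
  "cp = (\<lambda>(Y, Z, g) (X, Y', f). (X, Z, Comp T X Y Z g f))"
definition Ar :: "'o \<times> 'o \<times> 'm \<Rightarrow> bool" where "Ar = (\<lambda>(X, Y, f). ar X Y f)"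
definition We :: "'o \<times> 'o \<times> 'm \<Rightarrow> bool" where "We = (\<lambda>(X, Y, f). we X Y f)"
abbreviation dm :: "'o \<times> 'o \<times> 'm \<Rightarrow> 'o" where "dm \<equiv> fst"
abbreviation cd :: "'o \<times> 'o \<times> 'm \<Rightarrow> 'o" where "cd f \<equiv> fst (snd f)"
definition idd :: "'o \<Rightarrow> 'o \<times> 'o \<times> 'm" where "idd X = (X, X, Id T X)"

lemma We_Ar: "We f \<Longrightarrow> Ar f" by (auto simp: We_def Ar_def we_def)
lemma dm_cp [simp]: "dm (g \<cdot> f) = dm f" and cd_cp [simp]: "cd (g \<cdot> f) = cd g"
  by (auto simp: cp_def split: prod.splits)
lemma dm_idd [simp]: "dm (idd X) = X" and cd_idd [simp]: "cd (idd X) = X" by (auto simp: idd_def)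
lemma Ar_cp [intro]: "Ar g \<Longrightarrow> Ar f \<Longrightarrow> cd f = dm g \<Longrightarrow> Ar (g \<cdot> f)"
  by (auto simp: Ar_def ar_def cp_def intro: comp_mor split: prod.splits)
lemma We_cp [intro]: "We g \<Longrightarrow> We f \<Longrightarrow> cd f = dm g \<Longrightarrow> We (g \<cdot> f)"
  by (auto simp: We_def we_def ar_def cp_def intro: comp_mor S_comp split: prod.splits)
lemma We_cancel: "We (g \<cdot> f) \<Longrightarrow> We g \<Longrightarrow> Ar f \<Longrightarrow> cd f = dm g \<Longrightarrow> We f"
  by (auto simp: Ar_def We_def we_def ar_def cp_def intro: S_cancel split: prod.splits)
lemma cp_assoc: "Ar h \<Longrightarrow> Ar g \<Longrightarrow> Ar f \<Longrightarrow> cd f = dm g \<Longrightarrow> cd g = dm h \<Longrightarrow> (h \<cdot> g) \<cdot> f = h \<cdot> g \<cdot> f"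
  by (auto simp: Ar_def ar_def cp_def intro: comp_assoc split: prod.splits)
lemma Ar_idd: "X \<in> Ob T \<Longrightarrow> Ar (idd X)" and We_idd: "X \<in> Ob T \<Longrightarrow> We (idd X)"
  by (auto simp: Ar_def ar_def We_def we_def idd_def Id_mor S_id)
lemma cp_idd: "Ar f \<Longrightarrow> cd f = X \<Longrightarrow> idd X \<cdot> f = f" and cp_idd': "Ar f \<Longrightarrow> dm f = X \<Longrightarrow> f \<cdot> idd X = f"
  by (auto simp: Ar_def ar_def cp_def idd_def Id_left Id_right split: prod.splits)
lemma Ob_dm: "Ar f \<Longrightarrow> dm f \<in> Ob T" and Ob_cd: "Ar f \<Longrightarrow> cd f \<in> Ob T" by (auto simp: Ar_def ar_def)

lemma Ore':
  assumes "Ar f" "We t" "cd f = cd t"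
  obtains a b where "We a" "Ar b" "cd a = dm f" "cd b = dm t" "dm a = dm b" "f \<cdot> a = t \<cdot> b"
proof -
  obtain W Y f0 W' t0 where e: "f = (W, Y, f0)" "t = (W', Y, t0)" using assms(3) by (metis prod.collapse)
  then obtain V a b where "V \<in> Ob T" "a \<in> Mor T V W" "b \<in> Mor T V W'" "cone_in \<Delta> N V W a" "Comp T V W Y f0 a = Comp T V W' Y t0 b"
    using Ore[of W W' Y f0 t0] assms(1,2) by (auto simp: Ar_def We_def we_def ar_def)
  then show ?thesis using e assms(1,2) by (intro that[of "(V, W, a)" "(V, W', b)"]) (auto simp: Ar_def We_def we_def ar_def cp_def)
qed

lemma Canc':
  assumes "Ar f" "Ar g" "We t" "dm f = dm g" "cd f = dm t" "cd g = dm t" "t \<cdot> f = t \<cdot> g"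
  obtains a where "We a" "cd a = dm f" "f \<cdot> a = g \<cdot> a"
proof -
  obtain X Y f0 g0 Z t0 where e: "f = (X, Y, f0)" "g = (X, Y, g0)" "t = (Y, Z, t0)" using assms(4-6) by (metis prod.collapse)
  then obtain V a where "V \<in> Ob T" "a \<in> Mor T V X" "cone_in \<Delta> N V X a" "Comp T V X Y f0 a = Comp T V X Y g0 a"
    using Canc[of X Y Z f0 g0 t0] assms by (auto simp: Ar_def We_def we_def ar_def cp_def)
  then show ?thesis using e assms(1) by (intro that[of "(V, X, a)"]) (auto simp: Ar_def We_def we_def ar_def cp_def)
qed

section \<open>Equivalence and composition of roofs\<close>

definition roof :: "'o \<times> 'o \<times> 'm \<Rightarrow> 'o \<times> 'o \<times> 'm \<Rightarrow> bool" where
  "roof s f \<longleftrightarrow> We s \<and> Ar f \<and> dm s = dm f"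
definition req :: "'o \<times> 'o \<times> 'm \<Rightarrow> 'o \<times> 'o \<times> 'm \<Rightarrow> 'o \<times> 'o \<times> 'm \<Rightarrow> 'o \<times> 'o \<times> 'm \<Rightarrow> bool" where
  "req s f s' f' \<longleftrightarrow> (\<exists>a b. Ar a \<and> Ar b \<and> dm a = dm b \<and> cd a = dm s \<and> cd b = dm s' \<and>
     s \<cdot> a = s' \<cdot> b \<and> f \<cdot> a = f' \<cdot> b \<and> We (s \<cdot> a))"

lemma req_refl: "roof s f \<Longrightarrow> req s f s f"
  unfolding req_def roof_def
  by (intro exI[of _ "idd (dm s)"]) (auto simp: cp_idd' We_Ar Ar_idd Ob_dm)

lemma req_sym: "req s f s' f' \<Longrightarrow> req s' f' s f"
  unfolding req_def by metis

text \<open>The two refinements are joined over the middle roof by an Ore square of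
  \<open>a'\<close> and \<open>b\<close>; \<open>b\<close> lies in the class because
  \<open>s2 \<cdot> b\<close> and \<open>s2\<close> do.\<close>

lemma req_trans:
  assumes r: "roof s1 f1" "roof s2 f2" "roof s3 f3" and "req s1 f1 s2 f2" "req s2 f2 s3 f3"
  shows "req s1 f1 s3 f3"
proof -
  obtain a b where a: "Ar a" "Ar b" "dm a = dm b" "cd a = dm s1" "cd b = dm s2" "s1 \<cdot> a = s2 \<cdot> b" "f1 \<cdot> a = f2 \<cdot> b" "We (s1 \<cdot> a)"
    using assms(4) by (auto simp: req_def)
  obtain a' b' where a': "Ar a'" "Ar b'" "dm a' = dm b'" "cd a' = dm s2" "cd b' = dm s3" "s2 \<cdot> a' = s3 \<cdot> b'" "f2 \<cdot> a' = f3 \<cdot> b'" "We (s2 \<cdot> a')"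
    using assms(5) by (auto simp: req_def)
  have s: "We s1" "We s2" "We s3" "Ar f1" "Ar f2" "Ar f3" "dm s1 = dm f1" "dm s2 = dm f2" "dm s3 = dm f3"
    using r by (auto simp: roof_def)
  have "We b" using We_cancel[of s2 b] a s by simp
  then obtain p q where p: "We p" "Ar q" "cd p = dm a'" "cd q = dm b" "dm p = dm q" "a' \<cdot> p = b \<cdot> q"
    using Ore'[of a' b] a a' by metis
  note A = We_Ar[OF p(1)] We_Ar[OF s(1)] We_Ar[OF s(2)] We_Ar[OF s(3)]
  \<comment> \<open>Stated for arbitrary legs, so that it serves for the denominators
    \<open>s1\<close>, \<open>s2\<close>, \<open>s3\<close> as well as for the numerators
    \<open>f1\<close>, \<open>f2\<close>, \<open>f3\<close>.\<close>
  have e1: "g1 \<cdot> a \<cdot> q = g3 \<cdot> b' \<cdot> p" if "Ar g1" "Ar g2" "Ar g3" "dm g1 = dm s1" "dm g2 = dm s2" "dm g3 = dm s3"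
    "g1 \<cdot> a = g2 \<cdot> b" "g2 \<cdot> a' = g3 \<cdot> b'" for g1 g2 g3
  proof -
    have "g1 \<cdot> a \<cdot> q = (g1 \<cdot> a) \<cdot> q" using that a p by (intro cp_assoc[symmetric]) auto
    also have "\<dots> = g2 \<cdot> a' \<cdot> p" using that a a' p A by (simp add: cp_assoc)
    also have "\<dots> = (g2 \<cdot> a') \<cdot> p" using that a' p A by (intro cp_assoc[symmetric]) auto
    also have "\<dots> = g3 \<cdot> b' \<cdot> p" using that a a' p A by (simp add: cp_assoc)
    finally show ?thesis .
  qed
  have es: "s1 \<cdot> a \<cdot> q = s3 \<cdot> b' \<cdot> p" using e1[of s1 s2 s3] A a a' by simp
  have "We (s3 \<cdot> b')" using a' by simp
  then have "We ((s3 \<cdot> b') \<cdot> p)" using p a' by (simp add: We_cp)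
  then have "We (s1 \<cdot> a \<cdot> q)" unfolding es using a' p A by (simp add: cp_assoc)
  then show ?thesis unfolding req_def using es e1[of f1 f2 f3] s a a' p A
    by (intro exI[of _ "a \<cdot> q"] exI[of _ "b' \<cdot> p"]) (auto simp: Ar_cp)
qed

text \<open>This is the independence of composition from both the representatives and the chosen
  squares. All data are pulled back to one common source, where the legs can be compared.\<close>

lemma req_comp:
  assumes r: "roof s f" "roof s0 f0" "roof t g" "roof t0 g0" "req s f s0 f0" "req t g t0 g0"
    and o: "cd s = cd s0" "cd f = cd t" "cd f0 = cd t" "cd t = cd t0" "cd g = cd g0"
    and sq: "We a" "Ar b" "dm a = dm b" "cd a = dm f" "cd b = dm t" "f \<cdot> a = t \<cdot> b"
    and sq0: "We a0" "Ar b0" "dm a0 = dm b0" "cd a0 = dm f0" "cd b0 = dm t0" "f0 \<cdot> a0 = t0 \<cdot> b0"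
  shows "req (s \<cdot> a) (g \<cdot> b) (s0 \<cdot> a0) (g0 \<cdot> b0)"
proof -
  have s: "We s" "We s0" "We t" "We t0" "Ar f" "Ar f0" "Ar g" "Ar g0" "dm s = dm f" "dm s0 = dm f0" "dm t = dm g" "dm t0 = dm g0"
    using r by (auto simp: roof_def)
  obtain x y where x: "Ar x" "Ar y" "dm x = dm y" "cd x = dm s" "cd y = dm s0" "s \<cdot> x = s0 \<cdot> y" "f \<cdot> x = f0 \<cdot> y" "We (s \<cdot> x)"
    using r(5) by (auto simp: req_def)
  obtain x' y' where x': "Ar x'" "Ar y'" "dm x' = dm y'" "cd x' = dm t" "cd y' = dm t0" "t \<cdot> x' = t0 \<cdot> y'" "g \<cdot> x' = g0 \<cdot> y'" "We (t \<cdot> x')"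
    using r(6) by (auto simp: req_def)
  have wx: "We x" "We y" "We x'" using We_cancel[of s x] We_cancel[of s0 y] We_cancel[of t x'] x x' s by simp_all
  \<comment> \<open>Two Ore squares, with \<open>k1\<close> and then \<open>k2\<close>, connect the
    two chosen squares through the refinement \<open>x\<close>, \<open>y\<close> of the first
    roofs.\<close>
  obtain k1 l1 where 1: "We k1" "Ar l1" "cd k1 = dm a" "cd l1 = dm x" "dm k1 = dm l1" "a \<cdot> k1 = x \<cdot> l1"
    using Ore'[of a x] sq x wx s We_Ar by metis
  have "We (x \<cdot> l1)" using 1 sq We_cp by metis
  then have wl1: "We l1" using We_cancel[of x l1] wx 1 by simp
  have A: "Ar s" "Ar s0" "Ar t" "Ar t0" "Ar a" "Ar a0" "Ar k1" using s sq sq0 1 We_Ar by auto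
  have "Ar (y \<cdot> l1)" using x 1 by (intro Ar_cp) auto
  then obtain k2 m where 2: "We k2" "Ar m" "cd k2 = dm (y \<cdot> l1)" "cd m = dm a0" "dm k2 = dm m" "(y \<cdot> l1) \<cdot> k2 = a0 \<cdot> m"
    using Ore'[of "y \<cdot> l1" a0] sq0 x s by (metis cd_cp)
  have A2: "Ar k2" using 2 We_Ar by blast
  let ?p = "k1 \<cdot> k2"
  have p: "We ?p" "Ar ?p" using 1 2 A A2 by (auto intro!: We_cp Ar_cp)
  have yl: "y \<cdot> l1 \<cdot> k2 = a0 \<cdot> m" using 2 x 1 A2 by (simp add: cp_assoc)
  have ap: "a \<cdot> ?p = x \<cdot> l1 \<cdot> k2"
  proof -
    have "a \<cdot> ?p = (a \<cdot> k1) \<cdot> k2" using 1 2 A A2 by (intro cp_assoc[symmetric]) auto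
    then show ?thesis using 1 2 A A2 x by (simp add: cp_assoc)
  qed
  have lk: "Ar (l1 \<cdot> k2)" using 1 2 A2 by auto
  have gen: "h \<cdot> a \<cdot> ?p = h0 \<cdot> a0 \<cdot> m" if "Ar h" "Ar h0" "dm h = dm s" "dm h0 = dm s0" "h \<cdot> x = h0 \<cdot> y" for h h0
  proof -
    have "h \<cdot> a \<cdot> ?p = h \<cdot> x \<cdot> l1 \<cdot> k2" by (simp only: ap)
    also have "\<dots> = (h \<cdot> x) \<cdot> l1 \<cdot> k2" using that x lk 1 by (intro cp_assoc[symmetric]) auto
    also have "\<dots> = h0 \<cdot> y \<cdot> l1 \<cdot> k2" using that x lk 1 by (simp add: cp_assoc)
    finally show ?thesis using yl by simp
  qed
  have sap: "s \<cdot> a \<cdot> ?p = s0 \<cdot> a0 \<cdot> m" using gen[of s s0] A x by simp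
  have fap: "f \<cdot> a \<cdot> ?p = f0 \<cdot> a0 \<cdot> m" using gen[of f f0] s x by simp
  have tb: "t \<cdot> b \<cdot> ?p = t0 \<cdot> b0 \<cdot> m"
  proof -
    have "t \<cdot> b \<cdot> ?p = (f \<cdot> a) \<cdot> ?p" using sq A p 1 by (simp add: cp_assoc)
    also have "\<dots> = f \<cdot> a \<cdot> ?p" using A p 1 sq s by (intro cp_assoc) auto
    also have "\<dots> = f0 \<cdot> a0 \<cdot> m" by (rule fap)
    also have "\<dots> = (f0 \<cdot> a0) \<cdot> m" using s A 2 sq0 by (intro cp_assoc[symmetric]) auto
    also have "\<dots> = t0 \<cdot> b0 \<cdot> m" using sq0 A 2 by (simp add: cp_assoc)
    finally show ?thesis .
  qed
  have bp: "Ar (b \<cdot> ?p)" using Ar_cp[OF sq(2) p(2)] 1 sq by simp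
  then obtain k3 l3 where 3: "We k3" "Ar l3" "cd k3 = dm (b \<cdot> ?p)" "cd l3 = dm x'" "dm k3 = dm l3" "(b \<cdot> ?p) \<cdot> k3 = x' \<cdot> l3"
    using Ore'[of "b \<cdot> ?p" x'] wx sq x' by (metis cd_cp)
  have A3: "Ar k3" using 3 We_Ar by blast
  have bm: "Ar (b0 \<cdot> m)" using sq0 2 by (intro Ar_cp) auto
  have bmk: "Ar ((b0 \<cdot> m) \<cdot> k3)" using Ar_cp[OF bm A3] 3 2 1 by simp
  have yl3: "Ar (y' \<cdot> l3)" using x' 3 by (intro Ar_cp) auto
  have "t0 \<cdot> y' \<cdot> l3 = t0 \<cdot> (b0 \<cdot> m) \<cdot> k3"
  proof -
    have "t0 \<cdot> y' \<cdot> l3 = (t0 \<cdot> y') \<cdot> l3" using x' 3 A by (intro cp_assoc[symmetric]) auto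
    also have "\<dots> = (t \<cdot> x') \<cdot> l3" by (simp only: x'(6))
    also have "\<dots> = t \<cdot> x' \<cdot> l3" using x' 3 A by (intro cp_assoc) auto
    also have "\<dots> = t \<cdot> (b \<cdot> ?p) \<cdot> k3" by (simp only: 3(6))
    also have "\<dots> = (t \<cdot> b \<cdot> ?p) \<cdot> k3" by (rule cp_assoc[OF A(3) bp A3 3(3), symmetric]) (simp add: sq)
    also have "\<dots> = (t0 \<cdot> b0 \<cdot> m) \<cdot> k3" by (simp only: tb)
    also have "\<dots> = t0 \<cdot> (b0 \<cdot> m) \<cdot> k3" by (rule cp_assoc[OF A(4) bm A3]) (use 3 2 1 sq0 in simp_all)
    finally show ?thesis .
  qed
  \<comment> \<open>The maps \<open>y' \<cdot> l3\<close> and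
    \<open>(b0 \<cdot> m) \<cdot> k3\<close> are only known to agree after \<open>t0\<close>; a
    denominator can be cancelled at the price of a further precomposition, here with
    \<open>k4\<close>.\<close>
  then obtain k4 where 4: "We k4" "cd k4 = dm (y' \<cdot> l3)" "(y' \<cdot> l3) \<cdot> k4 = ((b0 \<cdot> m) \<cdot> k3) \<cdot> k4"
    using Canc'[OF yl3 bmk s(4)] x' 3 sq0 by auto
  have A4: "Ar k4" using 4 We_Ar by blast
  let ?k = "k3 \<cdot> k4"
  have k: "We ?k" "Ar ?k" using 3 4 A3 A4 by (auto intro!: We_cp Ar_cp)
  have pk: "Ar (?p \<cdot> ?k)" "We (?p \<cdot> ?k)" using p k 3 by (auto intro!: Ar_cp We_cp)
  have mk: "Ar (m \<cdot> ?k)" using 2 k 3 by (auto intro!: Ar_cp)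
  have gb: "g \<cdot> b \<cdot> ?p \<cdot> ?k = g0 \<cdot> b0 \<cdot> m \<cdot> ?k"
  proof -
    have l4: "Ar (l3 \<cdot> k4)" "cd k4 = dm l3" using 3 4 A4 by auto
    have "b \<cdot> ?p \<cdot> ?k = (b \<cdot> ?p) \<cdot> ?k"
      by (rule cp_assoc[OF sq(2) p(2) k(2), symmetric]) (use sq 1 2 3 in simp_all)
    also have "\<dots> = ((b \<cdot> ?p) \<cdot> k3) \<cdot> k4"
      by (rule cp_assoc[OF bp A3 A4, symmetric]) (use 3 4 in simp_all)
    also have "\<dots> = (x' \<cdot> l3) \<cdot> k4" by (simp only: 3(6))
    also have "\<dots> = x' \<cdot> l3 \<cdot> k4" using x'(1) 3(2,4) A4 l4 by (simp add: cp_assoc)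
    finally have "g \<cdot> b \<cdot> ?p \<cdot> ?k = g \<cdot> x' \<cdot> l3 \<cdot> k4" by simp
    also have "\<dots> = (g \<cdot> x') \<cdot> l3 \<cdot> k4"
      by (rule cp_assoc[OF s(7) x'(1) l4(1), symmetric]) (use 3 x' s in simp_all)
    also have "\<dots> = (g0 \<cdot> y') \<cdot> l3 \<cdot> k4" by (simp only: x'(7))
    also have "\<dots> = g0 \<cdot> y' \<cdot> l3 \<cdot> k4"
      by (rule cp_assoc[OF s(8) x'(2) l4(1)]) (use 3 x' s in simp_all)
    also have "y' \<cdot> l3 \<cdot> k4 = (y' \<cdot> l3) \<cdot> k4" using x'(2,3) 3(2,4) A4 l4 by (simp add: cp_assoc)
    also have "\<dots> = ((b0 \<cdot> m) \<cdot> k3) \<cdot> k4" by (rule 4(3))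
    also have "\<dots> = (b0 \<cdot> m) \<cdot> ?k" by (rule cp_assoc[OF bm A3 A4]) (use 1 2 3 4 in simp_all)
    also have "\<dots> = b0 \<cdot> m \<cdot> ?k" by (rule cp_assoc[OF sq0(2) 2(2) k(2)]) (use sq0 1 2 3 in simp_all)
    finally show ?thesis .
  qed
  have sb: "(s \<cdot> a) \<cdot> ?p \<cdot> ?k = (s0 \<cdot> a0) \<cdot> m \<cdot> ?k"
  proof -
    have "(s \<cdot> a) \<cdot> ?p \<cdot> ?k = (s \<cdot> a \<cdot> ?p) \<cdot> ?k" using A p k 1 3 sq s pk by (simp add: cp_assoc Ar_cp)
    also have "\<dots> = (s0 \<cdot> a0) \<cdot> m \<cdot> ?k" unfolding sap using A p k 2 3 sq0 s mk by (simp add: cp_assoc Ar_cp)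
    finally show ?thesis .
  qed
  have "We (s \<cdot> a)" using We_cp[OF s(1) sq(1)] s sq by simp
  then have w: "We ((s \<cdot> a) \<cdot> ?p \<cdot> ?k)" using pk(2) 1 by (simp add: We_cp)
  have "(g \<cdot> b) \<cdot> ?p \<cdot> ?k = g \<cdot> b \<cdot> ?p \<cdot> ?k"
    by (rule cp_assoc[OF s(7) sq(2) pk(1)]) (use 1 sq s in simp_all)
  moreover have "(g0 \<cdot> b0) \<cdot> m \<cdot> ?k = g0 \<cdot> b0 \<cdot> m \<cdot> ?k"
    by (rule cp_assoc[OF s(8) sq0(2) mk]) (use 2 sq0 s in simp_all)
  ultimately have "(g \<cdot> b) \<cdot> ?p \<cdot> ?k = (g0 \<cdot> b0) \<cdot> m \<cdot> ?k" using gb by simp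
  moreover have "dm (?p \<cdot> ?k) = dm (m \<cdot> ?k)" "cd (?p \<cdot> ?k) = dm (s \<cdot> a)" "cd (m \<cdot> ?k) = dm (s0 \<cdot> a0)"
    using 1 2 3 by simp_all
  ultimately show ?thesis unfolding req_def using pk(1) mk sb w by blast
qed

abbreviation "rc X Y \<equiv> roof_class T \<Delta> N X Y"

lemma roofs_iff: "X \<in> Ob T \<Longrightarrow> Y \<in> Ob T \<Longrightarrow> (W, s, f) \<in> roofs T \<Delta> N X Y \<longleftrightarrow> roof (W, X, s) (W, Y, f)"
  by (auto simp: roofs_def roof_def We_def Ar_def we_def ar_def)

lemma mem_rc_iff:
  assumes o: "X \<in> Ob T" "Y \<in> Ob T" and r: "roof (W, X, s) (W, Y, f)"
  shows "(W', s', f') \<in> rc X Y (W, s, f) \<longleftrightarrow> roof (W', X, s') (W', Y, f') \<and> req (W, X, s) (W, Y, f) (W', X, s') (W', Y, f')"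
proof -
  have W: "W \<in> Ob T" "s \<in> Mor T W X" using r by (auto simp: roof_def We_def we_def ar_def)
  have "(\<exists>V\<in>Ob T. \<exists>a\<in>Mor T V W. \<exists>b\<in>Mor T V W'.
       Comp T V W X s a = Comp T V W' X s' b \<and> Comp T V W Y f a = Comp T V W' Y f' b \<and>
       cone_in \<Delta> N V X (Comp T V W X s a)) \<longleftrightarrow> req (W, X, s) (W, Y, f) (W', X, s') (W', Y, f')"
    if r': "roof (W', X, s') (W', Y, f')"
  proof
    assume "\<exists>V\<in>Ob T. \<exists>a\<in>Mor T V W. \<exists>b\<in>Mor T V W'.
       Comp T V W X s a = Comp T V W' X s' b \<and> Comp T V W Y f a = Comp T V W' Y f' b \<and>
       cone_in \<Delta> N V X (Comp T V W X s a)"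
    then obtain V a b where v: "V \<in> Ob T" "a \<in> Mor T V W" "b \<in> Mor T V W'" "Comp T V W X s a = Comp T V W' X s' b"
      "Comp T V W Y f a = Comp T V W' Y f' b" "cone_in \<Delta> N V X (Comp T V W X s a)" by blast
    have "W' \<in> Ob T" using r' by (auto simp: roof_def We_def we_def ar_def)
    then show "req (W, X, s) (W, Y, f) (W', X, s') (W', Y, f')" unfolding req_def
      using v W o comp_mor[OF v(1) W(1) o(1) v(2) W(2)]
      by (intro exI[of _ "(V, W, a)"] exI[of _ "(V, W', b)"]) (auto simp: Ar_def ar_def cp_def We_def we_def)
  next
    assume "req (W, X, s) (W, Y, f) (W', X, s') (W', Y, f')"
    then obtain V a V' b where "Ar (V, W, a)" "Ar (V, W', b)" "(W, X, s) \<cdot> (V, W, a) = (W', X, s') \<cdot> (V, W', b)"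
      "(W, Y, f) \<cdot> (V, W, a) = (W', Y, f') \<cdot> (V, W', b)" "We ((W, X, s) \<cdot> (V, W, a))"
      unfolding req_def by (metis fst_conv prod.collapse snd_conv)
    then show "\<exists>V\<in>Ob T. \<exists>a\<in>Mor T V W. \<exists>b\<in>Mor T V W'.
       Comp T V W X s a = Comp T V W' X s' b \<and> Comp T V W Y f a = Comp T V W' Y f' b \<and>
       cone_in \<Delta> N V X (Comp T V W X s a)"
      by - (rule bexI[of _ V], rule bexI[of _ a], rule bexI[of _ b], auto simp: Ar_def ar_def cp_def We_def we_def)
  qed
  then show ?thesis unfolding roof_class_def using roofs_iff[OF o, of W' s' f'] by auto
qed

lemma rc_self: "X \<in> Ob T \<Longrightarrow> Y \<in> Ob T \<Longrightarrow> roof (W, X, s) (W, Y, f) \<Longrightarrow> (W, s, f) \<in> rc X Y (W, s, f)"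
  by (simp add: mem_rc_iff req_refl)

lemma rc_eqI:
  assumes "X \<in> Ob T" "Y \<in> Ob T" "roof (W, X, s) (W, Y, f)" "roof (W', X, s') (W', Y, f')"
    "req (W, X, s) (W, Y, f) (W', X, s') (W', Y, f')"
  shows "rc X Y (W, s, f) = rc X Y (W', s', f')"
proof -
  have "(V, t, g) \<in> rc X Y (W, s, f) \<longleftrightarrow> (V, t, g) \<in> rc X Y (W', s', f')" for V t g
    unfolding mem_rc_iff[OF assms(1-3)] mem_rc_iff[OF assms(1,2,4)]
    using req_trans[OF assms(4,3), of "(V, X, t)" "(V, Y, g)"] req_trans[OF assms(3,4), of "(V, X, t)" "(V, Y, g)"]
      assms(5) req_sym by blast
  then show ?thesis by auto
qed

lemma rc_eqD:
  assumes "X \<in> Ob T" "Y \<in> Ob T" "roof (W, X, s) (W, Y, f)" "roof (W', X, s') (W', Y, f')"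
    "rc X Y (W, s, f) = rc X Y (W', s', f')"
  shows "req (W, X, s) (W, Y, f) (W', X, s') (W', Y, f')"
proof -
  have "(W', s', f') \<in> rc X Y (W, s, f)" using rc_self[OF assms(1,2,4)] assms(5) by simp
  then show ?thesis using mem_rc_iff[OF assms(1-3)] by blast
qed

lemma cp_triple: "(Y, Z, g) \<cdot> (X, Y, f) = (X, Z, Comp T X Y Z g f)" by (simp add: cp_def)

text \<open>By \<open>req_comp\<close> all members of the union in \<open>roof_comp\<close> are the
  same class, so any one admissible square computes the composite.\<close>

lemma comp_rc:
  assumes o: "X \<in> Ob T" "Y \<in> Ob T" "Z \<in> Ob T"
    and r: "roof (W, X, s) (W, Y, f)" "roof (W', Y, t) (W', Z, g)"
    and sq: "We (V, W, a)" "Ar (V, W', b)" "Comp T V W Y f a = Comp T V W' Y t b"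
  shows "roof_comp T \<Delta> N X Y Z (rc Y Z (W', t, g)) (rc X Y (W, s, f)) = rc X Z (V, Comp T V W X s a, Comp T V W' Z g b)"
proof -
  have rr: "roof (V1, X, Comp T V1 W1 X s1 a1) (V1, Z, Comp T V1 W1' Z g1 b1)"
    if "roof (W1, X, s1) (W1, Y, f1)" "roof (W1', Y, t1) (W1', Z, g1)" "We (V1, W1, a1)" "Ar (V1, W1', b1)" for W1 s1 f1 W1' t1 g1 V1 a1 b1
    using that We_cp[of "(W1, X, s1)" "(V1, W1, a1)"] Ar_cp[of "(W1', Z, g1)" "(V1, W1', b1)"]
    by (auto simp: roof_def cp_triple)
  have m: "rc X Z (V1, Comp T V1 W1 X s1 a1, Comp T V1 W1' Z g1 b1) = rc X Z (V, Comp T V W X s a, Comp T V W' Z g b)"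
    if F: "(W1, s1, f1) \<in> rc X Y (W, s, f)" and G: "(W1', t1, g1) \<in> rc Y Z (W', t, g)"
      and q: "V1 \<in> Ob T" "a1 \<in> Mor T V1 W1" "cone_in \<Delta> N V1 W1 a1" "b1 \<in> Mor T V1 W1'" "Comp T V1 W1 Y f1 a1 = Comp T V1 W1' Y t1 b1"
    for V1 W1 W1' s1 f1 t1 g1 a1 b1
  proof -
    have F': "roof (W1, X, s1) (W1, Y, f1)" "req (W, X, s) (W, Y, f) (W1, X, s1) (W1, Y, f1)"
      using F mem_rc_iff[OF o(1,2) r(1)] by auto
    have G': "roof (W1', Y, t1) (W1', Z, g1)" "req (W', Y, t) (W', Z, g) (W1', Y, t1) (W1', Z, g1)"
      using G mem_rc_iff[OF o(2,3) r(2)] by auto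
    have "W1 \<in> Ob T" "W1' \<in> Ob T" using F'(1) G'(1) by (auto simp: roof_def We_def we_def ar_def)
    then have q': "We (V1, W1, a1)" "Ar (V1, W1', b1)" using q by (auto simp: We_def we_def Ar_def ar_def)
    have "req ((W1, X, s1) \<cdot> (V1, W1, a1)) ((W1', Z, g1) \<cdot> (V1, W1', b1)) ((W, X, s) \<cdot> (V, W, a)) ((W', Z, g) \<cdot> (V, W', b))"
      by (rule req_comp[OF F'(1) r(1) G'(1) r(2) req_sym[OF F'(2)] req_sym[OF G'(2)]])
        (use q q' sq in \<open>auto simp: cp_triple\<close>)
    then show ?thesis using rr[OF F'(1) G'(1) q'] rr[OF r sq(1,2)] o by (intro rc_eqI) (auto simp: cp_triple)
  qed
  have sq': "V \<in> Ob T" "a \<in> Mor T V W" "cone_in \<Delta> N V W a" "b \<in> Mor T V W'"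
    using sq by (auto simp: We_def we_def Ar_def ar_def)
  show ?thesis
  proof
    show "roof_comp T \<Delta> N X Y Z (rc Y Z (W', t, g)) (rc X Y (W, s, f)) \<subseteq> rc X Z (V, Comp T V W X s a, Comp T V W' Z g b)"
    proof
      fix e assume "e \<in> roof_comp T \<Delta> N X Y Z (rc Y Z (W', t, g)) (rc X Y (W, s, f))"
      then obtain V1 W1 W1' s1 f1 t1 g1 a1 b1 where "(W1, s1, f1) \<in> rc X Y (W, s, f)" "(W1', t1, g1) \<in> rc Y Z (W', t, g)"
        "V1 \<in> Ob T" "a1 \<in> Mor T V1 W1" "cone_in \<Delta> N V1 W1 a1" "b1 \<in> Mor T V1 W1'" "Comp T V1 W1 Y f1 a1 = Comp T V1 W1' Y t1 b1"
        "e \<in> rc X Z (V1, Comp T V1 W1 X s1 a1, Comp T V1 W1' Z g1 b1)"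
        unfolding roof_comp_def by blast
      then show "e \<in> rc X Z (V, Comp T V W X s a, Comp T V W' Z g b)" using m by metis
    qed
    show "rc X Z (V, Comp T V W X s a, Comp T V W' Z g b) \<subseteq> roof_comp T \<Delta> N X Y Z (rc Y Z (W', t, g)) (rc X Y (W, s, f))"
      unfolding roof_comp_def using rc_self[OF o(1,2) r(1)] rc_self[OF o(2,3) r(2)] sq' sq(3) by blast
  qed
qed

section \<open>Morphisms and triangles of the Verdier quotient\<close>

abbreviation "VQ \<equiv> verdier_quotient T \<Delta> N"
abbreviation "vm \<equiv> verdier_map T \<Delta> N"
abbreviation "vc \<equiv> roof_comp T \<Delta> N"

lemma VQ_sel: "Ob VQ = Ob T" "Mor VQ X Y = rc X Y ` roofs T \<Delta> N X Y" "Comp VQ = vc" "Sh VQ = Sh T"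
  "Id VQ X = vm X X (Id T X)"
  "ShM VQ X Y F = (\<Union>(W, s, f)\<in>F. rc (Sh T X) (Sh T Y) (Sh T W, ShM T W X s, ShM T W Y f))"
  by (simp_all add: verdier_quotient_def verdier_map_def)

lemma roof_vm: "X \<in> Ob T \<Longrightarrow> Y \<in> Ob T \<Longrightarrow> f \<in> Mor T X Y \<Longrightarrow> roof (X, X, Id T X) (X, Y, f)"
  by (auto simp: roof_def We_def we_def ar_def Ar_def Id_mor S_id)

lemma vm_mor: "X \<in> Ob T \<Longrightarrow> Y \<in> Ob T \<Longrightarrow> f \<in> Mor T X Y \<Longrightarrow> vm X Y f \<in> Mor VQ X Y"
  unfolding VQ_sel verdier_map_def using roof_vm roofs_iff by blast

lemma vm_comp:
  assumes "X \<in> Ob T" "Y \<in> Ob T" "Z \<in> Ob T" "f \<in> Mor T X Y" "g \<in> Mor T Y Z"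
  shows "vc X Y Z (vm Y Z g) (vm X Y f) = vm X Z (Comp T X Y Z g f)"
proof -
  have "vc X Y Z (vm Y Z g) (vm X Y f) = rc X Z (X, Comp T X X X (Id T X) (Id T X), Comp T X Y Z g f)"
    unfolding verdier_map_def using assms
    by (intro comp_rc roof_vm) (auto simp: We_def we_def ar_def Ar_def Id_mor S_id Id_left Id_right)
  then show ?thesis using assms by (simp add: verdier_map_def Id_left Id_mor)
qed

lemma iso_vm:
  assumes "X \<in> Ob T" "Y \<in> Ob T" "f \<in> Mor T X Y" "g \<in> Mor T Y X"
    "vm X X (Comp T X Y X g f) = vm X X (Id T X)" "vm Y Y (Comp T Y X Y f g) = vm Y Y (Id T Y)"
  shows "is_iso VQ X Y (vm X Y f)"
  unfolding is_iso_def using assms vm_mor[of X Y f] vm_mor[of Y X g]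
  by (auto simp: VQ_sel(3,5) vm_comp intro!: bexI[of _ "vm Y X g"])

lemma iso_id: "X \<in> Ob T \<Longrightarrow> is_iso VQ X X (vm X X (Id T X))"
  by (intro iso_vm[of _ _ _ "Id T X"]) (auto simp: Id_mor Id_left)

text \<open>The shift of a class is a union over its representatives. For the identity, the two legs
  of each representative agree after composition with some \<open>b\<close>, and the shift preserves
  this. Identities are the only morphisms shifted in the isomorphisms of triangles constructed
  below.\<close>

lemma ShM_vm_id:
  assumes X: "X \<in> Ob T" shows "ShM VQ X X (vm X X (Id T X)) = vm (Sh T X) (Sh T X) (Id T (Sh T X))"
proof -
  have r0: "roof (X, X, Id T X) (X, X, Id T X)" using roof_vm X Id_mor by blast
  have "rc (Sh T X) (Sh T X) (Sh T W, ShM T W X s, ShM T W X f) = vm (Sh T X) (Sh T X) (Id T (Sh T X))"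
    if m: "(W, s, f) \<in> vm X X (Id T X)" for W s f
  proof -
    have r: "roof (W, X, s) (W, X, f)" "req (X, X, Id T X) (X, X, Id T X) (W, X, s) (W, X, f)"
      using m mem_rc_iff[OF X X r0] by (auto simp: verdier_map_def)
    have W: "W \<in> Ob T" "s \<in> Mor T W X" "f \<in> Mor T W X" "cone_in \<Delta> N W X s"
      using r(1) by (auto simp: roof_def We_def we_def Ar_def ar_def)
    obtain V a b where v: "Ar (V, X, a)" "Ar (V, W, b)" "(X, X, Id T X) \<cdot> (V, X, a) = (W, X, s) \<cdot> (V, W, b)"
      "(X, X, Id T X) \<cdot> (V, X, a) = (W, X, f) \<cdot> (V, W, b)" "We ((X, X, Id T X) \<cdot> (V, X, a))"
      using r(2) unfolding req_def by (metis fst_conv prod.collapse snd_conv)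
    then have V: "V \<in> Ob T" "a \<in> Mor T V X" "b \<in> Mor T V W" "a = Comp T V W X s b" "a = Comp T V W X f b" "cone_in \<Delta> N V X a"
      using X by (auto simp: Ar_def ar_def cp_def We_def we_def Id_left)
    have o: "Sh T X \<in> Ob T" "Sh T W \<in> Ob T" "Sh T V \<in> Ob T" using Sh_ob X W V by auto
    have sm: "ShM T W X s \<in> Mor T (Sh T W) (Sh T X)" "ShM T W X f \<in> Mor T (Sh T W) (Sh T X)"
      "ShM T V X a \<in> Mor T (Sh T V) (Sh T X)" "ShM T V W b \<in> Mor T (Sh T V) (Sh T W)"
      using ShM_mor X W V by auto
    have e: "Comp T (Sh T V) (Sh T W) (Sh T X) (ShM T W X s) (ShM T V W b) = ShM T V X a"
      "Comp T (Sh T V) (Sh T W) (Sh T X) (ShM T W X f) (ShM T V W b) = ShM T V X a"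
      using ShM_comp[of V W X b s] ShM_comp[of V W X b f] V W X by auto
    have S: "cone_in \<Delta> N (Sh T W) (Sh T X) (ShM T W X s)" "cone_in \<Delta> N (Sh T V) (Sh T X) (ShM T V X a)"
      using ShM_S X W V by auto
    have "rc (Sh T X) (Sh T X) (Sh T W, ShM T W X s, ShM T W X f) = rc (Sh T X) (Sh T X) (Sh T X, Id T (Sh T X), Id T (Sh T X))"
    proof (rule rc_eqI[OF o(1) o(1)])
      show "roof (Sh T W, Sh T X, ShM T W X s) (Sh T W, Sh T X, ShM T W X f)"
        using S sm o by (auto simp: roof_def We_def we_def Ar_def ar_def)
      show "roof (Sh T X, Sh T X, Id T (Sh T X)) (Sh T X, Sh T X, Id T (Sh T X))" using roof_vm o Id_mor by blast
      show "req (Sh T W, Sh T X, ShM T W X s) (Sh T W, Sh T X, ShM T W X f)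
        (Sh T X, Sh T X, Id T (Sh T X)) (Sh T X, Sh T X, Id T (Sh T X))"
        unfolding req_def using S sm o e
        by (intro exI[of _ "(Sh T V, Sh T W, ShM T V W b)"] exI[of _ "(Sh T V, Sh T X, ShM T V X a)"])
          (auto simp: Ar_def ar_def We_def we_def cp_def Id_left)
    qed
    then show ?thesis by (simp add: verdier_map_def)
  qed
  moreover have "(X, Id T X, Id T X) \<in> vm X X (Id T X)" unfolding verdier_map_def by (rule rc_self[OF X X r0])
  ultimately show ?thesis unfolding VQ_sel(6) by fastforce
qed

lemma is_triangle_vm:
  "is_triangle T (X, Y, Z, u, v, w) \<Longrightarrow> is_triangle VQ (X, Y, Z, vm X Y u, vm Y Z v, vm Z (Sh T X) w)"
  by (auto simp: is_triangle_def VQ_sel(1,4) Sh_ob intro!: vm_mor)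

lemma vt_of_triangle:
  assumes t: "(X, Y, Z, u, v, w) \<in> \<Delta>" "is_triangle T (X, Y, Z, u, v, w)"
  shows "(X, Y, Z, vm X Y u, vm Y Z v, vm Z (Sh T X) w) \<in> verdier_triangles T \<Delta> N"
proof -
  have o: "X \<in> Ob T" "Y \<in> Ob T" "Z \<in> Ob T" "u \<in> Mor T X Y" "v \<in> Mor T Y Z" "w \<in> Mor T Z (Sh T X)" "Sh T X \<in> Ob T"
    using t(2) Sh_ob by (auto simp: is_triangle_def)
  have "triangle_iso VQ (X, Y, Z, vm X Y u, vm Y Z v, vm Z (Sh T X) w) (X, Y, Z, vm X Y u, vm Y Z v, vm Z (Sh T X) w)"
    unfolding triangle_iso_def prod.case VQ_sel(3,4)
    using o by (intro exI[of _ "vm X X (Id T X)"] exI[of _ "vm Y Y (Id T Y)"] exI[of _ "vm Z Z (Id T Z)"])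
      (simp add: iso_id vm_comp Id_mor Id_left Id_right ShM_vm_id)
  then show ?thesis unfolding verdier_triangles_def using is_triangle_vm[OF t(2)] t(1) by blast
qed

text \<open>\<open>P\<close> has a single endomorphism, so \<open>e\<close> after \<open>n\<close>
  is the identity, while \<open>n\<close> after \<open>e\<close> becomes the identity on composing
  with \<open>n\<close>, whose cone lies in \<open>N\<close>. Hence \<open>M\<close> is isomorphic
  to \<open>P\<close> in the quotient and may replace it in the triangle.\<close>

lemma vt_zero:
  assumes t: "(P, P, P, u, v, w) \<in> \<Delta>" "is_triangle T (P, P, P, u, v, w)"
    and M: "M \<in> Ob T" "e \<in> Mor T M P" "n \<in> Mor T P M" "cone_in \<Delta> N P M n"
    and uniq: "\<And>f g. f \<in> Mor T P P \<Longrightarrow> g \<in> Mor T P P \<Longrightarrow> f = g"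
  shows "\<exists>u' v' w'. (P, P, M, u', v', w') \<in> verdier_triangles T \<Delta> N"
proof -
  have o: "P \<in> Ob T" "u \<in> Mor T P P" "v \<in> Mor T P P" "w \<in> Mor T P (Sh T P)" "Sh T P \<in> Ob T"
    using t(2) Sh_ob by (auto simp: is_triangle_def)
  have en: "Comp T P M P e n = Id T P" by (rule uniq) (use o M in \<open>auto intro: comp_mor Id_mor\<close>)
  have ne: "Comp T M P M n e \<in> Mor T M M" using o M by (intro comp_mor)
  have nen: "Comp T P M M (Comp T M P M n e) n = n" using o M en by (simp add: comp_assoc Id_right)
  have "vm M M (Comp T M P M n e) = vm M M (Id T M)"
    unfolding verdier_map_def
  proof (rule rc_eqI[OF M(1) M(1) roof_vm[OF M(1) M(1) ne] roof_vm[OF M(1) M(1) Id_mor[OF M(1)]]])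
    show "req (M, M, Id T M) (M, M, Comp T M P M n e) (M, M, Id T M) (M, M, Id T M)"
      unfolding req_def using o M nen
      by (intro exI[of _ "(P, M, n)"]) (auto simp: Ar_def ar_def We_def we_def cp_def Id_left)
  qed
  then have iso: "is_iso VQ M P (vm M P e)" using o M en by (intro iso_vm[of _ _ _ n]) auto
  let ?v = "Comp T P P M n v" and ?w = "Comp T M P (Sh T P) w e"
  have tr: "is_triangle T (P, P, M, u, ?v, ?w)"
    using o M comp_mor[of P P M v n] comp_mor[of M P "Sh T P" e w] by (auto simp: is_triangle_def)
  have m: "?v \<in> Mor T P M" "?w \<in> Mor T M (Sh T P)" using tr by (auto simp: is_triangle_def)
  have ev: "Comp T P M P e ?v = v" by (rule uniq) (use o M m in \<open>auto intro: comp_mor\<close>)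
  have "triangle_iso VQ (P, P, M, vm P P u, vm P M ?v, vm M (Sh T P) ?w) (P, P, P, vm P P u, vm P P v, vm P (Sh T P) w)"
    unfolding triangle_iso_def prod.case VQ_sel(3,4)
    using o M m ev iso by (intro exI[of _ "vm P P (Id T P)"] exI[of _ "vm M P e"])
      (simp add: iso_id vm_comp Id_mor Id_left Id_right ShM_vm_id)
  then show ?thesis unfolding verdier_triangles_def using is_triangle_vm[OF tr] t(1) by blast
qed

text \<open>Equality with the class of the identity is unwound into equations between morphisms of
  \<open>T\<close>, valid after composition with a further \<open>x\<close> of the class. In this
  form an isomorphism of the quotient can be transported to other categories of maps.\<close>

lemma comp_is_id:
  assumes o: "X \<in> Ob T" "Y \<in> Ob T" and r: "roof (W, X, s) (W, Y, f)" "roof (W', Y, t) (W', X, g)"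
    and e: "vc X Y X (rc Y X (W', t, g)) (rc X Y (W, s, f)) = vm X X (Id T X)"
  shows "\<exists>V a b U x. We (V, W, a) \<and> Ar (V, W', b) \<and> We (U, V, x) \<and> Comp T V W Y f a = Comp T V W' Y t b \<and>
    Comp T U V X (Comp T V W X s a) x = Comp T U V X (Comp T V W' X g b) x"
proof -
  have s: "We (W, X, s)" "Ar (W, Y, f)" "We (W', Y, t)" "Ar (W', X, g)" using r by (auto simp: roof_def)
  obtain V a b where v: "We (V, W, a)" "Ar (V, W', b)" "(W, Y, f) \<cdot> (V, W, a) = (W', Y, t) \<cdot> (V, W', b)"
    using Ore'[OF s(2,3)] by (metis fst_conv prod.collapse snd_conv)
  then have fv: "Comp T V W Y f a = Comp T V W' Y t b" by (simp add: cp_triple)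
  let ?s = "Comp T V W X s a" and ?g = "Comp T V W' X g b"
  have rr: "roof (V, X, ?s) (V, X, ?g)" using We_cp[OF s(1) v(1)] Ar_cp[OF s(4) v(2)] by (auto simp: cp_triple roof_def)
  have "rc X X (V, ?s, ?g) = rc X X (X, Id T X, Id T X)"
    using comp_rc[OF o(1,2,1) r v(1,2) fv] e by (simp add: verdier_map_def)
  from rc_eqD[OF o(1,1) rr roof_vm[OF o(1,1) Id_mor[OF o(1)]] this]
  obtain U x y where u: "Ar (U, V, x)" "Ar (U, X, y)" "(V, X, ?s) \<cdot> (U, V, x) = (X, X, Id T X) \<cdot> (U, X, y)"
    "(V, X, ?g) \<cdot> (U, V, x) = (X, X, Id T X) \<cdot> (U, X, y)" "We ((V, X, ?s) \<cdot> (U, V, x))"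
    unfolding req_def by (metis fst_conv prod.collapse snd_conv)
  have "We (U, V, x)" using We_cancel[OF u(5)] u(1) rr by (simp add: roof_def)
  moreover have "Comp T U V X ?s x = Comp T U V X ?g x" using u(3,4) by (simp add: cp_triple)
  ultimately show ?thesis using v fv by blast
qed

lemma iso_VQ_data:
  assumes o: "X \<in> Ob T" "Y \<in> Ob T" and i: "is_iso VQ X Y F"
  shows "\<exists>W s f W' t g. roof (W, X, s) (W, Y, f) \<and> roof (W', Y, t) (W', X, g) \<and>
    (\<exists>V a b U x. We (V, W, a) \<and> Ar (V, W', b) \<and> We (U, V, x) \<and> Comp T V W Y f a = Comp T V W' Y t b \<and>
      Comp T U V X (Comp T V W X s a) x = Comp T U V X (Comp T V W' X g b) x) \<and>
    (\<exists>V a b U x. We (V, W', a) \<and> Ar (V, W, b) \<and> We (U, V, x) \<and> Comp T V W' X g a = Comp T V W X s b \<and>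
      Comp T U V Y (Comp T V W' Y t a) x = Comp T U V Y (Comp T V W Y f b) x)"
proof -
  obtain G where F: "F \<in> Mor VQ X Y" and G: "G \<in> Mor VQ Y X" and e: "vc X Y X G F = vm X X (Id T X)" "vc Y X Y F G = vm Y Y (Id T Y)"
    using i unfolding is_iso_def VQ_sel(3,5) by blast
  obtain W s f where f: "(W, s, f) \<in> roofs T \<Delta> N X Y" "F = rc X Y (W, s, f)" using F unfolding VQ_sel(2) by auto
  obtain W' t g where g: "(W', t, g) \<in> roofs T \<Delta> N Y X" "G = rc Y X (W', t, g)" using G unfolding VQ_sel(2) by auto
  have r: "roof (W, X, s) (W, Y, f)" "roof (W', Y, t) (W', X, g)" using f g o by (auto simp: roofs_iff)
  show ?thesis using r comp_is_id[OF o r] comp_is_id[OF o(2,1) r(2,1)] e f(2) g(2) by blast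
qed

end

section \<open>Projective and injective modules\<close>

lemma taft_iff:
  assumes d: "d > 0"
  shows "X \<in> taft_modules d \<zeta> \<longleftrightarrow> fdwf X \<and> ac X TK ^ d = idn X \<and> ac X TE ^ d = 0 \<and>
    ac X TK * ac X TE = cs \<zeta> * (ac X TE * ac X TK)"
proof (cases "fdwf X")
  case wf: True
  define n where "n = vdim X"
  have c: "act X g \<in> carrier_mat n n" for g using wf by (auto simp: fdwf_def n_def)
  note bt = bt_ac[OF wf, folded n_def]
  have pc: "act X g ^\<^sub>m k \<in> carrier_mat n n" for g k using c by simp
  have cc: "act X g * act X h \<in> carrier_mat n n" for g h using c mult_carrier_mat by blast
  have LP: "L (act X g ^\<^sub>m d) = ac X g ^ d" for g using bt[of g] d by (simp add: L_pow[OF c] un_pow[of n] ac_def)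
  have 1: "act X g ^\<^sub>m d = 1\<^sub>m n \<longleftrightarrow> ac X g ^ d = un n" for g using L_inj[OF pc one_carrier_mat, of g d] by (simp add: LP L_one)
  have 2: "act X g ^\<^sub>m d = 0\<^sub>m n n \<longleftrightarrow> ac X g ^ d = 0" for g using L_inj[OF pc zero_carrier_mat, of g d] by (simp add: LP L_zero)
  have 3: "act X g * act X h = q \<cdot>\<^sub>m (act X h * act X g) \<longleftrightarrow> ac X g * ac X h = cs q * (ac X h * ac X g)" for g h q
    using L_inj[OF cc smult_carrier_mat[OF cc], of g h q h g] by (simp add: L_mult[OF c c] L_smult[OF cc] ac_def)
  show ?thesis using wf c unfolding taft_modules_def Let_def mem_Collect_eq n_def[symmetric] by (simp add: 1 2 3)
next
  case False
  moreover have "fdwf X" if "X \<in> taft_modules d \<zeta>" using that unfolding taft_modules_def Let_def fdwf_def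
    by (auto, metis taft_gen.exhaust)
  ultimately show ?thesis by auto
qed

lemma ac_res: "ac (res_taft X) TE = ac X DE" "ac (res_taft X) TK = ac X DK" "vdim (res_taft X) = vdim X"
  by (simp_all add: ac_def res_taft_def)
lemma fdwf_res: "fdwf X \<Longrightarrow> fdwf (res_taft X)"
  by (auto simp: fdwf_def res_taft_def split: taft_gen.splits)

context dbl begin

lemma taft: "X \<in> taft_modules d \<zeta> \<longleftrightarrow> fdwf X \<and> ac X TK ^ d = idn X \<and> ac X TE ^ d = 0 \<and>
    ac X TK * ac X TE = cs \<zeta> * (ac X TE * ac X TK)"
  by (rule taft_iff[OF d0])

lemma res_in_taft: "X \<in> C \<Longrightarrow> res_taft X \<in> taft_modules d \<zeta>"
  unfolding taft using C_isM[of X] by (auto simp: ac_res fdwf_res C_wf isD_def)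

lemma fd_hom': "X \<in> C \<Longrightarrow> Y \<in> C \<Longrightarrow> fd_hom X Y f \<longleftrightarrow> f \<in> carrier_mat (vdim Y) (vdim X) \<and> H UNIV X Y (L f)"
  by (rule fd_hom_iff) (auto intro: C_wf)

text \<open>Higman's criterion. A projective module is a direct summand of an induced one, whose
  identity is a relative trace; conversely a relative trace lifts along every surjection.\<close>

lemma projective_iff: "projective C P \<longleftrightarrow> P \<in> C \<and> nD P P (idn P)"
proof
  assume P: "projective C P"
  then have PC: "P \<in> C" by (simp add: projective_def)
  obtain Q e where Q: "epi Q P e" "nD Q Q (idn Q)" using induced_module[OF PC] by blast
  have QC: "Q \<in> C" and He: "H UNIV Q P e" using Q by (auto simp: epi_def)
  have "fd_epi Q P (Mt (vdim P) (vdim Q) e)" using Q(1) H_bt[OF He] by (simp add: fd_epi_iff' QC PC L_Mt)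
  moreover have "fd_hom P P (1\<^sub>m (vdim P))" using H_idn[OF C_wf[OF PC], of UNIV] PC by (simp add: fd_hom' L_one)
  ultimately obtain h where h: "fd_hom P Q h" "Mt (vdim P) (vdim Q) e * h = 1\<^sub>m (vdim P)"
    using P QC PC unfolding projective_def by blast
  have h': "h \<in> carrier_mat (vdim Q) (vdim P)" "H UNIV P Q (L h)" using h(1) by (auto simp: fd_hom' QC PC)
  have "e * L h = idn P" using h(2) H_bt[OF He] by (simp add: L_mult_eq_iff[OF Mt_carrier h'(1) one_carrier_mat] L_Mt L_one)
  moreover have "nD P P (e * (idn Q * L h))" by (rule D.N_left[OF He D.N_right[OF h'(2) Q(2)]])
  ultimately show "P \<in> C \<and> nD P P (idn P)" using PC h'(2) by (simp add: H_unl)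
next
  assume a: "P \<in> C \<and> nD P P (idn P)"
  show "projective C P" unfolding projective_def
  proof (intro conjI ballI allI impI)
    show "P \<in> C" using a by simp
    fix X Y p f assume o: "X \<in> C" "Y \<in> C" and pf: "fd_epi X Y p \<and> fd_hom P Y f"
    then have p: "p \<in> carrier_mat (vdim Y) (vdim X)" "epi X Y (L p)" and f: "f \<in> carrier_mat (vdim Y) (vdim P)" "H UNIV P Y (L f)"
      using a by (auto simp: fd_epi_iff' fd_hom')
    obtain h where h: "nD P X h" "L p * h = L f" using D.N_lift[OF p(2)] D.N_idn_right[OF _ f(2)] a by blast
    have Hh: "H UNIV P X h" using D.N_H a o h by blast
    have "fd_hom P X (Mt (vdim X) (vdim P) h)" using Hh a o by (intro fd_hom_Mt C_wf) auto
    moreover have "p * Mt (vdim X) (vdim P) h = f" using h H_bt[OF Hh] by (simp add: L_mult_eq_iff[OF p(1) Mt_carrier f(1)] L_Mt)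
    ultimately show "\<exists>h. fd_hom P X h \<and> p * h = f" by blast
  qed
qed

text \<open>Dual to \<open>projective_iff\<close>, since every module also embeds in an induced one.
  The criterion is the same, so that projective and injective modules coincide.\<close>

lemma injective_iff: "injective C P \<longleftrightarrow> P \<in> C \<and> nD P P (idn P)"
proof
  assume P: "injective C P"
  then have PC: "P \<in> C" by (simp add: injective_def)
  obtain Q e where Q: "mono P Q e" "nD Q Q (idn Q)" using induced_module[OF PC] by blast
  have QC: "Q \<in> C" and He: "H UNIV P Q e" using Q by (auto simp: mono_def)
  have "fd_mono P Q (Mt (vdim Q) (vdim P) e)" using Q(1) H_bt[OF He] by (simp add: fd_mono_iff' QC PC L_Mt)
  moreover have "fd_hom P P (1\<^sub>m (vdim P))" using H_idn[OF C_wf[OF PC], of UNIV] PC by (simp add: fd_hom' L_one)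
  ultimately obtain h where h: "fd_hom Q P h" "h * Mt (vdim Q) (vdim P) e = 1\<^sub>m (vdim P)"
    using P QC PC unfolding injective_def by blast
  have h': "h \<in> carrier_mat (vdim P) (vdim Q)" "H UNIV Q P (L h)" using h(1) by (auto simp: fd_hom' QC PC)
  have "L h * e = idn P" using h(2) H_bt[OF He] by (simp add: L_mult_eq_iff[OF h'(1) Mt_carrier one_carrier_mat] L_Mt L_one)
  moreover have "nD P P (L h * (idn Q * e))" by (rule D.N_left[OF h'(2) D.N_right[OF He Q(2)]])
  ultimately show "P \<in> C \<and> nD P P (idn P)" using PC He by (simp add: H_unl)
next
  assume a: "P \<in> C \<and> nD P P (idn P)"
  show "injective C P" unfolding injective_def
  proof (intro conjI ballI allI impI)
    show "P \<in> C" using a by simp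
    fix X Y i f assume o: "X \<in> C" "Y \<in> C" and pf: "fd_mono X Y i \<and> fd_hom X P f"
    then have p: "i \<in> carrier_mat (vdim Y) (vdim X)" "mono X Y (L i)" and f: "f \<in> carrier_mat (vdim P) (vdim X)" "H UNIV X P (L f)"
      using a by (auto simp: fd_mono_iff' fd_hom')
    obtain h where h: "nD Y P h" "h * L i = L f" using D.N_ext[OF p(2)] D.N_idn_left[OF _ f(2)] a by blast
    have Hh: "H UNIV Y P h" using D.N_H a o h by blast
    have "fd_hom Y P (Mt (vdim P) (vdim Y) h)" using Hh a o by (intro fd_hom_Mt C_wf) auto
    moreover have "Mt (vdim P) (vdim Y) h * i = f" using h H_bt[OF Hh] by (simp add: L_mult_eq_iff[OF Mt_carrier p(1) f(1)] L_Mt)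
    ultimately show "\<exists>h. fd_hom Y P h \<and> h * i = f" by blast
  qed
qed

text \<open>A map through a projective module passes through an identity in \<open>nD\<close>;
  conversely a map in \<open>nD\<close> lifts along the surjection of an induced module onto
  \<open>Y\<close>, and so factors through it.\<close>

lemma factors_proj_iff:
  assumes o: "X \<in> C" "Y \<in> C"
  shows "factors_proj C X Y f \<longleftrightarrow> f \<in> carrier_mat (vdim Y) (vdim X) \<and> nD X Y (L f)"
proof
  assume "factors_proj C X Y f"
  then obtain P a b where P: "P \<in> C" "nD P P (idn P)" "fd_hom X P a" "fd_hom P Y b" "f = b * a"
    unfolding factors_proj_def projective_iff by blast
  have a: "a \<in> carrier_mat (vdim P) (vdim X)" "H UNIV X P (L a)" and b: "b \<in> carrier_mat (vdim Y) (vdim P)" "H UNIV P Y (L b)"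
    using P o by (auto simp: fd_hom')
  have "nD X Y (L b * (idn P * L a))" by (rule D.N_left[OF b(2) D.N_right[OF a(2) P(2)]])
  then show "f \<in> carrier_mat (vdim Y) (vdim X) \<and> nD X Y (L f)"
    using a b P(5) by (simp add: L_mult[OF b(1) a(1)] H_unl mult_carrier_mat[OF b(1) a(1)])
next
  assume a: "f \<in> carrier_mat (vdim Y) (vdim X) \<and> nD X Y (L f)"
  obtain Q e where Q: "epi Q Y e" "nD Q Q (idn Q)" using induced_module[OF o(2)] by blast
  have QC: "Q \<in> C" and He: "H UNIV Q Y e" using Q by (auto simp: epi_def)
  obtain h where h: "nD X Q h" "e * h = L f" using D.N_lift[OF Q(1)] a by blast
  have Hh: "H UNIV X Q h" using D.N_H o QC h by blast
  have "f = Mt (vdim Y) (vdim Q) e * Mt (vdim Q) (vdim X) h"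
    using a h H_bt[OF Hh] H_bt[OF He] L_mult_eq_iff[OF Mt_carrier Mt_carrier, of f "vdim Y" "vdim X" "vdim Q" e h] by (simp add: L_Mt)
  moreover have "fd_hom X Q (Mt (vdim Q) (vdim X) h)" "fd_hom Q Y (Mt (vdim Y) (vdim Q) e)"
    using Hh He o QC by (auto intro!: fd_hom_Mt C_wf)
  moreover have "projective C Q" using Q QC by (simp add: projective_iff)
  ultimately show "factors_proj C X Y f" unfolding factors_proj_def by blast
qed

text \<open>Higman's criterion for the Taft algebra, except that \<open>nE\<close> asks in addition
  for commutation with \<open>z\<close>, on which projectivity over \<open>B\<close> is silent. It
  is gained by averaging over \<open>z\<close>, which commutes with \<open>E\<close> and
  \<open>K\<close>.\<close>

lemma proj_B_iff: "X \<in> proj_B d \<zeta> \<longleftrightarrow> X \<in> C \<and> nE X X (idn X)"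
proof
  assume "X \<in> proj_B d \<zeta>"
  then have X: "X \<in> C" and P: "projective (taft_modules d \<zeta>) (res_taft X)" by (auto simp: proj_B_def)
  obtain Q e where Q: "epi Q X e" "nD Q Q (idn Q)" using induced_module[OF X] by blast
  have QC: "Q \<in> C" and He: "H UNIV Q X e" using Q by (auto simp: epi_def)
  obtain s where s: "H GK X Q s" "e * s = idn X" using Q(1) by (auto simp: epi_def)
  let ?e = "Mt (vdim X) (vdim Q) e"
  have wf: "fdwf (res_taft Q)" "fdwf (res_taft X)" using X QC by (auto intro: fdwf_res C_wf)
  have Le: "L ?e = e" using L_Mt H_bt[OF He] by blast
  have "H UNIV (res_taft Q) (res_taft X) e" unfolding H_def ac_res
  proof (intro conjI ballI)
    fix g show "e * ac (res_taft Q) g = ac (res_taft X) g * e" by (cases g) (simp_all add: ac_res H_ac[OF He])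
  qed (rule H_bt[OF He])
  then have "fd_hom (res_taft Q) (res_taft X) ?e" unfolding fd_hom_iff[OF wf] Le by (simp add: ac_res)
  then have ep: "fd_epi (res_taft Q) (res_taft X) ?e" unfolding fd_epi_iff Le ac_res using s H_bt[OF s(1)] by blast
  have id: "fd_hom (res_taft X) (res_taft X) (1\<^sub>m (vdim X))"
    unfolding fd_hom_iff[OF wf(2) wf(2)] L_one using H_idn[OF wf(2)] by (simp add: ac_res)
  obtain h where h: "fd_hom (res_taft X) (res_taft Q) h" "?e * h = 1\<^sub>m (vdim X)"
    using P ep id res_in_taft[OF QC] res_in_taft[OF X] unfolding projective_def by blast
  have h': "h \<in> carrier_mat (vdim Q) (vdim X)" "H UNIV (res_taft X) (res_taft Q) (L h)"
    using h(1) unfolding fd_hom_iff[OF wf(2,1)] by (auto simp: ac_res)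
  have eh: "e * L h = idn X" using h(2) by (simp add: L_mult_eq_iff[OF Mt_carrier h'(1) one_carrier_mat] Le L_one)
  have hE: "L h * ac X DE = ac Q DE * L h" using H_ac[OF h'(2), of TE] by (simp add: ac_res)
  have hK: "L h * ac X DK = ac Q DK * L h" using H_ac[OF h'(2), of TK] by (simp add: ac_res)
  \<comment> \<open>The average over \<open>z\<close> of the splitting still commutes with
    \<open>E\<close> and \<open>K\<close>, and it still splits \<open>e\<close>, since
    \<open>e\<close> commutes with \<open>z\<close>.\<close>
  let ?h = "av d (ac Q DZ) (ac X DZ) (L h)"
  have b: "bt (vdim Q) (vdim X) (L h)" using bt_L[OF h'(1)] .
  have hz: "ac Q DZ * ?h = ?h * ac X DZ"
    using X QC b by (intro av_commute) (simp_all add: gm_right_kz bt_def)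
  have gen: "?h * ac X g = ac Q g * ?h" if "L h * ac X g = ac Q g * L h" "ac Q DZ * ac Q g = ac Q g * ac Q DZ" "ac X DZ * ac X g = ac X g * ac X DZ" for g
    using av_left[of "ac Q g" "ac Q DZ" "ac Q DZ" d "ac X DZ" "L h"] av_right[of "ac X DZ" "ac X g" "ac X DZ" d "ac Q DZ" "L h"] that by simp
  have HA: "H GA X Q ?h" unfolding H_def using gen[OF hE] gen[OF hK] hz C_rel[OF X] C_rel[OF QC] gm_right_kz[OF X] gm_right_kz[OF QC]
      av_bt[OF bt_ac bt_ac b, of d DZ DZ] X QC by (auto simp: C_wf)
  have "e * ?h = av d (ac X DZ) (ac X DZ) (idn X)"
    using av_left[of e "ac Q DZ" "ac X DZ" d "ac X DZ" "L h"] H_ac[OF He] eh by simp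
  also have "\<dots> = idn X" using X by (intro av_const d0) (simp_all add: ac_idn gm_right_kz un_un)
  finally have e1: "e * ?h = idn X" .
  have "nE X X (e * (idn Q * ?h))"
    by (rule A.N_left[OF H_mono[OF He] A.N_right[OF HA nD_nE[OF QC QC Q(2)]]]) auto
  then show "X \<in> C \<and> nE X X (idn X)" using X e1 H_unl[OF HA] by simp
next
  assume a: "X \<in> C \<and> nE X X (idn X)"
  then obtain T where X: "X \<in> C" and T: "gw X X T" "idn X = TrE X X T" by (auto simp: nE_def)
  let ?R = "res_taft X"
  have wfR: "fdwf ?R" using X by (auto intro: fdwf_res C_wf)
  have "projective (taft_modules d \<zeta>) ?R" unfolding projective_def
  proof (intro conjI ballI allI impI)
    show "?R \<in> taft_modules d \<zeta>" using res_in_taft[OF X] .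
    fix U V p f assume U: "U \<in> taft_modules d \<zeta>" and V: "V \<in> taft_modules d \<zeta>" and pf: "fd_epi U V p \<and> fd_hom ?R V f"
    have u: "fdwf U" "ac U TK ^ d = idn U" "ac U TE ^ d = 0" "ac U TK * ac U TE = cs \<zeta> * (ac U TE * ac U TK)"
      and v: "fdwf V" "ac V TK ^ d = idn V" using U V unfolding taft by auto
    obtain S where p: "p \<in> carrier_mat (vdim V) (vdim U)" "H UNIV U V (L p)" and S: "bt (vdim U) (vdim V) S" "L p * S = idn V"
      using pf fd_hom_iff[OF u(1) v(1)] unfolding fd_epi_iff by blast
    have f: "f \<in> carrier_mat (vdim V) (vdim X)" "H UNIV ?R V (L f)"
      using pf fd_hom_iff[OF wfR v(1)] by (auto simp: ac_res)
    \<comment> \<open>\<open>U\<close> and \<open>V\<close> are modules of the Taft algebra, without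
      an action of \<open>z\<close>, so the linear splitting is averaged over \<open>K\<close>
      only.\<close>
    let ?s = "av d (ac U TK) (ac V TK) S"
    have s: "bt (vdim U) (vdim V) ?s" "ac U TK * ?s = ?s * ac V TK"
      using av_bt[OF bt_ac[OF u(1)] bt_ac[OF v(1)] S(1)] u v S by (auto intro!: av_commute simp: bt_def)
    have ps: "L p * ?s = idn V"
    proof -
      have "L p * ?s = av d (ac V TK) (ac V TK) (idn V)"
        using av_left[of "L p" "ac U TK" "ac V TK" d "ac V TK" S] H_ac[OF p(2)] S by simp
      also have "\<dots> = idn V" using v bt_ac[OF v(1)] by (intro av_const d0) (auto simp: bt_def un_un)
      finally show ?thesis .
    qed
    \<comment> \<open>The lift is a relative trace formed with the action of \<open>E\<close> on
      \<open>U\<close> on the left and on \<open>X\<close> on the right; composed with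
      \<open>p\<close> it becomes \<open>L f * TrE X X T\<close>, which is
      \<open>L f\<close>.\<close>
    let ?h = "trp d (ac U TE) (ac X DE) (?s * (L f * T))"
    have Tb: "bt (vdim X) (vdim X) T" and kT: "ac X DK * T = cs \<zeta> * (T * ac X DK)" using T by (auto simp: gw_def)
    have fb: "bt (vdim V) (vdim X) (L f)" using bt_L[OF f(1)] .
    have hb: "bt (vdim U) (vdim X) ?h"
      using s(1) fb Tb bt_ac[OF u(1)] bt_ac[OF C_wf[OF X]] by (intro trp_bt) auto
    have fK: "ac V TK * L f = L f * ac X DK" using H_ac[OF f(2), of TK] by (simp add: ac_res)
    have fE: "L f * ac X DE = ac V TE * L f" using H_ac[OF f(2), of TE] by (simp add: ac_res)
    have hE: "ac U TE * ?h = ?h * ac X DE" using u C_rel[OF X] by (intro trp_commute) simp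
    have "ac U TK * (?s * (L f * T)) = cs \<zeta> * (?s * (L f * T) * ac X DK)"
      by (simp only: assoc2[OF s(2)] assoc2[OF fK] kT cs_left[of "L f"] cs_left[of ?s] mult.assoc)
    then have "ac U TK * ?h = cs (\<zeta> * \<zeta> ^ (d - 1)) * (?h * ac X DK)"
      by (rule trp_scale[OF _ u(4) C_rel(5)[OF X]])
    then have hK: "ac U TK * ?h = ?h * ac X DK" using zeta_pred z0 by simp
    have "H UNIV ?R U ?h" unfolding H_def ac_res
    proof (intro conjI ballI)
      fix g show "?h * ac ?R g = ac U g * ?h" by (cases g) (simp_all add: ac_res hE hK)
    qed (rule hb)
    then have "fd_hom ?R U (Mt (vdim U) (vdim X) ?h)" using fd_hom_Mt[OF wfR u(1)] by (simp add: ac_res)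
    moreover have "L p * ?h = L f"
    proof -
      have "L p * ?h = trp d (ac V TE) (ac X DE) (L p * (?s * (L f * T)))" by (rule trp_left) (simp add: H_ac[OF p(2)])
      also have "\<dots> = trp d (ac V TE) (ac X DE) (L f * T)" using bt_unl'[OF fb] by (simp add: assoc2[OF ps])
      also have "\<dots> = L f * TrE X X T" unfolding TrE_def by (rule trp_left[symmetric, OF fE])
      finally show ?thesis using T(2) bt_unr[OF fb] by simp
    qed
    then have "p * Mt (vdim U) (vdim X) ?h = f" using hb by (simp add: L_mult_eq_iff[OF p(1) Mt_carrier f(1)] L_Mt)
    ultimately show "\<exists>h. fd_hom ?R U h \<and> p * h = f" by blast
  qed
  then show "X \<in> proj_B d \<zeta>" using X by (simp add: proj_B_def)
qed

end

section \<open>Weak equivalences\<close>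

context dbl begin

text \<open>Equality in the stable category of the Taft algebra.\<close>

definition eqA :: "double_gen fdmod \<Rightarrow> double_gen fdmod \<Rightarrow> lop \<Rightarrow> lop \<Rightarrow> bool" where
  "eqA X Y f g \<longleftrightarrow> X \<in> C \<and> Y \<in> C \<and> H GA X Y f \<and> H GA X Y g \<and> nE X Y (f - g)"

lemma UA: "H UNIV X Y f \<Longrightarrow> H GA X Y f" and AK: "H GA X Y f \<Longrightarrow> H GK X Y f" and UK: "H UNIV X Y f \<Longrightarrow> H GK X Y f"
  by (auto simp: H_def)
lemma HA_idn: "X \<in> C \<Longrightarrow> H G X X (idn X)" by (simp add: H_idn C_wf)

lemma eqA_refl: "X \<in> C \<Longrightarrow> Y \<in> C \<Longrightarrow> H GA X Y f \<Longrightarrow> eqA X Y f f" by (simp add: eqA_def A.N_0)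
lemma eqA_sym: "eqA X Y f g \<Longrightarrow> eqA X Y g f"
  unfolding eqA_def using A.N_uminus[of X Y "f - g"] by simp
lemma eqA_trans [trans]: "eqA X Y f g \<Longrightarrow> eqA X Y g h \<Longrightarrow> eqA X Y f h"
  unfolding eqA_def using A.N_add[of X Y "f - g" "g - h"] by simp
lemma eqA_mult: "eqA Y Z f f' \<Longrightarrow> eqA X Y g g' \<Longrightarrow> eqA X Z (f * g) (f' * g')"
proof -
  assume a: "eqA Y Z f f'" "eqA X Y g g'"
  have "nE X Z ((f - f') * g + f' * (g - g'))" using a unfolding eqA_def by (auto intro: A.N_add A.N_left A.N_right)
  then have "nE X Z (f * g - f' * g')" by (simp add: algebra_simps)
  then show ?thesis using a by (auto simp: eqA_def intro: H_mult)
qed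
lemma eqA_H: "eqA X Y f g \<Longrightarrow> H GA X Y f" "eqA X Y f g \<Longrightarrow> H GA X Y g" "eqA X Y f g \<Longrightarrow> X \<in> C" "eqA X Y f g \<Longrightarrow> Y \<in> C"
  by (auto simp: eqA_def)
lemma eqA_left: "H GA Y Z f \<Longrightarrow> Z \<in> C \<Longrightarrow> eqA X Y g g' \<Longrightarrow> eqA X Z (f * g) (f * g')"
  by (rule eqA_mult[OF eqA_refl]) (auto dest: eqA_H)
lemma eqA_right: "H GA X Y g \<Longrightarrow> X \<in> C \<Longrightarrow> eqA Y Z f f' \<Longrightarrow> eqA X Z (f * g) (f' * g)"
  by (rule eqA_mult[OF _ eqA_refl]) (auto dest: eqA_H)
lemma eqA_nD: "X \<in> C \<Longrightarrow> Y \<in> C \<Longrightarrow> H UNIV X Y f \<Longrightarrow> H UNIV X Y g \<Longrightarrow> nD X Y (f - g) \<Longrightarrow> eqA X Y f g"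
  by (simp add: eqA_def UA nD_nE)

text \<open>Isomorphism in the stable category of the Taft algebra with \<open>z\<close> adjoined:
  neither \<open>f\<close> nor its inverse has to commute with \<open>F\<close>. For maps of the
  double, \<open>cone_iff\<close> identifies this with having a cone in
  \<open>proj_B\<close>.\<close>

definition weq :: "double_gen fdmod \<Rightarrow> double_gen fdmod \<Rightarrow> lop \<Rightarrow> bool" where
  "weq X Y f \<longleftrightarrow> X \<in> C \<and> Y \<in> C \<and> H GA X Y f \<and> (\<exists>g. H GA Y X g \<and> eqA X X (g * f) (idn X) \<and> eqA Y Y (f * g) (idn Y))"

lemma weq_idn: "X \<in> C \<Longrightarrow> weq X X (idn X)"
  unfolding weq_def by (intro conjI exI[of _ "idn X"]) (auto simp: HA_idn un_un intro: eqA_refl)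

lemma weq_comp:
  assumes "weq X Y f" "weq Y Z g" shows "weq X Z (g * f)"
proof -
  obtain f' g' where a: "X \<in> C" "Y \<in> C" "Z \<in> C" "H GA X Y f" "H GA Y Z g" "H GA Y X f'" "H GA Z Y g'"
    "eqA X X (f' * f) (idn X)" "eqA Y Y (f * f') (idn Y)" "eqA Y Y (g' * g) (idn Y)" "eqA Z Z (g * g') (idn Z)"
    using assms by (auto simp: weq_def)
  have "eqA X X (f' * (g' * g) * f) (f' * idn Y * f)" using a by (intro eqA_right eqA_left) auto
  moreover have "f' * idn Y * f = f' * f" by (simp add: mult.assoc H_unl[OF a(4)])
  ultimately have "eqA X X (f' * (g' * g) * f) (idn X)" using eqA_trans[OF _ a(8)] by simp
  then have 1: "eqA X X ((f' * g') * (g * f)) (idn X)" by (simp add: mult.assoc)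
  have "eqA Z Z (g * (f * f') * g') (g * idn Y * g')" using a by (intro eqA_right eqA_left) auto
  moreover have "g * idn Y * g' = g * g'" by (simp add: mult.assoc H_unl[OF a(7)])
  ultimately have "eqA Z Z (g * (f * f') * g') (idn Z)" using eqA_trans[OF _ a(11)] by simp
  then have 2: "eqA Z Z ((g * f) * (f' * g')) (idn Z)" by (simp add: mult.assoc)
  show ?thesis unfolding weq_def using a 1 2 H_mult by blast
qed

lemma weq_cong: assumes "weq X Y f" "eqA X Y f f'" shows "weq X Y f'"
proof -
  obtain g where a: "X \<in> C" "Y \<in> C" "H GA Y X g" "eqA X X (g * f) (idn X)" "eqA Y Y (f * g) (idn Y)"
    using assms by (auto simp: weq_def)
  have f': "eqA X Y f' f" using assms eqA_sym by blast
  have "eqA X X (g * f') (idn X)" "eqA Y Y (f' * g) (idn Y)"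
    using eqA_trans[OF eqA_left[OF a(3) a(1) f'] a(4)] eqA_trans[OF eqA_right[OF a(3) a(2) f'] a(5)] .
  then show ?thesis unfolding weq_def using a eqA_H[OF f'] by blast
qed

lemma weq_cancel_left:
  assumes "weq X Z (t * s)" "weq Y Z t" "H GA X Y s" shows "weq X Y s"
proof -
  obtain r t' where a: "X \<in> C" "Y \<in> C" "Z \<in> C" "H GA Y Z t" "H GA Z Y t'" "H GA Z X r"
    "eqA X X (r * (t * s)) (idn X)" "eqA Z Z (t * s * r) (idn Z)" "eqA Y Y (t' * t) (idn Y)"
    using assms by (auto simp: weq_def)
  have srt: "H GA Y Y (s * r * t)" using a assms(3) by (intro H_mult) auto
  have "eqA Y Y ((t' * t) * (s * r * t)) (idn Y * (s * r * t))" using a srt by (intro eqA_right) auto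
  then have 1: "eqA Y Y (s * r * t) (t' * (t * s * r) * t)" using eqA_sym by (simp add: mult.assoc bt_unl'[OF H_bt[OF assms(3)]])
  have 2: "eqA Y Y (t' * (t * s * r) * t) (t' * idn Z * t)" using a by (intro eqA_right eqA_left) auto
  have "eqA Y Y (s * (r * t)) (idn Y)"
    using eqA_trans[OF eqA_trans[OF 1 2]] a(9) by (simp add: mult.assoc bt_unl[OF H_bt[OF a(4)]])
  moreover have "eqA X X ((r * t) * s) (idn X)" using a(7) by (simp add: mult.assoc)
  ultimately show ?thesis unfolding weq_def using a assms(3) H_mult by blast
qed

lemma weq_cancel_right:
  assumes "weq X Z (t * s)" "weq X Y s" "H GA Y Z t" shows "weq Y Z t"
proof -
  obtain r s' where a: "X \<in> C" "Y \<in> C" "Z \<in> C" "H GA X Y s" "H GA Y X s'" "H GA Z X r"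
    "eqA X X (r * (t * s)) (idn X)" "eqA Z Z (t * s * r) (idn Z)" "eqA Y Y (s * s') (idn Y)"
    using assms by (auto simp: weq_def)
  have srt: "H GA Y Y (s * r * t)" using a assms(3) by (intro H_mult) auto
  have "eqA Y Y ((s * r * t) * (s * s')) ((s * r * t) * idn Y)" using a srt by (intro eqA_left) auto
  then have 1: "eqA Y Y (s * r * t) (s * (r * (t * s)) * s')" using eqA_sym by (simp add: mult.assoc bt_unr[OF H_bt[OF assms(3)]])
  have 2: "eqA Y Y (s * (r * (t * s)) * s') (s * idn X * s')" using a by (intro eqA_right eqA_left) auto
  have "eqA Y Y ((s * r) * t) (idn Y)"
    using eqA_trans[OF eqA_trans[OF 1 2]] a(9) by (simp add: mult.assoc bt_unl[OF H_bt[OF a(5)]])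
  moreover have "eqA Z Z (t * (s * r)) (idn Z)" using a(8) by (simp add: mult.assoc)
  ultimately show ?thesis unfolding weq_def using a assms(3) H_mult by blast
qed

lemma weq_zero:
  assumes "X \<in> C" "Y \<in> C" "nE X X (idn X)" "nE Y Y (idn Y)" "H GA X Y f" shows "weq X Y f"
  unfolding weq_def using assms A.N_uminus[OF assms(3)] A.N_uminus[OF assms(4)]
  by (intro conjI exI[of _ 0]) (auto simp: eqA_def H_0 HA_idn)

lemma weq_obj:
  assumes w: "weq X Y f" and z: "nE X X (idn X)" shows "nE Y Y (idn Y)"
proof -
  obtain g where a: "H GA X Y f" "H GA Y X g" "eqA Y Y (f * g) (idn Y)" using w by (auto simp: weq_def)
  have "nE Y Y (f * (idn X * g))" by (rule A.N_left[OF a(1) A.N_right[OF a(2) z]])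
  then have "nE Y Y (f * g)" by (simp add: H_unl[OF a(2)])
  then show ?thesis using A.N_diff[of Y Y "f * g" "f * g - idn Y"] a(3) by (simp add: eqA_def)
qed

lemma weq_inclusion:
  assumes "X \<in> C" "S \<in> C" "H UNIV X S i" "H UNIV S X p" "p * i = idn X" "i * p + j * q = idn S" "nE S S (j * q)"
  shows "weq X S i"
proof -
  have "i * p - idn S = - (j * q)" using assms(6) by (simp add: algebra_simps)
  then have "nE S S (i * p - idn S)" using A.N_uminus[OF assms(7)] by simp
  moreover have "eqA X X (p * i) (idn X)" unfolding assms(5) using assms by (intro eqA_refl HA_idn)
  ultimately show ?thesis unfolding weq_def using assms
    by (auto simp: eqA_def UA HA_idn intro!: exI[of _ p] H_mult[OF UA UA])
qed

text \<open>Lifting the identity of \<open>Z\<close>, which lies in \<open>nE\<close>, gives a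
  section of \<open>v\<close> that commutes with \<open>E\<close> too. The sequence then splits over
  \<open>E\<close>, \<open>K\<close>, \<open>z\<close>, with a null complement of
  \<open>X\<close>.\<close>

lemma weq_of_cokernel:
  assumes s: "ses X Y Z u v" and z: "nE Z Z (idn Z)" shows "weq X Y u"
proof -
  have o: "X \<in> C" "Y \<in> C" "Z \<in> C" "H GA X Y u" "H GA Y Z v" using s by (auto simp: ses_def intro: UA)
  obtain h where h: "nE Z Y h" "v * h = idn Z" using A.N_lift[OF A.ses_epi[OF s] z] by blast
  have Hh: "H GA Z Y h" using A.N_H[OF o(3,2) h(1)] .
  have k: "H GA Y Y (idn Y - h * v)" by (intro H_diff HA_idn o H_mult[OF Hh o(5)])
  have "v * (idn Y - h * v) = 0" using o by (simp add: algebra_simps assoc2[OF h(2)] H_unl H_unr)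
  then obtain r where r: "H GA Y X r" "u * r = idn Y - h * v" using A.ker_factor[OF s k] by blast
  have "u * (r * u) = u * idn X"
    using o ses_vu[OF s] by (simp add: mult.assoc[symmetric] r(2) left_diff_distrib H_unl H_unr) (simp add: mult.assoc)
  then have ru: "r * u = idn X" using A.mono_cancel[OF A.ses_mono[OF s]] H_mult[OF r(1) o(4)] HA_idn[OF o(1)] by blast
  have "nE Y Y (u * r - idn Y)" unfolding r(2) using A.N_uminus[OF A.N_right[OF o(5) h(1)]] by simp
  then show ?thesis unfolding weq_def using o r ru H_mult[OF o(4) r(1)]
    by (auto simp: eqA_def HA_idn A.N_0 intro!: exI[of _ r])
qed

text \<open>The stable inverse \<open>g\<close> of \<open>u\<close> is corrected by a map in
  \<open>nE\<close>, extended from \<open>X\<close> to \<open>Y\<close>, to an honest retraction.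
  The complementary projection then lies in \<open>nE\<close> and gives the identity of
  \<open>Z\<close>.\<close>

lemma cokernel_of_weq:
  assumes s: "ses X Y Z u v" and w: "weq X Y u" shows "nE Z Z (idn Z)"
proof -
  have o: "X \<in> C" "Y \<in> C" "Z \<in> C" "H GA X Y u" "H GA Y Z v" using s by (auto simp: ses_def intro: UA)
  obtain g where g: "H GA Y X g" "eqA X X (g * u) (idn X)" "eqA Y Y (u * g) (idn Y)" using w by (auto simp: weq_def)
  obtain m where m: "nE Y X m" "m * u = g * u - idn X" using A.N_ext[OF A.ses_mono[OF s]] g(2) unfolding eqA_def by blast
  have Hm: "H GA Y X m" using A.N_H[OF o(2,1) m(1)] .
  let ?r = "g - m"
  have r: "H GA Y X ?r" "?r * u = idn X" using H_diff[OF g(1) Hm] m by (auto simp: left_diff_distrib)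
  let ?k = "idn Y - u * ?r"
  have k: "H GA Y Y ?k" by (intro H_diff HA_idn o H_mult[OF o(4) r(1)])
  have ku: "?k * u = 0" using r o by (simp add: left_diff_distrib[of "idn Y"] mult.assoc H_unl H_unr)
  have "nE Y Y (u * m - (u * g - idn Y))" using g(3) A.N_diff[OF A.N_left[OF o(4) m(1)]] by (simp add: eqA_def)
  then have nk: "nE Y Y ?k" by (simp add: algebra_simps)
  obtain t where t: "H GA Z Y t" "t * v = ?k" using A.quot_factor[OF s k ku] by blast
  have "v * t * v = idn Z * v" using o ses_vu[OF s] by (simp add: mult.assoc t(2) right_diff_distrib H_unl H_unr)
    (simp add: mult.assoc[symmetric])
  then have vt: "v * t = idn Z" using A.epi_cancel[OF A.ses_epi[OF s]] H_mult[OF o(5) t(1)] HA_idn[OF o(3)] by blast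
  have "nE Z Z (v * (?k * t))" by (rule A.N_left[OF o(5) A.N_right[OF t(1) nk]])
  moreover have "v * (?k * t) = idn Z"
    using H_unl[OF t(1)] by (simp add: t(2)[symmetric] mult.assoc vt assoc2[OF vt] H_unr[OF t(1)])
  ultimately show ?thesis by simp
qed

text \<open>The defect \<open>e * g - idn Y\<close> of a stable inverse lies in \<open>nE\<close>
  and so lifts along \<open>e\<close>; subtracting the lift makes \<open>g\<close> an honest
  section.\<close>

lemma weq_section:
  assumes e: "epi U Y e" and w: "weq U Y e"
  shows "\<exists>t. H GA Y U t \<and> e * t = idn Y \<and> nE U U (idn U - t * e)"
proof -
  have o: "U \<in> C" "Y \<in> C" "H GA U Y e" using e by (auto simp: epi_def intro: UA)
  obtain g where g: "H GA Y U g" "eqA U U (g * e) (idn U)" "eqA Y Y (e * g) (idn Y)" using w by (auto simp: weq_def)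
  obtain m where m: "nE Y U m" "e * m = e * g - idn Y" using A.N_lift[OF e] g(3) unfolding eqA_def by blast
  have Hm: "H GA Y U m" using A.N_H[OF o(2,1) m(1)] .
  have "nE U U (m * e - (g * e - idn U))" using g(2) A.N_diff[OF A.N_right[OF o(3) m(1)]] by (simp add: eqA_def)
  then have "nE U U (idn U - (g - m) * e)" by (simp add: algebra_simps)
  moreover have "e * (g - m) = idn Y" using m by (simp add: right_diff_distrib)
  ultimately show ?thesis using H_diff[OF g(1) Hm] by blast
qed

text \<open>With an honest section \<open>t\<close> the projection \<open>idn U - t * e\<close> onto
  the kernel lies in \<open>nE\<close>; on the kernel it is the identity.\<close>

lemma kernel_of_weq:
  assumes s: "ses X U Y n e" and w: "weq U Y e" shows "nE X X (idn X)"
proof -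
  have o: "X \<in> C" "U \<in> C" "Y \<in> C" "H GA X U n" "H GA U Y e" using s by (auto simp: ses_def intro: UA)
  obtain t where t: "H GA Y U t" "e * t = idn Y" "nE U U (idn U - t * e)" using weq_section[OF A.ses_epi[OF s] w] by blast
  let ?k = "idn U - t * e"
  have k: "H GA U U ?k" by (intro H_diff HA_idn o H_mult[OF t(1) o(5)])
  have ek: "e * ?k = 0" using o by (simp add: right_diff_distrib assoc2[OF t(2)] H_unl H_unr)
  obtain r where r: "H GA U X r" "n * r = ?k" using A.ker_factor[OF s k ek] by blast
  have kn: "?k * n = n" using o ses_vu[OF s] by (simp add: left_diff_distrib mult.assoc H_unl)
  have "n * (r * n) = n * idn X" using kn o by (simp add: mult.assoc[symmetric] r(2) H_unr)
  then have rn: "r * n = idn X" using A.mono_cancel[OF A.ses_mono[OF s]] H_mult[OF r(1) o(4)] HA_idn[OF o(1)] by blast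
  have "nE X X (r * (?k * n))" by (rule A.N_left[OF r(1) A.N_right[OF o(4) t(3)]])
  then show ?thesis using kn rn by simp
qed

text \<open>\<open>V\<close> is the kernel of \<open>f * p - e * q\<close> on the direct sum of
  \<open>W\<close> and \<open>U\<close>, hence a module of the double. The section \<open>t\<close>
  of \<open>e\<close> over \<open>E\<close>, \<open>K\<close>, \<open>z\<close> yields an inverse of
  the projection to \<open>W\<close>, up to a map through the null kernel of
  \<open>e\<close>.\<close>

lemma pullback:
  assumes e: "epi U Y e" "weq U Y e" and f: "H UNIV W Y f" "W \<in> C"
  shows "\<exists>V a b. V \<in> C \<and> H UNIV V W a \<and> H UNIV V U b \<and> f * a = e * b \<and> weq V W a"
proof -
  have o: "U \<in> C" "Y \<in> C" "H UNIV U Y e" "H GA U Y e" using e by (auto simp: epi_def intro: UA)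
  obtain x where x: "H GK Y U x" "e * x = idn Y" using e(1) by (auto simp: epi_def)
  obtain t where t: "H GA Y U t" "e * t = idn Y" "nE U U (idn U - t * e)" using weq_section[OF e] by blast
  obtain S i j p q where S: "S \<in> C" "H UNIV W S i" "H UNIV U S j" "H UNIV S W p" "H UNIV S U q"
    "p * i = idn W" "q * j = idn U" "p * j = 0" "q * i = 0" "i * p + j * q = idn S"
    using direct_sum_ex[OF f(2) o(1)] by blast
  let ?\<phi> = "f * p - e * q"
  have \<phi>: "H UNIV S Y ?\<phi>" by (intro H_diff H_mult[OF f(1) S(4)] H_mult[OF o(3) S(5)])
  have "?\<phi> * - (j * x) = idn Y" using x by (simp add: left_diff_distrib mult.assoc assoc2[OF S(7)] assoc2[OF S(8)] bt_unl[OF H_bt[OF x(1)]])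
  moreover have "H GK Y S (- (j * x))" by (intro H_uminus H_mult[OF UK[OF S(3)] x(1)])
  ultimately have "epi S Y ?\<phi>" using S(1) o(2) \<phi> by (auto simp: epi_def)
  then obtain V k where k: "ses V S Y k ?\<phi>" using kernel_ex by blast
  have V: "V \<in> C" "H UNIV V S k" using k by (auto simp: ses_def)
  have pk: "H UNIV V W (p * k)" "H UNIV V U (q * k)" using H_mult S V by blast+
  have fe: "f * (p * k) = e * (q * k)" using ses_vu[OF k] by (simp add: left_diff_distrib mult.assoc)
  have Ai: "H GA W S i" "H GA U S j" "H GA W Y f" using S f by (auto intro: UA)
  \<comment> \<open>The graph of \<open>t * f\<close>; it lands in the pullback because
    \<open>e * t\<close> is the identity.\<close>
  let ?\<theta> = "i + j * (t * f)"
  have \<theta>: "H GA W S ?\<theta>" by (intro H_add Ai H_mult[OF Ai(2) H_mult[OF t(1) Ai(3)]])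
  have "?\<phi> * ?\<theta> = 0" using S f by (simp add: algebra_simps assoc2[OF S(7)] assoc2[OF S(8)] bt_unl'[OF H_bt[OF t(1)]] assoc2[OF t(2)] H_unl H_unr)
  then obtain a' where a': "H GA W V a'" "k * a' = ?\<theta>" using A.ker_factor[OF k \<theta>] by blast
  have aa: "p * k * a' = idn W" by (simp add: mult.assoc a'(2) distrib_left S(6) assoc2[OF S(8)])
  \<comment> \<open>The projection onto the kernel of \<open>e\<close>, which lies in
    \<open>nE\<close>. The difference between \<open>a' * (p * k)\<close> and the identity of
    \<open>V\<close> is going to factor through it.\<close>
  let ?\<pi> = "idn U - t * e"
  have \<pi>H: "H GA U U ?\<pi>" by (intro H_diff HA_idn o H_mult[OF t(1) o(4)])
  have e\<pi>: "e * ?\<pi> = 0" using o by (simp add: right_diff_distrib assoc2[OF t(2)] H_unl H_unr)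
  have \<pi>\<pi>: "?\<pi> * ?\<pi> = ?\<pi>" using H_unl[OF \<pi>H] e\<pi> by (simp add: left_diff_distrib[of "idn U" "t * e" "?\<pi>"] mult.assoc)
  have j\<pi>: "H GA U S (j * ?\<pi>)" by (rule H_mult[OF Ai(2) \<pi>H])
  have "?\<phi> * (j * ?\<pi>) = 0" using H_unl[OF \<pi>H] e\<pi>
    by (simp add: left_diff_distrib[of "f * p"] mult.assoc assoc2[OF S(7)] assoc2[OF S(8)])
  then obtain \<tau> where \<tau>: "H GA U V \<tau>" "k * \<tau> = j * ?\<pi>" using A.ker_factor[OF k j\<pi>] by blast
  have "k * (\<tau> * ?\<pi>) = k * \<tau>" by (simp add: mult.assoc[symmetric] \<tau>(2)) (simp add: mult.assoc \<pi>\<pi>)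
  then have "\<tau> * ?\<pi> = \<tau>" using A.mono_cancel[OF A.ses_mono[OF k]] H_mult[OF \<tau>(1) \<pi>H] \<tau>(1) by blast
  then have n\<tau>: "nE U V \<tau>" using A.N_left[OF \<tau>(1) t(3)] by simp
  have "k * (a' * (p * k) - idn V) = k * - (\<tau> * (q * k))"
  proof -
    have "(i * p + j * q) * k = k" using S(10) V(2) H_unl by metis
    then have ipk: "i * (p * k) = k - j * (q * k)" by (simp add: algebra_simps)
    have "k * (a' * (p * k) - idn V) = i * (p * k) + j * (t * (f * (p * k))) - k"
      using V(2) by (simp add: right_diff_distrib mult.assoc[symmetric] a'(2) H_unr) (simp add: distrib_right mult.assoc)
    also have "\<dots> = j * (t * (e * (q * k))) - j * (q * k)" unfolding ipk fe by simp
    also have "\<dots> = - (j * (?\<pi> * (q * k)))" using H_unl[OF pk(2)] by (simp add: left_diff_distrib right_diff_distrib mult.assoc)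
    also have "\<dots> = k * - (\<tau> * (q * k))" using \<tau>(2) by (simp add: mult.assoc[symmetric])
    finally show ?thesis .
  qed
  moreover have "H GA V V (a' * (p * k) - idn V)" by (intro H_diff HA_idn V H_mult[OF a'(1) UA[OF pk(1)]])
  moreover have "H GA V V (- (\<tau> * (q * k)))" by (intro H_uminus H_mult[OF \<tau>(1) UA[OF pk(2)]])
  ultimately have "a' * (p * k) - idn V = - (\<tau> * (q * k))" using A.mono_cancel[OF A.ses_mono[OF k]] by blast
  moreover have "nE V V (- (\<tau> * (q * k)))" by (intro A.N_uminus A.N_right[OF UA[OF pk(2)] n\<tau>])
  ultimately have "nE V V (a' * (p * k) - idn V)" by simp
  then have "weq V W (p * k)" unfolding weq_def using V f(2) pk aa a'(1) H_mult[OF a'(1) UA[OF pk(1)]]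
    by (auto simp: eqA_def UA HA_idn A.N_0 intro!: exI[of _ a'])
  then show ?thesis using V pk fe by blast
qed

lemma nD_through: "nD Q Q (idn Q) \<Longrightarrow> H UNIV X Q f \<Longrightarrow> H UNIV Q Y g \<Longrightarrow> nD X Y (g * f)"
  using D.N_left[OF _ D.N_idn_left] by blast

text \<open>Adding a projective module \<open>Q\<close> that maps onto \<open>Y\<close> leaves the
  source unchanged up to stable isomorphism and makes the map surjective, as \<open>pullback\<close>
  requires.\<close>

lemma weq_make_epi:
  assumes t: "H UNIV W Y t" "weq W Y t"
  shows "\<exists>U Q e i p \<epsilon> q. epi U Y e \<and> weq U Y e \<and> epi Q Y \<epsilon> \<and> nD Q Q (idn Q) \<and> H UNIV W U i \<and> H UNIV U W p \<and> H UNIV U Q q \<and>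
    p * i = idn W \<and> e * i = t \<and> e = t * p + \<epsilon> * q \<and> (\<exists>j. H UNIV Q U j \<and> e * j = \<epsilon> \<and> p * j = 0)"
proof -
  have o: "W \<in> C" "Y \<in> C" using t by (auto simp: weq_def)
  obtain Q \<epsilon> where Q: "epi Q Y \<epsilon>" "nD Q Q (idn Q)" using induced_module[OF o(2)] by blast
  obtain s where QC: "Q \<in> C" "H UNIV Q Y \<epsilon>" "H GK Y Q s" "\<epsilon> * s = idn Y" using Q by (auto simp: epi_def)
  obtain U i j p q where S: "U \<in> C" "H UNIV W U i" "H UNIV Q U j" "H UNIV U W p" "H UNIV U Q q"
    "p * i = idn W" "q * j = idn Q" "p * j = 0" "q * i = 0" "i * p + j * q = idn U"
    using direct_sum_ex[OF o(1) QC(1)] by blast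
  let ?e = "t * p + \<epsilon> * q"
  have e: "H UNIV U Y ?e" by (intro H_add H_mult[OF t(1) S(4)] H_mult[OF QC(2) S(5)])
  have ei: "?e * i = t" "?e * j = \<epsilon>" using t QC by (simp_all add: distrib_right mult.assoc S H_unr)
  have "?e * (j * s) = idn Y" using ei QC by (simp add: mult.assoc[symmetric])
  then have ep: "epi U Y ?e" unfolding epi_def using S(1) o(2) e H_mult[OF UK[OF S(3)] QC(3)] by blast
  have "nE U U (j * q)" using nD_nE[OF S(1) S(1) nD_through[OF Q(2) S(5,3)]] .
  then have wi: "weq W U i" by (rule weq_inclusion[OF o(1) S(1,2,4,6,10)])
  have "weq U Y ?e" by (rule weq_cancel_right[OF _ wi UA[OF e]]) (use ei t in simp)
  then show ?thesis using ep Q S ei by blast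
qed

text \<open>With \<open>t\<close> replaced by a surjection the square commutes strictly; dropping
  the added summand leaves an error that factors through the projective module
  \<open>Q\<close>.\<close>

lemma Ore_modules:
  assumes t: "H UNIV W' Y t" "weq W' Y t" and f: "H UNIV W Y f" "W \<in> C"
  shows "\<exists>V a b. V \<in> C \<and> H UNIV V W a \<and> H UNIV V W' b \<and> nD V Y (f * a - t * b) \<and> weq V W a"
proof -
  obtain U Q e i p \<epsilon> q where U: "epi U Y e" "weq U Y e" "epi Q Y \<epsilon>" "nD Q Q (idn Q)" "H UNIV U W' p" "H UNIV U Q q" "e = t * p + \<epsilon> * q"
    using weq_make_epi[OF t] by blast
  obtain V a b where V: "V \<in> C" "H UNIV V W a" "H UNIV V U b" "f * a = e * b" "weq V W a"
    using pullback[OF U(1,2) f] by blast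
  have "nD V Y (\<epsilon> * (q * b))" using U(3) nD_through[OF U(4) H_mult[OF U(6) V(3)]] by (simp add: epi_def)
  moreover have "f * a - t * (p * b) = \<epsilon> * (q * b)" using V(4) U(7) by (simp add: algebra_simps)
  ultimately show ?thesis using V H_mult[OF U(5) V(3)] by metis
qed

text \<open>The kernel of a surjective weak equivalence is null for \<open>nE\<close> but not
  necessarily for \<open>nD\<close>. A surjection onto it from a projective module of the double is
  a weak equivalence between null objects; pulling back along it turns a map through the kernel into
  one through a projective module.\<close>

lemma Canc_modules:
  assumes t: "H UNIV Y Z t" "weq Y Z t" and h: "H UNIV X Y h" "X \<in> C" "nD X Z (t * h)"
  shows "\<exists>V a. V \<in> C \<and> H UNIV V X a \<and> nD V Y (h * a) \<and> weq V X a"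
proof -
  obtain U Q e i p \<epsilon> j where U: "epi U Z e" "weq U Z e" "epi Q Z \<epsilon>" "nD Q Q (idn Q)" "H UNIV Y U i" "H UNIV U Y p"
    "p * i = idn Y" "e * i = t" "H UNIV Q U j" "e * j = \<epsilon>" "p * j = 0"
    using weq_make_epi[OF t] by blast
  have QC: "Q \<in> C" "U \<in> C" using U by (auto simp: epi_def)
  obtain k where k: "nD X Q k" "\<epsilon> * k = t * h" using D.N_lift[OF U(3) h(3)] by blast
  have Hk: "H UNIV X Q k" using D.N_H[OF h(2) QC(1) k(1)] .
  \<comment> \<open>As \<open>t * h\<close> vanishes only stably, \<open>j * k\<close> is subtracted
    so that \<open>e\<close> kills \<open>?\<theta>\<close> strictly and it factors through the
    kernel.\<close>
  let ?\<theta> = "i * h - j * k"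
  have \<theta>: "H UNIV X U ?\<theta>" by (intro H_diff H_mult[OF U(5) h(1)] H_mult[OF U(9) Hk])
  have "e * ?\<theta> = 0" using k by (simp add: right_diff_distrib assoc2[OF U(8)] assoc2[OF U(10)])
  moreover obtain N n where n: "ses N U Z n e" using kernel_ex[OF U(1)] by blast
  ultimately obtain \<theta>' where \<theta>': "H UNIV X N \<theta>'" "n * \<theta>' = ?\<theta>" using D.ker_factor[OF n \<theta>] by blast
  have N: "N \<in> C" "H UNIV N U n" "nE N N (idn N)" using n kernel_of_weq[OF n U(2)] by (auto simp: ses_def)
  obtain P g where P: "epi P N g" "nD P P (idn P)" using induced_module[OF N(1)] by blast
  have PC: "P \<in> C" "H UNIV P N g" using P by (auto simp: epi_def)
  have "weq P N g" by (rule weq_zero[OF PC(1) N(1) nD_nE[OF PC(1) PC(1) P(2)] N(3) UA[OF PC(2)]])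
  then obtain V a b where V: "V \<in> C" "H UNIV V X a" "H UNIV V P b" "\<theta>' * a = g * b" "weq V X a"
    using pullback[OF P(1) _ \<theta>'(1) h(2)] by blast
  have ph: "p * ?\<theta> = h" using h by (simp add: right_diff_distrib assoc2[OF U(7)] assoc2[OF U(11)] H_unl)
  have "h * a = p * (n * (\<theta>' * a))" using ph \<theta>'(2) by (metis mult.assoc)
  also have "\<dots> = p * (n * g) * b" by (simp add: V(4) mult.assoc)
  finally have "nD V Y (h * a)" using nD_through[OF P(2) V(3) H_mult[OF U(6) H_mult[OF N(2) PC(2)]]] by simp
  then show ?thesis using V by blast
qed

end

section \<open>The stable category and its quotient\<close>

context dbl begin

abbreviation "ST \<equiv> stab C"
abbreviation "TR \<equiv> stab_triangles C"

text \<open>The stable class of an operator. It lets the Hom sets of \<open>stab C\<close> be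
  indexed by operators, with equality of classes meaning that the difference lies in
  \<open>nD\<close>.\<close>

definition q :: "double_gen fdmod \<Rightarrow> double_gen fdmod \<Rightarrow> lop \<Rightarrow> complex mat set" where
  "q X Y f = stab_class C X Y (Mt (vdim Y) (vdim X) f)"

lemma q_L: "A \<in> carrier_mat (vdim Y) (vdim X) \<Longrightarrow> stab_class C X Y A = q X Y (L A)"
  by (simp add: q_def Mt_L)

lemma mem_q:
  assumes o: "X \<in> C" "Y \<in> C" and f: "H UNIV X Y f"
  shows "g \<in> q X Y f \<longleftrightarrow> g \<in> carrier_mat (vdim Y) (vdim X) \<and> H UNIV X Y (L g) \<and> nD X Y (L g - f)"
proof (cases "g \<in> carrier_mat (vdim Y) (vdim X)")
  case True
  let ?f = "Mt (vdim Y) (vdim X) f"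
  have "L (g - ?f) = L g - f" using L_diff[OF True Mt_carrier] L_Mt[OF H_bt[OF f]] by simp
  then show ?thesis using True minus_carrier_mat[OF Mt_carrier, of g "vdim Y" "vdim X" f]
    by (simp add: q_def stab_class_def fd_hom' o factors_proj_iff)
qed (simp add: q_def stab_class_def fd_hom' o)

lemma Mt_in_q:
  assumes "X \<in> C" "Y \<in> C" "H UNIV X Y f" shows "Mt (vdim Y) (vdim X) f \<in> q X Y f"
  using assms by (simp add: mem_q L_Mt H_bt D.N_0)

lemma q_eqI:
  assumes "X \<in> C" "Y \<in> C" "H UNIV X Y f" "H UNIV X Y g" "nD X Y (f - g)" shows "q X Y f = q X Y g"
proof -
  have "nD X Y (h - f) \<longleftrightarrow> nD X Y (h - g)" for h
    using D.N_add[OF _ assms(5), of "h - f"] D.N_diff[OF _ assms(5), of "h - g"] by auto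
  then show ?thesis using assms by (auto simp: mem_q)
qed

lemma q_eqD:
  assumes "X \<in> C" "Y \<in> C" "H UNIV X Y f" "H UNIV X Y g" "q X Y f = q X Y g" shows "nD X Y (f - g)"
proof -
  have "Mt (vdim Y) (vdim X) f \<in> q X Y g" using Mt_in_q assms by blast
  then show ?thesis using assms by (simp add: mem_q L_Mt H_bt)
qed

lemma Mor_ST:
  assumes "X \<in> C" "Y \<in> C" shows "Mor ST X Y = {q X Y f | f. H UNIV X Y f}"
proof -
  have "stab_class C X Y g \<in> {q X Y f | f. H UNIV X Y f}" if "fd_hom X Y g" for g
    using that q_L[of g Y X] assms by (auto simp: fd_hom')
  moreover have "q X Y f \<in> stab_class C X Y ` {g. fd_hom X Y g}" if "H UNIV X Y f" for f
    unfolding q_def using fd_hom_Mt[OF C_wf C_wf that] assms by blast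
  ultimately show ?thesis by (auto simp: stab_def)
qed

lemma ST_sel: "Ob ST = C" "Sh ST = stab_shift C" "ShM ST = stab_shift_mor C"
  "Id ST X = q X X (idn X)"
proof -
  show "Id ST X = q X X (idn X)" by (simp add: stab_def q_L[OF one_carrier_mat] L_one)
qed (simp_all add: stab_def)

lemma Comp_ST:
  assumes o: "X \<in> C" "Y \<in> C" "Z \<in> C" and f: "H UNIV X Y f" and g: "H UNIV Y Z g"
  shows "Comp ST X Y Z (q Y Z g) (q X Y f) = q X Z (g * f)"
proof -
  have gf: "H UNIV X Z (g * f)" by (rule H_mult[OF g f])
  have "stab_class C X Z (g' * f') = q X Z (g * f)" if g': "g' \<in> q Y Z g" and f': "f' \<in> q X Y f" for g' f'
  proof -
    have a: "g' \<in> carrier_mat (vdim Z) (vdim Y)" "H UNIV Y Z (L g')" "nD Y Z (L g' - g)"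
      "f' \<in> carrier_mat (vdim Y) (vdim X)" "H UNIV X Y (L f')" "nD X Y (L f' - f)"
      using g' f' o f g by (simp_all add: mem_q)
    have "nD X Z ((L g' - g) * L f' + g * (L f' - f))" using a g by (intro D.N_add D.N_left[OF g] D.N_right) auto
    then have "nD X Z (L g' * L f' - g * f)" by (simp add: algebra_simps)
    then have "q X Z (L g' * L f') = q X Z (g * f)" by (rule q_eqI[OF o(1,3) H_mult[OF a(2,5)] gf])
    then show ?thesis using q_L[OF mult_carrier_mat[OF a(1,4)]] by (simp add: L_mult[OF a(1,4)])
  qed
  moreover have "q Y Z g \<noteq> {}" "q X Y f \<noteq> {}" using Mt_in_q o f g by blast+
  ultimately show ?thesis by (auto simp: stab_def)
qed

text \<open>Every module embeds in an induced one, which is injective, so the choice made in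
  \<open>inj_embedding\<close> has the intended properties.\<close>

lemma emb_ex:
  assumes X: "X \<in> C"
  shows "\<exists>I S i p. inj_embedding C X = (I, S, i, p) \<and> stab_shift C X = S \<and> nD I I (idn I) \<and> ses X I S (L i) (L p) \<and>
    i \<in> carrier_mat (vdim I) (vdim X) \<and> p \<in> carrier_mat (vdim S) (vdim I)"
proof -
  obtain I i where I: "mono X I i" "nD I I (idn I)" using induced_module[OF X] by blast
  obtain S p where s: "ses X I S i p" using cokernel_ex[OF I(1)] by blast
  have IC: "I \<in> C" "H UNIV X I i" "H UNIV I S p" using s by (auto simp: ses_def)
  have "injective C I \<and> short_exact C X I S (Mt (vdim I) (vdim X) i) (Mt (vdim S) (vdim I) p)"
    using s I(2) IC by (simp add: injective_iff ses_iff L_Mt H_bt)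
  then have "\<exists>x. (case x of (I, S, i, p) \<Rightarrow> injective C I \<and> short_exact C X I S i p)" by auto
  from someI_ex[OF this] have a: "case inj_embedding C X of (I, S, i, p) \<Rightarrow> injective C I \<and> short_exact C X I S i p"
    unfolding inj_embedding_def .
  obtain I S i p where e: "inj_embedding C X = (I, S, i, p)" by (metis prod_cases4)
  then show ?thesis using a by (auto simp: injective_iff ses_iff stab_shift_def)
qed

text \<open>\<open>g\<close> is induced on the cokernels by some extension \<open>h\<close> of
  \<open>f\<close> to the chosen injective modules. This is a relation, because \<open>h\<close> is
  not unique and \<open>g\<close> is so only modulo \<open>nD\<close>.\<close>

definition shift_data :: "double_gen fdmod \<Rightarrow> double_gen fdmod \<Rightarrow> lop \<Rightarrow> lop \<Rightarrow> bool" where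
  "shift_data X Y f g \<longleftrightarrow> H UNIV X Y f \<and> H UNIV (stab_shift C X) (stab_shift C Y) g \<and>
    (\<exists>I S i p I' S' i' p' h. inj_embedding C X = (I, S, i, p) \<and> inj_embedding C Y = (I', S', i', p') \<and>
      H UNIV I I' h \<and> h * L i = L i' * f \<and> g * L p = L p' * h)"

lemma shift_data_ex:
  assumes o: "X \<in> C" "Y \<in> C" and f: "H UNIV X Y f" shows "\<exists>g. shift_data X Y f g"
proof -
  obtain I S i p where X: "inj_embedding C X = (I, S, i, p)" "stab_shift C X = S" "nD I I (idn I)" "ses X I S (L i) (L p)"
    using emb_ex[OF o(1)] by blast
  obtain I' S' i' p' where Y: "inj_embedding C Y = (I', S', i', p')" "stab_shift C Y = S'" "nD I' I' (idn I')" "ses Y I' S' (L i') (L p')"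
    using emb_ex[OF o(2)] by blast
  have h': "H UNIV Y I' (L i')" "H UNIV I' S' (L p')" "I \<in> C" "I' \<in> C" using X Y by (auto simp: ses_def)
  have "nD X I' (L i' * f)" by (rule D.N_idn_left[OF Y(3) H_mult[OF h'(1) f]])
  then obtain h where h: "nD I I' h" "h * L i = L i' * f" using D.N_ext[OF D.ses_mono[OF X(4)]] by blast
  have Hh: "H UNIV I I' h" by (rule D.N_H[OF h'(3,4) h(1)])
  have "L p' * h * L i = 0" using ses_vu[OF Y(4)] by (simp add: mult.assoc h(2) assoc2)
  then obtain g where "H UNIV S S' g" "g * L p = L p' * h" using D.quot_factor[OF X(4) H_mult[OF h'(2) Hh]] by blast
  then show ?thesis unfolding shift_data_def X(2) Y(2) using f X(1) Y(1) Hh h(2) by blast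
qed

text \<open>Different extensions give maps of the cokernels that differ by a null map, by
  \<open>shift_nul\<close>; conversely every map in the class of \<open>g\<close> arises from a
  changed extension.\<close>

lemma ShM_q:
  assumes o: "X \<in> C" "Y \<in> C" and sd: "shift_data X Y f g"
  shows "ShM ST X Y (q X Y f) = q (stab_shift C X) (stab_shift C Y) g"
proof -
  obtain I S i p where X: "inj_embedding C X = (I, S, i, p)" "stab_shift C X = S" "nD I I (idn I)" "ses X I S (L i) (L p)"
    "i \<in> carrier_mat (vdim I) (vdim X)" "p \<in> carrier_mat (vdim S) (vdim I)"
    using emb_ex[OF o(1)] by blast
  obtain I' S' i' p' where Y: "inj_embedding C Y = (I', S', i', p')" "stab_shift C Y = S'" "nD I' I' (idn I')" "ses Y I' S' (L i') (L p')"
    "i' \<in> carrier_mat (vdim I') (vdim Y)" "p' \<in> carrier_mat (vdim S') (vdim I')"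
    using emb_ex[OF o(2)] by blast
  obtain h where f: "H UNIV X Y f" and g: "H UNIV S S' g" and h: "H UNIV I I' h" "h * L i = L i' * f" "g * L p = L p' * h"
    using sd unfolding shift_data_def X(1,2) Y(1,2) by blast
  have c: "I \<in> C" "S \<in> C" "I' \<in> C" "S' \<in> C" "H UNIV I S (L p)" "H UNIV Y I' (L i')" "H UNIV I' S' (L p')" using X Y by (auto simp: ses_def)
  have "ShM ST X Y (q X Y f) = {g. fd_hom S S' g \<and> (\<exists>f\<in>q X Y f. \<exists>h. fd_hom I I' h \<and> h * i = i' * f \<and> g * p = p' * h)}"
    by (simp add: ST_sel stab_shift_mor_def X Y)
  also have "\<dots> = q S S' g"
  proof (rule Set.set_eqI, rule iffI)
    fix g1 assume "g1 \<in> {g. fd_hom S S' g \<and> (\<exists>f\<in>q X Y f. \<exists>h. fd_hom I I' h \<and> h * i = i' * f \<and> g * p = p' * h)}"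
    then obtain f1 h1 where a: "fd_hom S S' g1" "f1 \<in> q X Y f" "fd_hom I I' h1" "h1 * i = i' * f1" "g1 * p = p' * h1" by blast
    have g1: "g1 \<in> carrier_mat (vdim S') (vdim S)" "H UNIV S S' (L g1)" and h1: "h1 \<in> carrier_mat (vdim I') (vdim I)" "H UNIV I I' (L h1)"
      and f1: "f1 \<in> carrier_mat (vdim Y) (vdim X)" "H UNIV X Y (L f1)" "nD X Y (L f1 - f)"
      using a c o f by (auto simp: fd_hom' mem_q)
    have e1: "L h1 * L i = L i' * L f1" using arg_cong[OF a(4), of L] by (simp add: L_mult[OF h1(1) X(5)] L_mult[OF Y(5) f1(1)])
    have e2: "L g1 * L p = L p' * L h1" using arg_cong[OF a(5), of L] by (simp add: L_mult[OF g1(1) X(6)] L_mult[OF Y(6) h1(1)])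
    have "nD S S' (L g1 - g)"
      by (rule D.shift_nul[OF X(4) Y(4,3) f1(3) H_diff[OF h1(2) h(1)] _ H_diff[OF g1(2) g]])
        (simp_all add: e1 e2 h left_diff_distrib right_diff_distrib)
    then show "g1 \<in> q S S' g" using g1 c g by (simp add: mem_q)
  next
    fix g1 assume "g1 \<in> q S S' g"
    then have g1: "g1 \<in> carrier_mat (vdim S') (vdim S)" "H UNIV S S' (L g1)" "nD S S' (L g1 - g)" using c g by (auto simp: mem_q)
    \<comment> \<open>The null difference lifts along \<open>L p'\<close> to \<open>m\<close>.
      Adding \<open>m * L p\<close> to \<open>h\<close> realizes \<open>g1\<close> and does not
      change the restriction to \<open>X\<close>.\<close>
    obtain m where m: "nD S I' m" "L p' * m = L g1 - g" using D.N_lift[OF D.ses_epi[OF Y(4)] g1(3)] by blast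
    have Hm: "H UNIV S I' m" by (rule D.N_H[OF c(2,3) m(1)])
    let ?h = "h + m * L p"
    have Hh: "H UNIV I I' ?h" by (intro H_add h H_mult[OF Hm c(5)])
    have "?h * L i = L i' * f" using ses_vu[OF X(4)] h by (simp add: distrib_right mult.assoc)
    moreover have "L g1 * L p = L p' * ?h" using h(3) by (simp add: distrib_left mult.assoc[symmetric] m(2) left_diff_distrib)
    moreover have "L (Mt (vdim I') (vdim I) ?h) = ?h" "L (Mt (vdim Y) (vdim X) f) = f" using L_Mt H_bt Hh f by blast+
    ultimately have "L (Mt (vdim I') (vdim I) ?h * i) = L (i' * Mt (vdim Y) (vdim X) f)" "L (g1 * p) = L (p' * Mt (vdim I') (vdim I) ?h)"
      using L_mult[OF Mt_carrier X(5)] L_mult[OF Y(5) Mt_carrier] L_mult[OF g1(1) X(6)] L_mult[OF Y(6) Mt_carrier] by simp_all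
    then have "Mt (vdim I') (vdim I) ?h * i = i' * Mt (vdim Y) (vdim X) f" "g1 * p = p' * Mt (vdim I') (vdim I) ?h"
      using L_inj[OF mult_carrier_mat[OF Mt_carrier X(5)] mult_carrier_mat[OF Y(5) Mt_carrier]]
        L_inj[OF mult_carrier_mat[OF g1(1) X(6)] mult_carrier_mat[OF Y(6) Mt_carrier]] by blast+
    moreover have "fd_hom I I' (Mt (vdim I') (vdim I) ?h)" "fd_hom S S' g1" using fd_hom_Mt[OF C_wf C_wf Hh] c g1 by (auto simp: fd_hom')
    ultimately show "g1 \<in> {g. fd_hom S S' g \<and> (\<exists>f\<in>q X Y f. \<exists>h. fd_hom I I' h \<and> h * i = i' * f \<and> g * p = p' * h)}"
      using Mt_in_q[OF o f] by blast
  qed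
  finally show ?thesis by (simp add: X Y)
qed

lemma shift_C: "X \<in> C \<Longrightarrow> stab_shift C X \<in> C" using emb_ex[of X] by (auto simp: ses_def)

lemma shift_data_id: assumes X: "X \<in> C" shows "shift_data X X (idn X) (idn (stab_shift C X))"
proof -
  obtain I S i p where e: "inj_embedding C X = (I, S, i, p)" "stab_shift C X = S" "ses X I S (L i) (L p)"
    using emb_ex[OF X] by blast
  have c: "I \<in> C" "S \<in> C" "H UNIV X I (L i)" "H UNIV I S (L p)" using e by (auto simp: ses_def)
  show ?thesis unfolding shift_data_def e(2)
    using e(1) c X by (auto intro!: exI[of _ "idn I"] HA_idn simp: H_unl[OF c(3)] H_unr[OF c(3)] H_unl[OF c(4)] H_unr[OF c(4)])
qed

lemma shift_data_comp:
  assumes "shift_data X Y f g" "shift_data Y Z f' g'" shows "shift_data X Z (f' * f) (g' * g)"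
proof -
  obtain I S i p I' S' i' p' h where a: "H UNIV X Y f" "H UNIV (stab_shift C X) (stab_shift C Y) g"
     "inj_embedding C X = (I, S, i, p)" "inj_embedding C Y = (I', S', i', p')" "H UNIV I I' h" "h * L i = L i' * f" "g * L p = L p' * h"
    using assms(1) unfolding shift_data_def by blast
  obtain I2 S2 i2 p2 h' where b: "H UNIV Y Z f'" "H UNIV (stab_shift C Y) (stab_shift C Z) g'"
     "inj_embedding C Z = (I2, S2, i2, p2)" "H UNIV I' I2 h'" "h' * L i' = L i2 * f'" "g' * L p' = L p2 * h'"
    using assms(2) unfolding shift_data_def a(4) by auto
  have "h' * h * L i = L i2 * (f' * f)" "g' * g * L p = L p2 * (h' * h)"
    using a(6,7) b(5,6) by (metis mult.assoc)+
  then show ?thesis unfolding shift_data_def using a(1-3) b(1-3) H_mult[OF b(1) a(1)] H_mult[OF b(2) a(2)] H_mult[OF b(4) a(5)] by blast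
qed

text \<open>The inverse \<open>t\<close> of \<open>f\<close> need not be a map of the double, so
  \<open>shift_data\<close> does not provide its shift. It is extended to the injective modules by
  maps over \<open>E\<close>, \<open>K\<close>, \<open>z\<close>, and \<open>shift_nul\<close> for
  \<open>nE\<close> compares the composites with identities.\<close>

lemma shift_weq:
  assumes sd: "shift_data X Y f g" and w: "weq X Y f" shows "weq (stab_shift C X) (stab_shift C Y) g"
proof -
  have o: "X \<in> C" "Y \<in> C" using w by (auto simp: weq_def)
  obtain I S i p where X: "inj_embedding C X = (I, S, i, p)" "stab_shift C X = S" "nD I I (idn I)" "ses X I S (L i) (L p)"
    using emb_ex[OF o(1)] by blast
  obtain I' S' i' p' where Y: "inj_embedding C Y = (I', S', i', p')" "stab_shift C Y = S'" "nD I' I' (idn I')" "ses Y I' S' (L i') (L p')"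
    using emb_ex[OF o(2)] by blast
  obtain h where f: "H UNIV X Y f" and g: "H UNIV S S' g" and h: "H UNIV I I' h" "h * L i = L i' * f" "g * L p = L p' * h"
    using sd unfolding shift_data_def X(1,2) Y(1,2) by blast
  have c: "I \<in> C" "S \<in> C" "I' \<in> C" "S' \<in> C" "H GA X I (L i)" "H GA I S (L p)" using X Y by (auto simp: ses_def UA)
  have nI: "nE I I (idn I)" "nE I' I' (idn I')" using nD_nE X(3) Y(3) c by blast+
  obtain t where t: "H GA Y X t" "eqA X X (t * f) (idn X)" "eqA Y Y (f * t) (idn Y)" using w by (auto simp: weq_def)
  have "nE Y I (L i * t)" by (rule A.N_idn_left[OF nI(1) H_mult[OF c(5) t(1)]])
  then obtain h' where h': "nE I' I h'" "h' * L i' = L i * t" using A.N_ext[OF A.ses_mono[OF Y(4)]] by blast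
  have Hh': "H GA I' I h'" by (rule A.N_H[OF c(3,1) h'(1)])
  have "L p * h' * L i' = 0" using ses_vu[OF X(4)] by (simp add: mult.assoc h'(2) assoc2)
  then obtain g' where g': "H GA S' S g'" "g' * L p' = L p * h'" using A.quot_factor[OF Y(4) H_mult[OF c(6) Hh']] by blast
  have e1: "eqA S S (g' * g) (idn S)"
  proof -
    have "nE S S (g' * g - idn S)"
    proof (rule A.shift_nul[OF X(4) X(4) nI(1)])
      show "nE X X (t * f - idn X)" using t by (simp add: eqA_def)
      show "H GA I I (h' * h - idn I)" using c by (intro H_diff H_mult[OF Hh' UA[OF h(1)]] HA_idn)
      show "H GA S S (g' * g - idn S)" using c by (intro H_diff H_mult[OF g'(1) UA[OF g]] HA_idn)
      show "(h' * h - idn I) * L i = L i * (t * f - idn X)"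
        by (simp add: left_diff_distrib right_diff_distrib mult.assoc h(2) assoc2[OF h'(2)] H_unl[OF c(5)] H_unr[OF c(5)])
      show "(g' * g - idn S) * L p = L p * (h' * h - idn I)"
        by (simp add: left_diff_distrib right_diff_distrib mult.assoc h(3) assoc2[OF g'(2)] H_unl[OF c(6)] H_unr[OF c(6)])
    qed
    then show ?thesis using c H_mult[OF g'(1) UA[OF g]] by (simp add: eqA_def HA_idn)
  qed
  have ci: "H GA Y I' (L i')" "H GA I' S' (L p')" using Y by (auto simp: ses_def UA)
  have e2: "eqA S' S' (g * g') (idn S')"
  proof -
    have "nE S' S' (g * g' - idn S')"
    proof (rule A.shift_nul[OF Y(4) Y(4) nI(2)])
      show "nE Y Y (f * t - idn Y)" using t by (simp add: eqA_def)
      show "H GA I' I' (h * h' - idn I')" using c by (intro H_diff H_mult[OF UA[OF h(1)] Hh'] HA_idn)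
      show "H GA S' S' (g * g' - idn S')" using c by (intro H_diff H_mult[OF UA[OF g] g'(1)] HA_idn)
      show "(h * h' - idn I') * L i' = L i' * (f * t - idn Y)"
        by (simp add: left_diff_distrib right_diff_distrib mult.assoc h'(2) assoc2[OF h(2)] H_unl[OF ci(1)] H_unr[OF ci(1)])
      show "(g * g' - idn S') * L p' = L p' * (h * h' - idn I')"
        by (simp add: left_diff_distrib right_diff_distrib mult.assoc g'(2) assoc2[OF h(3)] H_unl[OF ci(2)] H_unr[OF ci(2)])
    qed
    then show ?thesis using c H_mult[OF UA[OF g] g'(1)] by (simp add: eqA_def HA_idn)
  qed
  show ?thesis unfolding X(2) Y(2) weq_def using c UA[OF g] g'(1) e1 e2 by blast
qed

lemma iso_STD:
  assumes o: "X \<in> C" "Y \<in> C" and i: "is_iso ST X Y F"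
  shows "\<exists>f. F = q X Y f \<and> H UNIV X Y f \<and> weq X Y f"
proof -
  obtain f g where f: "F = q X Y f" "H UNIV X Y f" and g: "H UNIV Y X g"
    and e: "Comp ST X Y X (q Y X g) (q X Y f) = Id ST X" "Comp ST Y X Y (q X Y f) (q Y X g) = Id ST Y"
    using i o unfolding is_iso_def by (auto simp: Mor_ST)
  have "q X X (g * f) = q X X (idn X)" "q Y Y (f * g) = q Y Y (idn Y)"
    using e f g o by (simp_all add: Comp_ST ST_sel)
  then have "nD X X (g * f - idn X)" "nD Y Y (f * g - idn Y)"
    using q_eqD[OF o(1,1) H_mult[OF g f(2)] HA_idn[OF o(1)]] q_eqD[OF o(2,2) H_mult[OF f(2) g] HA_idn[OF o(2)]] by auto
  then have "eqA X X (g * f) (idn X)" "eqA Y Y (f * g) (idn Y)"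
    using o H_mult[OF g f(2)] H_mult[OF f(2) g] by (auto intro!: eqA_nD HA_idn)
  then show ?thesis using f g o unfolding weq_def by (blast intro: UA)
qed

lemma iso_STI:
  assumes "X \<in> C" "Y \<in> C" "H UNIV X Y f" "H UNIV Y X g" "nD X X (g * f - idn X)" "nD Y Y (f * g - idn Y)"
  shows "is_iso ST X Y (q X Y f)"
proof -
  have "q X X (g * f) = q X X (idn X)" by (rule q_eqI[OF assms(1,1) H_mult[OF assms(4,3)] HA_idn[OF assms(1)] assms(5)])
  moreover have "q Y Y (f * g) = q Y Y (idn Y)" by (rule q_eqI[OF assms(2,2) H_mult[OF assms(3,4)] HA_idn[OF assms(2)] assms(6)])
  ultimately show ?thesis unfolding is_iso_def using assms
    by (auto simp: Mor_ST ST_sel Comp_ST intro!: exI[of _ "q Y X g"] bexI[of _ "q Y X g"])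
qed

lemma iso_ST_id: "X \<in> C \<Longrightarrow> is_iso ST X X (q X X (idn X))"
  by (rule iso_STI[of _ _ _ "idn X"]) (simp_all add: HA_idn un_un D.N_0)

lemma standard_ex:
  assumes s: "ses X Y Z u v"
  shows "\<exists>w. H UNIV Z (stab_shift C X) w \<and> (X, Y, Z, q X Y u, q Y Z v, q Z (stab_shift C X) w) \<in> standard_triangles C"
proof -
  have o: "X \<in> C" "Y \<in> C" "Z \<in> C" "H UNIV X Y u" "H UNIV Y Z v" using s by (auto simp: ses_def)
  obtain I S i p where X: "inj_embedding C X = (I, S, i, p)" "stab_shift C X = S" "nD I I (idn I)" "ses X I S (L i) (L p)"
    "i \<in> carrier_mat (vdim I) (vdim X)" "p \<in> carrier_mat (vdim S) (vdim I)"
    using emb_ex[OF o(1)] by blast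
  have c: "I \<in> C" "S \<in> C" "H UNIV X I (L i)" "H UNIV I S (L p)" using X by (auto simp: ses_def)
  obtain h where h: "nD Y I h" "h * u = L i" using D.N_ext[OF D.ses_mono[OF s] D.N_idn_left[OF X(3) c(3)]] by blast
  have Hh: "H UNIV Y I h" by (rule D.N_H[OF o(2) c(1) h(1)])
  have "- (L p * h) * u = 0" using ses_vu[OF X(4)] h by (simp add: mult.assoc)
  then obtain w where w: "H UNIV Z S w" "w * v = - (L p * h)"
    using D.quot_factor[OF s H_uminus[OF H_mult[OF c(4) Hh]]] by blast
  let ?u = "Mt (vdim Y) (vdim X) u" and ?v = "Mt (vdim Z) (vdim Y) v" and ?w = "Mt (vdim S) (vdim Z) w" and ?h = "Mt (vdim I) (vdim Y) h"
  have Ls: "L ?u = u" "L ?v = v" "L ?w = w" "L ?h = h" using L_Mt H_bt o w Hh by blast+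
  have "short_exact C X Y Z ?u ?v" using s by (simp add: ses_iff Ls)
  moreover have "fd_hom Y I ?h" "fd_hom Z S ?w" using Hh w o c by (auto intro!: fd_hom_Mt C_wf)
  moreover have "?h * ?u = i" using h by (simp add: L_mult_eq_iff[OF Mt_carrier Mt_carrier X(5)] Ls)
  moreover have ph: "p * ?h \<in> carrier_mat (vdim S) (vdim Y)" by (rule mult_carrier_mat[OF X(6) Mt_carrier])
  moreover have "?w * ?v = - (p * ?h)"
    using w(2) by (simp add: L_mult_eq_iff[OF Mt_carrier Mt_carrier uminus_carrier_mat[OF ph]] Ls L_uminus[OF ph] L_mult[OF X(6) Mt_carrier])
  ultimately have "(X, Y, Z, stab_class C X Y ?u, stab_class C Y Z ?v, stab_class C Z S ?w) \<in> standard_triangles C"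
    unfolding standard_triangles_def using X(1) by blast
  then show ?thesis using w(1) by (auto simp: q_def X(2))
qed

lemma standardD:
  assumes "(X, Y, Z, U, V, W) \<in> standard_triangles C"
  shows "\<exists>u v. ses X Y Z u v \<and> U = q X Y u \<and> H UNIV X Y u"
proof -
  obtain u v where s: "short_exact C X Y Z u v" "U = stab_class C X Y u" using assms by (auto simp: standard_triangles_def)
  then have "ses X Y Z (L u) (L v)" "u \<in> carrier_mat (vdim Y) (vdim X)" by (auto simp: ses_iff)
  then show ?thesis using s(2) by (auto simp: q_L ses_def)
qed

lemma TR_I:
  assumes s: "ses X S Z u v" and Y: "Y \<in> C" and i: "H UNIV Y S i" "H UNIV S Y p" "nD Y Y (p * i - idn Y)" "nD S S (i * p - idn S)"
    and f: "H UNIV X Y f" "nD X S (i * f - u)"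
  shows "\<exists>w. H UNIV Z (stab_shift C X) w \<and> (X, Y, Z, q X Y f, q Y Z (v * i), q Z (stab_shift C X) w) \<in> TR \<and>
    is_triangle ST (X, Y, Z, q X Y f, q Y Z (v * i), q Z (stab_shift C X) w)"
proof -
  have o: "X \<in> C" "S \<in> C" "Z \<in> C" "H UNIV X S u" "H UNIV S Z v" "stab_shift C X \<in> C" using s by (auto simp: ses_def shift_C)
  obtain w where w: "H UNIV Z (stab_shift C X) w" "(X, S, Z, q X S u, q S Z v, q Z (stab_shift C X) w) \<in> standard_triangles C"
    using standard_ex[OF s] by blast
  have vi: "H UNIV Y Z (v * i)" by (rule H_mult[OF o(5) i(1)])
  have t: "is_triangle ST (X, Y, Z, q X Y f, q Y Z (v * i), q Z (stab_shift C X) w)"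
    using o Y f(1) vi w(1) by (auto simp: is_triangle_def ST_sel Mor_ST)
  have e: "q X S (i * f) = q X S u" by (rule q_eqI[OF o(1,2) H_mult[OF i(1) f(1)] o(4) f(2)])
  have "triangle_iso ST (X, Y, Z, q X Y f, q Y Z (v * i), q Z (stab_shift C X) w) (X, S, Z, q X S u, q S Z v, q Z (stab_shift C X) w)"
    unfolding triangle_iso_def prod.case
    using o Y i f w(1) vi e
    by (intro exI[of _ "q X X (idn X)"] exI[of _ "q Y S i"] exI[of _ "q Z Z (idn Z)"])
      (simp add: iso_ST_id iso_STI ST_sel(2) Comp_ST HA_idn ShM_q[OF _ _ shift_data_id] H_unl[OF vi] H_unr[OF o(4)] H_unl[OF w(1)] H_unr[OF w(1)])
  then show ?thesis using w t unfolding stab_triangles_def by blast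
qed

lemma TR_ses:
  assumes s: "ses X Y Z u v"
  shows "\<exists>w. H UNIV Z (stab_shift C X) w \<and> (X, Y, Z, q X Y u, q Y Z v, q Z (stab_shift C X) w) \<in> TR \<and>
    is_triangle ST (X, Y, Z, q X Y u, q Y Z v, q Z (stab_shift C X) w)"
proof -
  have o: "X \<in> C" "Y \<in> C" "H UNIV X Y u" "H UNIV Y Z v" using s by (auto simp: ses_def)
  have "v * idn Y = v" by (rule H_unr[OF o(4)])
  then show ?thesis using TR_I[OF s o(2) HA_idn[OF o(2)] HA_idn[OF o(2)] _ _ o(3)] o by (simp add: un_un D.N_0 H_unl[OF o(3)])
qed

text \<open>In one direction the cone is compared with the cokernel of a standard triangle by stable
  isomorphisms, which are weak equivalences; in the other a mapping cylinder realizes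
  \<open>f\<close> as the start of a short exact sequence.\<close>

lemma cone_iff:
  assumes f: "X \<in> C" "Y \<in> C" "H UNIV X Y f"
  shows "cone_in TR (proj_B d \<zeta>) X Y (q X Y f) \<longleftrightarrow> weq X Y f"
proof
  assume "cone_in TR (proj_B d \<zeta>) X Y (q X Y f)"
  then obtain Z v w where t: "(X, Y, Z, q X Y f, v, w) \<in> TR" "nE Z Z (idn Z)" "Z \<in> C" unfolding cone_in_def proj_B_iff by blast
  obtain X' Y' Z' u' v' w' where st: "(X', Y', Z', u', v', w') \<in> standard_triangles C"
    and ti: "triangle_iso ST (X, Y, Z, q X Y f, v, w) (X', Y', Z', u', v', w')"
    using t(1) unfolding stab_triangles_def by (auto split: prod.splits)
  obtain u1 v1 where s: "ses X' Y' Z' u1 v1" "u' = q X' Y' u1" "H UNIV X' Y' u1" using standardD[OF st] by blast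
  have o: "X' \<in> C" "Y' \<in> C" "Z' \<in> C" using s by (auto simp: ses_def)
  obtain a b c where abc: "is_iso ST X X' a" "is_iso ST Y Y' b" "is_iso ST Z Z' c" "Comp ST X Y Y' b (q X Y f) = Comp ST X X' Y' u' a"
    using ti unfolding triangle_iso_def by auto
  obtain a1 where a: "a = q X X' a1" "H UNIV X X' a1" "weq X X' a1" using iso_STD[OF f(1) o(1) abc(1)] by blast
  obtain b1 where b: "b = q Y Y' b1" "H UNIV Y Y' b1" "weq Y Y' b1" using iso_STD[OF f(2) o(2) abc(2)] by blast
  obtain c1 where c: "weq Z Z' c1" using iso_STD[OF t(3) o(3) abc(3)] by blast
  have "weq X' Y' u1" by (rule weq_of_cokernel[OF s(1) weq_obj[OF c t(2)]])
  then have w1: "weq X Y' (u1 * a1)" using weq_comp a(3) by blast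
  have "q X Y' (b1 * f) = q X Y' (u1 * a1)" using abc(4) a b f o s by (simp add: Comp_ST)
  then have "nD X Y' (u1 * a1 - b1 * f)" by (intro q_eqD[OF f(1) o(2) H_mult[OF s(3) a(2)] H_mult[OF b(2) f(3)]]) simp
  then have "eqA X Y' (u1 * a1) (b1 * f)" by (intro eqA_nD[OF f(1) o(2) H_mult[OF s(3) a(2)] H_mult[OF b(2) f(3)]])
  then show "weq X Y f" using weq_cancel_left[OF weq_cong[OF w1] b(3) UA[OF f(3)]] by blast
next
  assume w: "weq X Y f"
  obtain Q \<iota> where Q: "mono X Q \<iota>" "nD Q Q (idn Q)" using induced_module[OF f(1)] by blast
  obtain r where QC: "Q \<in> C" "H UNIV X Q \<iota>" "H GK Q X r" "r * \<iota> = idn X" using Q by (auto simp: mono_def)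
  obtain S i j p x where S: "S \<in> C" "H UNIV Y S i" "H UNIV Q S j" "H UNIV S Y p" "H UNIV S Q x"
    "p * i = idn Y" "x * j = idn Q" "p * j = 0" "x * i = 0" "i * p + j * x = idn S"
    using direct_sum_ex[OF f(2) QC(1)] by blast
  \<comment> \<open>Adding an embedding of \<open>X\<close> into a projective module
    \<open>Q\<close> makes \<open>f\<close> injective without changing its stable class; the
    cokernel is then the cone.\<close>
  let ?u = "i * f + j * \<iota>"
  have u: "H UNIV X S ?u" by (intro H_add H_mult[OF S(2) f(3)] H_mult[OF S(3) QC(2)])
  have "r * x * ?u = idn X" using QC by (simp add: distrib_left mult.assoc assoc2[OF S(9)] assoc2[OF S(7)] H_unl)
  then have "mono X S ?u" unfolding mono_def using f(1) S(1) u H_mult[OF QC(3) UK[OF S(5)]] by blast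
  then obtain Z v where s: "ses X S Z ?u v" using cokernel_ex by blast
  have jx: "nD S S (j * x)" by (rule nD_through[OF Q(2) S(5,3)])
  have ji: "nD X S (j * \<iota>)" by (rule nD_through[OF Q(2) QC(2) S(3)])
  have wi: "weq Y S i" by (rule weq_inclusion[OF f(2) S(1,2,4,6,10) nD_nE[OF S(1) S(1) jx]])
  have "nD X S (i * f - ?u)" using D.N_uminus[OF ji] by simp
  then have n: "nD X S (i * f - ?u)" "eqA X S (i * f) ?u" using eqA_nD[OF f(1) S(1) H_mult[OF S(2) f(3)] u] by auto
  have "weq X S ?u" by (rule weq_cong[OF weq_comp[OF w wi] n(2)])
  then have Z: "Z \<in> proj_B d \<zeta>" using cokernel_of_weq[OF s] s by (auto simp: proj_B_iff ses_def)
  have "i * p - idn S = - (j * x)" using S(10) by (simp add: algebra_simps)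
  then have "nD S S (i * p - idn S)" using D.N_uminus[OF jx] by simp
  moreover have "nD Y Y (p * i - idn Y)" by (simp add: S(6) D.N_0)
  ultimately show "cone_in TR (proj_B d \<zeta>) X Y (q X Y f)"
    unfolding cone_in_def using TR_I[OF s f(2) S(2,4) _ _ f(3) n(1)] Z by blast
qed

text \<open>By \<open>cone_iff\<close> the class consists of the weak equivalences, so that each
  axiom is one of the statements on modules read modulo \<open>nD\<close>.\<close>

lemma stab_fractions: "fractions ST TR (proj_B d \<zeta>)"
proof (unfold_locales, unfold ST_sel, goal_cases)
  case (1 X) then show ?case by (auto simp: Mor_ST HA_idn)
next
  case (2 X Y Z f g) then show ?case by (auto simp: Mor_ST Comp_ST intro: H_mult)
next
  case (3 W X Y Z f g h)
  then obtain f1 g1 h1 where "f = q W X f1" "H UNIV W X f1" "g = q X Y g1" "H UNIV X Y g1" "h = q Y Z h1" "H UNIV Y Z h1"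
    by (auto simp: Mor_ST)
  then show ?case using 3 H_mult[of UNIV X Y g1 W f1] H_mult[of UNIV Y Z h1 X g1] by (simp add: Comp_ST mult.assoc)
next
  case (4 X Y f) then show ?case by (auto simp: Mor_ST Comp_ST HA_idn H_unl)
next
  case (5 X Y f) then show ?case by (auto simp: Mor_ST Comp_ST HA_idn H_unr)
next
  case (6 X) then show ?case by (simp add: cone_iff HA_idn weq_idn)
next
  case (7 X Y Z f g)
  then obtain f1 g1 where "f = q X Y f1" "H UNIV X Y f1" "g = q Y Z g1" "H UNIV Y Z g1" by (auto simp: Mor_ST)
  then show ?case using 7 H_mult[of UNIV Y Z g1 X f1] by (auto simp: Comp_ST cone_iff intro: weq_comp)
next
  case (8 X Y Z f g)
  then obtain f1 g1 where "f = q X Y f1" "H UNIV X Y f1" "g = q Y Z g1" "H UNIV Y Z g1" by (auto simp: Mor_ST)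
  then show ?case using 8 H_mult[of UNIV Y Z g1 X f1] by (auto simp: Comp_ST cone_iff intro: weq_cancel_left UA)
next
  case (9 W W' Y f t)
  then obtain f1 t1 where ft: "f = q W Y f1" "H UNIV W Y f1" "t = q W' Y t1" "H UNIV W' Y t1" "weq W' Y t1" by (auto simp: Mor_ST cone_iff)
  obtain V a b where V: "V \<in> C" "H UNIV V W a" "H UNIV V W' b" "nD V Y (f1 * a - t1 * b)" "weq V W a"
    using Ore_modules[OF ft(4,5,2) 9(1)] by blast
  have "q V Y (f1 * a) = q V Y (t1 * b)" by (rule q_eqI[OF V(1) 9(3) H_mult[OF ft(2) V(2)] H_mult[OF ft(4) V(3)] V(4)])
  then have "Comp ST V W Y f (q V W a) = Comp ST V W' Y t (q V W' b)"
    using V ft 9(1-3) by (simp add: Comp_ST)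
  moreover have "cone_in TR (proj_B d \<zeta>) V W (q V W a)" using V 9(1) by (simp add: cone_iff)
  moreover have "q V W a \<in> Mor ST V W" "q V W' b \<in> Mor ST V W'" unfolding Mor_ST[OF V(1) 9(1)] Mor_ST[OF V(1) 9(2)] using V by blast+
  ultimately show ?case using V(1) by blast
next
  case (10 X Y Z f g t)
  then obtain f1 g1 t1 where ft: "f = q X Y f1" "H UNIV X Y f1" "g = q X Y g1" "H UNIV X Y g1" "t = q Y Z t1" "H UNIV Y Z t1" "weq Y Z t1"
    by (auto simp: Mor_ST cone_iff)
  have "q X Z (t1 * f1) = q X Z (t1 * g1)" using 10 ft by (simp add: Comp_ST)
  then have "nD X Z (t1 * f1 - t1 * g1)" by (rule q_eqD[OF 10(1,3) H_mult[OF ft(6,2)] H_mult[OF ft(6,4)]])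
  then have "nD X Z (t1 * (f1 - g1))" by (simp add: right_diff_distrib)
  then obtain V a where V: "V \<in> C" "H UNIV V X a" "nD V Y ((f1 - g1) * a)" "weq V X a"
    using Canc_modules[OF ft(6,7) H_diff[OF ft(2,4)] 10(1)] by blast
  have "q V Y (f1 * a) = q V Y (g1 * a)"
    by (rule q_eqI[OF V(1) 10(2) H_mult[OF ft(2) V(2)] H_mult[OF ft(4) V(2)]]) (use V(3) in \<open>simp add: left_diff_distrib\<close>)
  then have "Comp ST V X Y f (q V X a) = Comp ST V X Y g (q V X a)"
    using V ft 10(1-3) by (simp add: Comp_ST)
  moreover have "cone_in TR (proj_B d \<zeta>) V X (q V X a)" using V 10(1) by (simp add: cone_iff)
  moreover have "q V X a \<in> Mor ST V X" unfolding Mor_ST[OF V(1) 10(1)] using V by blast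
  ultimately show ?case using V(1) by blast
next
  case (11 X) then show ?case by (rule shift_C)
next
  case (12 X Y f)
  then obtain f1 where f: "f = q X Y f1" "H UNIV X Y f1" by (auto simp: Mor_ST)
  obtain g where "shift_data X Y f1 g" using shift_data_ex[OF 12(1,2) f(2)] by blast
  then show ?case using ShM_q[OF 12(1,2)] f 12 by (auto simp: Mor_ST shift_C ST_sel shift_data_def)
next
  case (13 X) then show ?case using ShM_q[OF _ _ shift_data_id] by (simp add: ST_sel)
next
  case (14 X Y Z f g)
  then obtain f1 g1 where f: "f = q X Y f1" "H UNIV X Y f1" "g = q Y Z g1" "H UNIV Y Z g1" by (auto simp: Mor_ST)
  obtain f2 g2 where s: "shift_data X Y f1 f2" "shift_data Y Z g1 g2" using shift_data_ex[OF 14(1,2) f(2)] shift_data_ex[OF 14(2,3) f(4)] by blast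
  have "H UNIV (stab_shift C X) (stab_shift C Y) f2" "H UNIV (stab_shift C Y) (stab_shift C Z) g2" using s by (auto simp: shift_data_def)
  then show ?case using f 14 ShM_q[OF 14(1,2) s(1)] ShM_q[OF 14(2,3) s(2)] ShM_q[OF 14(1,3) shift_data_comp[OF s]]
    by (simp add: Comp_ST shift_C ST_sel)
next
  case (15 X Y f)
  then obtain f1 where f: "f = q X Y f1" "H UNIV X Y f1" "weq X Y f1" by (auto simp: Mor_ST cone_iff)
  obtain g where g: "shift_data X Y f1 g" using shift_data_ex[OF 15(1,2) f(2)] by blast
  have "H UNIV (stab_shift C X) (stab_shift C Y) g" using g by (auto simp: shift_data_def)
  then show ?case using ShM_q[OF 15(1,2) g] f 15 shift_weq[OF g f(3)] by (simp add: cone_iff shift_C ST_sel)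
qed

end

section \<open>Consequences for the Grothendieck group\<close>

context dbl begin

text \<open>The factor \<open>idn X\<close> keeps the product an operator of the size of
  \<open>X\<close> when \<open>l = p = 0\<close>, where the powers are the unit of the whole
  ring.\<close>

definition ch :: "nat \<Rightarrow> nat \<Rightarrow> double_gen fdmod \<Rightarrow> complex" where
  "ch l p X = tr (vdim X) (idn X * (ac X DK ^ l * ac X DZ ^ p))"

lemma ch_trace: assumes X: "X \<in> C" shows "mat_trace (act X DK ^\<^sub>m l * act X DZ ^\<^sub>m p) = ch l p X"
proof -
  have c: "act X g \<in> carrier_mat (vdim X) (vdim X)" for g using C_wf[OF X] by (auto simp: fdwf_def)
  have pc: "act X g ^\<^sub>m m \<in> carrier_mat (vdim X) (vdim X)" for g m using c by simp
  have "L (act X DK ^\<^sub>m l * act X DZ ^\<^sub>m p) = idn X * ac X DK ^ l * (idn X * ac X DZ ^ p)"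
    using L_mult[OF pc pc] by (simp add: L_pow[OF c] ac_def)
  also have "\<dots> = idn X * (ac X DK ^ l * ac X DZ ^ p)"
  proof -
    have "ac X DK ^ l * idn X = idn X * ac X DK ^ l"
      using ac_idn[OF X] by (metis power_commuting_commutes)
    then show ?thesis by (simp add: mult.assoc[symmetric]) (simp add: mult.assoc un_un[of "vdim X" "vdim X", simplified] assoc2[OF un_un])
  qed
  finally show ?thesis unfolding ch_def using tr_L[OF mult_carrier_mat[OF pc pc]] by metis
qed

lemma H_KZ:
  assumes "H GK X Y f" shows "f * (ac X DK ^ l * ac X DZ ^ p) = ac Y DK ^ l * ac Y DZ ^ p * f"
proof -
  have a: "f * ac X DK ^ l = ac Y DK ^ l * f" "f * ac X DZ ^ p = ac Y DZ ^ p * f" using H_pow[OF assms] by auto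
  show ?thesis by (simp only: assoc2[OF a(1)] a(2) mult.assoc)
qed

lemma bt_KZ: "H GK X X T \<Longrightarrow> X \<in> C \<Longrightarrow> bt (vdim X) (vdim X) (ac X DK ^ l * ac X DZ ^ p * T)"
  by (auto simp: mult.assoc intro!: bt_powl bt_ac C_wf intro: H_bt[of GK])

lemma idn_KZ: "X \<in> C \<Longrightarrow> idn X * (ac X DK ^ l * ac X DZ ^ p) = ac X DK ^ l * ac X DZ ^ p * idn X"
  by (rule H_KZ[OF HA_idn])

text \<open>Inserting \<open>u * r + t * v = idn Y\<close> splits the trace into two, and cyclicity
  moves the parts to \<open>X\<close> and \<open>Z\<close>. A splitting over \<open>K\<close> and
  \<open>z\<close> is enough for \<open>K^l z^p\<close> to pass through it.\<close>

lemma ch_ses: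
  assumes s: "ses X Y Z u v" shows "ch l p Y = ch l p X + ch l p Z"
proof -
  obtain r t where a: "X \<in> C" "Y \<in> C" "Z \<in> C" "H GK X Y u" "H GK Y Z v" "H GK Y X r" "H GK Z Y t"
    "r * u = idn X" "v * t = idn Z" "u * r + t * v = idn Y"
    using s UK by (auto simp: ses_def)
  let ?k = "\<lambda>X. ac X DK ^ l * ac X DZ ^ p"
  have k: "tr (vdim Y) (?k Y * (u * r)) = tr (vdim X) (?k X * idn X)"
    if "H GK X Y u" "H GK Y X r" "r * u = idn X" "X \<in> C" "Y \<in> C" for X u r
  proof -
    have "?k Y * (u * r) = u * (?k X * r)" using H_KZ[OF that(1)] by (simp add: mult.assoc[symmetric])
    then have "tr (vdim Y) (?k Y * (u * r)) = tr (vdim X) (?k X * r * u)"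
      using tr_comm[OF H_bt[OF that(1)], of "?k X * r"] bt_mult[OF bt_KZ[OF HA_idn[OF that(4)] that(4)] H_bt[OF that(2)]] H_unl[OF that(2)]
      by (simp add: mult.assoc)
    then show ?thesis by (simp add: mult.assoc that(3))
  qed
  have "ch l p Y = tr (vdim Y) (?k Y * (u * r + t * v))" unfolding ch_def idn_KZ[OF a(2)] a(10) ..
  also have "\<dots> = tr (vdim X) (?k X * idn X) + tr (vdim Z) (?k Z * idn Z)"
    using k[OF a(4,6,8,1,2)] k[OF a(7,5,9,3,2)] by (simp add: distrib_left tr_add)
  finally show ?thesis unfolding ch_def idn_KZ[OF a(1)] idn_KZ[OF a(3)] .
qed

lemma zeta_pow_eq_1_iff: "\<zeta> ^ m = 1 \<longleftrightarrow> d dvd m"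
proof
  assume a: "\<zeta> ^ m = 1"
  have "\<zeta> ^ m = (\<zeta> ^ d) ^ (m div d) * \<zeta> ^ (m mod d)" by (simp add: power_mult[symmetric] power_add[symmetric])
  then have "\<zeta> ^ (m mod d) = 1" using a zd by simp
  then have "m mod d = 0" using prim d0 by (metis gr0I mod_less_divisor)
  then show "d dvd m" by auto
next
  assume "d dvd m" then show "\<zeta> ^ m = 1" using zd by (auto simp: power_mult)
qed

lemma sum_zeta: "(\<Sum>i<d. \<zeta> ^ (m * i)) = (if d dvd m then of_nat d else 0)"
proof (cases "d dvd m")
  case True
  then have "\<zeta> ^ (m * i) = 1" for i by (simp add: zeta_pow_eq_1_iff)
  then show ?thesis using True by simp
next
  case False
  then have "\<zeta> ^ m \<noteq> 1" by (simp add: zeta_pow_eq_1_iff)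
  moreover have "(\<zeta> ^ m) ^ d = 1" using zeta_pow_eq_1_iff[of "m * d"] by (simp add: power_mult)
  ultimately show ?thesis using False geometric_sum[of "\<zeta> ^ m" d] by (simp add: power_mult)
qed

text \<open>The trace of \<open>K\<^sup>l z\<^sup>p\<close> against \<open>TrE T\<close> is a multiple of \<open>\<Sum>i<d. \<zeta>\<^sup>l\<^sup>i\<close>, which vanishes.\<close>

lemma trace_nE:
  assumes X: "X \<in> C" and n: "nE X X f" and l: "0 < l" "l < d"
  shows "tr (vdim X) (ac X DK ^ l * ac X DZ ^ p * f) = 0"
proof -
  obtain T where T: "bt (vdim X) (vdim X) T" "f = TrE X X T" using n by (auto simp: nE_def gw_def)
  let ?E = "ac X DE" and ?k = "ac X DK ^ l * ac X DZ ^ p"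
  have kE: "?k * ?E = cs (\<zeta> ^ l) * (?E * ?k)"
  proof -
    have "ac X DZ ^ p * ?E = ?E * ac X DZ ^ p" using C_rel(3)[OF X] by (metis power_commuting_commutes)
    then show ?thesis using cs_pow_comm[OF C_rel(5)[OF X], of l] by (simp add: mult.assoc) (simp add: mult.assoc[symmetric])
  qed
  have bE: "bt (vdim X) (vdim X) ?E" using bt_ac[OF C_wf[OF X]] .
  have bk: "bt (vdim X) (vdim X) (?k * T)"
    using T(1) by (auto simp: mult.assoc intro!: bt_powl bt_ac C_wf X)
  \<comment> \<open>Cyclicity of the trace collects all powers of \<open>E\<close> behind
    \<open>T\<close>; what depends on \<open>i\<close> is then only the factor from moving
    \<open>K^l z^p\<close> past \<open>E ^ i\<close>.\<close>
  have term_eq: "tr (vdim X) (?k * (?E ^ i * (T * ?E ^ (d - 1 - i)))) = (\<zeta> ^ l) ^ i * tr (vdim X) (?k * T * ?E ^ (d - 1))"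
    if i: "i < d" for i
  proof -
    have e: "?k * (?E ^ i * (T * ?E ^ (d - 1 - i))) = cs ((\<zeta> ^ l) ^ i) * (?E ^ i * (?k * T * ?E ^ (d - 1 - i)))"
      using cs_comm_pow[OF kE, of i] by (simp only: mult.assoc[symmetric])
    have "tr (vdim X) (?E ^ i * (?k * T * ?E ^ (d - 1 - i))) = tr (vdim X) (?k * T * ?E ^ (d - 1))"
    proof (cases "i = 0")
      case False
      have "bt (vdim X) (vdim X) (?E ^ i)" using bE False by auto
      moreover have "bt (vdim X) (vdim X) (?k * T * ?E ^ (d - 1 - i))" by (rule bt_powr[OF bE bk])
      ultimately have "tr (vdim X) (?E ^ i * (?k * T * ?E ^ (d - 1 - i))) = tr (vdim X) (?k * T * ?E ^ (d - 1 - i) * ?E ^ i)"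
        by (rule tr_comm)
      moreover have "?E ^ (d - 1 - i) * ?E ^ i = ?E ^ (d - 1)" using i by (simp add: power_add[symmetric])
      ultimately show ?thesis by (simp only: mult.assoc)
    qed simp
    then show ?thesis unfolding e tr_cs by simp
  qed
  have "tr (vdim X) (?k * f) = (\<Sum>i<d. tr (vdim X) (?k * (?E ^ i * (T * ?E ^ (d - 1 - i)))))"
    by (simp add: T(2) TrE_def trp_def sum_distrib_left tr_sum)
  also have "\<dots> = (\<Sum>i<d. (\<zeta> ^ l) ^ i * tr (vdim X) (?k * T * ?E ^ (d - 1)))"
    using term_eq by (intro sum.cong refl) auto
  also have "\<dots> = (\<Sum>i<d. \<zeta> ^ (l * i)) * tr (vdim X) (?k * T * ?E ^ (d - 1))"
    by (simp add: sum_distrib_right power_mult)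
  also have "\<dots> = 0" using l nat_dvd_not_less[of l d] by (simp add: sum_zeta)
  finally show ?thesis .
qed

text \<open>By cyclicity \<open>g * f\<close> and \<open>f * g\<close> have the same trace against
  \<open>K^l z^p\<close>, and each differs from an identity by a map in \<open>nE\<close>, on which
  this trace vanishes.\<close>

lemma ch_weq:
  assumes w: "weq X Y f" and l: "0 < l" "l < d" shows "ch l p X = ch l p Y"
proof -
  obtain g where a: "X \<in> C" "Y \<in> C" "H GA X Y f" "H GA Y X g" "nE X X (g * f - idn X)" "nE Y Y (f * g - idn Y)"
    using w by (auto simp: weq_def eqA_def)
  let ?k = "\<lambda>X. ac X DK ^ l * ac X DZ ^ p"
  have "tr (vdim X) (?k X * (g * f - idn X)) = 0" "tr (vdim Y) (?k Y * (f * g - idn Y)) = 0"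
    using trace_nE a l by blast+
  then have "tr (vdim X) (?k X * (g * f)) = ch l p X" "tr (vdim Y) (?k Y * (f * g)) = ch l p Y"
    unfolding ch_def idn_KZ[OF a(1)] idn_KZ[OF a(2)] by (simp_all add: right_diff_distrib tr_diff)
  moreover have "tr (vdim X) (?k X * (g * f)) = tr (vdim Y) (?k Y * (f * g))"
  proof -
    have gb: "bt (vdim X) (vdim Y) (?k X * g)"
      using bt_mult[OF bt_KZ[OF HA_idn[OF a(1)] a(1)] H_bt[OF a(4)]] H_unl[OF a(4)] by (simp add: mult.assoc)
    have "tr (vdim X) (?k X * (g * f)) = tr (vdim Y) (f * (?k X * g))"
      using tr_comm[OF gb H_bt[OF a(3)]] by (simp add: mult.assoc)
    also have "f * (?k X * g) = ?k Y * (f * g)" using H_KZ[OF AK[OF a(3)]] by (simp add: mult.assoc[symmetric])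
    finally show ?thesis .
  qed
  ultimately show ?thesis by simp
qed

lemma stB_ses:
  assumes s: "ses X Y Z u v" shows "\<exists>u' v' w'. (X, Y, Z, u', v', w') \<in> stab_B_triangles d \<zeta>"
proof -
  interpret fr: fractions ST TR "proj_B d \<zeta>" by (rule stab_fractions)
  show ?thesis unfolding stab_B_triangles_def Let_def using TR_ses[OF s] fr.vt_of_triangle by blast
qed

definition zero_mod :: "double_gen fdmod" where "zero_mod = mk 0 0 0 0 0"

lemma zero_mod: "zero_mod \<in> C" "vdim zero_mod = 0"
proof -
  have "isD 0 0 0 0 0" using d0 by (simp add: isD_def power_0_left)
  from mk[OF this] show "zero_mod \<in> C" "vdim zero_mod = 0" by (simp_all add: zero_mod_def)
qed

text \<open>A module projective over \<open>B\<close> is isomorphic to zero in the quotient and may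
  be put in the third place of the triangle of zero modules. This yields the relation
  \<open>[M] = 0\<close>.\<close>

lemma stB_zero:
  assumes M: "M \<in> proj_B d \<zeta>" shows "\<exists>u' v' w'. (zero_mod, zero_mod, M, u', v', w') \<in> stab_B_triangles d \<zeta>"
proof -
  interpret fr: fractions ST TR "proj_B d \<zeta>" by (rule stab_fractions)
  let ?P = zero_mod
  have MC: "M \<in> C" "nE M M (idn M)" using M by (auto simp: proj_B_iff)
  have un: "idn ?P = 0" by (simp add: zero_mod(2))
  have s: "ses ?P ?P ?P 0 0" unfolding ses_def un using zero_mod(1) H_0 by auto
  obtain w where w: "(?P, ?P, ?P, q ?P ?P 0, q ?P ?P 0, q ?P (stab_shift C ?P) w) \<in> TR"
    "is_triangle ST (?P, ?P, ?P, q ?P ?P 0, q ?P ?P 0, q ?P (stab_shift C ?P) w)"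
    using TR_ses[OF s] by blast
  have z: "f = 0" if "H UNIV ?P ?P f" for f using H_unl[OF that] un by simp
  have "weq ?P M 0" using zero_mod(1) MC A.N_0 un by (intro weq_zero H_0) auto
  then have "cone_in TR (proj_B d \<zeta>) ?P M (q ?P M 0)" using zero_mod(1) MC(1) by (simp add: cone_iff H_0)
  moreover have "q M ?P 0 \<in> Mor ST M ?P" "q ?P M 0 \<in> Mor ST ?P M"
    unfolding Mor_ST[OF MC(1) zero_mod(1)] Mor_ST[OF zero_mod(1) MC(1)] using H_0 by blast+
  moreover have "f = g" if "f \<in> Mor ST ?P ?P" "g \<in> Mor ST ?P ?P" for f g
    using that z unfolding Mor_ST[OF zero_mod(1) zero_mod(1)] by auto
  ultimately show ?thesis unfolding stab_B_triangles_def Let_def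
    using fr.vt_zero[OF w, of M "q M ?P 0" "q ?P M 0"] MC(1) by (simp add: ST_sel)
qed

text \<open>Denominators are invertible modulo \<open>nE\<close>, so that a roof becomes the map
  \<open>f1 * s'\<close> over \<open>E\<close>, \<open>K\<close>, \<open>z\<close>. Equalities of
  roofs hold after composition with weak equivalences, and these can be cancelled modulo
  \<open>nE\<close>.\<close>

lemma weq_of_VQ_iso:
  assumes o: "X \<in> C" "Y \<in> C" and i: "is_iso (verdier_quotient ST TR (proj_B d \<zeta>)) X Y F"
  shows "\<exists>f. weq X Y f"
proof -
  interpret fr: fractions ST TR "proj_B d \<zeta>" by (rule stab_fractions)
  have we: "V \<in> C \<and> W \<in> C \<and> (\<exists>f1. f = q V W f1 \<and> H UNIV V W f1 \<and> weq V W f1)" if "fr.We (V, W, f)" for V W f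
    using that unfolding fr.We_def fr.we_def fr.ar_def by (auto simp: ST_sel Mor_ST cone_iff) blast
  have ar: "V \<in> C \<and> W \<in> C \<and> (\<exists>f1. f = q V W f1 \<and> H UNIV V W f1)" if "fr.Ar (V, W, f)" for V W f
    using that unfolding fr.Ar_def fr.ar_def by (auto simp: ST_sel Mor_ST)
  \<comment> \<open>Stated for arbitrary data because it is used twice, with the roles of the two
    roofs exchanged.\<close>
  have key: "eqA X X (g * t' * (f * s')) (idn X)"
    if c: "V \<in> C" "W \<in> C" "W' \<in> C" "X \<in> C" "Y \<in> C" "U \<in> C"
      and s: "H UNIV W X s" "weq W X s" "H GA X W s'" "eqA W W (s' * s) (idn W)" and f: "H UNIV W Y f"
      and t: "H UNIV W' Y t" "H GA Y W' t'" "eqA W' W' (t' * t) (idn W')" and g: "H UNIV W' X g"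
      and a: "H UNIV V W a" "weq V W a" and b: "H UNIV V W' b" and x: "H UNIV U V x" "weq U V x"
      and e1: "q V Y (f * a) = q V Y (t * b)" and e2: "q U X (s * a * x) = q U X (g * b * x)"
    for V W W' X Y U s s' f t t' g a b x
  proof -
    let ?y = "s * a * x" and ?p = "g * t' * (f * s')"
    have fa: "eqA V Y (f * a) (t * b)"
      using q_eqD[OF c(1,5) H_mult[OF f a(1)] H_mult[OF t(1) b] e1] by (intro eqA_nD c H_mult[OF f a(1)] H_mult[OF t(1) b])
    have sg: "eqA U X ?y (g * b * x)"
      using q_eqD[OF c(6,4) H_mult[OF H_mult[OF s(1) a(1)] x(1)] H_mult[OF H_mult[OF g b] x(1)] e2]
      by (intro eqA_nD c H_mult[OF H_mult[OF s(1) a(1)] x(1)] H_mult[OF H_mult[OF g b] x(1)])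
    have y: "weq U X ?y" using weq_comp[OF x(2) weq_comp[OF a(2) s(2)]] .
    then obtain y' where y': "H GA X U y'" "eqA X X (?y * y') (idn X)" by (auto simp: weq_def)
    have P: "H GA X X ?p" by (intro H_mult[OF H_mult[OF UA[OF g] t(2)]] H_mult[OF UA[OF f] s(3)])
    have 1: "eqA U X (?p * ?y) (g * t' * f * idn W * (a * x))"
    proof -
      have "eqA U X (g * t' * f * (s' * s) * (a * x)) (g * t' * f * idn W * (a * x))"
        by (rule eqA_right[OF H_mult[OF UA[OF a(1)] UA[OF x(1)]] c(6) eqA_left[OF H_mult[OF H_mult[OF UA[OF g] t(2)] UA[OF f]] c(4) s(4)]])
      then show ?thesis by (simp add: mult.assoc)
    qed
    have 2: "eqA U X (g * t' * f * idn W * (a * x)) (g * t' * (t * b) * x)"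
    proof -
      have "eqA U X (g * t' * (f * a) * x) (g * t' * (t * b) * x)"
        by (rule eqA_right[OF UA[OF x(1)] c(6) eqA_left[OF H_mult[OF UA[OF g] t(2)] c(4) fa]])
      then show ?thesis using H_unl[OF a(1)] H_unr[OF f] by (simp add: mult.assoc assoc2[OF H_unr[OF f]])
    qed
    have 3: "eqA U X (g * t' * (t * b) * x) (g * b * x)"
    proof -
      have "eqA U X (g * (t' * t) * (b * x)) (g * idn W' * (b * x))"
        by (rule eqA_right[OF H_mult[OF UA[OF b] UA[OF x(1)]] c(6) eqA_left[OF UA[OF g] c(4) t(3)]])
      then show ?thesis using H_unr[OF g] by (simp add: mult.assoc assoc2[OF H_unr[OF g]])
    qed
    have "eqA U X (?p * ?y) ?y" using eqA_trans[OF eqA_trans[OF eqA_trans[OF 1 2] 3] eqA_sym[OF sg]] .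
    then have "eqA X X (?p * ?y * y') (?y * y')" by (rule eqA_right[OF y'(1) c(4)])
    then have 4: "eqA X X (?p * (?y * y')) (?y * y')" by (simp only: mult.assoc)
    have "eqA X X (?p * (?y * y')) (?p * idn X)" by (rule eqA_left[OF P c(4) y'(2)])
    then have "eqA X X (?p * (?y * y')) ?p" using H_unr[OF P] by simp
    then show ?thesis using eqA_trans[OF eqA_sym] eqA_trans[OF 4 y'(2)] by blast
  qed
  obtain W s f W' t g where r: "fr.roof (W, X, s) (W, Y, f)" "fr.roof (W', Y, t) (W', X, g)"
    and d1: "\<exists>V a b U x. fr.We (V, W, a) \<and> fr.Ar (V, W', b) \<and> fr.We (U, V, x) \<and> Comp ST V W Y f a = Comp ST V W' Y t b \<and>
      Comp ST U V X (Comp ST V W X s a) x = Comp ST U V X (Comp ST V W' X g b) x"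
    and d2: "\<exists>V a b U x. fr.We (V, W', a) \<and> fr.Ar (V, W, b) \<and> fr.We (U, V, x) \<and> Comp ST V W' X g a = Comp ST V W X s b \<and>
      Comp ST U V Y (Comp ST V W' Y t a) x = Comp ST U V Y (Comp ST V W Y f b) x"
    using fr.iso_VQ_data[OF _ _ i] o unfolding ST_sel by blast
  have r': "fr.We (W, X, s)" "fr.Ar (W, Y, f)" "fr.We (W', Y, t)" "fr.Ar (W', X, g)" using r by (auto simp: fr.roof_def)
  obtain s1 where s: "s = q W X s1" "H UNIV W X s1" "weq W X s1" and W: "W \<in> C" using we[OF r'(1)] by blast
  obtain t1 where t: "t = q W' Y t1" "H UNIV W' Y t1" "weq W' Y t1" and W': "W' \<in> C" using we[OF r'(3)] by blast
  obtain f1 where f: "f = q W Y f1" "H UNIV W Y f1" using ar[OF r'(2)] by blast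
  obtain g1 where g: "g = q W' X g1" "H UNIV W' X g1" using ar[OF r'(4)] by blast
  obtain s' where s': "H GA X W s'" "eqA W W (s' * s1) (idn W)" using s(3) by (auto simp: weq_def)
  obtain t' where t': "H GA Y W' t'" "eqA W' W' (t' * t1) (idn W')" using t(3) by (auto simp: weq_def)
  have 1: "eqA X X (g1 * t' * (f1 * s')) (idn X)"
  proof -
    obtain V a b U x where v: "fr.We (V, W, a)" "fr.Ar (V, W', b)" "fr.We (U, V, x)" and e: "Comp ST V W Y f a = Comp ST V W' Y t b"
      "Comp ST U V X (Comp ST V W X s a) x = Comp ST U V X (Comp ST V W' X g b) x" using d1 by blast
    obtain a1 b1 x1 where c: "V \<in> C" "U \<in> C" "a = q V W a1" "H UNIV V W a1" "weq V W a1" "b = q V W' b1" "H UNIV V W' b1"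
      "x = q U V x1" "H UNIV U V x1" "weq U V x1" using we[OF v(1)] ar[OF v(2)] we[OF v(3)] by blast
    have "q V Y (f1 * a1) = q V Y (t1 * b1)" "q U X (s1 * a1 * x1) = q U X (g1 * b1 * x1)"
      using e c W W' o s f t g H_mult[OF s(2) c(4)] H_mult[OF g(2) c(7)] by (simp_all add: Comp_ST)
    then show ?thesis by (rule key[OF c(1) W W' o c(2) s(2,3) s' f(2) t(2) t' g(2) c(4,5,7,9,10)])
  qed
  have 2: "eqA Y Y (f1 * s' * (g1 * t')) (idn Y)"
  proof -
    obtain V a b U x where v: "fr.We (V, W', a)" "fr.Ar (V, W, b)" "fr.We (U, V, x)" and e: "Comp ST V W' X g a = Comp ST V W X s b"
      "Comp ST U V Y (Comp ST V W' Y t a) x = Comp ST U V Y (Comp ST V W Y f b) x" using d2 by blast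
    obtain a1 b1 x1 where c: "V \<in> C" "U \<in> C" "a = q V W' a1" "H UNIV V W' a1" "weq V W' a1" "b = q V W b1" "H UNIV V W b1"
      "x = q U V x1" "H UNIV U V x1" "weq U V x1" using we[OF v(1)] ar[OF v(2)] we[OF v(3)] by blast
    have "q V X (g1 * a1) = q V X (s1 * b1)" "q U Y (t1 * a1 * x1) = q U Y (f1 * b1 * x1)"
      using e c W W' o s f t g H_mult[OF t(2) c(4)] H_mult[OF f(2) c(7)] by (simp_all add: Comp_ST)
    then show ?thesis by (rule key[OF c(1) W' W o(2,1) c(2) t(2,3) t' g(2) s(2) s' f(2) c(4,5,7,9,10)])
  qed
  show ?thesis unfolding weq_def
    using o 1 2 H_mult[OF UA[OF f(2)] s'(1)] H_mult[OF UA[OF g(2)] t'(1)] by blast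
qed

lemma stB_ch:
  assumes t: "(X, Y, Z, u, v, w) \<in> stab_B_triangles d \<zeta>" and l: "0 < l" "l < d"
  shows "X \<in> C" "Y \<in> C" "Z \<in> C" "ch l p Y = ch l p X + ch l p Z"
proof -
  interpret fr: fractions ST TR "proj_B d \<zeta>" by (rule stab_fractions)
  obtain X' Y' Z' u' v' w' where t': "(X', Y', Z', u', v', w') \<in> TR"
    and o: "X \<in> C" "Y \<in> C" "Z \<in> C" and
    ti: "triangle_iso (verdier_quotient ST TR (proj_B d \<zeta>)) (X, Y, Z, u, v, w) (X', Y', Z', verdier_map ST TR (proj_B d \<zeta>) X' Y' u',
      verdier_map ST TR (proj_B d \<zeta>) Y' Z' v', verdier_map ST TR (proj_B d \<zeta>) Z' (Sh ST X') w')"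
    using t unfolding stab_B_triangles_def Let_def verdier_triangles_def
    by (auto simp: is_triangle_def fr.VQ_sel ST_sel)
  show "X \<in> C" "Y \<in> C" "Z \<in> C" using o .
  obtain X2 Y2 Z2 u2 v2 w2 where st: "(X2, Y2, Z2, u2, v2, w2) \<in> standard_triangles C"
    and ti': "triangle_iso ST (X', Y', Z', u', v', w') (X2, Y2, Z2, u2, v2, w2)" and o': "X' \<in> C" "Y' \<in> C" "Z' \<in> C"
    using t' unfolding stab_triangles_def by (auto split: prod.splits simp: is_triangle_def ST_sel)
  obtain a b where s: "ses X2 Y2 Z2 a b" using standardD[OF st] by blast
  have o2: "X2 \<in> C" "Y2 \<in> C" "Z2 \<in> C" using s by (auto simp: ses_def)
  have 1: "ch l p X = ch l p X'" "ch l p Y = ch l p Y'" "ch l p Z = ch l p Z'"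
    using ti o o' weq_of_VQ_iso ch_weq[OF _ l] unfolding triangle_iso_def prod.case by metis+
  have 2: "ch l p X' = ch l p X2" "ch l p Y' = ch l p Y2" "ch l p Z' = ch l p Z2"
    using ti' o' o2 iso_STD ch_weq[OF _ l] unfolding triangle_iso_def prod.case by metis+
  show "ch l p Y = ch l p X + ch l p Z" using 1 2 ch_ses[OF s] by simp
qed

end

section \<open>Tensor products\<close>

text \<open>The homogeneous components of \<open>(a + t b)\<^sup>n\<close>.\<close>

fun hom_part :: "lop \<Rightarrow> lop \<Rightarrow> nat \<Rightarrow> nat \<Rightarrow> lop" where
  "hom_part a b 0 m = (if m = 0 then 1 else 0)"
| "hom_part a b (Suc n) 0 = hom_part a b n 0 * a"
| "hom_part a b (Suc n) (Suc m) = hom_part a b n (Suc m) * a + hom_part a b n m * b"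

lemma hom_part_big: "m > n \<Longrightarrow> hom_part a b n m = 0"
proof (induction n arbitrary: m)
  case (Suc n) then show ?case by (cases m) auto
qed simp

lemma hom_part_ends: "hom_part a b n 0 = a ^ n" "hom_part a b n n = b ^ n"
  by (induction n) (auto simp: hom_part_big power_Suc2 simp del: power_Suc)

lemma hom_part_sum: "(a + cs t * b) ^ n = (\<Sum>m\<le>n. cs (t ^ m) * hom_part a b n m)"
proof (induction n)
  case (Suc n)
  have "(a + cs t * b) ^ Suc n = (\<Sum>m\<le>n. cs (t ^ m) * hom_part a b n m) * (a + cs t * b)"
    by (simp only: power_Suc2 Suc.IH)
  also have "\<dots> = (\<Sum>m\<le>n. cs (t ^ m) * (hom_part a b n m * a)) + (\<Sum>m\<le>n. cs (t ^ Suc m) * (hom_part a b n m * b))"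
    by (simp add: distrib_left sum_distrib_right mult.assoc cs_left[of "hom_part a b n m" for m] cs_cs mult.commute)
  also have "(\<Sum>m\<le>n. cs (t ^ m) * (hom_part a b n m * a)) = (\<Sum>m\<le>Suc n. cs (t ^ m) * (hom_part a b n m * a))"
    by (simp add: hom_part_big)
  also have "\<dots> + (\<Sum>m\<le>n. cs (t ^ Suc m) * (hom_part a b n m * b)) = (\<Sum>m\<le>Suc n. cs (t ^ m) * hom_part a b (Suc n) m)"
    by (simp add: sum.atMost_Suc_shift[of _ n] distrib_left sum.distrib del: sum.atMost_Suc)
  finally show ?case .
qed simp

context dbl begin

text \<open>The \<open>q\<close>-binomial theorem at a root of unity. Writing \<open>c\<^sub>j = a + \<zeta>\<^sup>j b\<close>, the commutation rule gives
  \<open>c\<^sub>j\<^sup>n a = a c\<^sub>j\<^sub>+\<^sub>1\<^sup>n\<close> and \<open>c\<^sub>j\<^sup>n b = \<zeta>\<^sup>-\<^sup>n b c\<^sub>j\<^sub>+\<^sub>1\<^sup>n\<close>, hence \<open>c\<^sub>j\<^sup>d = c\<^sub>j\<^sub>+\<^sub>1\<^sup>d\<close>; averaging over \<open>j\<close> kills the mixed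
  components.\<close>

lemma q_binomial:
  assumes ba: "b * a = cs \<zeta> * (a * b)" shows "(a + b) ^ d = a ^ d + b ^ d"
proof -
  define c where "c j = a + cs (\<zeta> ^ j) * b" for j :: nat
  have ca: "c j * a = a * c (Suc j)" for j
    by (simp add: c_def distrib_left distrib_right mult.assoc ba cs_cs cs_left[of a] mult.commute)
  have cb: "c j * b = cs (1 / \<zeta>) * (b * c (Suc j))" for j
    using z0 by (simp add: c_def distrib_left distrib_right mult.assoc ba cs_cs cs_left[of b])
  have can: "c j ^ n * a = a * c (Suc j) ^ n" for j n
    by (induction n) (auto simp: power_Suc2 mult.assoc ca simp del: power_Suc, simp add: mult.assoc[symmetric])
  have cbn: "c j ^ n * b = cs ((1 / \<zeta>) ^ n) * (b * c (Suc j) ^ n)" for j n by (rule cs_pow_comm[OF cb])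
  have step: "c (Suc j) ^ d = c j ^ d" for j
  proof -
    have "c j ^ d = c j ^ (d - 1) * c j" using power_minus_mult[OF d0] by metis
    also have "\<dots> = c j ^ (d - 1) * a + cs (\<zeta> ^ j) * (c j ^ (d - 1) * b)"
      by (simp add: c_def[of j] distrib_left cs_left[of "(a + cs (\<zeta> ^ j) * b) ^ (d - Suc 0)"])
    also have "\<dots> = (a + cs (\<zeta> ^ j * (1 / \<zeta>) ^ (d - 1)) * b) * c (Suc j) ^ (d - 1)"
      unfolding can cbn by (simp add: distrib_right mult.assoc cs_cs)
    also have "(1 / \<zeta>) ^ (d - 1) = \<zeta>" using zeta_inv_pred by (simp add: inverse_eq_divide)
    also have "a + cs (\<zeta> ^ j * \<zeta>) * b = c (Suc j)" by (simp add: c_def mult.commute)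
    finally show ?thesis using power_minus_mult[OF d0, of "c (Suc j)"] by (simp add: power_commutes)
  qed
  have cj: "c j ^ d = c 0 ^ d" for j by (induction j) (auto simp: step)
  have "(\<Sum>j<d. c j ^ d) = (\<Sum>j<d. c 0 ^ d)" by (rule sum.cong[OF refl cj])
  then have "cs (of_nat d) * c 0 ^ d = (\<Sum>j<d. c j ^ d)" by (simp add: cs_of_nat)
  also have "\<dots> = (\<Sum>j<d. \<Sum>m\<le>d. cs (\<zeta> ^ (m * j)) * hom_part a b d m)"
    by (simp add: c_def hom_part_sum power_mult[symmetric] mult.commute)
  also have "\<dots> = (\<Sum>m\<le>d. cs (\<Sum>j<d. \<zeta> ^ (m * j)) * hom_part a b d m)"
    by (subst sum.swap) (simp add: cs_sum sum_distrib_right)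
  also have "\<dots> = (\<Sum>m\<in>{0, d}. cs (of_nat d) * hom_part a b d m)"
    unfolding sum_zeta by (rule sum.mono_neutral_cong_right) (auto dest: dvd_imp_le)
  also have "\<dots> = cs (of_nat d) * (a ^ d + b ^ d)" using d0 by (simp add: hom_part_ends distrib_left)
  finally have "cs (1 / of_nat d) * (cs (of_nat d) * c 0 ^ d) = cs (1 / of_nat d) * (cs (of_nat d) * (a ^ d + b ^ d))" by simp
  then show ?thesis using d0 by (simp add: cs_cancel c_def)
qed

end

text \<open>The Kronecker product of \<open>n \<times> n\<close> and \<open>m \<times> m\<close> matrices, in blocks.\<close>

definition kr :: "nat \<Rightarrow> nat \<Rightarrow> lop \<Rightarrow> lop \<Rightarrow> lop" where
  "kr n m A B = (\<Sum>i<n. \<Sum>j<n. cs (ent A i j) * (blk m i * (B * blk' m j)))"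

lemma kr_diff_left: "kr n m (A - A') B = kr n m A B - kr n m A' B"
  by (simp add: kr_def ent_diff cs_diff left_diff_distrib sum_subtractf)
lemma kr_diff_right: "kr n m A (B - B') = kr n m A B - kr n m A B'"
  by (simp add: kr_def right_diff_distrib left_diff_distrib sum_subtractf)
lemma kr_cs_left: "kr n m (cs c * A) B = cs c * kr n m A B"
  by (simp add: kr_def ent_cs cs_cs sum_distrib_left)
lemma kr_cs_right: "kr n m A (cs c * B) = cs c * kr n m A B"
  by (simp add: kr_def mult.assoc cs_left[of "blk m i" for i] cs_cs sum_distrib_left mult.commute)
lemma kr_0: "kr n m 0 B = 0" "kr n m A 0 = 0" by (simp_all add: kr_def ent_0)

lemma bt_kr: assumes "bt m m B" shows "bt (n * m) (n * m) (kr n m A B)"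
  unfolding kr_def by (intro bt_sum bt_cs bt_mult[OF bt_blk(1)] bt_mult[OF assms bt_blk(2)]) auto

lemma kr_mult:
  assumes A: "bt n n A" and B: "bt m m B"
  shows "kr n m A B * kr n m A' B' = kr n m (A * A') (B * B')"
proof -
  have b: "blk' m j * (blk m k * T) = (if j = k then un m * T else 0)" for j k T
    by (simp add: mult.assoc[symmetric] blk'_blk)
  have "kr n m A B * kr n m A' B' = (\<Sum>i<n. \<Sum>j<n. \<Sum>k<n. \<Sum>l<n. cs (ent A i j) * (blk m i * (B * blk' m j)) * (cs (ent A' k l) * (blk m k * (B' * blk' m l))))"
    by (simp only: kr_def sum_distrib_right) (simp only: sum_distrib_left)
  also have "\<dots> = (\<Sum>i<n. \<Sum>j<n. \<Sum>k<n. \<Sum>l<n. if j = k then cs (ent A i j * ent A' j l) * (blk m i * (B * (B' * blk' m l))) else 0)"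
    using bt_unr'[OF B] by (intro sum.cong refl)
      (simp add: mult.assoc cs_left[of "blk' m j" for j] cs_left[of "blk m j" for j] cs_left[of B] cs_cs b)
  also have "\<dots> = (\<Sum>i<n. \<Sum>j<n. \<Sum>k<n. if j = k then (\<Sum>l<n. cs (ent A i j * ent A' j l) * (blk m i * (B * (B' * blk' m l)))) else 0)"
    by (rule sum.cong[OF refl], rule sum.cong[OF refl], rule sum.cong[OF refl]) simp
  also have "\<dots> = (\<Sum>i<n. \<Sum>j<n. \<Sum>l<n. cs (ent A i j * ent A' j l) * (blk m i * (B * (B' * blk' m l))))"
    by (rule sum.cong[OF refl], rule sum.cong[OF refl]) simp
  also have "\<dots> = (\<Sum>i<n. \<Sum>l<n. \<Sum>j<n. cs (ent A i j * ent A' j l) * (blk m i * (B * (B' * blk' m l))))"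
    by (rule sum.cong[OF refl]) (rule sum.swap)
  also have "\<dots> = kr n m (A * A') (B * B')"
    using A by (simp add: kr_def ent_mult[of A n] bt_def cs_sum sum_distrib_right mult.assoc)
  finally show ?thesis .
qed

lemma kr_un: "kr n m (un n) (un m) = un (n * m)"
proof -
  have "blk m i * (un m * blk' m j) = blk m i * blk' m j" for i j
    using bt_unl[OF bt_blk(2)[of j "Suc j" m]] by simp
  then have "kr n m (un n) (un m) = (\<Sum>i<n. \<Sum>j<n. if i = j then blk m i * blk' m j else 0)"
    by (simp add: kr_def ent_un if_distrib if_distribR cong: if_cong)
  also have "\<dots> = (\<Sum>i<n. \<Sum>l<m. eu (i * m + l) (i * m + l))" by (simp add: blk_blk')
  finally show ?thesis by (simp add: un_sum sum_lessThan_mult)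
qed

lemma kr_pow:
  assumes "bt n n A" "bt m m B" "l > 0" shows "kr n m A B ^ l = kr n m (A ^ l) (B ^ l)"
proof -
  have "kr n m A B ^ Suc l = kr n m (A ^ Suc l) (B ^ Suc l)" for l
  proof (induction l)
    case (Suc l)
    have "kr n m A B ^ Suc (Suc l) = kr n m A B * kr n m (A ^ Suc l) (B ^ Suc l)"
      unfolding power_Suc[of "kr n m A B" "Suc l"] Suc.IH ..
    then show ?case using kr_mult[OF assms(1,2)] by (simp only: power_Suc)
  qed simp
  then show ?thesis using assms(3) gr0_implies_Suc by metis
qed

lemma tr_kr: assumes B: "bt m m B" shows "tr (n * m) (kr n m A B) = tr n A * tr m B"
proof -
  have t: "tr (n * m) (blk m i * (B * blk' m j)) = (if i = j then tr m B else 0)" if "i < n" "j < n" for i j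
  proof -
    have "tr (n * m) (blk m i * (B * blk' m j)) = tr m ((B * blk' m j) * blk m i)"
      by (rule tr_comm[OF bt_blk(1)[OF that(1)] bt_mult[OF B bt_blk(2)[OF that(2)]]])
    then show ?thesis using bt_unr[OF B] by (simp add: mult.assoc blk'_blk tr_0)
  qed
  have "tr (n * m) (kr n m A B) = (\<Sum>i<n. \<Sum>j<n. if i = j then ent A i j * tr m B else 0)"
    unfolding kr_def tr_sum tr_cs by (intro sum.cong refl) (simp add: t)
  also have "\<dots> = (\<Sum>i<n. ent A i i * tr m B)" by (intro sum.cong refl) simp
  finally show ?thesis by (simp add: tr_def sum_distrib_right)
qed

lemma ent_blk: "ent (blk m i) r s = (if s < m \<and> r = i * m + s then 1 else 0)"
  by (auto simp: blk_def ent_sum ent_eu)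
lemma ent_blk': "ent (blk' m i) r s = (if r < m \<and> s = i * m + r then 1 else 0)"
  by (auto simp: blk'_def ent_sum ent_eu)

text \<open>A row \<open>r\<close> is split into the block \<open>r div m\<close> and the position
  \<open>r mod m\<close> in it, which is the numbering of \<open>kronecker\<close> with the first
  factor as the outer index.\<close>

lemma L_kronecker:
  assumes A: "A \<in> carrier_mat n n" and B: "B \<in> carrier_mat m m"
  shows "kronecker A B \<in> carrier_mat (n * m) (n * m)" "L (kronecker A B) = kr n m (L A) (L B)"
proof -
  show c: "kronecker A B \<in> carrier_mat (n * m) (n * m)" using A B by (simp add: kronecker_def)
  show "L (kronecker A B) = kr n m (L A) (L B)"
  proof (rule lop_eqI[OF bt_L[OF c] bt_kr[OF bt_L[OF B]]])
    fix r s assume rs: "r < n * m" "s < n * m"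
    then have m: "m > 0" by (cases m) auto
    have dv: "r div m < n" "s div m < n" using rs by (simp_all add: less_mult_imp_div_less)
    have md: "r mod m < m" "s mod m < m" using m by simp_all
    have bl: "un m * blk' m j = blk' m j" for j using bt_unl[OF bt_blk(2)[of j "Suc j" m]] by simp
    have e: "ent (blk m i * (L B * blk' m j)) r s = (if i = r div m \<and> j = s div m then B $$ (r mod m, s mod m) else 0)" for i j
    proof -
      have "ent (L B * blk' m j) t s = (if j = s div m then ent (L B) t (s mod m) else 0)" if "t < m" for t
      proof -
        have "ent (L B * blk' m j) t s = (\<Sum>u<m. ent (L B) t u * (if s = j * m + u then 1 else 0))"
          using bt_unr[OF bt_L[OF B]] by (simp add: ent_mult ent_blk')
        also have "\<dots> = (\<Sum>u<m. if u = s mod m then (if j = s div m then ent (L B) t u else 0) else 0)"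
        proof (intro sum.cong refl)
          fix u assume "u \<in> {..<m}"
          then have "s = j * m + u \<longleftrightarrow> u = s mod m \<and> j = s div m" using m by auto
          then show "ent (L B) t u * (if s = j * m + u then 1 else 0) = (if u = s mod m then (if j = s div m then ent (L B) t u else 0) else 0)" by auto
        qed
        finally show ?thesis using md by simp
      qed
      note 1 = this
      have "blk m i * un m = blk m i" using bt_unr[OF bt_blk(1)[of i "Suc i" m]] by simp
      then have "ent (blk m i * (L B * blk' m j)) r s = (\<Sum>t<m. (if r = i * m + t then 1 else 0) * ent (L B * blk' m j) t s)"
        by (simp add: ent_mult ent_blk)
      also have "\<dots> = (\<Sum>t<m. if t = r mod m then (if i = r div m \<and> j = s div m then ent (L B) t (s mod m) else 0) else 0)"
      proof (intro sum.cong refl)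
        fix t assume t: "t \<in> {..<m}"
        then have "r = i * m + t \<longleftrightarrow> t = r mod m \<and> i = r div m" using m by auto
        then show "(if r = i * m + t then 1 else 0) * ent (L B * blk' m j) t s = (if t = r mod m then (if i = r div m \<and> j = s div m then ent (L B) t (s mod m) else 0) else 0)"
          using t 1 by auto
      qed
      finally show ?thesis using md ent_L[OF B] by simp
    qed
    have "ent (kr n m (L A) (L B)) r s = (\<Sum>i<n. \<Sum>j<n. ent (L A) i j * (if i = r div m \<and> j = s div m then B $$ (r mod m, s mod m) else 0))"
      by (simp add: kr_def ent_sum ent_cs e)
    also have "\<dots> = (\<Sum>i<n. \<Sum>j<n. if j = s div m then (if i = r div m then ent (L A) i j * B $$ (r mod m, s mod m) else 0) else 0)"
      by (intro sum.cong refl) auto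
    also have "\<dots> = (\<Sum>i<n. if i = r div m then ent (L A) i (s div m) * B $$ (r mod m, s mod m) else 0)"
      using dv by (intro sum.cong refl) simp
    also have "\<dots> = A $$ (r div m, s div m) * B $$ (r mod m, s mod m)" using dv ent_L[OF A] by simp
    finally show "ent (L (kronecker A B)) r s = ent (kr n m (L A) (L B)) r s"
      using rs A B by (simp add: ent_L[OF c]) (simp add: kronecker_def)
  qed
qed

context dbl begin

text \<open>\<open>E\<close> and \<open>F\<close> act as sums of two terms that commute up to the
  factor \<open>\<zeta>\<close>, so their \<open>d\<close>-th powers vanish by
  \<open>q_binomial\<close>. The traces multiply because \<open>K\<close> and \<open>z\<close> act
  by Kronecker products.\<close>

lemma tensor_module:
  assumes X: "X \<in> C" and Y: "Y \<in> C"
  shows "mod_tensor d X Y \<in> C" "ch l p (mod_tensor d X Y) = ch l p X * ch l p Y"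
proof -
  let ?n = "vdim X" and ?m = "vdim Y" and ?T = "mod_tensor d X Y"
  let ?kr = "kr ?n ?m"
  have cX: "act X g \<in> carrier_mat ?n ?n" and cY: "act Y g \<in> carrier_mat ?m ?m" for g
    using C_wf[OF X] C_wf[OF Y] by (auto simp: fdwf_def)
  have d1: "d - 1 > 0" using d2 by simp
  have zk: "act X DZ * act X DK ^\<^sub>m (d - 1) \<in> carrier_mat ?n ?n" using cX by (meson mult_carrier_mat pow_carrier_mat)
  have bX: "bt ?n ?n (ac X g)" and bY: "bt ?m ?m (ac Y g)" for g using X Y by (auto intro: bt_ac C_wf)
  let ?k' = "ac X DZ * ac X DK ^ (d - 1)" and ?l' = "ac Y DZ * ac Y DK ^ (d - 1)"
  have Lzk: "L (act X DZ * act X DK ^\<^sub>m (d - 1)) = ?k'"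
    using bX[of DK] d1 by (simp only: L_mult[OF cX pow_carrier_mat[OF cX]] L_pow[OF cX] ac_def[symmetric] un_pow)
  have v: "vdim ?T = ?n * ?m" by (simp add: mod_tensor_def)
  have aT: "act ?T DE = kronecker (1\<^sub>m ?n) (act Y DE) + kronecker (act X DE) (act Y DK)"
    "act ?T DF = kronecker (act X DF) (1\<^sub>m ?m) + kronecker (act X DZ * act X DK ^\<^sub>m (d - 1)) (act Y DF)"
    "act ?T DK = kronecker (act X DK) (act Y DK)" "act ?T DZ = kronecker (act X DZ) (act Y DZ)"
    by (simp_all add: mod_tensor_def)
  note kc = L_kronecker[OF one_carrier_mat cY] L_kronecker[OF cX cY] L_kronecker[OF cX one_carrier_mat] L_kronecker[OF zk cY]
  have wf: "fdwf ?T" unfolding fdwf_def v double_gen_all aT using kc by (auto intro!: add_carrier_mat)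
  have acT: "ac ?T DE = ?kr (un ?n) (ac Y DE) + ?kr (ac X DE) (ac Y DK)"
    "ac ?T DF = ?kr (ac X DF) (un ?m) + ?kr ?k' (ac Y DF)" "ac ?T DK = ?kr (ac X DK) (ac Y DK)" "ac ?T DZ = ?kr (ac X DZ) (ac Y DZ)"
    by (simp_all only: ac_def aT L_add[OF kc(1) kc(3)] L_add[OF kc(5) kc(7)] kc L_one Lzk[unfolded ac_def])
  have bk': "bt ?n ?n ?k'" "bt ?m ?m ?l'" using bX bY d1 by (auto intro!: bt_mult[OF _ bt_pow])
  note RX = C_isM[OF X, unfolded isD_def] and RY = C_isM[OF Y, unfolded isD_def]
  interpret UX: uq \<zeta> "ac X DE" "ac X DF" "ac X DK" ?k' by (rule isD_uq[OF C_isM[OF X]])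
  interpret UY: uq \<zeta> "ac Y DE" "ac Y DF" "ac Y DK" ?l' by (rule isD_uq[OF C_isM[OF Y]])
  have zX: "ac X DZ * ?k' = ?k' * ac X DZ"
    using RX by (metis mult.assoc power_commuting_commutes)
  have kX: "ac X DK * ?k' = ?k' * ac X DK"
    using RX by (metis mult.assoc power_commutes)
  have uX: "un ?n * ac X g = ac X g" "ac X g * un ?n = ac X g" "un ?m * ac Y g = ac Y g" "ac Y g * un ?m = ac Y g" for g
    using bX bY by (auto simp: bt_def)
  have uk: "un ?n * ?k' = ?k'" "?k' * un ?n = ?k'" using bk' by (auto simp: bt_def)
  have m: "?kr A B * ?kr A' B' = ?kr (A * A') (B * B')" if "bt ?n ?n A" "bt ?m ?m B" for A B A' B' using kr_mult[OF that] .
  note mm = m[OF bX bY] m[OF bt_un bY] m[OF bX bt_un] m[OF bk'(1) bY]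
  have isM: "isM ?T" unfolding isD_def v acT
  proof (intro conjI)
    show "bt (?n * ?m) (?n * ?m) (?kr (un ?n) (ac Y DE) + ?kr (ac X DE) (ac Y DK))"
      "bt (?n * ?m) (?n * ?m) (?kr (ac X DF) (un ?m) + ?kr ?k' (ac Y DF))"
      "bt (?n * ?m) (?n * ?m) (?kr (ac X DK) (ac Y DK))" "bt (?n * ?m) (?n * ?m) (?kr (ac X DZ) (ac Y DZ))"
      using bY by (auto intro!: bt_kr)
    show "?kr (ac X DK) (ac Y DK) ^ d = un (?n * ?m)" "?kr (ac X DZ) (ac Y DZ) ^ d = un (?n * ?m)"
      using RX RY by (simp_all add: kr_pow[OF bX bY d0] kr_un)
    have "?kr (ac X DE) (ac Y DK) * ?kr (un ?n) (ac Y DE) = cs \<zeta> * (?kr (un ?n) (ac Y DE) * ?kr (ac X DE) (ac Y DK))"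
      by (simp add: mm uX UY.ke kr_cs_right)
    from q_binomial[OF this] show "(?kr (un ?n) (ac Y DE) + ?kr (ac X DE) (ac Y DK)) ^ d = 0"
      using RX RY by (simp add: kr_pow[OF bX bY d0] kr_pow[OF bt_un bY d0] kr_0)
    have "?kr ?k' (ac Y DF) * ?kr (ac X DF) (un ?m) = cs \<zeta> * (?kr (ac X DF) (un ?m) * ?kr ?k' (ac Y DF))"
      by (simp only: mm uX UX.k'f kr_cs_left)
    then show "(?kr (ac X DF) (un ?m) + ?kr ?k' (ac Y DF)) ^ d = 0"
      unfolding q_binomial[OF \<open>?kr ?k' (ac Y DF) * ?kr (ac X DF) (un ?m) = cs \<zeta> * (?kr (ac X DF) (un ?m) * ?kr ?k' (ac Y DF))\<close>]
        kr_pow[OF bX bt_un d0] kr_pow[OF bk'(1) bY d0] C_rel(2)[OF X] C_rel(2)[OF Y] by (simp add: kr_0)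
    show "?kr (ac X DZ) (ac Y DZ) * (?kr (un ?n) (ac Y DE) + ?kr (ac X DE) (ac Y DK)) =
      (?kr (un ?n) (ac Y DE) + ?kr (ac X DE) (ac Y DK)) * ?kr (ac X DZ) (ac Y DZ)"
      using RX RY by (simp add: distrib_left distrib_right mm uX)
    show "?kr (ac X DZ) (ac Y DZ) * (?kr (ac X DF) (un ?m) + ?kr ?k' (ac Y DF)) =
      (?kr (ac X DF) (un ?m) + ?kr ?k' (ac Y DF)) * ?kr (ac X DZ) (ac Y DZ)"
      using RX RY by (simp only: distrib_left distrib_right mm uX zX)
    show "?kr (ac X DZ) (ac Y DZ) * ?kr (ac X DK) (ac Y DK) = ?kr (ac X DK) (ac Y DK) * ?kr (ac X DZ) (ac Y DZ)"
      using RX RY by (simp only: mm)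
    show "?kr (ac X DK) (ac Y DK) * (?kr (un ?n) (ac Y DE) + ?kr (ac X DE) (ac Y DK)) =
      cs \<zeta> * ((?kr (un ?n) (ac Y DE) + ?kr (ac X DE) (ac Y DK)) * ?kr (ac X DK) (ac Y DK))"
      by (simp only: distrib_left distrib_right mm uX UX.ke UY.ke kr_cs_left kr_cs_right)
    show "?kr (ac X DK) (ac Y DK) * (?kr (ac X DF) (un ?m) + ?kr ?k' (ac Y DF)) =
      cs (inverse \<zeta>) * ((?kr (ac X DF) (un ?m) + ?kr ?k' (ac Y DF)) * ?kr (ac X DK) (ac Y DK))"
      by (simp only: distrib_left distrib_right mm uX kX UX.kf UY.kf kr_cs_left kr_cs_right inverse_eq_divide)
    have "?kr (ac X DZ) (ac Y DZ) * ?kr (ac X DK) (ac Y DK) ^ (d - 1) = ?kr ?k' ?l'"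
      by (simp only: kr_pow[OF bX bY d1] mm)
    \<comment> \<open>The first and the last of the four terms occur in both orders and cancel in
      the commutator. The other two leave
      \<open>?k' \<otimes> (K - ?l') + (K - ?k') \<otimes> K\<close>, which telescopes to
      \<open>K \<otimes> K - ?k' \<otimes> ?l'\<close>.\<close>
    moreover have "(?kr (un ?n) (ac Y DE) + ?kr (ac X DE) (ac Y DK)) * (?kr (ac X DF) (un ?m) + ?kr ?k' (ac Y DF)) =
       ?kr (ac X DF) (ac Y DE) + ?kr ?k' (ac Y DE * ac Y DF) + ?kr (ac X DE * ac X DF) (ac Y DK) + cs (1 / \<zeta>) * ?kr (ac X DE * ?k') (ac Y DF * ac Y DK)"
      by (simp only: distrib_left distrib_right mm uX uk UY.kf kr_cs_right) (simp only: ac_simps)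
    moreover have "(?kr (ac X DF) (un ?m) + ?kr ?k' (ac Y DF)) * (?kr (un ?n) (ac Y DE) + ?kr (ac X DE) (ac Y DK)) =
       ?kr (ac X DF) (ac Y DE) + ?kr ?k' (ac Y DF * ac Y DE) + ?kr (ac X DF * ac X DE) (ac Y DK) + cs (1 / \<zeta>) * ?kr (ac X DE * ?k') (ac Y DF * ac Y DK)"
      by (simp only: distrib_left distrib_right mm uX uk UX.k'e kr_cs_left) (simp only: ac_simps)
    ultimately show "(?kr (un ?n) (ac Y DE) + ?kr (ac X DE) (ac Y DK)) * (?kr (ac X DF) (un ?m) + ?kr ?k' (ac Y DF)) -
      (?kr (ac X DF) (un ?m) + ?kr ?k' (ac Y DF)) * (?kr (un ?n) (ac Y DE) + ?kr (ac X DE) (ac Y DK)) =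
      ?kr (ac X DK) (ac Y DK) - ?kr (ac X DZ) (ac Y DZ) * ?kr (ac X DK) (ac Y DK) ^ (d - 1)"
      using UX.fe UY.fe by (simp only: kr_diff_left kr_diff_right) (simp add: algebra_simps)
  qed
  show "?T \<in> C" using wf isM by (simp add: C_iff)
  have pw: "un (?n * ?m) * ?kr (ac X g) (ac Y g) ^ l = ?kr (un ?n * ac X g ^ l) (un ?m * ac Y g ^ l)" for g l
  proof (cases "l = 0")
    case False
    then show ?thesis using bt_pow[OF bX[of g], of l] bt_pow[OF bY[of g], of l] bt_kr[OF bt_pow[OF bY[of g], of l], of ?n]
      by (simp add: kr_pow[OF bX bY] bt_def)
  qed (simp add: kr_un)
  have bl: "bt ?n ?n (un ?n * ac X g ^ l)" "bt ?m ?m (un ?m * ac Y g ^ l)" for g l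
    using bX bY by (cases "l = 0"; auto simp: un_pow intro: bt_pow)+
  have sw: "idn Z * (ac Z DK ^ l * ac Z DZ ^ p) = (idn Z * ac Z DK ^ l) * (idn Z * ac Z DZ ^ p)" if Z: "Z \<in> C" for Z
  proof -
    have "ac Z DK ^ l * idn Z = idn Z * ac Z DK ^ l" using ac_idn[OF Z] by (metis power_commuting_commutes)
    then show ?thesis by (simp add: mult.assoc[symmetric]) (simp add: mult.assoc assoc2[OF un_un])
  qed
  have "idn ?T * (ac ?T DK ^ l * ac ?T DZ ^ p) = ?kr (idn X * (ac X DK ^ l * ac X DZ ^ p)) (idn Y * (ac Y DK ^ l * ac Y DZ ^ p))"
    unfolding sw[OF \<open>?T \<in> C\<close>] unfolding v acT pw m[OF bl] sw[OF X] sw[OF Y] ..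
  moreover have "bt ?m ?m (idn Y * (ac Y DK ^ l * ac Y DZ ^ p))" unfolding sw[OF Y] by (rule bt_mult[OF bl(2) bl(2)])
  ultimately show "ch l p ?T = ch l p X * ch l p Y" unfolding ch_def by (simp add: v tr_kr)
qed

lemma trivial_module: "trivial_mod \<in> C" "ch l p trivial_mod = 1"
proof -
  have ac: "ac trivial_mod DE = 0" "ac trivial_mod DF = 0" "ac trivial_mod DK = un 1" "ac trivial_mod DZ = un 1" "vdim trivial_mod = 1"
    using L_one[of 1] L_zero[of 1 1] by (simp_all add: trivial_mod_def ac_def)
  have pw: "un 1 ^ Suc m = un 1" for m by (induction m) (simp_all add: un_un)
  then have pw': "un 1 ^ m = un 1" if "m > 0" for m using that gr0_implies_Suc by metis
  have d1: "d - 1 > 0" using d2 by simp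
  have "fdwf trivial_mod" by (auto simp: fdwf_def double_gen_all trivial_mod_def)
  moreover have "isM trivial_mod" unfolding isD_def ac
    using pw'[OF d0] pw'[OF d1] d0 un_un[of 1 1] by (simp add: power_0_left)
  ultimately show "trivial_mod \<in> C" by (simp add: C_iff)
  have u: "un 1 * un 1 ^ m = un 1" for m using pw[of m] by simp
  have "un 1 * (un 1 ^ l * un 1 ^ p) = un 1" by (simp only: mult.assoc[symmetric] u)
  then show "ch l p trivial_mod = 1" unfolding ch_def ac by (simp add: tr_un)
qed

end

section \<open>Standard modules\<close>

text \<open>Vectors are columns, as operators of format \<open>n \<times> 1\<close>. From index
  \<open>n\<close> on they are 0, so that raising past the end is covered by the same rules.\<close>

definition V :: "nat \<Rightarrow> nat \<Rightarrow> lop" where "V n i = (if i < n then eu i 0 else 0)"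

lemma V_out: "n \<le> i \<Longrightarrow> V n i = 0" by (simp add: V_def)
lemma bt_V: "bt n 1 (V n i)" "bt n (Suc 0) (V n i)" by (simp_all add: V_def bt_eu)
lemma V_eu: "V n i * eu 0 0 = V n i" by (simp add: V_def eu_eu)

lemma ext_V:
  assumes S: "bt r n S" and T: "bt r n T" and e: "\<And>i. i < n \<Longrightarrow> S * V n i = T * V n i" shows "S = T"
proof -
  have x: "R = (\<Sum>i<n. R * V n i * eu 0 i)" if "bt r n R" for R
  proof -
    have "R = R * un n" using that by (simp add: bt_def)
    also have "\<dots> = (\<Sum>i<n. R * V n i * eu 0 i)" by (simp add: un_sum sum_distrib_left V_def mult.assoc eu_eu)
    finally show ?thesis .
  qed
  show ?thesis using x[OF S] x[OF T] e by simp
qed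

definition vop :: "nat \<Rightarrow> (nat \<Rightarrow> lop) \<Rightarrow> lop" where "vop n g = (\<Sum>i<n. g i * eu 0 i)"

lemma vop_V: assumes "\<And>i. g i * eu 0 0 = g i" shows "vop n g * V n i = (if i < n then g i else 0)"
  using assms by (simp add: vop_def V_def sum_distrib_right mult.assoc eu_eu if_distrib cong: if_cong)

lemma bt_vop: assumes "\<And>i. bt r 1 (g i)" shows "bt r n (vop n g)"
  unfolding vop_def by (intro bt_sum bt_mult[OF assms] bt_eu) auto

context dbl begin

text \<open>The eigenvalue of the commutator term \<open>c m\<close> of \<open>uq\<close> on a
  vector on which \<open>K\<close> acts by \<open>\<kappa>\<close> and \<open>z\<close> by
  \<open>\<omega>\<close>.\<close>

definition gam :: "complex \<Rightarrow> complex \<Rightarrow> nat \<Rightarrow> complex" where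
  "gam \<kappa> \<omega> m = (\<Sum>a<m. \<kappa> * \<zeta> ^ a - \<omega> / \<kappa> * (1 / \<zeta>) ^ a)"

text \<open>The quotient of length \<open>n\<close> of the module with basis \<open>V\<^sub>i = E\<^sup>i V\<^sub>0\<close>, where \<open>F V\<^sub>0 = 0\<close>, \<open>K V\<^sub>0 = \<kappa> V\<^sub>0\<close> and
  \<open>z = \<omega>\<close>. It exists for \<open>n \<le> d\<close> if \<open>gam \<kappa> \<omega> n = 0\<close>.\<close>

definition lw :: "nat \<Rightarrow> complex \<Rightarrow> complex \<Rightarrow> double_gen fdmod" where
  "lw n \<kappa> \<omega> = mk n (vop n (\<lambda>i. V n (Suc i))) (vop n (\<lambda>i. if i = 0 then 0 else cs (- gam \<kappa> \<omega> i) * V n (i - 1)))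
     (vop n (\<lambda>i. cs (\<kappa> * \<zeta> ^ i) * V n i)) (cs \<omega> * un n)"

definition lw_ok :: "nat \<Rightarrow> complex \<Rightarrow> complex \<Rightarrow> bool" where
  "lw_ok n \<kappa> \<omega> \<longleftrightarrow> n \<le> d \<and> \<kappa> ^ d = 1 \<and> \<omega> ^ d = 1 \<and> gam \<kappa> \<omega> n = 0"

lemma root_facts: fixes x :: complex assumes "x ^ d = 1" shows "x \<noteq> 0" "x ^ (d - 1) = 1 / x"
proof -
  show x: "x \<noteq> 0" using assms d0 by (cases "x = 0") (simp_all add: zero_power)
  show "x ^ (d - 1) = 1 / x" using power_minus_mult[OF d0, of x] assms x by (simp add: eq_divide_eq)
qed

lemma kz_root: "\<kappa> ^ d = 1 \<Longrightarrow> (\<kappa> * \<zeta> ^ i) ^ d = 1"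
  using zeta_pow_eq_1_iff[of "i * d"] by (simp add: power_mult_distrib power_mult[symmetric])

lemma lw:
  assumes ok: "lw_ok n \<kappa> \<omega>"
  shows "lw n \<kappa> \<omega> \<in> C" "vdim (lw n \<kappa> \<omega>) = n"
    "ac (lw n \<kappa> \<omega>) DE * V n i = V n (Suc i)" "ac (lw n \<kappa> \<omega>) DF * V n 0 = 0"
    "ac (lw n \<kappa> \<omega>) DF * V n (Suc i) = cs (- gam \<kappa> \<omega> (Suc i)) * V n i"
    "ac (lw n \<kappa> \<omega>) DK * V n i = cs (\<kappa> * \<zeta> ^ i) * V n i" "ac (lw n \<kappa> \<omega>) DZ * V n i = cs \<omega> * V n i"
proof -
  have nd: "n \<le> d" and k: "\<kappa> ^ d = 1" and o: "\<omega> ^ d = 1" and g: "gam \<kappa> \<omega> n = 0" using ok by (auto simp: lw_ok_def)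
  define E where "E = vop n (\<lambda>i. V n (Suc i))"
  define F where "F = vop n (\<lambda>i. if i = 0 then 0 else cs (- gam \<kappa> \<omega> i) * V n (i - 1))"
  define K where "K = vop n (\<lambda>i. cs (\<kappa> * \<zeta> ^ i) * V n i)"
  define Z where "Z = cs \<omega> * un n"
  have b: "bt n n E" "bt n n F" "bt n n K" "bt n n Z"
    unfolding E_def F_def K_def Z_def by (auto intro!: bt_vop bt_V bt_cs)
  have EV: "E * V n i = V n (Suc i)" for i by (simp add: E_def vop_V V_eu V_out)
  have F0: "F * V n 0 = 0" by (simp add: F_def vop_V V_eu mult.assoc)
  \<comment> \<open>For \<open>Suc i = n\<close> the left side is 0 since \<open>V n n\<close> is,
    and the right side is 0 by \<open>gam \<kappa> \<omega> n = 0\<close>: this is the condition for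
    the truncation at \<open>n\<close>.\<close>
  have FS: "F * V n (Suc i) = cs (- gam \<kappa> \<omega> (Suc i)) * V n i" for i
    using g by (cases "Suc i = n") (auto simp: F_def vop_V V_eu mult.assoc V_out)
  have KV: "K * V n i = cs (\<kappa> * \<zeta> ^ i) * V n i" for i by (simp add: K_def vop_V V_eu mult.assoc V_out)
  have ZV: "Z * V n i = cs \<omega> * V n i" for i by (simp add: Z_def V_def un_eu mult.assoc)
  have pw: "T ^ m * V n i = cs (x ^ m) * V n i" if "T * V n i = cs x * V n i" for T x i m
    using cs_pow_comm[of T "V n i" x 1 m] that by simp
  have EP: "E ^ m * V n i = V n (i + m)" for m i
    by (induction m arbitrary: i) (auto simp: power_Suc2 mult.assoc EV simp del: power_Suc)
  have FP: "m > i \<Longrightarrow> F ^ m * V n i = 0" for m i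
  proof (induction i arbitrary: m)
    case 0 then show ?case by (cases m) (auto simp: power_Suc2 mult.assoc F0 simp del: power_Suc)
  next
    case (Suc i)
    then obtain m' where "m = Suc m'" "m' > i" by (cases m) auto
    then show ?case using Suc.IH[of m'] by (simp add: power_Suc2 mult.assoc FS cs_left[of "F ^ m'"] del: power_Suc)
  qed
  have d1: "d - 1 > 0" using d2 by simp
  have D: "isD n E F K Z" unfolding isD_def
  proof (intro conjI b)
    note bd = bt_pow[OF b(1) d0] bt_pow[OF b(2) d0] bt_pow[OF b(3) d0] bt_pow[OF b(4) d0]
    show "K ^ d = un n" by (rule ext_V[OF bd(3) bt_un]) (simp_all add: pw[OF KV] kz_root[OF k] bt_unl[OF bt_V(1)])
    show "Z ^ d = un n" by (rule ext_V[OF bd(4) bt_un]) (simp_all add: pw[OF ZV] o bt_unl[OF bt_V(1)])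
    show "E ^ d = 0" using nd by (intro ext_V[OF bd(1) bt_zero]) (simp add: EP V_out)
    show "F ^ d = 0" using nd by (intro ext_V[OF bd(2) bt_zero]) (simp add: FP)
    show "Z * E = E * Z" by (rule ext_V[OF bt_mult[OF b(4,1)] bt_mult[OF b(1,4)]]) (simp add: mult.assoc EV ZV cs_left[of E])
    show "Z * K = K * Z" by (rule ext_V[OF bt_mult[OF b(4,3)] bt_mult[OF b(3,4)]])
      (simp add: mult.assoc KV ZV cs_left[of K] cs_left[of Z] cs_cs mult.commute)
    show "K * E = cs \<zeta> * (E * K)" by (rule ext_V[OF bt_mult[OF b(3,1)] bt_cs[OF bt_mult[OF b(1,3)]]])
      (simp add: mult.assoc EV KV cs_left[of E] cs_cs mult.left_commute)
    show "Z * F = F * Z"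
    proof (rule ext_V[OF bt_mult[OF b(4,2)] bt_mult[OF b(2,4)]])
      fix i show "Z * F * V n i = F * Z * V n i"
        by (cases i) (simp_all add: mult.assoc F0 FS ZV cs_left[of F] cs_left[of Z] cs_cs mult.commute)
    qed
    show "K * F = cs (inverse \<zeta>) * (F * K)"
    proof (rule ext_V[OF bt_mult[OF b(3,2)] bt_cs[OF bt_mult[OF b(2,3)]]])
      fix i show "K * F * V n i = cs (inverse \<zeta>) * (F * K) * V n i"
        using z0 by (cases i) (simp_all add: mult.assoc F0 FS KV cs_left[of F] cs_left[of K] cs_cs field_simps)
    qed
    show "E * F - F * E = K - Z * K ^ (d - 1)"
    proof (rule ext_V[of n n])
      show "bt n n (E * F - F * E)" "bt n n (K - Z * K ^ (d - 1))" using b bt_pow[OF b(3) d1] by auto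
      fix i assume "i < n"
      have kk: "(\<kappa> * \<zeta> ^ i) ^ (d - 1) = 1 / (\<kappa> * \<zeta> ^ i)" by (rule root_facts(2)[OF kz_root[OF k]])
      have r: "(K - Z * K ^ (d - 1)) * V n i = cs (\<kappa> * \<zeta> ^ i - \<omega> / \<kappa> * (1 / \<zeta>) ^ i) * V n i"
        by (simp only: left_diff_distrib mult.assoc KV pw[OF KV] kk cs_left[of Z] ZV cs_cs cs_diff)
          (simp add: power_divide mult.commute)
      have "(E * F - F * E) * V n i = cs (gam \<kappa> \<omega> (Suc i) - gam \<kappa> \<omega> i) * V n i"
        by (cases i) (simp_all add: left_diff_distrib mult.assoc F0 FS EV cs_left[of E] cs_minus cs_diff, simp add: gam_def)
      then show "(E * F - F * E) * V n i = (K - Z * K ^ (d - 1)) * V n i" unfolding r by (simp add: gam_def)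
    qed
  qed
  note m = mk[OF D, unfolded E_def F_def K_def Z_def, folded lw_def]
  show "lw n \<kappa> \<omega> \<in> C" "vdim (lw n \<kappa> \<omega>) = n" by (fact m)+
  show "ac (lw n \<kappa> \<omega>) DE * V n i = V n (Suc i)" "ac (lw n \<kappa> \<omega>) DF * V n 0 = 0"
    "ac (lw n \<kappa> \<omega>) DF * V n (Suc i) = cs (- gam \<kappa> \<omega> (Suc i)) * V n i"
    "ac (lw n \<kappa> \<omega>) DK * V n i = cs (\<kappa> * \<zeta> ^ i) * V n i" "ac (lw n \<kappa> \<omega>) DZ * V n i = cs \<omega> * V n i"
    unfolding m using EV F0 FS KV ZV by (simp_all only: E_def F_def K_def Z_def)
qed

lemma lw_pow:
  assumes ok: "lw_ok n \<kappa> \<omega>"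
  shows "ac (lw n \<kappa> \<omega>) DE ^ m * V n i = V n (i + m)" "ac (lw n \<kappa> \<omega>) DK ^ m * V n i = cs ((\<kappa> * \<zeta> ^ i) ^ m) * V n i"
    "ac (lw n \<kappa> \<omega>) DZ ^ m * V n i = cs (\<omega> ^ m) * V n i"
proof -
  show "ac (lw n \<kappa> \<omega>) DE ^ m * V n i = V n (i + m)"
    by (induction m arbitrary: i) (auto simp: power_Suc2 mult.assoc lw[OF ok] simp del: power_Suc)
  have pw: "T ^ m * V n i = cs (x ^ m) * V n i" if "T * V n i = cs x * V n i" for T x
    using cs_pow_comm[of T "V n i" x 1 m] that by simp
  show "ac (lw n \<kappa> \<omega>) DK ^ m * V n i = cs ((\<kappa> * \<zeta> ^ i) ^ m) * V n i" "ac (lw n \<kappa> \<omega>) DZ ^ m * V n i = cs (\<omega> ^ m) * V n i"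
    using pw lw[OF ok] by blast+
qed

lemma ch_lw:
  assumes ok: "lw_ok n \<kappa> \<omega>" shows "ch l p (lw n \<kappa> \<omega>) = \<omega> ^ p * \<kappa> ^ l * (\<Sum>i<n. \<zeta> ^ (l * i))"
proof -
  let ?T = "un n * (ac (lw n \<kappa> \<omega>) DK ^ l * ac (lw n \<kappa> \<omega>) DZ ^ p)"
  have "ent ?T i i = (\<kappa> * \<zeta> ^ i) ^ l * \<omega> ^ p" if "i < n" for i
  proof -
    have "?T * V n i = cs (\<omega> ^ p * (\<kappa> * \<zeta> ^ i) ^ l) * V n i"
      by (simp add: mult.assoc lw_pow[OF ok] cs_left[of "ac (lw n \<kappa> \<omega>) DK ^ l"] cs_left[of "un n"] cs_cs bt_unl[OF bt_V(1)])
    then have "ent (?T * eu i 0) i 0 = \<omega> ^ p * (\<kappa> * \<zeta> ^ i) ^ l" using that by (simp add: V_def ent_cs ent_eu)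
    then show ?thesis by (simp add: ent_mult_eu)
  qed
  then show ?thesis by (simp add: ch_def tr_def lw(2)[OF ok] sum_distrib_left power_mult_distrib power_mult[symmetric] mult.commute mult.left_commute)
qed

text \<open>At length \<open>d\<close> the module is free over the truncated polynomials in
  \<open>E\<close>. The matrix unit \<open>eu 0 (d - 1)\<close> sends the top vector to the lowest
  one, so that \<open>E^i T E^(d-1-i)\<close> is the projection onto \<open>V d i\<close>, and these
  add up to the identity.\<close>

lemma lw_projective:
  assumes ok: "lw_ok d \<kappa> \<omega>" shows "lw d \<kappa> \<omega> \<in> proj_B d \<zeta>"
proof -
  let ?X = "lw d \<kappa> \<omega>"
  note l = lw[OF ok]
  let ?T = "eu 0 (d - 1)"
  have TV: "?T * V d j = (if j = d - 1 then V d 0 else 0)" for j using d0 by (auto simp: V_def eu_eu)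
  have bT: "bt d d ?T" using d0 by auto
  have bX: "bt d d (ac ?X g)" for g using bt_ac[OF C_wf[OF l(1)], of g] l(2) by simp
  have "ac ?X DZ * ?T = ?T * ac ?X DZ"
    by (rule ext_V[OF bt_mult[OF bX bT] bt_mult[OF bT bX]]) (simp add: mult.assoc TV[unfolded One_nat_def] l cs_left[of "eu 0 (d - Suc 0)"])
  moreover have "ac ?X DK * ?T = cs \<zeta> * (?T * ac ?X DK)"
  proof (rule ext_V[OF bt_mult[OF bX bT] bt_cs[OF bt_mult[OF bT bX]]])
    fix i
    have kz: "\<zeta> * (\<kappa> * \<zeta> ^ (d - Suc 0)) = \<kappa>" unfolding zeta_pred[unfolded One_nat_def] using z0 by simp
    show "ac ?X DK * ?T * V d i = cs \<zeta> * (?T * ac ?X DK) * V d i"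
      using l(6)[of 0] by (simp add: mult.assoc TV[unfolded One_nat_def] l cs_left[of "eu 0 (d - Suc 0)"] cs_cs kz)
  qed
  ultimately have gw: "gw ?X ?X ?T" using bT by (simp add: gw_def l)
  have "idn ?X = TrE ?X ?X ?T"
  proof (rule ext_V[of d d])
    show "bt d d (idn ?X)" "bt d d (TrE ?X ?X ?T)" using trp_bt[OF bX bX bT] l(2) by (auto simp: TrE_def)
    fix k assume k: "k < d"
    have "TrE ?X ?X ?T * V d k = (\<Sum>i<d. ac ?X DE ^ i * (?T * V d (k + (d - 1 - i))))"
      by (simp add: TrE_def trp_def sum_distrib_right mult.assoc lw_pow[OF ok])
    also have "\<dots> = (\<Sum>i<d. if i = k then V d k else 0)"
      using k by (intro sum.cong refl) (auto simp: TV[unfolded One_nat_def] lw_pow[OF ok])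
    finally show "idn ?X * V d k = TrE ?X ?X ?T * V d k" using k l(2) by (simp add: bt_unl[OF bt_V(1)])
  qed
  then show ?thesis unfolding proj_B_iff nE_def using l(1) gw by blast
qed

lemma gam_split: "gam \<kappa> \<omega> (n + m) = gam \<kappa> \<omega> n + gam (\<kappa> * \<zeta> ^ n) \<omega> m"
proof -
  have "(1 / \<zeta>) ^ n / 1 = 1 / \<zeta> ^ n" by (simp add: power_divide)
  then show ?thesis unfolding gam_def sum_lessThan_add by (simp add: power_add mult.assoc power_divide)
qed

lemma gam_closed: "gam \<kappa> \<omega> n = \<kappa> * (\<Sum>a<n. \<zeta> ^ a) - \<omega> / \<kappa> * (\<Sum>a<n. (1 / \<zeta>) ^ a)"
  unfolding gam_def sum_subtractf by (simp only: sum_distrib_left)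

lemma gam_d: "gam \<kappa> \<omega> d = 0" unfolding gam_closed zeta_sums by simp

text \<open>The vectors \<open>V d i\<close> with \<open>n \<le> i\<close> span a submodule, because
  \<open>F\<close> sends \<open>V d n\<close> to a multiple of its predecessor with the factor
  \<open>- gam \<kappa> \<omega> n = 0\<close>. Its lowest weight is
  \<open>\<kappa> * \<zeta> ^ n\<close>, and the quotient has length \<open>n\<close>.\<close>

lemma lw_ses:
  assumes n: "lw_ok n \<kappa> \<omega>" "n \<le> d"
  shows "\<exists>u v. ses (lw (d - n) (\<kappa> * \<zeta> ^ n) \<omega>) (lw d \<kappa> \<omega>) (lw n \<kappa> \<omega>) u v" "lw_ok (d - n) (\<kappa> * \<zeta> ^ n) \<omega>" "lw_ok d \<kappa> \<omega>"
proof -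
  have g: "gam \<kappa> \<omega> n = 0" and k: "\<kappa> ^ d = 1" "\<omega> ^ d = 1" using n by (auto simp: lw_ok_def)
  have gs: "gam (\<kappa> * \<zeta> ^ n) \<omega> m = gam \<kappa> \<omega> (n + m)" for m using gam_split g by simp
  show okX: "lw_ok (d - n) (\<kappa> * \<zeta> ^ n) \<omega>" unfolding lw_ok_def gs using n k kz_root gam_d by simp
  show okY: "lw_ok d \<kappa> \<omega>" unfolding lw_ok_def using k gam_d by simp
  let ?m = "d - n" and ?X = "lw (d - n) (\<kappa> * \<zeta> ^ n) \<omega>" and ?Y = "lw d \<kappa> \<omega>" and ?Z = "lw n \<kappa> \<omega>"
  note X = lw[OF okX] and Y = lw[OF okY] and Z = lw[OF n(1)]
  define u where "u = vop ?m (\<lambda>i. V d (n + i))"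
  define r where "r = vop d (\<lambda>i. if n \<le> i then V ?m (i - n) else 0)"
  define v where "v = vop d (\<lambda>i. V n i)"
  define s where "s = vop n (\<lambda>i. V d i)"
  have b: "bt d ?m u" "bt ?m d r" "bt n d v" "bt d n s" unfolding u_def r_def v_def s_def by (auto intro!: bt_vop bt_V)
  have uV: "u * V ?m i = V d (n + i)" for i by (simp add: u_def vop_V V_eu V_out)
  have rV: "r * V d i = (if n \<le> i then V ?m (i - n) else 0)" for i by (simp add: r_def vop_V V_eu V_out)
  have vV: "v * V d i = V n i" for i using n(2) by (simp add: v_def vop_V V_eu V_out)
  have sV: "s * V n i = (if i < n then V d i else 0)" for i by (simp add: s_def vop_V V_eu)
  have bX: "bt ?m ?m (ac ?X g)" and bY: "bt d d (ac ?Y g)" and bZ: "bt n n (ac ?Z g)" for g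
    using bt_ac[OF C_wf[OF X(1)], of g] bt_ac[OF C_wf[OF Y(1)], of g] bt_ac[OF C_wf[OF Z(1)], of g] X(2) Y(2) Z(2) by simp_all
  have gn: "n = Suc n' \<Longrightarrow> gam \<kappa> \<omega> (Suc n') = 0" for n' using g by simp
  have F0n: "ac ?Y DF * V d n = 0"
  proof (cases n)
    case 0 then show ?thesis using Y(4) by simp
  next
    case (Suc n') then show ?thesis using Y(5)[of n'] gn by simp
  qed
  have Hu: "H UNIV ?X ?Y u" unfolding H_def X(2) Y(2)
  proof (intro conjI ballI b)
    fix g show "u * ac ?X g = ac ?Y g * u"
    proof (rule ext_V[OF bt_mult[OF b(1) bX] bt_mult[OF bY b(1)]])
      fix i show "u * ac ?X g * V ?m i = ac ?Y g * u * V ?m i"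
      proof (cases g)
        case DE then show ?thesis by (simp add: mult.assoc uV X Y)
      next
        case DK then show ?thesis by (simp add: mult.assoc uV X Y cs_left[of u] power_add)
      next
        case DZ then show ?thesis by (simp add: mult.assoc uV X Y cs_left[of u])
      next
        case DF then show ?thesis
          by (cases i) (simp_all add: mult.assoc uV X(4,5) Y(5) F0n cs_left[of u] gs)
      qed
    qed
  qed
  have Hv: "H UNIV ?Y ?Z v" unfolding H_def Z(2) Y(2)
  proof (intro conjI ballI b)
    fix g show "v * ac ?Y g = ac ?Z g * v"
    proof (rule ext_V[OF bt_mult[OF b(3) bY] bt_mult[OF bZ b(3)]])
      fix i show "v * ac ?Y g * V d i = ac ?Z g * v * V d i"
      proof (cases g)
        case DF then show ?thesis by (cases i) (simp_all add: mult.assoc vV Z(4,5) Y(4,5) cs_left[of v])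
      qed (simp_all add: mult.assoc vV Y Z cs_left[of v])
    qed
  qed
  have Hr: "H GK ?Y ?X r" unfolding H_def X(2) Y(2)
  proof (intro conjI ballI b)
    fix g assume "g \<in> GK"
    then consider "g = DK" | "g = DZ" by auto
    then show "r * ac ?Y g = ac ?X g * r"
      by cases (rule ext_V[OF bt_mult[OF b(2) bY] bt_mult[OF bX b(2)]],
        simp add: mult.assoc rV X Y cs_left[of r] power_add[symmetric])+
  qed
  have Hs: "H GK ?Z ?Y s" unfolding H_def Z(2) Y(2)
  proof (intro conjI ballI b)
    fix g assume "g \<in> GK"
    then consider "g = DK" | "g = DZ" by auto
    then show "s * ac ?Z g = ac ?Y g * s"
      by cases (rule ext_V[OF bt_mult[OF b(4) bZ] bt_mult[OF bY b(4)]], simp add: mult.assoc sV Y Z cs_left[of s])+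
  qed
  have "r * u = un ?m" by (rule ext_V[OF bt_mult[OF b(2,1)] bt_un]) (simp_all add: mult.assoc uV rV bt_unl[OF bt_V(1)])
  moreover have "v * s = un n" by (rule ext_V[OF bt_mult[OF b(3,4)] bt_un]) (simp_all add: mult.assoc sV vV bt_unl[OF bt_V(1)])
  moreover have "u * r + s * v = un d"
  proof (rule ext_V[of d d])
    show "bt d d (u * r + s * v)" using b by auto
    fix i show "(u * r + s * v) * V d i = un d * V d i"
      by (cases "i < n") (auto simp: distrib_right mult.assoc rV uV vV sV bt_unl[OF bt_V(1)] V_out)
  qed auto
  ultimately have "ses ?X ?Y ?Z u v" unfolding ses_def X(2) Y(2) Z(2) using X(1) Y(1) Z(1) Hu Hv Hr Hs by blast
  then show "\<exists>u v. ses ?X ?Y ?Z u v" by blast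
qed

text \<open>The sums are \<open>d\<close> times the projections of \<open>y\<close> to the
  eigenspaces of \<open>k\<close>. Over all \<open>b\<close> they add up to \<open>d\<close> times
  \<open>y\<close>, so one of them is nonzero.\<close>

lemma eigenvector:
  assumes y: "k ^ d * y = y" "y \<noteq> 0"
  shows "\<exists>b<d. (\<Sum>a<d. cs ((1 / \<zeta>) ^ (b * a)) * (k ^ a * y)) \<noteq> 0 \<and>
    k * (\<Sum>a<d. cs ((1 / \<zeta>) ^ (b * a)) * (k ^ a * y)) = cs (\<zeta> ^ b) * (\<Sum>a<d. cs ((1 / \<zeta>) ^ (b * a)) * (k ^ a * y))"
proof -
  define p where "p b = (\<Sum>a<d. cs ((1 / \<zeta>) ^ (b * a)) * (k ^ a * y))" for b
  have "(\<Sum>b<d. p b) = (\<Sum>a<d. cs (\<Sum>b<d. (1 / \<zeta>) ^ (b * a)) * (k ^ a * y))"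
    unfolding p_def by (subst sum.swap) (simp add: cs_sum sum_distrib_right)
  also have "\<dots> = (\<Sum>a<d. if a = 0 then cs (of_nat d) * y else 0)"
  proof (intro sum.cong refl)
    fix a assume a: "a \<in> {..<d}"
    show "cs (\<Sum>b<d. (1 / \<zeta>) ^ (b * a)) * (k ^ a * y) = (if a = 0 then cs (of_nat d) * y else 0)"
    proof (cases "a = 0")
      case False
      have z1: "(1 / \<zeta>) ^ a \<noteq> 1" using prim a False by (auto simp: power_divide)
      have "((1 / \<zeta>) ^ a) ^ d = (1 / \<zeta> ^ d) ^ a" by (simp add: power_mult[symmetric] power_divide mult.commute)
      then have "(\<Sum>b<d. ((1 / \<zeta>) ^ a) ^ b) = 0" using geometric_sum[OF z1, of d] zd by simp
      then have "(\<Sum>b<d. (1 / \<zeta>) ^ (b * a)) = 0" by (simp add: power_mult[symmetric] mult.commute)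
      then show ?thesis using False by simp
    qed simp
  qed
  also have "\<dots> = cs (of_nat d) * y" using d0 by simp
  finally have sp: "(\<Sum>b<d. p b) = cs (of_nat d) * y" .
  have "cs (of_nat d) * y \<noteq> 0"
  proof
    assume "cs (of_nat d) * y = 0"
    then have "cs (1 / of_nat d) * (cs (of_nat d) * y) = 0" by simp
    then show False using y d0 by (simp add: cs_cs)
  qed
  then obtain b where b: "b < d" "p b \<noteq> 0" using sp by (metis (no_types, lifting) lessThan_iff sum.neutral)
  define g where "g a = cs ((1 / \<zeta>) ^ (b * a)) * (k ^ a * y)" for a
  have "k * g a = cs (\<zeta> ^ b) * g (Suc a)" for a
    using z0 by (simp add: g_def cs_left[of k] cs_cs mult.assoc power_add power_divide)
  then have "k * (\<Sum>a<d. g a) = cs (\<zeta> ^ b) * (\<Sum>a<d. g (Suc a))" by (simp add: sum_distrib_left)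
  moreover have "(\<Sum>a<d. g (Suc a)) + g 0 = (\<Sum>a<d. g a) + g d"
    using sum.lessThan_Suc_shift[of g d] by (simp add: add.commute)
  moreover have "g d = g 0"
  proof -
    have "(1 / \<zeta>) ^ (b * d) = (1 / \<zeta> ^ d) ^ b" by (simp add: power_mult[symmetric] power_divide mult.commute)
    then show ?thesis using y zd by (simp add: g_def)
  qed
  ultimately have "k * p b = cs (\<zeta> ^ b) * p b" by (simp add: p_def g_def)
  then show ?thesis using b unfolding p_def by blast
qed

text \<open>The last nonzero power of \<open>F\<close> applied to a vector gives one killed by
  \<open>F\<close>. Projecting it to an eigenspace of \<open>K\<close> and then of \<open>z\<close>
  keeps what was gained, since \<open>K\<close> commutes with \<open>F\<close> up to a scalar and
  \<open>z\<close> commutes with both.\<close>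

lemma lowest_weight_vector:
  assumes X: "X \<in> C" "vdim X > 0"
  shows "\<exists>y b s. b < d \<and> s < d \<and> bt (vdim X) 1 y \<and> y \<noteq> 0 \<and> ac X DF * y = 0 \<and> ac X DK * y = cs (\<zeta> ^ b) * y \<and> ac X DZ * y = cs (\<zeta> ^ s) * y"
proof -
  let ?y0 = "eu 0 0"
  have y0: "bt (vdim X) 1 ?y0" "?y0 \<noteq> 0"
    using X(2) by (auto, metis ent_0 ent_eu zero_neq_one)
  have bX: "bt (vdim X) (vdim X) (ac X g)" for g using bt_ac[OF C_wf[OF X(1)]] .
  define m where "m = (LEAST m. ac X DF ^ m * ?y0 = 0)"
  have "ac X DF ^ d * ?y0 = 0" using C_rel(2)[OF X(1)] by simp
  then have m: "ac X DF ^ m * ?y0 = 0" unfolding m_def by (rule LeastI)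
  then have m0: "m > 0" using y0 by (cases m) auto
  define y1 where "y1 = ac X DF ^ (m - 1) * ?y0"
  have y1: "y1 \<noteq> 0" unfolding y1_def using m0 not_less_Least[of "m - 1" "\<lambda>m. ac X DF ^ m * ?y0 = 0"] by (auto simp: m_def)
  have F1: "ac X DF * y1 = 0" using m m0 by (simp add: y1_def mult.assoc[symmetric] power_eq_if)
  have b1: "bt (vdim X) 1 y1" unfolding y1_def by (intro bt_powl bX y0)
  have kd: "ac X DK ^ d * y = y" "ac X DZ ^ d * y = y" if "bt (vdim X) 1 y" for y
    using that by (simp_all add: gm_right_kz[OF X(1)] bt_def)
  obtain b where b: "b < d" "(\<Sum>a<d. cs ((1 / \<zeta>) ^ (b * a)) * (ac X DK ^ a * y1)) \<noteq> 0"
    "ac X DK * (\<Sum>a<d. cs ((1 / \<zeta>) ^ (b * a)) * (ac X DK ^ a * y1)) = cs (\<zeta> ^ b) * (\<Sum>a<d. cs ((1 / \<zeta>) ^ (b * a)) * (ac X DK ^ a * y1))"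
    using eigenvector[OF kd(1)[OF b1] y1] by blast
  define y2 where "y2 = (\<Sum>a<d. cs ((1 / \<zeta>) ^ (b * a)) * (ac X DK ^ a * y1))"
  have b2: "bt (vdim X) 1 y2" unfolding y2_def by (intro bt_sum bt_cs bt_powl bX b1)
  have fk: "ac X DF * (ac X DK ^ a * y1) = 0" for a
  proof -
    have "ac X DK ^ a * (ac X DF * y1) = cs (inverse \<zeta> ^ a) * (ac X DF * (ac X DK ^ a * y1))"
      using cs_pow_comm[OF C_rel(6)[OF X(1)], of a] by (simp add: mult.assoc[symmetric])
    then have "cs (inverse \<zeta> ^ a) * (ac X DF * (ac X DK ^ a * y1)) = 0" using F1 by simp
    then have "cs (\<zeta> ^ a) * (cs (inverse \<zeta> ^ a) * (ac X DF * (ac X DK ^ a * y1))) = 0" by simp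
    then show ?thesis using z0 by (simp add: cs_cs power_mult_distrib[symmetric])
  qed
  have F2: "ac X DF * y2 = 0" unfolding y2_def by (simp add: sum_distrib_left cs_left[of "ac X DF"] fk)
  obtain s where s: "s < d" "(\<Sum>a<d. cs ((1 / \<zeta>) ^ (s * a)) * (ac X DZ ^ a * y2)) \<noteq> 0"
    "ac X DZ * (\<Sum>a<d. cs ((1 / \<zeta>) ^ (s * a)) * (ac X DZ ^ a * y2)) = cs (\<zeta> ^ s) * (\<Sum>a<d. cs ((1 / \<zeta>) ^ (s * a)) * (ac X DZ ^ a * y2))"
    using eigenvector[OF kd(2)[OF b2] b(2)[folded y2_def]] by blast
  define y3 where "y3 = (\<Sum>a<d. cs ((1 / \<zeta>) ^ (s * a)) * (ac X DZ ^ a * y2))"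
  have b3: "bt (vdim X) 1 y3" unfolding y3_def by (intro bt_sum bt_cs bt_powl bX b2)
  have zc: "T * (ac X DZ ^ a * y2) = cs t * (ac X DZ ^ a * y2)" if "ac X DZ * T = T * ac X DZ" "T * y2 = cs t * y2" for T a t
  proof -
    have "ac X DZ ^ a * T = T * ac X DZ ^ a" using that(1) by (metis power_commuting_commutes)
    then have "T * (ac X DZ ^ a * y2) = ac X DZ ^ a * (T * y2)" by (simp add: mult.assoc[symmetric])
    then show ?thesis by (simp add: that(2) cs_left[of "ac X DZ ^ a"])
  qed
  have "ac X DF * y3 = 0" unfolding y3_def
    using zc[of "ac X DF" 0] C_rel(4)[OF X(1)] F2 by (simp add: sum_distrib_left cs_left[of "ac X DF"])
  moreover have "ac X DK * y3 = cs (\<zeta> ^ b) * y3" unfolding y3_def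
    using zc[of "ac X DK" "\<zeta> ^ b"] gm_right_kz(3)[OF X(1)] b(3)[folded y2_def]
    by (simp add: sum_distrib_left cs_left[of "ac X DK"] cs_cs mult.commute)
  ultimately show ?thesis using b(1) s b3 unfolding y3_def by blast
qed

text \<open>A lowest weight vector \<open>y\<close> generates a submodule with basis
  \<open>E^i y\<close> for \<open>i < n\<close>, where \<open>n\<close> is the least exponent with
  \<open>E ^ n * y = 0\<close>.\<close>

lemma lw_submodule:
  assumes X: "X \<in> C" "vdim X > 0"
  shows "\<exists>n b s u Z v. 0 < n \<and> lw_ok n (\<zeta> ^ b) (\<zeta> ^ s) \<and> b < d \<and> ses (lw n (\<zeta> ^ b) (\<zeta> ^ s)) X Z u v"
proof -
  obtain y b s where b: "b < d" "s < d" "bt (vdim X) 1 y" "y \<noteq> 0" "ac X DF * y = 0"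
    "ac X DK * y = cs (\<zeta> ^ b) * y" "ac X DZ * y = cs (\<zeta> ^ s) * y"
    using lowest_weight_vector[OF X] by blast
  let ?E = "ac X DE" and ?F = "ac X DF"
  have bX: "bt (vdim X) (vdim X) (ac X g)" for g using bt_ac[OF C_wf[OF X(1)]] .
  define n where "n = (LEAST n. ?E ^ n * y = 0)"
  have Ed: "?E ^ d * y = 0" using C_rel(1)[OF X(1)] by simp
  then have n: "?E ^ n * y = 0" "n \<le> d" unfolding n_def by (rule LeastI, rule Least_le)
  then have n0: "n > 0" using b by (cases n) auto
  have ne: "?E ^ (n - 1) * y \<noteq> 0" using n0 not_less_Least[of "n - 1" "\<lambda>n. ?E ^ n * y = 0"] by (auto simp: n_def)
  have Eout: "?E ^ i * y = 0" if "n \<le> i" for i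
  proof -
    have "?E ^ i * y = ?E ^ (i - n) * (?E ^ n * y)" using that by (simp add: mult.assoc[symmetric] power_add[symmetric])
    then show ?thesis using n by simp
  qed
  interpret U: uq \<zeta> ?E ?F "ac X DK" "ac X DZ * ac X DK ^ (d - 1)" by (rule isD_uq[OF C_isM[OF X(1)]])
  let ?k = "\<zeta> ^ b" and ?o = "\<zeta> ^ s"
  have kr: "?k ^ d = 1" "?o ^ d = 1" using zeta_pow_eq_1_iff[of "b * d"] zeta_pow_eq_1_iff[of "s * d"] by (simp_all add: power_mult)
  have k'y: "ac X DZ * ac X DK ^ (d - 1) * y = cs (?o / ?k) * y"
  proof -
    have "ac X DK ^ (d - 1) * y = cs (?k ^ (d - 1)) * y" using cs_pow_comm[of "ac X DK" y ?k 1 "d - 1"] b by simp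
    then show ?thesis using b by (simp add: mult.assoc root_facts(2)[OF kr(1), simplified] cs_left[of "ac X DZ"] cs_cs)
  qed
  have cy: "U.c m * y = cs (gam ?k ?o m) * y" for m
    unfolding U.c_def gam_def by (simp only: sum_distrib_right left_diff_distrib mult.assoc[of "cs _"] b k'y cs_cs cs_sum cs_diff)
      (simp add: mult.commute)
  have FE: "?F * (?E ^ Suc i * y) = cs (- gam ?k ?o (Suc i)) * (?E ^ i * y)" for i
  proof -
    have "?F * (?E ^ Suc i * y) = (?F * ?E ^ Suc i) * y" by (simp only: mult.assoc)
    also have "\<dots> = - (?E ^ i * (U.c (Suc i) * y))" unfolding U.f_e_pow by (simp add: left_diff_distrib mult.assoc b)
    finally show ?thesis unfolding cy by (simp add: cs_minus cs_left[of "?E ^ i"])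
  qed
  \<comment> \<open>\<open>F\<close> applied to \<open>E ^ n * y = 0\<close> gives the nonzero
    vector \<open>E ^ (n - 1) * y\<close> with the factor \<open>- gam ?k ?o n\<close>, which must
    therefore vanish.\<close>
  have "gam ?k ?o n = 0"
  proof (rule ccontr)
    assume g: "gam ?k ?o n \<noteq> 0"
    obtain n' where n': "n = Suc n'" using n0 by (cases n) auto
    have "cs (- gam ?k ?o n) * (?E ^ n' * y) = 0" using FE[of n'] n by (simp add: n'[symmetric])
    then have "cs (1 / (- gam ?k ?o n)) * (cs (- gam ?k ?o n) * (?E ^ n' * y)) = 0" by simp
    then show False using ne n' g by (simp add: cs_cs)
  qed
  then have ok: "lw_ok n ?k ?o" using n kr by (simp add: lw_ok_def)
  note M = lw[OF ok] and MP = lw_pow[OF ok]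
  let ?M = "lw n ?k ?o"
  define T where "T = vop n (\<lambda>i. ?E ^ i * y)"
  have ye: "?E ^ i * y * eu 0 0 = ?E ^ i * y" for i
  proof -
    have "un 1 = eu 0 0" using un_Suc[of 0] by simp
    then show ?thesis using bt_unr[OF b(3)] by (simp add: mult.assoc)
  qed
  have TV: "T * V n i = ?E ^ i * y" for i by (simp add: T_def vop_V ye Eout)
  have bT: "bt (vdim X) n T" unfolding T_def by (intro bt_vop bt_powl bX b)
  have bM: "bt n n (ac ?M g)" for g using bt_ac[OF C_wf[OF M(1)], of g] M(2) by simp
  have HT: "H UNIV ?M X T" unfolding H_def M(2)
  proof (intro conjI ballI bT)
    fix g show "T * ac ?M g = ac X g * T"
    proof (rule ext_V[OF bt_mult[OF bT bM] bt_mult[OF bX bT]])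
      fix i show "T * ac ?M g * V n i = ac X g * T * V n i"
      proof (cases g)
        case DE then show ?thesis by (simp add: mult.assoc TV M)
      next
        case DF then show ?thesis by (cases i) (simp_all only: mult.assoc TV M FE cs_left[of T], simp_all add: b)
      next
        case DK
        have "ac X DK * (?E ^ i * y) = cs (?k * \<zeta> ^ i) * (?E ^ i * y)"
          using cs_comm_pow[OF C_rel(5)[OF X(1)], of i] b
          by (simp add: mult.assoc[symmetric]) (simp add: mult.assoc cs_left[of "?E ^ i"] cs_cs mult.commute)
        then show ?thesis using DK by (simp add: mult.assoc TV M cs_left[of T])
      next
        case DZ
        have "ac X DZ * (?E ^ i * y) = cs ?o * (?E ^ i * y)"
        proof -
          have "?E ^ i * ac X DZ = ac X DZ * ?E ^ i" using C_rel(3)[OF X(1)] by (metis power_commuting_commutes)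
          then have "ac X DZ * (?E ^ i * y) = ?E ^ i * (ac X DZ * y)" by (simp add: mult.assoc[symmetric])
          then show ?thesis by (simp add: b cs_left[of "?E ^ i"])
        qed
        then show ?thesis using DZ by (simp add: mult.assoc TV M cs_left[of T])
      qed
    qed
  qed
  have "\<exists>R. bt n (vdim X) R \<and> R * T = un n"
  proof (rule left_inverse_if_cancel[OF bT])
    fix N assume N: "bt n n N" "T * N = 0"
    show "N = 0"
    proof (rule ccontr)
      assume "N \<noteq> 0"
      then obtain i j where ij: "i < n" "j < n" "ent N i j \<noteq> 0" using lop_eqI[OF N(1) bt_zero] by (auto simp: ent_0)
      \<comment> \<open>The lowest nonzero coefficient in column \<open>j\<close> of
        \<open>N\<close>. Raising by \<open>E ^ (n - 1 - i0)\<close> pushes all higher terms past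
        the end and leaves a nonzero multiple of the top vector, which \<open>T\<close> does not
        kill.\<close>
      define i0 where "i0 = (LEAST i. ent N i j \<noteq> 0)"
      have i0: "ent N i0 j \<noteq> 0" "i0 \<le> i" unfolding i0_def using LeastI[of "\<lambda>i. ent N i j \<noteq> 0" i] Least_le[of "\<lambda>i. ent N i j \<noteq> 0" i] ij by simp_all
      have low: "ent N k j = 0" if "k < i0" for k using that not_less_Least unfolding i0_def by blast
      have "N * eu j 0 = (\<Sum>k<n. cs (ent N k j) * V n k)"
      proof (rule lop_eqI[of n 1])
        show "bt n 1 (N * eu j 0)" using N ij by auto
        show "bt n 1 (\<Sum>k<n. cs (ent N k j) * V n k)" by (intro bt_sum bt_cs bt_V)
        fix a c assume "a < n" "c < (1::nat)"
        then show "ent (N * eu j 0) a c = ent (\<Sum>k<n. cs (ent N k j) * V n k) a c"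
          unfolding ent_sum ent_cs V_def by (simp add: ent_mult_eu ent_eu if_distrib cong: if_cong)
      qed
      then have "ac ?M DE ^ (n - 1 - i0) * (N * eu j 0) = (\<Sum>k<n. cs (ent N k j) * V n (k + (n - 1 - i0)))"
        by (simp add: sum_distrib_left cs_left[of "ac ?M DE ^ (n - Suc i0)"] MP)
      also have "\<dots> = (\<Sum>k<n. if k = i0 then cs (ent N i0 j) * V n (n - 1) else 0)"
      proof (intro sum.cong refl)
        fix k assume "k \<in> {..<n}"
        consider "k < i0" | "k = i0" | "k > i0" by linarith
        then show "cs (ent N k j) * V n (k + (n - 1 - i0)) = (if k = i0 then cs (ent N i0 j) * V n (n - 1) else 0)"
          using low i0 ij by cases (auto simp: V_out)
      qed
      also have "\<dots> = cs (ent N i0 j) * V n (n - 1)" using i0 ij by simp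
      finally have "T * (ac ?M DE ^ (n - 1 - i0) * (N * eu j 0)) = T * (cs (ent N i0 j) * V n (n - 1))" by simp
      then have "T * (ac ?M DE ^ (n - 1 - i0) * (N * eu j 0)) = cs (ent N i0 j) * (?E ^ (n - 1) * y)" by (simp only: cs_left[of T] TV)
      moreover have "T * (ac ?M DE ^ (n - 1 - i0) * (N * eu j 0)) = ?E ^ (n - 1 - i0) * ((T * N) * eu j 0)"
        using H_pow[OF HT, of DE "n - 1 - i0"] by (simp add: mult.assoc[symmetric])
      ultimately have "cs (ent N i0 j) * (?E ^ (n - 1) * y) = 0" using N by simp
      then have "cs (1 / ent N i0 j) * (cs (ent N i0 j) * (?E ^ (n - 1) * y)) = 0" by simp
      then show False using i0 ne by (simp add: cs_cs)
    qed
  qed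
  then have "mono ?M X T" unfolding mono_def using retraction_gm[OF M(1) X(1) HT] M HT X(1) by auto
  then obtain Z v where "ses ?M X Z T v" using cokernel_ex by blast
  then show ?thesis using n0 ok b(1) by blast
qed

end

text \<open>The summands are taken in pairs, one orbit of the fixed point free involution
  \<open>\<tau>\<close> at a time.\<close>

lemma sum_involution:
  fixes f :: "'a \<Rightarrow> 'b::ab_group_add"
  assumes S: "finite S" "\<And>x. x \<in> S \<Longrightarrow> \<tau> x \<in> S \<and> \<tau> (\<tau> x) = x \<and> \<tau> x \<noteq> x"
    and W: "0 \<in> W" "\<And>x y. x \<in> W \<Longrightarrow> y \<in> W \<Longrightarrow> x + y \<in> W" and f: "\<And>x. x \<in> S \<Longrightarrow> f x + f (\<tau> x) \<in> W"
  shows "sum f S \<in> W"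
  using S f
proof (induction "card S" arbitrary: S rule: less_induct)
  case less
  show ?case
  proof (cases "S = {}")
    case False
    then obtain x where x: "x \<in> S" by blast
    let ?S = "S - {x, \<tau> x}"
    have i: "\<tau> x \<in> S" "\<tau> (\<tau> x) = x" "\<tau> x \<noteq> x" using less.prems(2)[OF x] by auto
    have "card ?S < card S" using x less.prems(1) by (intro psubset_card_mono) auto
    moreover have "\<tau> y \<in> ?S \<and> \<tau> (\<tau> y) = y \<and> \<tau> y \<noteq> y" if "y \<in> ?S" for y
    proof -
      have "\<tau> y \<in> S" "\<tau> (\<tau> y) = y" "\<tau> y \<noteq> y" using less.prems(2)[of y] that by auto
      moreover have "\<tau> y \<noteq> x" "\<tau> y \<noteq> \<tau> x" using calculation(2) i(2) that by auto
      ultimately show ?thesis by simp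
    qed
    ultimately have r: "sum f ?S \<in> W" using less.hyps[of ?S] less.prems by simp
    have "sum f S = f x + sum f (S - {x})" using less.prems(1) x by (rule sum.remove)
    also have "sum f (S - {x}) = f (\<tau> x) + sum f (S - {x} - {\<tau> x})" using less.prems(1) i by (intro sum.remove) auto
    also have "S - {x} - {\<tau> x} = ?S" by blast
    finally show ?thesis using W(2)[OF less.prems(3)[OF x] r] by (simp add: add.assoc)
  qed (simp add: W)
qed

context dbl begin

section \<open>Standard modules of length less than \<open>d\<close>, their duality and their
  traces\<close>

definition weights :: "(nat \<times> nat) set" where "weights = {1..<d} \<times> {0..<d}"

text \<open>For length below \<open>d\<close> the value of \<open>z\<close> is forced by the lowest
  weight: \<open>lw_ok_iff\<close> gives \<open>\<omega> = \<kappa>^2 * \<zeta>^(n-1)\<close>, hence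
  the exponent \<open>2 * b + n - 1\<close>.\<close>

definition std :: "nat \<times> nat \<Rightarrow> double_gen fdmod" where
  "std = (\<lambda>(n, b). lw n (\<zeta> ^ b) (\<zeta> ^ (2 * b + n - 1)))"

text \<open>The parameters of the submodule in \<open>lw_ses\<close>: length \<open>d - n\<close>
  and lowest weight \<open>\<zeta> ^ (b + n)\<close>.\<close>

definition dual :: "nat \<times> nat \<Rightarrow> nat \<times> nat" where "dual = (\<lambda>(n, b). (d - n, (b + n) mod d))"

lemma finite_weights: "finite weights" by (simp add: weights_def)

lemma zeta_mod: "\<zeta> ^ (m mod d) = \<zeta> ^ m"
proof -
  have "\<zeta> ^ m = \<zeta> ^ (d * (m div d) + m mod d)" by simp
  also have "\<dots> = \<zeta> ^ (m mod d)" by (simp only: power_add power_mult zd power_one mult_1_left)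
  finally show ?thesis by simp
qed

lemma zeta_eq_iff: "\<zeta> ^ a = \<zeta> ^ b \<longleftrightarrow> a mod d = b mod d"
proof -
  have *: "a mod d = b mod d" if "\<zeta> ^ a = \<zeta> ^ b" "a mod d \<le> b mod d" for a b
  proof -
    have "\<zeta> ^ (b mod d) = \<zeta> ^ (a mod d) * \<zeta> ^ (b mod d - a mod d)" using that by (simp add: power_add[symmetric])
    then have "\<zeta> ^ (b mod d - a mod d) = 1" using that z0 by (simp add: zeta_mod)
    then have "d dvd b mod d - a mod d" by (simp add: zeta_pow_eq_1_iff)
    moreover have "b mod d - a mod d < d" using d0 by (meson less_imp_diff_less mod_less_divisor)
    ultimately show ?thesis using that(2) by (auto dest!: dvd_imp_le)
  qed
  show ?thesis using *[of a b] *[of b a] zeta_mod[of a] zeta_mod[of b] by (metis nle_le)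
qed

text \<open>Reversing one geometric sum factors \<open>gam \<kappa> \<omega> n\<close> as
  \<open>S * (\<kappa> * \<zeta> ^ (n - 1) - \<omega> / \<kappa>)\<close>, and \<open>S\<close> is
  nonzero because \<open>0 < n < d\<close>.\<close>

lemma lw_ok_iff:
  assumes n: "0 < n" "n < d" and k: "\<kappa> ^ d = 1"
  shows "lw_ok n \<kappa> \<omega> \<longleftrightarrow> \<omega> = \<kappa>\<^sup>2 * \<zeta> ^ (n - 1)"
proof -
  define S where "S = (\<Sum>a<n. (1 / \<zeta>) ^ a)"
  have k0: "\<kappa> \<noteq> 0" using root_facts[OF k] by simp
  have r: "(\<Sum>a<n. \<zeta> ^ a) = \<zeta> ^ (n - 1) * S"
  proof -
    have "(\<Sum>a<n. \<zeta> ^ a) = (\<Sum>a<n. \<zeta> ^ (n - Suc a))" by (rule sum.nat_diff_reindex[symmetric])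
    also have "\<dots> = (\<Sum>a<n. \<zeta> ^ (n - 1) * (1 / \<zeta>) ^ a)"
    proof (rule sum.cong[OF refl])
      fix a assume "a \<in> {..<n}"
      then have "\<zeta> ^ (n - 1) = \<zeta> ^ (n - Suc a) * \<zeta> ^ a" by (simp add: power_add[symmetric])
      then show "\<zeta> ^ (n - Suc a) = \<zeta> ^ (n - 1) * (1 / \<zeta>) ^ a" using z0 by (simp add: power_divide)
    qed
    finally show ?thesis by (simp add: S_def sum_distrib_left)
  qed
  have "\<zeta> ^ n \<noteq> 1" using zeta_pow_eq_1_iff[of n] n by (auto dest: dvd_imp_le)
  then have "(\<Sum>a<n. \<zeta> ^ a) \<noteq> 0" using geometric_sum[OF zeta_ne_1, of n] zeta_ne_1 by auto
  then have S0: "S \<noteq> 0" using r by auto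
  have "gam \<kappa> \<omega> n = S * (\<kappa> * \<zeta> ^ (n - 1) - \<omega> / \<kappa>)" unfolding gam_closed r S_def[symmetric] by (simp add: algebra_simps)
  then have "gam \<kappa> \<omega> n = 0 \<longleftrightarrow> \<omega> = \<kappa>\<^sup>2 * \<zeta> ^ (n - 1)" using S0 k0 by (auto simp: field_simps power2_eq_square)
  moreover have "(\<kappa>\<^sup>2 * \<zeta> ^ (n - 1)) ^ d = 1"
    by (rule kz_root) (simp add: power_mult[symmetric] mult.commute[of 2], simp add: power_mult k)
  ultimately show ?thesis using n k by (auto simp: lw_ok_def)
qed

lemma zeta_root: "(\<zeta> ^ b) ^ d = 1" using zeta_pow_eq_1_iff[of "b * d"] by (simp add: power_mult)

lemma lw_ok_std: "(n, b) \<in> weights \<Longrightarrow> lw_ok n (\<zeta> ^ b) (\<zeta> ^ (2 * b + n - 1))"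
  by (subst lw_ok_iff[OF _ _ zeta_root]) (auto simp: weights_def power_mult[symmetric] power_add[symmetric] mult.commute add.commute)

lemma lw_std: "0 < n \<Longrightarrow> n < d \<Longrightarrow> lw_ok n (\<zeta> ^ b) \<omega> \<Longrightarrow> lw n (\<zeta> ^ b) \<omega> = std (n, b mod d)"
proof -
  assume n: "0 < n" "n < d" "lw_ok n (\<zeta> ^ b) \<omega>"
  have "\<omega> = (\<zeta> ^ (b mod d))\<^sup>2 * \<zeta> ^ (n - 1)" using lw_ok_iff[OF n(1,2) zeta_root] n(3) by (simp add: zeta_mod)
  also have "\<dots> = \<zeta> ^ (2 * (b mod d) + n - 1)" using n(1) by (simp add: power_mult[symmetric] power_add[symmetric] mult.commute add.commute)
  finally show ?thesis by (simp add: std_def zeta_mod)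
qed

lemma std_C: "y \<in> weights \<Longrightarrow> std y \<in> C"
  using lw(1)[OF lw_ok_std] by (cases y) (auto simp: std_def)

lemma ch_std: "(n, b) \<in> weights \<Longrightarrow> ch l p (std (n, b)) = (\<Sum>i<n. \<zeta> ^ ((2 * b + n - 1) * p + b * l + l * i))"
  using ch_lw[OF lw_ok_std] by (simp add: std_def sum_distrib_left power_add power_mult)

text \<open>A fixed point would need \<open>n = d - n\<close> and \<open>d\<close> dividing
  \<open>n\<close>, impossible for \<open>0 < n < d\<close>. This is what
  \<open>sum_involution\<close> requires.\<close>

lemma dual_weights: assumes "y \<in> weights" shows "dual y \<in> weights" "dual (dual y) = y" "dual y \<noteq> y"
proof -
  obtain n b where y: "y = (n, b)" "0 < n" "n < d" "b < d" using assms by (cases y) (auto simp: weights_def)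
  show "dual y \<in> weights" using y by (auto simp: dual_def weights_def)
  have "((b + n) mod d + (d - n)) mod d = (b + n + (d - n)) mod d" by (rule mod_add_left_eq)
  then show "dual (dual y) = y" using y by (simp add: dual_def)
  show "dual y \<noteq> y"
  proof
    assume "dual y = y"
    then have "d = n + n" "(b + n) mod d = b mod d" using y by (auto simp: dual_def)
    then have "d dvd n" by (metis add_diff_cancel_left' le_add1 mod_eq_dvd_iff_nat)
    then show False using y by (auto dest: dvd_imp_le)
  qed
qed

lemma std_dual_ses:
  assumes y: "y \<in> weights" shows "\<exists>P u v. P \<in> proj_B d \<zeta> \<and> ses (std (dual y)) P (std y) u v"
proof -
  obtain n b where e: "y = (n, b)" "0 < n" "n < d" "b < d" using y by (cases y) (auto simp: weights_def)
  have ok: "lw_ok n (\<zeta> ^ b) (\<zeta> ^ (2 * b + n - 1))" using lw_ok_std y e by blast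
  note s = lw_ses[OF ok]
  have nd: "n \<le> d" "0 < d - n" "d - n < d" using e by auto
  have "std (dual y) = lw (d - n) (\<zeta> ^ b * \<zeta> ^ n) (\<zeta> ^ (2 * b + n - 1))"
    using lw_std[OF nd(2,3), of "b + n" "\<zeta> ^ (2 * b + n - 1)"] s(2)[OF nd(1)] by (simp add: e dual_def power_add)
  moreover have "std y = lw n (\<zeta> ^ b) (\<zeta> ^ (2 * b + n - 1))" by (simp add: e std_def)
  ultimately show ?thesis using s(1)[OF nd(1)] lw_projective[OF s(3)[OF nd(1)]] by metis
qed

lemma ch_00: "ch 0 0 X = of_nat (vdim X)" by (simp add: ch_def tr_un)

lemma ses_vdim: "ses X Y Z u v \<Longrightarrow> vdim Y = vdim X + vdim Z"
  using ch_ses[of X Y Z u v 0 0] by (simp add: ch_00 del: of_nat_add add: of_nat_add[symmetric])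

lemma zero_dim_proj: assumes X: "X \<in> C" "vdim X = 0" shows "X \<in> proj_B d \<zeta>"
proof -
  have "gw X X 0" by (simp add: gw_def X)
  moreover have "idn X = TrE X X 0" by (simp add: X TrE_def trp_def)
  ultimately show ?thesis unfolding proj_B_iff nE_def using X by blast
qed

text \<open>By dimension, splitting off a lowest weight submodule: it is standard if its length is
  below \<open>d\<close>, and projective over \<open>B\<close> if the length is
  \<open>d\<close>.\<close>

lemma module_induct [consumes 1, case_names std proj ses]:
  assumes X: "X \<in> C"
    and std: "\<And>y. y \<in> weights \<Longrightarrow> Q (std y)" and proj: "\<And>M. M \<in> proj_B d \<zeta> \<Longrightarrow> Q M"
    and ses: "\<And>X Y Z u v. ses X Y Z u v \<Longrightarrow> Q X \<Longrightarrow> Q Z \<Longrightarrow> Q Y"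
  shows "Q X"
  using X
proof (induction "vdim X" arbitrary: X rule: less_induct)
  case less
  show ?case
  proof (cases "vdim X = 0")
    case True then show ?thesis using proj zero_dim_proj less.prems by blast
  next
    case False
    then obtain n b s u Z v where n: "0 < n" "lw_ok n (\<zeta> ^ b) (\<zeta> ^ s)" "b < d" "ses (lw n (\<zeta> ^ b) (\<zeta> ^ s)) X Z u v"
      using lw_submodule less.prems by blast
    have "n \<le> d" using n(2) by (simp add: lw_ok_def)
    have "Q (lw n (\<zeta> ^ b) (\<zeta> ^ s))"
    proof (cases "n = d")
      case True then show ?thesis using n(2) proj lw_projective by blast
    next
      case False
      then have "n < d" using \<open>n \<le> d\<close> by simp
      then show ?thesis using lw_std[OF n(1) _ n(2)] n std[of "(n, b)"] by (simp add: weights_def)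
    qed
    moreover have "vdim Z < vdim X" using ses_vdim[OF n(4)] lw(2)[OF n(2)] n(1) by simp
    moreover have "Z \<in> C" using n(4) by (auto simp: ses_def H_def)
    ultimately show ?thesis using ses[OF n(4)] less.hyps by blast
  qed
qed

text \<open>In the triangle with two zero modules and \<open>M\<close>, additivity of the trace
  leaves \<open>ch l p M = 0\<close>.\<close>

lemma ch_proj: assumes M: "M \<in> proj_B d \<zeta>" and l: "0 < l" "l < d" shows "ch l p M = 0"
  using stB_zero[OF M] stB_ch[OF _ l] by fastforce

text \<open>On a standard module the two sums differ by reversing the order of the weights,
  \<open>i\<close> against \<open>n - 1 - i\<close>. The other modules follow by additivity, those
  projective over \<open>B\<close> having trace 0.\<close>

lemma ch_iota:
  assumes X: "X \<in> C" and l: "0 < l" "l < d" shows "ch (d - l) ((p + l) mod d) X = ch l p X"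
  using X
proof (induction rule: module_induct)
  case (std y)
  obtain n b where e: "y = (n, b)" by (cases y)
  obtain m where m: "d = l + m" using l less_imp_add_positive by blast
  let ?s = "2 * b + n - 1"
  have "(\<Sum>i<n. \<zeta> ^ (?s * ((p + l) mod d) + b * (d - l) + (d - l) * i)) = (\<Sum>i<n. \<zeta> ^ (?s * p + b * l + l * (n - Suc i)))"
  proof (rule sum.cong[OF refl])
    fix i assume "i \<in> {..<n}"
    then obtain j where j: "n = Suc (i + j)" using less_imp_Suc_add by blast
    have "\<zeta> ^ (?s * ((p + l) mod d) + b * (d - l) + (d - l) * i) = \<zeta> ^ (?s * (p + l) + b * (d - l) + (d - l) * i)"
      by (simp only: zeta_eq_iff) (intro mod_add_cong mod_mult_right_eq refl)
    also have "?s * (p + l) + b * (d - l) + (d - l) * i = ?s * p + b * l + l * (n - Suc i) + d * (b + i)"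
      by (simp add: m j algebra_simps)
    finally show "\<zeta> ^ (?s * ((p + l) mod d) + b * (d - l) + (d - l) * i) = \<zeta> ^ (?s * p + b * l + l * (n - Suc i))"
      by (simp add: zeta_eq_iff)
  qed
  also have "\<dots> = (\<Sum>i<n. \<zeta> ^ (?s * p + b * l + l * i))"
    by (rule sum.nat_diff_reindex[of "\<lambda>i. \<zeta> ^ (?s * p + b * l + l * i)"])
  finally show ?case using std e by (simp add: ch_std)
next
  case (proj M) then show ?case using ch_proj l by simp
next
  case (ses X Y Z u v) then show ?case using ch_ses by metis
qed

text \<open>Exponents are natural numbers, so that \<open>(d - 1) * c\<close> plays the part of
  \<open>- c\<close>.\<close>

lemma dvd_shift: "d dvd a + (d - 1) * c \<longleftrightarrow> int d dvd int a - int c"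
proof -
  have "int (a + (d - 1) * c) = (int a - int c) + int d * int c" using d0 by (cases d) (simp_all add: algebra_simps)
  then have "int d dvd int (a + (d - 1) * c) \<longleftrightarrow> int d dvd int a - int c" by (simp only: dvd_add_times_triv_right_iff mult.commute[of "int d"])
  then show ?thesis by (simp only: int_dvd_int_iff)
qed

text \<open>The frequencies of \<open>std (n, b)\<close> are \<open>(2 * b + n - 1, b)\<close> and
  \<open>(2 * b + n - 1, b + n)\<close>. Modulo \<open>d\<close> the first one determines the
  weight, and the second one is the first one of the dual weight.\<close>

lemma weights_eq:
  assumes "(n, b) \<in> weights" "(n', b') \<in> weights"
  shows "int d dvd int (2 * b + n - 1) - int (2 * b' + n' - 1) \<and> int d dvd int b - int b' \<longleftrightarrow> (n, b) = (n', b')"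
    "int d dvd int (2 * b + n - 1) - int (2 * b' + n' - 1) \<and> int d dvd int (b + n) - int b' \<longleftrightarrow> (n, b) = dual (n', b')"
proof -
  have w: "0 < n" "n < d" "b < d" "0 < n'" "n' < d" "b' < d" using assms by (auto simp: weights_def)
  have s: "int (2 * b + n - 1) - int (2 * b' + n' - 1) = 2 * int b + int n - 2 * int b' - int n'" using w by (simp add: of_nat_diff)
  have small: "x = 0" if "int d dvd x" "\<bar>x\<bar> < int d" for x using that dvd_imp_le_int[of x "int d"] by force
  show "int d dvd int (2 * b + n - 1) - int (2 * b' + n' - 1) \<and> int d dvd int b - int b' \<longleftrightarrow> (n, b) = (n', b')"
    unfolding s
  proof
    assume a: "int d dvd 2 * int b + int n - 2 * int b' - int n' \<and> int d dvd int b - int b'"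
    then have "b = b'" using small[of "int b - int b'"] w by auto
    moreover have "n = n'" using small[of "int n - int n'"] a calculation w by auto
    ultimately show "(n, b) = (n', b')" by simp
  qed auto
  show "int d dvd int (2 * b + n - 1) - int (2 * b' + n' - 1) \<and> int d dvd int (b + n) - int b' \<longleftrightarrow> (n, b) = dual (n', b')"
    unfolding s
  proof
    assume a: "int d dvd 2 * int b + int n - 2 * int b' - int n' \<and> int d dvd int (b + n) - int b'"
    then have "int d dvd (2 * int b + int n - 2 * int b' - int n') - (int (b + n) - int b')" using dvd_diff by blast
    then have 1: "int d dvd int b - int (b' + n')" by (simp add: algebra_simps)
    then have "int b mod int d = int (b' + n') mod int d" by (simp only: mod_eq_dvd_iff)
    then have "int (b mod d) = int ((b' + n') mod d)" by (simp only: zmod_int)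
    then have b: "b = (b' + n') mod d" using w by (simp only: of_nat_eq_iff mod_less)
    have "int d dvd (int (b + n) - int b') - (int b - int (b' + n'))" using a 1 dvd_diff by blast
    then have "int d dvd int n + int n' - int d" by (simp add: algebra_simps)
    then have "n = d - n'" using small[of "int n + int n' - int d"] w by linarith
    then show "(n, b) = dual (n', b')" using b by (simp add: dual_def)
  next
    assume "(n, b) = dual (n', b')"
    then have e: "int n = int d - int n'" "b = (b' + n') mod d" using w by (auto simp: dual_def of_nat_diff)
    have b: "int b = int b' + int n' - int d * ((int b' + int n') div int d)"
      unfolding e(2) zmod_int of_nat_add by (simp add: minus_mult_div_eq_mod)
    define y where "y = (int b' + int n') div int d"
    have "2 * int b + int n - 2 * int b' - int n' = int d * (1 - 2 * y)" "int (b + n) - int b' = int d * (1 - y)"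
      unfolding of_nat_add b y_def[symmetric] e(1) by (simp_all add: algebra_simps)
    then show "int d dvd 2 * int b + int n - 2 * int b' - int n' \<and> int d dvd int (b + n) - int b'" by simp
  qed
qed

text \<open>Multiplied by \<open>\<zeta>\<^sup>l - 1\<close>, the trace of \<open>K\<^sup>l z\<^sup>p\<close> on \<open>std (n, b)\<close> becomes the difference of two characters of
  \<open>(\<int>/d)\<^sup>2\<close> in \<open>(l, p)\<close>. This also covers \<open>l = 0\<close>, so that Fourier inversion applies.\<close>

lemma fourier:
  assumes x: "\<And>l p. 0 < l \<Longrightarrow> l < d \<Longrightarrow> p < d \<Longrightarrow> (\<Sum>y\<in>weights. x y * ch l p (std y)) = 0" and w: "y' \<in> weights"
  shows "x y' = x (dual y')"
proof -
  define s where "s = (\<lambda>(n, b). 2 * b + n - 1 :: nat)"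
  obtain n' b' where e': "y' = (n', b')" by (cases y')
  let ?g = "\<lambda>y l p. \<zeta> ^ (s y * p + (snd y + fst y) * l) - \<zeta> ^ (s y * p + snd y * l)"
  have g: "(\<zeta> ^ l - 1) * ch l p (std y) = ?g y l p" if "y \<in> weights" for y l p
  proof -
    obtain n b where e: "y = (n, b)" by (cases y)
    have 1: "(\<zeta> ^ l - 1) * (\<Sum>i<n. (\<zeta> ^ l) ^ i) = (\<zeta> ^ l) ^ n - 1" by (rule power_diff_1_eq[symmetric])
    have "\<zeta> ^ (s y * p + b * l) * ((\<zeta> ^ l - 1) * (\<Sum>i<n. (\<zeta> ^ l) ^ i)) = ?g y l p"
      unfolding 1 by (simp add: e algebra_simps power_add power_mult)
    moreover have "ch l p (std y) = \<zeta> ^ (s y * p + b * l) * (\<Sum>i<n. (\<zeta> ^ l) ^ i)"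
      using ch_std that by (simp add: e s_def power_add power_mult sum_distrib_left)
    ultimately show ?thesis by (simp add: mult.left_commute)
  qed
  have z: "(\<Sum>y\<in>weights. x y * ?g y l p) = 0" if "l < d" "p < d" for l p
  proof -
    have "(\<Sum>y\<in>weights. x y * ?g y l p) = (\<zeta> ^ l - 1) * (\<Sum>y\<in>weights. x y * ch l p (std y))"
      unfolding sum_distrib_left by (rule sum.cong[OF refl]) (simp add: g[symmetric])
    then show ?thesis using x[of l p] that by (cases "l = 0") auto
  qed
  \<comment> \<open>The inverse of the character of frequency \<open>(s y', b')\<close>, with
    negative exponents written as multiples of \<open>d - 1\<close>.\<close>
  define h where "h l p = \<zeta> ^ (((d - 1) * s y') * p + ((d - 1) * b') * l)" for l p
  have dd: "(\<Sum>l<d. \<Sum>p<d. h l p * \<zeta> ^ (a * p + c * l)) =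
      (if d dvd a + (d - 1) * s y' \<and> d dvd c + (d - 1) * b' then of_nat d * of_nat d else 0)" for a c
  proof -
    have ar: "(e * s) * p + (e * b) * l + (a * p + c * l) = (c + e * b) * l + (a + e * s) * p" for e s b p l :: nat
      by (simp add: algebra_simps)
    have "(\<Sum>l<d. \<Sum>p<d. h l p * \<zeta> ^ (a * p + c * l)) = (\<Sum>l<d. \<Sum>p<d. \<zeta> ^ ((c + (d - 1) * b') * l) * \<zeta> ^ ((a + (d - 1) * s y') * p))"
      by (simp only: h_def power_add[symmetric] ar)
    also have "\<dots> = (\<Sum>l<d. \<zeta> ^ ((c + (d - 1) * b') * l)) * (\<Sum>p<d. \<zeta> ^ ((a + (d - 1) * s y') * p))"
      by (rule sum_product[symmetric])
    finally show ?thesis by (simp only: sum_zeta) simp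
  qed
  have "0 = (\<Sum>l<d. \<Sum>p<d. h l p * (\<Sum>y\<in>weights. x y * ?g y l p))" using z by simp
  also have "\<dots> = (\<Sum>l<d. \<Sum>y\<in>weights. \<Sum>p<d. x y * (h l p * ?g y l p))"
    unfolding sum_distrib_left by (rule sum.cong[OF refl], subst sum.swap) (simp add: mult.left_commute)
  also have "\<dots> = (\<Sum>y\<in>weights. x y * (\<Sum>l<d. \<Sum>p<d. h l p * ?g y l p))"
    unfolding sum_distrib_left by (rule sum.swap)
  \<comment> \<open>By orthogonality just two weights contribute at this frequency:
    \<open>y'\<close> through its subtracted character and \<open>dual y'\<close> through its other
    one, hence the opposite signs.\<close>
  also have "\<dots> = (\<Sum>y\<in>weights. x y * (of_nat d * of_nat d * ((if y = dual y' then 1 else 0) - (if y = y' then 1 else 0))))"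
  proof (rule sum.cong[OF refl])
    fix y assume y: "y \<in> weights"
    obtain n b where e: "y = (n, b)" by (cases y)
    have "(\<Sum>l<d. \<Sum>p<d. h l p * ?g y l p) = of_nat d * of_nat d * ((if y = dual y' then 1 else 0) - (if y = y' then 1 else 0))"
      unfolding right_diff_distrib sum_subtractf dd dvd_shift using weights_eq[of n b n' b'] y w by (simp add: e e' s_def)
    then show "x y * (\<Sum>l<d. \<Sum>p<d. h l p * ?g y l p) = x y * (of_nat d * of_nat d * ((if y = dual y' then 1 else 0) - (if y = y' then 1 else 0)))"
      by simp
  qed
  also have "\<dots> = (\<Sum>y\<in>weights. if y = dual y' then of_nat d * of_nat d * x y else 0) - (\<Sum>y\<in>weights. if y = y' then of_nat d * of_nat d * x y else 0)"
    unfolding sum_subtractf[symmetric] by (rule sum.cong[OF refl]) auto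
  also have "\<dots> = of_nat d * of_nat d * (x (dual y') - x y')"
    using finite_weights w dual_weights(1)[OF w] by (simp add: right_diff_distrib)
  finally show ?thesis using d0 by simp
qed

text \<open>Sum and product of \<open>\<zeta> ^ p\<close> and \<open>\<zeta> ^ (p + l)\<close> are
  traces on two small modules, so the unordered pair of these numbers is determined;
  \<open>iota\<close> exchanges them.\<close>

lemma ch_separates:
  assumes l: "(l, p) \<in> Lam_sharp d" "(l', p') \<in> Lam_sharp d" and e: "\<And>X. X \<in> C \<Longrightarrow> ch l p X = ch l' p' X"
  shows "(l', p') = (l, p) \<or> (l', p') = iota d (l, p)"
proof -
  have L: "0 < l" "l < d" "p < d" "0 < l'" "l' < d" "p' < d" using l by (auto simp: Lam_sharp_def Lam_def)
  \<comment> \<open>The module of length 1 with weight \<open>\<zeta>\<close> has trace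
    \<open>\<zeta> ^ (2 * p + l)\<close>, the product. The one of length 2 below has trace
    \<open>\<zeta> ^ p + \<zeta> ^ (p + l)\<close>; for \<open>d = 2\<close> it has full length,
    which \<open>lw_ok\<close> allows.\<close>
  have k1: "lw_ok 1 \<zeta> (\<zeta>\<^sup>2)" using zeta_root[of 2] zd z0 d2 by (simp add: lw_ok_def gam_def power2_eq_square)
  have k2: "lw_ok 2 1 \<zeta>" using zd z0 d2 by (simp add: lw_ok_def gam_def numeral_2_eq_2)
  let ?a = "\<zeta> ^ p" and ?b = "\<zeta> ^ (p + l)" and ?a' = "\<zeta> ^ p'" and ?b' = "\<zeta> ^ (p' + l')"
  have pr: "?a * ?b = ?a' * ?b'"
    using e[OF lw(1)[OF k1]] unfolding ch_lw[OF k1] by (simp add: power_mult[symmetric] power_add[symmetric] mult_2 add.assoc)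
  have su: "?a + ?b = ?a' + ?b'"
    using e[OF lw(1)[OF k2]] unfolding ch_lw[OF k2] by (simp add: numeral_2_eq_2 distrib_left power_add)
  have "(?a' - ?a) * (?a' - ?b) = ?a' * ?a' - (?a + ?b) * ?a' + ?a * ?b" by (simp add: algebra_simps)
  also have "\<dots> = 0" unfolding su pr by (simp add: algebra_simps)
  finally consider "?a' = ?a" | "?a' = ?b" by auto
  then show ?thesis
  proof cases
    case 1
    then have "p' = p" using L by (simp add: zeta_eq_iff)
    moreover have "l' = l" using su 1 z0 L calculation by (simp add: power_add zeta_eq_iff)
    ultimately show ?thesis by simp
  next
    case 2
    then have p: "p' = (p + l) mod d" using L by (simp add: zeta_eq_iff)
    have "?b' = ?a" using su 2 by simp
    then have "?a * \<zeta> ^ (l + l') = ?a * 1" using 2 by (simp add: power_add mult.assoc)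
    then have "d dvd l + l'" using z0 by (simp add: zeta_pow_eq_1_iff)
    then obtain k where k: "l + l' = d * k" by blast
    then have "k = 1"
    proof -
      have "d * k < d * 2" unfolding k[symmetric] using L by linarith
      then have "k < 2" by (rule mult_less_cancel1[THEN iffD1, THEN conjunct2])
      moreover have "k \<noteq> 0" using k L by (cases k) simp_all
      ultimately show ?thesis by simp
    qed
    then have "l' = d - l" using k by simp
    then show ?thesis using p L by (simp add: iota_def)
  qed
qed

end

section \<open>Quotients of monoid rings\<close>

definition lin :: "('a \<Rightarrow> complex) \<Rightarrow> ('a \<Rightarrow>\<^sub>0 int) \<Rightarrow> complex" where
  "lin h c = (\<Sum>x\<in>Poly_Mapping.keys c. of_int (Poly_Mapping.lookup c x) * h x)"

lemma lin_superset:
  assumes "finite A" "Poly_Mapping.keys c \<subseteq> A" shows "lin h c = (\<Sum>x\<in>A. of_int (Poly_Mapping.lookup c x) * h x)"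
  unfolding lin_def using assms by (intro sum.mono_neutral_left) (auto simp: in_keys_iff)

lemma lin_0 [simp]: "lin h 0 = 0" by (simp add: lin_def)
lemma lin_frag_of [simp]: "lin h (frag_of x) = h x" by (simp add: lin_def)

lemma lin_add: "lin h (a + b) = lin h a + lin h b"
proof -
  let ?A = "Poly_Mapping.keys a \<union> Poly_Mapping.keys b"
  have "finite ?A" "Poly_Mapping.keys (a + b) \<subseteq> ?A" using keys_add[of a b] by auto
  then show ?thesis by (simp add: lin_superset[of ?A] lookup_add distrib_right sum.distrib)
qed

lemma lin_diff: "lin h (a - b) = lin h a - lin h b"
  using lin_add[of h "a - b" b] by simp

lemma lin_cong: "(\<And>x. x \<in> Poly_Mapping.keys c \<Longrightarrow> g x = h x) \<Longrightarrow> lin g c = lin h c"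
  by (simp add: lin_def)

lemma lin_scale: "lin (\<lambda>x. k * h x) c = k * lin h c" "lin (\<lambda>x. h x * k) c = lin h c * k"
  by (simp_all add: lin_def sum_distrib_left sum_distrib_right mult.left_commute mult.assoc)

lemma lin_extend: "lin h (frag_extend g c) = lin (\<lambda>x. lin h (g x)) c"
  by (rule frag_induction[OF subset_UNIV]) (simp_all add: frag_extend_diff lin_diff)

lemma imr_simps [simp]:
  "carrier (int_monoid_ring M) = {c. Poly_Mapping.keys c \<subseteq> carrier M}" "zero (int_monoid_ring M) = 0"
  "add (int_monoid_ring M) = (+)" "one (int_monoid_ring M) = frag_of \<one>\<^bsub>M\<^esub>"
  by (simp_all add: int_monoid_ring_def)

lemma lin_mult:
  assumes "Poly_Mapping.keys a \<subseteq> carrier M" "Poly_Mapping.keys b \<subseteq> carrier M"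
    and h: "\<And>x y. x \<in> carrier M \<Longrightarrow> y \<in> carrier M \<Longrightarrow> h (x \<otimes>\<^bsub>M\<^esub> y) = h x * h y"
  shows "lin h (a \<otimes>\<^bsub>int_monoid_ring M\<^esub> b) = lin h a * lin h b"
proof -
  have "lin h (a \<otimes>\<^bsub>int_monoid_ring M\<^esub> b) = lin (\<lambda>x. lin (\<lambda>y. h (x \<otimes>\<^bsub>M\<^esub> y)) b) a"
    by (simp add: int_monoid_ring_def lin_extend)
  also have "\<dots> = lin (\<lambda>x. lin (\<lambda>y. h x * h y) b) a"
    using assms by (intro lin_cong) (simp add: subset_iff)
  finally show ?thesis by (simp add: lin_scale)
qed

lemma keys_imr_mult:
  assumes "Poly_Mapping.keys a \<subseteq> carrier M" "Poly_Mapping.keys b \<subseteq> carrier M"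
    and h: "\<And>x y. x \<in> carrier M \<Longrightarrow> y \<in> carrier M \<Longrightarrow> x \<otimes>\<^bsub>M\<^esub> y \<in> carrier M"
  shows "Poly_Mapping.keys (a \<otimes>\<^bsub>int_monoid_ring M\<^esub> b) \<subseteq> carrier M"
proof -
  have "Poly_Mapping.keys (frag_extend (\<lambda>y. frag_of (x \<otimes>\<^bsub>M\<^esub> y)) b) \<subseteq> carrier M" if "x \<in> Poly_Mapping.keys a" for x
    using keys_frag_extend[of "\<lambda>y. frag_of (x \<otimes>\<^bsub>M\<^esub> y)" b] assms that by auto blast
  then show ?thesis
    using keys_frag_extend[of "\<lambda>x. frag_extend (\<lambda>y. frag_of (x \<otimes>\<^bsub>M\<^esub> y)) b" a] by (simp add: int_monoid_ring_def) blast
qed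

lemma keys_sub: "Poly_Mapping.keys a \<subseteq> S \<Longrightarrow> Poly_Mapping.keys b \<subseteq> S \<Longrightarrow> Poly_Mapping.keys (a + b) \<subseteq> S"
  "Poly_Mapping.keys a \<subseteq> S \<Longrightarrow> Poly_Mapping.keys b \<subseteq> S \<Longrightarrow> Poly_Mapping.keys (a - b) \<subseteq> S"
  for a b :: "'a \<Rightarrow>\<^sub>0 int"
  using keys_add[of a b] keys_diff[of a b] by blast+

lemma imr_group: "group (add_monoid (int_monoid_ring M))"
proof (rule groupI)
  fix x assume "x \<in> carrier (add_monoid (int_monoid_ring M))"
  then show "\<exists>y\<in>carrier (add_monoid (int_monoid_ring M)). y \<otimes>\<^bsub>add_monoid (int_monoid_ring M)\<^esub> x = \<one>\<^bsub>add_monoid (int_monoid_ring M)\<^esub>"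
    by (intro bexI[of _ "- x"]) auto
qed (auto simp: keys_sub add.assoc)

lemma subgroup_imr_iff:
  "subgroup U (add_monoid (int_monoid_ring M)) \<longleftrightarrow>
    U \<subseteq> {c. Poly_Mapping.keys c \<subseteq> carrier M} \<and> 0 \<in> U \<and> (\<forall>a\<in>U. \<forall>b\<in>U. a - b \<in> U)" (is "?l \<longleftrightarrow> ?r")
proof -
  let ?G = "add_monoid (int_monoid_ring M)"
  interpret group ?G by (rule imr_group)
  have inv: "inv\<^bsub>?G\<^esub> x = - x" if "Poly_Mapping.keys x \<subseteq> carrier M" for x
    by (rule inv_equality) (use that in auto)
  show ?thesis
  proof
    assume l: ?l
    then interpret subgroup U ?G .
    have "a - b \<in> U" if "a \<in> U" "b \<in> U" for a b
      using m_closed[OF that(1) m_inv_closed[OF that(2)]] inv[of b] mem_carrier[OF that(2)] by simp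
    then show ?r using subset one_closed by auto
  next
    assume r: ?r
    have m: "- a \<in> U" if "a \<in> U" for a using r that by (metis diff_0)
    show ?l
    proof
      fix x y assume "x \<in> U" "y \<in> U"
      then have "x - - y \<in> U" using r m by blast
      then show "x \<otimes>\<^bsub>?G\<^esub> y \<in> U" by simp
    next
      fix x assume "x \<in> U"
      then show "inv\<^bsub>?G\<^esub> x \<in> U" using inv[of x] m r by auto
    qed (use r in auto)
  qed
qed

lemma span:
  assumes "S \<subseteq> {c. Poly_Mapping.keys c \<subseteq> carrier M}"
  shows span_subgroup: "subgroup (additive_span (int_monoid_ring M) S) (add_monoid (int_monoid_ring M))"
    and span_base: "S \<subseteq> additive_span (int_monoid_ring M) S"
    and span_least: "\<And>U. S \<subseteq> U \<Longrightarrow> subgroup U (add_monoid (int_monoid_ring M)) \<Longrightarrow> additive_span (int_monoid_ring M) S \<subseteq> U"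
proof -
  interpret group "add_monoid (int_monoid_ring M)" by (rule imr_group)
  show "subgroup (additive_span (int_monoid_ring M) S) (add_monoid (int_monoid_ring M))"
    unfolding additive_span_def using assms by (intro generate_is_subgroup) auto
  show "S \<subseteq> additive_span (int_monoid_ring M) S" by (auto simp: additive_span_def intro: generate.incl)
  show "additive_span (int_monoid_ring M) S \<subseteq> U" if "S \<subseteq> U" "subgroup U (add_monoid (int_monoid_ring M))" for U
    unfolding additive_span_def using that by (rule generate_subgroup_incl)
qed

text \<open>The functions \<open>v l\<close> separate points and respect the operations, so that
  each equational axiom follows from the same identity of complex numbers.\<close>

lemma cring_if_separated:
  fixes Q (structure) and v :: "'l \<Rightarrow> 'a \<Rightarrow> complex"
  assumes c: "\<And>x y. x \<in> carrier Q \<Longrightarrow> y \<in> carrier Q \<Longrightarrow> x \<oplus> y \<in> carrier Q" "\<And>x y. x \<in> carrier Q \<Longrightarrow> y \<in> carrier Q \<Longrightarrow> x \<otimes> y \<in> carrier Q"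
      "\<zero> \<in> carrier Q" "\<one> \<in> carrier Q" "\<And>x. x \<in> carrier Q \<Longrightarrow> \<exists>y\<in>carrier Q. y \<oplus> x = \<zero>"
    and h: "\<And>l x y. l \<in> S \<Longrightarrow> x \<in> carrier Q \<Longrightarrow> y \<in> carrier Q \<Longrightarrow> v l (x \<oplus> y) = v l x + v l y"
      "\<And>l x y. l \<in> S \<Longrightarrow> x \<in> carrier Q \<Longrightarrow> y \<in> carrier Q \<Longrightarrow> v l (x \<otimes> y) = v l x * v l y"
      "\<And>l. l \<in> S \<Longrightarrow> v l \<zero> = 0" "\<And>l. l \<in> S \<Longrightarrow> v l \<one> = 1"
    and i: "\<And>x y. x \<in> carrier Q \<Longrightarrow> y \<in> carrier Q \<Longrightarrow> (\<And>l. l \<in> S \<Longrightarrow> v l x = v l y) \<Longrightarrow> x = y"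
  shows "cring Q"
  by (intro cringI abelian_groupI comm_monoidI c; (rule i)?) (simp_all add: c h algebra_simps)

text \<open>\<open>Q\<close> behaves as a ring of functions on a finite set that contains the
  constants, by \<open>s\<close>. An ideal contains an element \<open>e\<close> with value 1 at all
  points where the ideal does not vanish; it acts as a unit on the ideal, and its annihilator is a
  complement.\<close>

lemma semisimple_if_separated:
  fixes Q (structure) and v :: "'l \<Rightarrow> 'a \<Rightarrow> complex"
  assumes Q: "cring Q" and S: "finite S"
    and h: "\<And>l x y. l \<in> S \<Longrightarrow> x \<in> carrier Q \<Longrightarrow> y \<in> carrier Q \<Longrightarrow> v l (x \<oplus> y) = v l x + v l y"
      "\<And>l x y. l \<in> S \<Longrightarrow> x \<in> carrier Q \<Longrightarrow> y \<in> carrier Q \<Longrightarrow> v l (x \<otimes> y) = v l x * v l y"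
      "\<And>l. l \<in> S \<Longrightarrow> v l \<zero> = 0"
    and i: "\<And>x y. x \<in> carrier Q \<Longrightarrow> y \<in> carrier Q \<Longrightarrow> (\<And>l. l \<in> S \<Longrightarrow> v l x = v l y) \<Longrightarrow> x = y"
    and s: "\<And>k. \<exists>x\<in>carrier Q. \<forall>l\<in>S. v l x = k"
  shows "semisimple_ring Q"
proof -
  interpret cring Q by (rule Q)
  have hm: "v l (x \<ominus> y) = v l x - v l y" if "l \<in> S" "x \<in> carrier Q" "y \<in> carrier Q" for l x y
  proof -
    have "x = (x \<ominus> y) \<oplus> y" using that by (simp add: minus_eq a_assoc l_neg)
    then have "v l x = v l (x \<ominus> y) + v l y" using h(1)[OF that(1), of "x \<ominus> y" y] that by simp
    then show ?thesis by simp
  qed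
  have "\<exists>J. left_ideal J Q \<and> I \<inter> J = {\<zero>} \<and> I <+> J = carrier Q" if I: "left_ideal I Q" for I
  proof -
    interpret I: additive_subgroup I Q using I by (simp add: left_ideal_def)
    have lm: "r \<otimes> x \<in> I" if "r \<in> carrier Q" "x \<in> I" for r x using I that by (simp add: left_ideal_def)
    have unit: "\<exists>e\<in>I. \<forall>l\<in>F. (\<exists>x\<in>I. v l x \<noteq> 0) \<longrightarrow> v l e = 1" if "finite F" "F \<subseteq> S" for F
      using that
    proof (induction F rule: finite_induct)
      case empty then show ?case using I.zero_closed by blast
    next
      case (insert l F)
      then obtain e where e: "e \<in> I" "\<And>m. m \<in> F \<Longrightarrow> (\<exists>x\<in>I. v m x \<noteq> 0) \<Longrightarrow> v m e = 1" by auto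
      show ?case
      proof (cases "\<exists>x\<in>I. v l x \<noteq> 0")
        case False
        then have "\<forall>m\<in>insert l F. (\<exists>x\<in>I. v m x \<noteq> 0) \<longrightarrow> v m e = 1" using e(2) by blast
        then show ?thesis using e(1) by blast
      next
        case True
        then obtain x where x: "x \<in> I" "v l x \<noteq> 0" by blast
        \<comment> \<open>The constant \<open>1 / v l x\<close> normalizes the value of
          \<open>x\<close> at \<open>l\<close> to 1.\<close>
        obtain k where k: "k \<in> carrier Q" "\<forall>m\<in>S. v m k = 1 / v l x" using s by blast
        let ?f = "k \<otimes> x"
        \<comment> \<open>This is \<open>1 - (1 - ?f) * (1 - e)\<close> multiplied out: it takes the
          value 1 wherever \<open>e\<close> or \<open>?f\<close> does, and it stays in the
          ideal.\<close>
        let ?e = "(e \<oplus> ?f) \<ominus> ?f \<otimes> e"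
        have f: "?f \<in> I" using lm k x by blast
        have c: "e \<in> carrier Q" "?f \<in> carrier Q" using e(1) f I.a_Hcarr by auto
        have ee: "?e \<in> I" unfolding minus_eq using e(1) f lm[OF c(2) e(1)] by (intro I.a_closed I.a_inv_closed)
        have v: "v m ?e = v m e + v m ?f - v m ?f * v m e" if "m \<in> S" for m using that c hm h by simp
        have "v l ?f = 1" using h(2)[of l k x] k x insert.prems I.a_Hcarr by simp
        then have "v m ?e = 1" if "m \<in> insert l F" "\<exists>x\<in>I. v m x \<noteq> 0" for m
          using v[of m] e(2)[of m] that insert.prems by (cases "m = l") auto
        then show ?thesis using ee by blast
      qed
    qed
    obtain e where e0: "e \<in> I" "\<forall>l\<in>S. (\<exists>x\<in>I. v l x \<noteq> 0) \<longrightarrow> v l e = 1" using unit[OF S subset_refl] by (rule bexE)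
    note e = e0(1) e0(2)[rule_format]
    have ec: "e \<in> carrier Q" using e I.a_Hcarr by blast
    have ex: "e \<otimes> x = x" if x: "x \<in> I" for x
    proof (rule i)
      have xc: "x \<in> carrier Q" using x I.a_Hcarr by blast
      then show "e \<otimes> x \<in> carrier Q" "x \<in> carrier Q" using ec by auto
      fix l assume l: "l \<in> S"
      show "v l (e \<otimes> x) = v l x"
        unfolding h(2)[OF l ec xc] using e(2)[OF l] x by (cases "v l x = 0") auto
    qed
    define J where "J = {t \<in> carrier Q. t \<otimes> e = \<zero>}"
    have "left_ideal J Q" unfolding left_ideal_def
    proof (intro conjI ballI)
      show "additive_subgroup J Q"
      proof (intro additive_subgroupI add.subgroupI)
        show "J \<subseteq> carrier Q" "J \<noteq> {}" using ec by (auto simp: J_def intro!: exI[of _ \<zero>])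
        show "\<ominus> a \<in> J" if "a \<in> J" for a using that ec by (simp add: J_def l_minus)
        show "a \<oplus> b \<in> J" if "a \<in> J" "b \<in> J" for a b using that ec by (simp add: J_def l_distr)
      qed
      show "r \<otimes> x \<in> J" if "r \<in> carrier Q" "x \<in> J" for r x using that ec by (simp add: J_def m_assoc)
    qed
    moreover have "I \<inter> J = {\<zero>}"
    proof
      show "I \<inter> J \<subseteq> {\<zero>}"
      proof
        fix x assume x: "x \<in> I \<inter> J"
        then have "x = x \<otimes> e" using ex m_comm[of x e] ec by (auto simp: J_def)
        then show "x \<in> {\<zero>}" using x by (simp add: J_def)
      qed
      show "{\<zero>} \<subseteq> I \<inter> J" using ec I.zero_closed by (simp add: J_def)
    qed
    moreover have "I <+> J = carrier Q"
    proof
      show "I <+> J \<subseteq> carrier Q" using I.a_Hcarr by (auto simp: set_add_def' J_def)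
      show "carrier Q \<subseteq> I <+> J"
      proof
        fix t assume t: "t \<in> carrier Q"
        have te: "t \<otimes> e \<in> I" using lm t e(1) by blast
        have "(t \<ominus> t \<otimes> e) \<otimes> e = t \<otimes> e \<ominus> t \<otimes> (e \<otimes> e)" using t ec by (simp add: minus_eq l_distr l_minus m_assoc)
        also have "\<dots> = \<zero>" using t ec ex[OF e(1)] by (simp add: minus_eq r_neg)
        finally have "t \<ominus> t \<otimes> e \<in> J" using t ec by (simp add: J_def)
        moreover have "t = t \<otimes> e \<oplus> (t \<ominus> t \<otimes> e)"
        proof -
          have "t \<otimes> e \<oplus> (t \<ominus> t \<otimes> e) = t \<oplus> (t \<otimes> e \<ominus> t \<otimes> e)" using t ec by (simp add: minus_eq a_lcomm)
          then show ?thesis using t ec by (simp add: minus_eq r_neg)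
        qed
        ultimately show "t \<in> I <+> J" unfolding set_add_def' using te by blast
      qed
    qed
    ultimately show ?thesis by blast
  qed
  then show ?thesis using ring_axioms by (simp add: semisimple_ring_def)
qed

text \<open>An integral monoid ring modulo the common kernel of finitely many characters of the
  monoid. It is used twice: for the Grothendieck ring, with modules as monoid, and for its
  complexification, with pairs of a scalar and a class.\<close>

locale separated_ring =
  fixes M :: "('a, 'b) monoid_scheme" and S :: "'l set" and \<chi> :: "'l \<Rightarrow> 'a \<Rightarrow> complex"
  assumes finL: "finite S"
    and m_closed: "\<And>x y. x \<in> carrier M \<Longrightarrow> y \<in> carrier M \<Longrightarrow> x \<otimes>\<^bsub>M\<^esub> y \<in> carrier M" and one_closed: "\<one>\<^bsub>M\<^esub> \<in> carrier M"
    and \<chi>_mult: "\<And>l x y. l \<in> S \<Longrightarrow> x \<in> carrier M \<Longrightarrow> y \<in> carrier M \<Longrightarrow> \<chi> l (x \<otimes>\<^bsub>M\<^esub> y) = \<chi> l x * \<chi> l y"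
    and \<chi>_one: "\<And>l. l \<in> S \<Longrightarrow> \<chi> l \<one>\<^bsub>M\<^esub> = 1"
begin

abbreviation "R \<equiv> int_monoid_ring M"
abbreviation "RC \<equiv> {c :: 'a \<Rightarrow>\<^sub>0 int. Poly_Mapping.keys c \<subseteq> carrier M}"
definition "Ker = {c \<in> RC. \<forall>l\<in>S. lin (\<chi> l) c = 0}"
definition "cl c = Ker +>\<^bsub>R\<^esub> c"
abbreviation "Q \<equiv> R Quot Ker"
text \<open>On a class \<open>cl c\<close> the choice is immaterial: by \<open>val_cl\<close> all
  representatives have the same value.\<close>

definition "val l A = lin (\<chi> l) (SOME c. c \<in> A)"

lemma Ker_subgroup: "subgroup Ker (add_monoid R)"
  unfolding subgroup_imr_iff by (auto simp: Ker_def keys_sub lin_diff)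

lemma cl: "c \<in> RC \<Longrightarrow> cl c = {x \<in> RC. \<forall>l\<in>S. lin (\<chi> l) x = lin (\<chi> l) c}"
proof -
  assume c: "c \<in> RC"
  show ?thesis
  proof (rule subset_antisym; rule subsetI)
    fix x assume "x \<in> cl c"
    then obtain h where "h \<in> Ker" "x = h + c" by (auto simp: cl_def a_r_coset_def')
    then show "x \<in> {x \<in> RC. \<forall>l\<in>S. lin (\<chi> l) x = lin (\<chi> l) c}" using c by (simp add: Ker_def keys_sub lin_add)
  next
    fix x assume "x \<in> {x \<in> RC. \<forall>l\<in>S. lin (\<chi> l) x = lin (\<chi> l) c}"
    then have "x - c \<in> Ker" using c by (simp add: Ker_def keys_sub lin_diff)
    then show "x \<in> cl c" unfolding cl_def a_r_coset_def' by (rule UN_I) simp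
  qed
qed

lemma cl_eq_iff: "a \<in> RC \<Longrightarrow> b \<in> RC \<Longrightarrow> cl a = cl b \<longleftrightarrow> (\<forall>l\<in>S. lin (\<chi> l) a = lin (\<chi> l) b)"
  by (auto simp: cl)

lemma cl_self: "c \<in> RC \<Longrightarrow> c \<in> cl c" by (simp add: cl)

lemma carrier_Q: "carrier Q = cl ` RC"
  by (auto simp: FactRing_def A_RCOSETS_def' cl_def)

lemma mult_RC: "a \<in> RC \<Longrightarrow> b \<in> RC \<Longrightarrow> a \<otimes>\<^bsub>R\<^esub> b \<in> RC"
  using keys_imr_mult[of a M b] m_closed by simp

lemma lin_RC: "a \<in> RC \<Longrightarrow> b \<in> RC \<Longrightarrow> l \<in> S \<Longrightarrow> lin (\<chi> l) (a \<otimes>\<^bsub>R\<^esub> b) = lin (\<chi> l) a * lin (\<chi> l) b"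
  using lin_mult[of a M b] \<chi>_mult by simp

lemma Q_mult: assumes "a \<in> RC" "b \<in> RC" shows "cl a \<otimes>\<^bsub>Q\<^esub> cl b = cl (a \<otimes>\<^bsub>R\<^esub> b)"
proof -
  have "cl (x \<otimes>\<^bsub>R\<^esub> y) = cl (a \<otimes>\<^bsub>R\<^esub> b)" if "x \<in> cl a" "y \<in> cl b" for x y
  proof -
    have xy: "x \<in> RC" "y \<in> RC" "\<And>l. l \<in> S \<Longrightarrow> lin (\<chi> l) x = lin (\<chi> l) a" "\<And>l. l \<in> S \<Longrightarrow> lin (\<chi> l) y = lin (\<chi> l) b"
      using that assms by (simp_all add: cl)
    show ?thesis unfolding cl_eq_iff[OF mult_RC[OF xy(1,2)] mult_RC[OF assms]]
    proof
      fix l assume "l \<in> S"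
      then show "lin (\<chi> l) (x \<otimes>\<^bsub>R\<^esub> y) = lin (\<chi> l) (a \<otimes>\<^bsub>R\<^esub> b)"
        using xy(3,4) lin_RC[OF xy(1,2)] lin_RC[OF assms] by (simp only:)
    qed
  qed
  then have "(\<Union>x\<in>cl a. \<Union>y\<in>cl b. cl (x \<otimes>\<^bsub>R\<^esub> y)) = cl (a \<otimes>\<^bsub>R\<^esub> b)" using cl_self[OF assms(1)] cl_self[OF assms(2)] by blast
  then show ?thesis by (simp add: FactRing_def rcoset_mult_def cl_def)
qed

lemma Q_add: assumes "a \<in> RC" "b \<in> RC" shows "cl a \<oplus>\<^bsub>Q\<^esub> cl b = cl (a + b)"
proof -
  have ab: "a + b \<in> RC" using assms by (simp add: keys_sub)
  have "(\<Union>x\<in>cl a. \<Union>y\<in>cl b. {x + y}) = cl (a + b)"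
  proof
    show "(\<Union>x\<in>cl a. \<Union>y\<in>cl b. {x + y}) \<subseteq> cl (a + b)" unfolding cl[OF ab] unfolding cl[OF assms(1)] cl[OF assms(2)]
      by (intro subsetI, elim UN_E) (simp add: keys_sub lin_add)
    show "cl (a + b) \<subseteq> (\<Union>x\<in>cl a. \<Union>y\<in>cl b. {x + y})"
    proof
      fix x assume x: "x \<in> cl (a + b)"
      then have "x - a \<in> cl b" unfolding cl[OF ab] using assms by (simp add: cl keys_sub lin_diff lin_add)
      moreover have "x = a + (x - a)" by simp
      ultimately show "x \<in> (\<Union>x\<in>cl a. \<Union>y\<in>cl b. {x + y})" using cl_self[OF assms(1)] by blast
    qed
  qed
  then show ?thesis by (simp add: FactRing_def set_add_def' cl_def)
qed

lemma Q_zero: "\<zero>\<^bsub>Q\<^esub> = cl 0" by (auto simp: cl FactRing_def Ker_def)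
lemma Q_one: "\<one>\<^bsub>Q\<^esub> = cl (frag_of \<one>\<^bsub>M\<^esub>)" by (simp add: cl_def FactRing_def)

lemma val_cl: assumes "l \<in> S" "c \<in> RC" shows "val l (cl c) = lin (\<chi> l) c"
proof -
  define x where "x = (SOME x. x \<in> cl c)"
  have "x \<in> cl c" unfolding x_def by (rule someI[of "\<lambda>x. x \<in> cl c", OF cl_self[OF assms(2)]])
  then have "lin (\<chi> l) x = lin (\<chi> l) c" unfolding cl[OF assms(2)] using assms(1) by simp
  then show ?thesis by (simp add: val_def x_def)
qed

lemma Q_inj: "A \<in> carrier Q \<Longrightarrow> B \<in> carrier Q \<Longrightarrow> (\<And>l. l \<in> S \<Longrightarrow> val l A = val l B) \<Longrightarrow> A = B"
  unfolding carrier_Q by (elim imageE, hypsubst, subst cl_eq_iff) (simp_all only: val_cl, simp_all)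

lemma zero_RC: "0 \<in> RC" by simp
lemma one_RC: "frag_of \<one>\<^bsub>M\<^esub> \<in> RC" using one_closed by simp
lemma add_RC: "a \<in> RC \<Longrightarrow> b \<in> RC \<Longrightarrow> a + b \<in> RC" "a \<in> RC \<Longrightarrow> b \<in> RC \<Longrightarrow> a - b \<in> RC" by (simp_all add: keys_sub)

lemma Q_closed:
  "A \<in> carrier Q \<Longrightarrow> B \<in> carrier Q \<Longrightarrow> A \<oplus>\<^bsub>Q\<^esub> B \<in> carrier Q" "A \<in> carrier Q \<Longrightarrow> B \<in> carrier Q \<Longrightarrow> A \<otimes>\<^bsub>Q\<^esub> B \<in> carrier Q"
  "\<zero>\<^bsub>Q\<^esub> \<in> carrier Q" "\<one>\<^bsub>Q\<^esub> \<in> carrier Q"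
  unfolding carrier_Q Q_zero Q_one
  by (elim imageE, hypsubst, simp only: Q_add Q_mult add_RC mult_RC zero_RC one_RC image_eqI[OF refl])+ (intro image_eqI[OF refl] zero_RC one_RC)+

lemma val_hom:
  "l \<in> S \<Longrightarrow> A \<in> carrier Q \<Longrightarrow> B \<in> carrier Q \<Longrightarrow> val l (A \<oplus>\<^bsub>Q\<^esub> B) = val l A + val l B"
  "l \<in> S \<Longrightarrow> A \<in> carrier Q \<Longrightarrow> B \<in> carrier Q \<Longrightarrow> val l (A \<otimes>\<^bsub>Q\<^esub> B) = val l A * val l B"
  "l \<in> S \<Longrightarrow> val l \<zero>\<^bsub>Q\<^esub> = 0" "l \<in> S \<Longrightarrow> val l \<one>\<^bsub>Q\<^esub> = 1"
  unfolding carrier_Q Q_zero Q_one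
  by (elim imageE, hypsubst, simp only: Q_add Q_mult val_cl add_RC mult_RC lin_add lin_RC)+
    (simp_all only: val_cl zero_RC one_RC lin_0 lin_frag_of \<chi>_one)

lemma cring_Q: "cring Q"
proof (rule cring_if_separated[where v = val and S = S])
  fix A assume "A \<in> carrier Q"
  then obtain c where c: "A = cl c" "c \<in> RC" unfolding carrier_Q by blast
  have "0 - c \<in> RC" using c zero_RC add_RC by blast
  moreover from this have "cl (0 - c) \<oplus>\<^bsub>Q\<^esub> A = \<zero>\<^bsub>Q\<^esub>" unfolding c(1) Q_zero using c(2) by (simp only: Q_add) simp
  ultimately show "\<exists>B\<in>carrier Q. B \<oplus>\<^bsub>Q\<^esub> A = \<zero>\<^bsub>Q\<^esub>" unfolding carrier_Q by blast
qed (use Q_closed val_hom Q_inj in auto)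

end

lemma lin_cmul: "lin h (frag_cmul k c) = of_int k * lin h c"
  by (cases "k = 0") (auto simp: lin_def sum_distrib_left mult.assoc intro!: sum.cong)

lemma lin_sum: "lin h (\<Sum>x\<in>A. f x) = (\<Sum>x\<in>A. lin h (f x))"
  by (induction A rule: infinite_finite_induct) (simp_all add: lin_add)

lemma subgroup_imr:
  assumes "subgroup U (add_monoid (int_monoid_ring M))"
  shows sg_0: "0 \<in> U" and sg_diff: "\<And>a b. a \<in> U \<Longrightarrow> b \<in> U \<Longrightarrow> a - b \<in> U" and sg_add: "\<And>a b. a \<in> U \<Longrightarrow> b \<in> U \<Longrightarrow> a + b \<in> U"
    and sg_sum: "\<And>(f :: 'i \<Rightarrow> _) A. (\<And>x. x \<in> A \<Longrightarrow> f x \<in> U) \<Longrightarrow> sum f A \<in> U"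
    and sg_cmul: "\<And>a k. a \<in> U \<Longrightarrow> frag_cmul k a \<in> U"
    and sg_RC: "\<And>a. a \<in> U \<Longrightarrow> Poly_Mapping.keys a \<subseteq> carrier M"
proof -
  have r: "U \<subseteq> {c. Poly_Mapping.keys c \<subseteq> carrier M}" "0 \<in> U" "\<forall>a\<in>U. \<forall>b\<in>U. a - b \<in> U"
    using assms unfolding subgroup_imr_iff by auto
  show 0: "0 \<in> U" and d: "\<And>a b. a \<in> U \<Longrightarrow> b \<in> U \<Longrightarrow> a - b \<in> U" using r by auto
  show p: "a + b \<in> U" if "a \<in> U" "b \<in> U" for a b
    using d[OF that(1) d[OF 0 that(2)]] by simp
  show "sum f A \<in> U" if "\<And>x. x \<in> A \<Longrightarrow> f x \<in> U" for f :: "'i \<Rightarrow> _" and A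
    using that by (induction A rule: infinite_finite_induct) (simp_all add: 0 p)
  show "frag_cmul k a \<in> U" if a: "a \<in> U" for a k
  proof (induction k rule: int_induct[of _ 0])
    case base show ?case using 0 by simp
  next
    case (step1 i) then show ?case using p a by (simp add: frag_cmul_distrib)
  next
    case (step2 i) then show ?case using d a by (simp add: frag_cmul_diff_distrib)
  qed
  show "\<And>a. a \<in> U \<Longrightarrow> Poly_Mapping.keys a \<subseteq> carrier M" using r by auto
qed

context dbl begin

section \<open>The Grothendieck rings and the kernel of the natural map\<close>

abbreviation "DM \<equiv> double_monoid d \<zeta>"

definition chh :: "nat \<times> nat \<Rightarrow> double_gen fdmod \<Rightarrow> complex" where "chh = (\<lambda>(l, p). ch l p)"

lemma DM_simps [simp]: "carrier DM = C" "X \<otimes>\<^bsub>DM\<^esub> Y = mod_tensor d X Y" "\<one>\<^bsub>DM\<^esub> = trivial_mod"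
  by (simp_all add: double_monoid_def)

sublocale G: separated_ring DM "Lam_sharp d" chh
proof
  have "Lam_sharp d \<subseteq> {0..<d} \<times> {0..<d}" by (auto simp: Lam_sharp_def Lam_def)
  then show "finite (Lam_sharp d)" using finite_subset by blast
qed (auto simp: chh_def tensor_module trivial_module)

lemma frag_RC: "X \<in> C \<Longrightarrow> frag_of X \<in> G.RC" by simp

definition "P = Gr_stB_rel d \<zeta>"

lemma P_rels: "additivity_relations {(X, Y, Z). \<exists>u v w. (X, Y, Z, u, v, w) \<in> stab_B_triangles d \<zeta>} \<subseteq> G.Ker"
proof
  fix c assume "c \<in> additivity_relations {(X, Y, Z). \<exists>u v w. (X, Y, Z, u, v, w) \<in> stab_B_triangles d \<zeta>}"
  then obtain X Y Z u v w where c: "c = frag_of Y - (frag_of X + frag_of Z)" and t: "(X, Y, Z, u, v, w) \<in> stab_B_triangles d \<zeta>"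
    by (auto simp: additivity_relations_def)
  have m: "X \<in> C" "Y \<in> C" "Z \<in> C" using stB_ch[OF t, of 1] d2 by auto
  have "lin (chh \<mu>) c = 0" if "\<mu> \<in> Lam_sharp d" for \<mu>
    using stB_ch(4)[OF t, of "fst \<mu>" "snd \<mu>"] that by (auto simp: c lin_diff lin_add chh_def Lam_sharp_def Lam_def)
  moreover have "c \<in> G.RC" unfolding c by (intro G.add_RC frag_RC m)
  ultimately show "c \<in> G.Ker" by (simp add: G.Ker_def)
qed

lemma P_rels_RC: "additivity_relations {(X, Y, Z). \<exists>u v w. (X, Y, Z, u, v, w) \<in> stab_B_triangles d \<zeta>} \<subseteq> G.RC"
  using P_rels by (auto simp: G.Ker_def)

lemma P_subgroup: "subgroup P (add_monoid G.R)"
  unfolding P_def Gr_stB_rel_def by (rule span_subgroup[OF P_rels_RC])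

lemmas P_closed = subgroup_imr[OF P_subgroup]

lemma P_Ker: "P \<subseteq> G.Ker"
  unfolding P_def Gr_stB_rel_def by (rule span_least[OF P_rels_RC P_rels G.Ker_subgroup])

lemma P_triangle: "(X, Y, Z, u, v, w) \<in> stab_B_triangles d \<zeta> \<Longrightarrow> frag_of Y - (frag_of X + frag_of Z) \<in> P"
  unfolding P_def Gr_stB_rel_def by (rule subsetD[OF span_base[OF P_rels_RC]]) (unfold additivity_relations_def, blast)

lemma P_ses: "ses X Y Z u v \<Longrightarrow> frag_of Y - (frag_of X + frag_of Z) \<in> P"
  using stB_ses P_triangle by blast

lemma P_proj: assumes "M \<in> proj_B d \<zeta>" shows "frag_of M \<in> P"
proof -
  obtain u v w where "(zero_mod, zero_mod, M, u, v, w) \<in> stab_B_triangles d \<zeta>" using stB_zero[OF assms] by blast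
  then have "0 - (frag_of zero_mod - (frag_of zero_mod + frag_of M)) \<in> P" using P_triangle P_closed(1,2) by blast
  then show ?thesis by simp
qed

lemma P_dual: assumes "y \<in> weights" shows "frag_of (std y) + frag_of (std (dual y)) \<in> P"
proof -
  obtain N u v where N: "N \<in> proj_B d \<zeta>" "ses (std (dual y)) N (std y) u v" using std_dual_ses[OF assms] by blast
  have "frag_of N - (frag_of N - (frag_of (std (dual y)) + frag_of (std y))) \<in> P"
    using P_proj[OF N(1)] P_ses[OF N(2)] P_closed(2) by blast
  then show ?thesis by (simp add: add.commute)
qed

definition comb :: "(nat \<times> nat \<Rightarrow> int) \<Rightarrow> (double_gen fdmod \<Rightarrow>\<^sub>0 int)" where
  "comb x = (\<Sum>y\<in>weights. frag_cmul (x y) (frag_of (std y)))"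

lemma comb_diff: "comb (\<lambda>y. x y - x' y) = comb x - comb x'"
  by (simp add: comb_def frag_cmul_diff_distrib sum_subtractf)

text \<open>Modulo the relations the class of a module is the sum of the classes of its layers, and
  the layers that are projective over \<open>B\<close> disappear.\<close>

lemma comb_module: assumes X: "X \<in> C" shows "\<exists>x. frag_of X - comb x \<in> P"
  using X
proof (induction rule: module_induct)
  case (std y)
  have "comb (\<lambda>y'. if y' = y then 1 else 0) = (\<Sum>y'\<in>weights. if y' = y then frag_of (std y') else 0)"
    unfolding comb_def by (rule sum.cong[OF refl]) simp
  also have "\<dots> = frag_of (std y)" using std finite_weights by simp
  finally have "frag_of (std y) - comb (\<lambda>y'. if y' = y then 1 else 0) = 0" by simp
  then show ?case using P_closed(1) by metis
next
  case (proj M)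
  have "comb (\<lambda>_. 0) = 0" by (simp add: comb_def)
  then show ?case using P_proj[OF proj] by (intro exI[of _ "\<lambda>_. 0"]) simp
next
  case (ses X Y Z u v)
  then obtain x z where x: "frag_of X - comb x \<in> P" and z: "frag_of Z - comb z \<in> P" by blast
  have c: "comb (\<lambda>y. x y - (0 - z y)) = comb x + comb z"
    unfolding comb_diff by (simp add: comb_def)
  have "(frag_of Y - (frag_of X + frag_of Z)) + ((frag_of X - comb x) + (frag_of Z - comb z)) \<in> P"
    using P_ses[OF ses(1)] x z by (intro P_closed(3))
  then have "frag_of Y - comb (\<lambda>y. x y - (0 - z y)) \<in> P" unfolding c by (simp add: algebra_simps)
  then show ?case by blast
qed

lemma comb_ex: assumes c: "c \<in> G.RC" shows "\<exists>x. c - comb x \<in> P"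
proof -
  have "Poly_Mapping.keys c \<subseteq> C" using c by simp
  then show ?thesis
  proof (induction c rule: frag_induction)
    case zero show ?case using P_closed(1) by (intro exI[of _ "\<lambda>_. 0"]) (simp add: comb_def)
  next
    case (one X) then show ?case by (rule comb_module)
  next
    case (diff a b)
    then obtain x z where "a - comb x \<in> P" "b - comb z \<in> P" by blast
    then have "(a - comb x) - (b - comb z) \<in> P" by (rule P_closed(2))
    then have "a - b - comb (\<lambda>y. x y - z y) \<in> P" by (simp add: comb_diff algebra_simps)
    then show ?case by blast
  qed
qed

lemma P_eq_Ker: "P = G.Ker"
proof (rule subset_antisym[OF P_Ker], rule subsetI)
  fix c assume c: "c \<in> G.Ker"
  then have "c \<in> G.RC" by (simp add: G.Ker_def)
  then obtain x where x: "c - comb x \<in> P" using comb_ex by blast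
  have z: "(\<Sum>y\<in>weights. of_int (x y) * ch l p (std y)) = 0" if "0 < l" "l < d" "p < d" for l p
  proof -
    have m: "(l, p) \<in> Lam_sharp d" using that by (simp add: Lam_sharp_def Lam_def)
    have "lin (chh (l, p)) (c - comb x) = 0" "lin (chh (l, p)) c = 0" using x c m P_Ker by (auto simp: G.Ker_def)
    then have "lin (chh (l, p)) (comb x) = 0" by (simp add: lin_diff)
    then show ?thesis by (simp add: comb_def lin_sum lin_cmul chh_def)
  qed
  \<comment> \<open>\<open>fourier\<close> is applied to the complex numbers
    \<open>of_int (x y)\<close>. Equal coefficients at dual weights make \<open>comb x\<close> a sum
    of integral multiples of the elements in \<open>P_dual\<close>.\<close>
  have xd: "x y = x (dual y)" if "y \<in> weights" for y
    using fourier[OF z that] by simp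
  have "comb x \<in> P" unfolding comb_def
  proof (rule sum_involution[where \<tau> = dual])
    fix y assume y: "y \<in> weights"
    show "frag_cmul (x y) (frag_of (std y)) + frag_cmul (x (dual y)) (frag_of (std (dual y))) \<in> P"
      using P_closed(5)[OF P_dual[OF y], of "x y"] xd[OF y] by (simp add: frag_cmul_distrib2)
  qed (use finite_weights dual_weights P_closed(1,3) in auto)
  then have "(c - comb x) + comb x \<in> P" using x P_closed(3) by blast
  then show "c \<in> P" by simp
qed

lemma Gr_stB_eq: "Gr_stB_rel d \<zeta> = G.Ker" "Gr_stB d \<zeta> = G.Q"
  using P_eq_Ker by (simp_all add: P_def Gr_stB_def)

lemma lin_chi: "c \<in> G.RC \<Longrightarrow> lin_chi \<mu> c = lin (chh \<mu>) c"
  by (cases \<mu>) (auto simp: lin_chi_def lin_def chh_def subset_iff ch_trace intro!: sum.cong)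

lemma Gr_rel: assumes "c \<in> Gr_rel d \<zeta>" shows "c \<in> G.RC" "lin (chh \<mu>) c = 0"
proof -
  define U where "U = {c \<in> G.RC. \<forall>\<mu>. lin (chh \<mu>) c = 0}"
  let ?A = "additivity_relations {(X, Y, Z). \<exists>u v. short_exact C X Y Z u v}"
  have A: "?A \<subseteq> U"
  proof
    fix c assume "c \<in> ?A"
    then obtain X Y Z u v where c: "c = frag_of Y - (frag_of X + frag_of Z)" and t: "short_exact C X Y Z u v"
      by (auto simp: additivity_relations_def)
    have m: "X \<in> C" "Y \<in> C" "Z \<in> C" using t by (auto simp: short_exact_def)
    have "c \<in> G.RC" unfolding c by (intro G.add_RC frag_RC m)
    moreover have "lin (chh \<mu>) c = 0" for \<mu>
      using ch_ses[of X Y Z "L u" "L v" "fst \<mu>" "snd \<mu>"] t ses_iff by (simp add: c lin_diff lin_add chh_def case_prod_beta)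
    ultimately show "c \<in> U" by (simp add: U_def)
  qed
  moreover have "subgroup U (add_monoid G.R)" unfolding subgroup_imr_iff by (auto simp: U_def keys_sub lin_diff)
  moreover have "?A \<subseteq> G.RC" using A by (auto simp: U_def)
  ultimately have "Gr_rel d \<zeta> \<subseteq> U" unfolding Gr_rel_def using span_least by blast
  then show "c \<in> G.RC" "lin (chh \<mu>) c = 0" using assms unfolding U_def by blast+
qed

lemma Gr_rel_0: "0 \<in> Gr_rel d \<zeta>"
  unfolding Gr_rel_def additive_span_def using generate.one[of "add_monoid G.R"] by simp

lemma Gr_carrier: "carrier (Gr d \<zeta>) = (\<lambda>c. Gr_rel d \<zeta> +>\<^bsub>G.R\<^esub> c) ` G.RC"
  by (auto simp: Gr_def FactRing_def A_RCOSETS_def')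

text \<open>The relations of \<open>Gr\<close> lie in the kernel of all traces, so
  \<open>lin_chi\<close> is constant on a coset, and adding the larger kernel turns the coset into
  one of that kernel.\<close>

lemma Gr_coset: assumes c: "c \<in> G.RC"
  shows "chi \<mu> (Gr_rel d \<zeta> +>\<^bsub>G.R\<^esub> c) = lin (chh \<mu>) c" "Gr_to_stB d \<zeta> (Gr_rel d \<zeta> +>\<^bsub>G.R\<^esub> c) = G.cl c"
proof -
  let ?A = "Gr_rel d \<zeta> +>\<^bsub>G.R\<^esub> c"
  have A: "?A = (\<lambda>h. h + c) ` Gr_rel d \<zeta>" by (auto simp: a_r_coset_def')
  have "lin_chi \<mu> (h + c) = lin (chh \<mu>) c" if "h \<in> Gr_rel d \<zeta>" for h
  proof -
    have "h + c \<in> G.RC" using Gr_rel(1)[OF that] c by (rule G.add_RC)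
    then show ?thesis using Gr_rel(2)[OF that] by (simp add: lin_chi lin_add)
  qed
  then have "lin_chi \<mu> ` ?A = (\<lambda>h. lin (chh \<mu>) c) ` Gr_rel d \<zeta>" unfolding A image_image by (rule image_cong[OF refl])
  then have "lin_chi \<mu> ` ?A = {lin (chh \<mu>) c}" using Gr_rel_0 by auto
  then show "chi \<mu> ?A = lin (chh \<mu>) c" by (simp add: chi_def)
  have hK: "h \<in> G.Ker" if "h \<in> Gr_rel d \<zeta>" for h using Gr_rel[OF that] by (simp add: G.Ker_def)
  show "Gr_to_stB d \<zeta> ?A = G.cl c"
  proof (rule subset_antisym; rule subsetI)
    fix x assume "x \<in> Gr_to_stB d \<zeta> ?A"
    then obtain k h where k: "k \<in> G.Ker" "h \<in> Gr_rel d \<zeta>" "x = k + (h + c)"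
      unfolding Gr_to_stB_def Gr_stB_eq A set_add_def' by auto
    have "k + h \<in> G.Ker" using sg_add[OF G.Ker_subgroup k(1) hK[OF k(2)]] .
    then show "x \<in> G.cl c" unfolding G.cl_def a_r_coset_def' k(3) by (rule UN_I) (simp add: add.assoc)
  next
    fix x assume "x \<in> G.cl c"
    then obtain h where h: "h \<in> G.Ker" "x = h + (0 + c)" unfolding G.cl_def a_r_coset_def' by auto
    show "x \<in> Gr_to_stB d \<zeta> ?A" unfolding Gr_to_stB_def Gr_stB_eq A set_add_def'
      using h Gr_rel_0 by (intro UN_I[of h] UN_I[of "0 + c"]) auto
  qed
qed

lemma val_ring_hom: "\<mu> \<in> Lam_sharp d \<Longrightarrow> G.val \<mu> \<in> Ring.ring_hom G.Q complex_ring"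
  by (rule ring_hom_memI) (simp_all add: class_ring_simps G.val_hom)

lemma factors_iff:
  assumes \<mu>: "\<mu> \<in> Lam d"
  shows "(\<exists>\<phi>\<in>Ring.ring_hom (Gr_stB d \<zeta>) complex_ring. \<forall>A\<in>carrier (Gr d \<zeta>). chi \<mu> A = \<phi> (Gr_to_stB d \<zeta> A)) \<longleftrightarrow> \<mu> \<in> Lam_sharp d"
proof
  assume "\<mu> \<in> Lam_sharp d"
  then show "\<exists>\<phi>\<in>Ring.ring_hom (Gr_stB d \<zeta>) complex_ring. \<forall>A\<in>carrier (Gr d \<zeta>). chi \<mu> A = \<phi> (Gr_to_stB d \<zeta> A)"
    unfolding Gr_stB_eq Gr_carrier by (intro bexI[OF _ val_ring_hom]) (auto simp del: DM_simps imr_simps simp: Gr_coset G.val_cl)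
next
  assume "\<exists>\<phi>\<in>Ring.ring_hom (Gr_stB d \<zeta>) complex_ring. \<forall>A\<in>carrier (Gr d \<zeta>). chi \<mu> A = \<phi> (Gr_to_stB d \<zeta> A)"
  then obtain \<phi> where p: "\<And>A. A \<in> carrier (Gr d \<zeta>) \<Longrightarrow> chi \<mu> A = \<phi> (Gr_to_stB d \<zeta> A)" by blast
  have e: "lin (chh \<mu>) c = \<phi> (G.cl c)" if "c \<in> G.RC" for c
  proof -
    have "Gr_rel d \<zeta> +>\<^bsub>G.R\<^esub> c \<in> carrier (Gr d \<zeta>)" unfolding Gr_carrier using that by (rule imageI)
    from p[OF this] show ?thesis unfolding Gr_coset[OF that] .
  qed
  \<comment> \<open>The test module of length \<open>d\<close> with trivial lowest weight: its class
    vanishes in the quotient, while for \<open>l = 0\<close> its trace is \<open>d\<close>.\<close>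
  have ok: "lw_ok d 1 1" by (simp add: lw_ok_def gam_d)
  let ?M = "lw d 1 1"
  have M: "frag_of ?M \<in> G.Ker" using P_proj[OF lw_projective[OF ok]] P_eq_Ker by simp
  then have R: "frag_of ?M \<in> G.RC" by (simp add: G.Ker_def)
  have "G.cl (frag_of ?M) = G.cl 0" unfolding G.cl_eq_iff[OF R G.zero_RC] using M by (simp add: G.Ker_def)
  then have "chh \<mu> ?M = 0" using e[OF R] e[OF G.zero_RC] by simp
  then have "fst \<mu> \<noteq> 0" using d0 by (cases "fst \<mu> = 0") (simp_all add: chh_def case_prod_beta ch_lw[OF ok])
  then show "\<mu> \<in> Lam_sharp d" using \<mu> by (auto simp: Lam_sharp_def)
qed

lemma val_iota: assumes \<mu>: "\<mu> \<in> Lam_sharp d" "iota d \<mu> \<in> Lam_sharp d" and A: "A \<in> carrier G.Q" shows "G.val (iota d \<mu>) A = G.val \<mu> A"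
proof -
  obtain c where c: "A = G.cl c" "c \<in> G.RC" using A unfolding G.carrier_Q by blast
  have "chh (iota d \<mu>) X = chh \<mu> X" if "X \<in> C" for X
    using ch_iota[OF that, of "fst \<mu>" "snd \<mu>"] \<mu>(1) by (auto simp: chh_def iota_def Lam_sharp_def Lam_def)
  then have "lin (chh (iota d \<mu>)) c = lin (chh \<mu>) c" using c(2) by (intro lin_cong) auto
  then show ?thesis unfolding c(1) G.val_cl[OF \<mu>(1) c(2)] G.val_cl[OF \<mu>(2) c(2)] .
qed

section \<open>The complexified Grothendieck ring\<close>

definition tch :: "nat \<times> nat \<Rightarrow> complex \<times> (double_gen fdmod \<Rightarrow>\<^sub>0 int) set \<Rightarrow> complex" where
  "tch \<mu> = (\<lambda>(a, A). a * G.val \<mu> A)"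

text \<open>The monoid is the product of the multiplicative monoids of the two tensor factors, and
  \<open>tch \<mu>\<close> is multiplicative on it. The tensor relations will turn out to span the
  whole common kernel of these characters.\<close>

sublocale T: separated_ring "complex_ring \<times>\<times> G.Q" "Lam_sharp d" tch
  by standard (auto simp: tch_def DirProd_def class_ring_simps G.finL G.Q_closed G.val_hom simp del: imr_simps)

abbreviation "TR_rels \<equiv> tensor_relations complex_ring G.Q"

definition "W = additive_span T.R TR_rels"

lemma TR_cases:
  assumes "c \<in> TR_rels"
  obtains a a' B where "B \<in> carrier G.Q" "c = frag_of (a + a', B) - (frag_of (a, B) + frag_of (a', B))"
  | a B B' where "B \<in> carrier G.Q" "B' \<in> carrier G.Q" "c = frag_of (a, B \<oplus>\<^bsub>G.Q\<^esub> B') - (frag_of (a, B) + frag_of (a, B'))"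
  using assms unfolding tensor_relations_def by (auto simp: class_ring_simps)

lemma T_frag: "B \<in> carrier G.Q \<Longrightarrow> frag_of (a, B) \<in> T.RC" by (simp add: DirProd_def class_ring_simps)

lemma additive_rels:
  assumes h: "\<And>B B'. B \<in> carrier G.Q \<Longrightarrow> B' \<in> carrier G.Q \<Longrightarrow> h (B \<oplus>\<^bsub>G.Q\<^esub> B') = h B + h B'" and c: "c \<in> TR_rels"
  shows "c \<in> T.RC" "lin (\<lambda>(a, B). a * h B) c = 0"
proof -
  show "c \<in> T.RC" using c
  proof (cases rule: TR_cases)
    case (1 a a' B) show ?thesis unfolding 1(2) by (intro T.add_RC T_frag 1)
  next
    case (2 a B B') show ?thesis unfolding 2(3) by (intro T.add_RC T_frag G.Q_closed 2)
  qed
  show "lin (\<lambda>(a, B). a * h B) c = 0" using c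
  proof (cases rule: TR_cases)
    case (1 a a' B) show ?thesis unfolding 1(2) by (simp add: lin_diff lin_add algebra_simps)
  next
    case (2 a B B') show ?thesis unfolding 2(3) by (simp add: lin_diff lin_add h 2(1,2) algebra_simps)
  qed
qed

lemma W_rels: "TR_rels \<subseteq> T.RC" using additive_rels(1)[of "\<lambda>_. 0"] by (simp add: subset_iff del: imr_simps)

lemma W_subgroup: "subgroup W (add_monoid T.R)" unfolding W_def by (rule span_subgroup[OF W_rels])

lemmas W_closed = subgroup_imr[OF W_subgroup]

text \<open>Stated for any additive \<open>h\<close>, since it is applied both to the known
  characters \<open>G.val \<mu>\<close> and to an arbitrary ring morphism
  \<open>\<phi>\<close>.\<close>

lemma W_additive:
  assumes h: "\<And>B B'. B \<in> carrier G.Q \<Longrightarrow> B' \<in> carrier G.Q \<Longrightarrow> h (B \<oplus>\<^bsub>G.Q\<^esub> B') = h B + h B'" and t: "t \<in> W"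
  shows "lin (\<lambda>(a, B). a * h B) t = 0"
proof -
  define U where "U = {c \<in> T.RC. lin (\<lambda>(a, B). a * h B) c = 0}"
  have "TR_rels \<subseteq> U" unfolding U_def using additive_rels[OF h] by blast
  moreover have "subgroup U (add_monoid T.R)" unfolding subgroup_imr_iff
  proof (intro conjI ballI)
    show "U \<subseteq> T.RC" unfolding U_def by blast
    show "0 \<in> U" by (simp add: U_def)
    show "a - b \<in> U" if "a \<in> U" "b \<in> U" for a b
      using that T.add_RC(2)[of a b] unfolding U_def by (simp add: lin_diff)
  qed
  ultimately have "W \<subseteq> U" unfolding W_def by (rule span_least[OF W_rels])
  then show ?thesis using t by (auto simp: U_def)
qed

lemma W_Ker: "W \<subseteq> T.Ker"
proof
  fix t assume t: "t \<in> W"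
  have "lin (tch \<mu>) t = 0" if "\<mu> \<in> Lam_sharp d" for \<mu>
    unfolding tch_def by (rule W_additive[OF G.val_hom(1)[OF that] t])
  then show "t \<in> T.Ker" using W_closed(6)[OF t] by (simp add: T.Ker_def)
qed

lemma W_left: "B \<in> carrier G.Q \<Longrightarrow> frag_of (a + a', B) - (frag_of (a, B) + frag_of (a', B)) \<in> W"
  unfolding W_def by (rule subsetD[OF span_base[OF W_rels]]) (unfold tensor_relations_def, rule UnI1, force simp: class_ring_simps)

lemma W_right: "B \<in> carrier G.Q \<Longrightarrow> B' \<in> carrier G.Q \<Longrightarrow> frag_of (a, B \<oplus>\<^bsub>G.Q\<^esub> B') - (frag_of (a, B) + frag_of (a, B')) \<in> W"
  unfolding W_def by (rule subsetD[OF span_base[OF W_rels]]) (unfold tensor_relations_def, rule UnI2, force simp: class_ring_simps)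

lemma W_cl: "b \<in> G.RC \<Longrightarrow> c \<in> G.RC \<Longrightarrow> frag_of (a, G.cl (b + c)) - (frag_of (a, G.cl b) + frag_of (a, G.cl c)) \<in> W"
  using W_right[of "G.cl b" "G.cl c" a] G.Q_add[of b c] by (simp only: G.carrier_Q image_eqI[OF refl])

lemma W_zero: "frag_of (a, G.cl 0) \<in> W" "B \<in> carrier G.Q \<Longrightarrow> frag_of (0, B) \<in> W"
proof -
  have *: "f \<in> W" if "f - (f + f) \<in> W" for f
    using W_closed(2)[OF W_closed(1) that] by simp
  show "frag_of (a, G.cl 0) \<in> W" using *[of "frag_of (a, G.cl 0)"] W_cl[OF G.zero_RC G.zero_RC, of a] by simp
  show "frag_of (0, B) \<in> W" if "B \<in> carrier G.Q" using *[of "frag_of (0, B)"] W_left[OF that, of 0 0] by simp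
qed

definition sgen :: "nat \<times> nat \<Rightarrow> (double_gen fdmod \<Rightarrow>\<^sub>0 int) set" where "sgen y = G.cl (frag_of (std y))"

lemma sgen: "y \<in> weights \<Longrightarrow> sgen y \<in> carrier G.Q"
  unfolding sgen_def G.carrier_Q by (intro imageI frag_RC std_C)

text \<open>Complex coefficients enter through the first tensor factor, where \<open>comb\<close>
  uses integral multiples.\<close>

definition tcomb :: "(nat \<times> nat \<Rightarrow> complex) \<Rightarrow> (complex \<times> (double_gen fdmod \<Rightarrow>\<^sub>0 int) set \<Rightarrow>\<^sub>0 int)" where
  "tcomb x = (\<Sum>y\<in>weights. frag_of (x y, sgen y))"

lemma tcomb_diff: "tcomb x - (tcomb (\<lambda>y. x y - z y) + tcomb z) \<in> W"
proof -
  have "tcomb x - (tcomb (\<lambda>y. x y - z y) + tcomb z) =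
      (\<Sum>y\<in>weights. frag_of ((x y - z y) + z y, sgen y) - (frag_of (x y - z y, sgen y) + frag_of (z y, sgen y)))"
    by (simp add: tcomb_def sum_subtractf sum.distrib)
  also have "\<dots> \<in> W" by (intro W_closed(4) W_left sgen)
  finally show ?thesis .
qed

text \<open>The elements that agree modulo \<open>W\<close> with a combination of standard classes.
  Working with this set keeps the coefficients out of the inductions.\<close>

definition "span_std = {t. \<exists>x. t - tcomb x \<in> W}"

lemma span_std_diff: assumes "s \<in> span_std" "t \<in> span_std" shows "s - t \<in> span_std"
proof -
  obtain x z where x: "s - tcomb x \<in> W" and z: "t - tcomb z \<in> W" using assms by (auto simp: span_std_def)
  have "((s - tcomb x) - (t - tcomb z)) + (tcomb x - (tcomb (\<lambda>y. x y - z y) + tcomb z)) \<in> W"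
    by (intro W_closed(2,3) x z tcomb_diff)
  then have "s - t - tcomb (\<lambda>y. x y - z y) \<in> W" by (simp add: algebra_simps)
  then show ?thesis by (auto simp: span_std_def)
qed

lemma span_std_W: assumes "t \<in> W" shows "t \<in> span_std"
proof -
  have "tcomb (\<lambda>_. 0) \<in> W" unfolding tcomb_def by (intro W_closed(4) W_zero(2) sgen)
  then have "t - tcomb (\<lambda>_. 0) \<in> W" by (intro W_closed(2) assms)
  then show ?thesis by (auto simp: span_std_def)
qed

lemma span_std_cl: assumes b: "b \<in> G.RC" "c \<in> G.RC"
  shows "frag_of (a, G.cl b) \<in> span_std \<Longrightarrow> frag_of (a, G.cl c) \<in> span_std \<Longrightarrow> frag_of (a, G.cl (b + c)) \<in> span_std"
proof -
  let ?f = "\<lambda>c. frag_of (a, G.cl c)"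
  assume f: "?f b \<in> span_std" "?f c \<in> span_std"
  have w: "?f (b + c) - (?f b + ?f c) \<in> span_std" by (rule span_std_W[OF W_cl[OF b]])
  have z: "0 \<in> span_std" by (rule span_std_W[OF W_closed(1)])
  have "(?f (b + c) - (?f b + ?f c)) - ((0 - ?f b) - ?f c) \<in> span_std" by (intro span_std_diff w z f)
  then show "?f (b + c) \<in> span_std" by simp
qed

lemma cl_Ker: "c \<in> G.Ker \<Longrightarrow> G.cl c = G.cl 0"
proof -
  assume c: "c \<in> G.Ker"
  then have R: "c \<in> G.RC" by (simp add: G.Ker_def)
  show ?thesis unfolding G.cl_eq_iff[OF R G.zero_RC] using c by (simp add: G.Ker_def)
qed

lemma span_std_module: assumes X: "X \<in> C" shows "frag_of (a, G.cl (frag_of X)) \<in> span_std"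
  using X
proof (induction rule: module_induct)
  case (std y)
  let ?x = "\<lambda>y'. if y' = y then a else 0"
  have "tcomb ?x = frag_of (a, sgen y) + (\<Sum>y'\<in>weights - {y}. frag_of (?x y', sgen y'))"
    unfolding tcomb_def using sum.remove[OF finite_weights std, of "\<lambda>y'. frag_of (?x y', sgen y')"] by simp
  moreover have "(\<Sum>y'\<in>weights - {y}. frag_of (?x y', sgen y')) \<in> W"
  proof (rule W_closed(4))
    fix y' assume "y' \<in> weights - {y}"
    then show "frag_of (?x y', sgen y') \<in> W" using W_zero(2)[OF sgen[of y']] by simp
  qed
  ultimately have "tcomb ?x - frag_of (a, sgen y) \<in> W" by simp
  then have "0 - (tcomb ?x - frag_of (a, sgen y)) \<in> W" by (rule W_closed(2)[OF W_closed(1)])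
  then have "frag_of (a, sgen y) - tcomb ?x \<in> W" by simp
  then show ?case unfolding span_std_def sgen_def by blast
next
  case (proj M)
  then have "G.cl (frag_of M) = G.cl 0" using cl_Ker P_proj P_eq_Ker by blast
  then show ?case using span_std_W[OF W_zero(1)] by simp
next
  case (ses X Y Z u v)
  have C: "X \<in> C" "Y \<in> C" "Z \<in> C" using ses(1) by (auto simp: ses_def H_def)
  have R: "frag_of X + frag_of Z \<in> G.RC" by (intro G.add_RC frag_RC C)
  have "frag_of Y - (frag_of X + frag_of Z) \<in> G.Ker" using P_ses[OF ses(1)] P_eq_Ker by simp
  then have "G.cl (frag_of Y) = G.cl (frag_of X + frag_of Z)" unfolding G.cl_eq_iff[OF frag_RC[OF C(2)] R]
    by (simp add: G.Ker_def lin_diff)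
  then show ?case using span_std_cl[OF frag_RC[OF C(1)] frag_RC[OF C(3)] ses(2,3)] by simp
qed

lemma span_std_frag: assumes B: "B \<in> carrier G.Q" shows "frag_of (a, B) \<in> span_std"
proof -
  obtain c where c: "B = G.cl c" "c \<in> G.RC" using B unfolding G.carrier_Q by blast
  have "Poly_Mapping.keys c \<subseteq> C" using c(2) by simp
  then have "c \<in> G.RC \<and> frag_of (a, G.cl c) \<in> span_std"
  proof (induction c rule: frag_induction)
    case zero show ?case using span_std_W[OF W_zero(1)] by simp
  next
    case (one X) then show ?case using span_std_module by simp
  next
    case (diff b c)
    let ?f = "\<lambda>c. frag_of (a, G.cl c)"
    have R: "b - c \<in> G.RC" using diff by (intro G.add_RC) auto
    have w: "?f b - (?f (b - c) + ?f c) \<in> W" using W_cl[OF R, of c a] diff by simp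
    have s: "?f b \<in> span_std" "?f c \<in> span_std" using diff by auto
    have "(?f b - ?f c) - (?f b - (?f (b - c) + ?f c)) \<in> span_std" by (rule span_std_diff[OF span_std_diff[OF s] span_std_W[OF w]])
    then show ?case using R by simp
  qed
  then show ?thesis by (simp add: c)
qed

lemma span_std_RC: assumes t: "t \<in> T.RC" shows "t \<in> span_std"
proof -
  have "Poly_Mapping.keys t \<subseteq> UNIV \<times> carrier G.Q" using t by (simp add: DirProd_def class_ring_simps)
  then show ?thesis
  proof (induction t rule: frag_induction)
    case zero show ?case by (rule span_std_W[OF W_closed(1)])
  next
    case (one x) then show ?case using span_std_frag by (cases x) simp
  next
    case (diff a b) then show ?case by (intro span_std_diff)
  qed
qed

text \<open>The argument of \<open>P_eq_Ker\<close> carries over, as \<open>fourier\<close> is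
  stated for complex coefficients. Two dual standard classes are opposite, so by additivity in the
  second factor their tensors with the same scalar cancel.\<close>

lemma W_eq_Ker: "W = T.Ker"
proof (rule subset_antisym[OF W_Ker], rule subsetI)
  fix t assume t: "t \<in> T.Ker"
  then have "t \<in> T.RC" by (simp add: T.Ker_def)
  then obtain x where x: "t - tcomb x \<in> W" using span_std_RC by (auto simp: span_std_def)
  have z: "(\<Sum>y\<in>weights. x y * ch l p (std y)) = 0" if "0 < l" "l < d" "p < d" for l p
  proof -
    have m: "(l, p) \<in> Lam_sharp d" using that by (simp add: Lam_sharp_def Lam_def)
    have "lin (tch (l, p)) (t - tcomb x) = 0" "lin (tch (l, p)) t = 0" using x t m W_Ker by (auto simp: T.Ker_def)
    then have "lin (tch (l, p)) (tcomb x) = 0" by (simp add: lin_diff)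
    moreover have "G.val (l, p) (sgen y) = ch l p (std y)" if "y \<in> weights" for y
      unfolding sgen_def G.val_cl[OF m frag_RC[OF std_C[OF that]]] by (simp add: chh_def)
    ultimately show ?thesis by (simp add: tcomb_def lin_sum tch_def)
  qed
  have xd: "x y = x (dual y)" if "y \<in> weights" for y using fourier[OF z that] by simp
  have "tcomb x \<in> W" unfolding tcomb_def
  proof (rule sum_involution[where \<tau> = dual])
    fix y assume y: "y \<in> weights"
    let ?a = "frag_of (std y)" and ?b = "frag_of (std (dual y))"
    have R: "?a \<in> G.RC" "?b \<in> G.RC" using std_C y dual_weights(1) by (auto intro!: frag_RC)
    have z: "G.cl (?a + ?b) = G.cl 0" using cl_Ker P_dual[OF y] P_eq_Ker by blast
    have "frag_of (x y, G.cl 0) - (frag_of (x y, G.cl 0) - (frag_of (x y, G.cl ?a) + frag_of (x y, G.cl ?b))) \<in> W"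
      by (rule W_closed(2)[OF W_zero(1) W_cl[OF R, of "x y", unfolded z]])
    then show "frag_of (x y, sgen y) + frag_of (x (dual y), sgen (dual y)) \<in> W" using xd[OF y] by (simp add: sgen_def add.commute)
  qed (use finite_weights dual_weights W_closed(1,3) in auto)
  then have "(t - tcomb x) + tcomb x \<in> W" using x W_closed(3) by blast
  then show "t \<in> W" by simp
qed

lemma semisimple: "semisimple_ring (tensor_ring complex_ring (Gr_stB d \<zeta>))"
proof -
  have "tensor_ring complex_ring (Gr_stB d \<zeta>) = T.Q"
    using W_eq_Ker by (simp add: tensor_ring_def Gr_stB_eq W_def)
  moreover have "semisimple_ring T.Q"
  proof (rule semisimple_if_separated[OF T.cring_Q T.finL T.val_hom(1-3) T.Q_inj])
    fix k
    \<comment> \<open>The tensor of \<open>k\<close> with the unit takes the value \<open>k\<close>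
      under every character; these are the constants that \<open>semisimple_if_separated\<close>
      asks for.\<close>
    have R: "frag_of (k, \<one>\<^bsub>G.Q\<^esub>) \<in> T.RC" by (rule T_frag[OF G.Q_closed(4)])
    have "T.cl (frag_of (k, \<one>\<^bsub>G.Q\<^esub>)) \<in> carrier T.Q" unfolding T.carrier_Q using R by (rule imageI)
    moreover have "T.val \<mu> (T.cl (frag_of (k, \<one>\<^bsub>G.Q\<^esub>))) = k" if "\<mu> \<in> Lam_sharp d" for \<mu>
      unfolding T.val_cl[OF that R] by (simp add: tch_def G.val_hom(4)[OF that])
    ultimately show "\<exists>x\<in>carrier T.Q. \<forall>\<mu>\<in>Lam_sharp d. T.val \<mu> x = k" by blast
  qed
  ultimately show ?thesis by simp
qed

text \<open>If \<open>\<phi>\<close> differs from each \<open>val \<mu>\<close>, a product of elements \<open>1 \<otimes> A - val \<mu> A \<otimes> 1\<close> of the tensor ring is killed by all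
  \<open>val \<mu>\<close>, hence zero, but \<open>\<phi>\<close> does not kill it.\<close>

lemma ring_hom_val:
  assumes f: "\<phi> \<in> Ring.ring_hom G.Q complex_ring"
  shows "\<exists>\<mu>\<in>Lam_sharp d. \<forall>A\<in>carrier G.Q. \<phi> A = G.val \<mu> A"
proof (rule ccontr)
  assume n: "\<not> ?thesis"
  have fa: "\<phi> (A \<oplus>\<^bsub>G.Q\<^esub> B) = \<phi> A + \<phi> B" "\<phi> (A \<otimes>\<^bsub>G.Q\<^esub> B) = \<phi> A * \<phi> B" if "A \<in> carrier G.Q" "B \<in> carrier G.Q" for A B
    using ring_hom_add[OF f that] ring_hom_mult[OF f that] by (simp_all add: class_ring_simps)
  have f1: "\<phi> \<one>\<^bsub>G.Q\<^esub> = 1" using ring_hom_one[OF f] by (simp add: class_ring_simps)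
  \<comment> \<open>The extension of \<open>\<phi>\<close> to the tensor ring. Scalars are available
    there, so that the number \<open>G.val \<mu> A\<close> can be subtracted from the class
    \<open>A\<close>.\<close>
  define h where "h = (\<lambda>(a, B). a * \<phi> B)"
  have hm: "h (x \<otimes>\<^bsub>complex_ring \<times>\<times> G.Q\<^esub> y) = h x * h y" if "x \<in> carrier (complex_ring \<times>\<times> G.Q)" "y \<in> carrier (complex_ring \<times>\<times> G.Q)" for x y
    using that by (auto simp: h_def DirProd_def class_ring_simps fa simp del: imr_simps)
  have "\<exists>t\<in>T.RC. lin h t \<noteq> 0 \<and> (\<forall>\<mu>\<in>F. lin (tch \<mu>) t = 0)" if "finite F" "F \<subseteq> Lam_sharp d" for F
    using that
  proof (induction F rule: finite_induct)
    case empty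
    have "lin h (frag_of (1, \<one>\<^bsub>G.Q\<^esub>)) \<noteq> 0" by (simp add: h_def f1)
    then show ?case using T_frag[OF G.Q_closed(4), of 1] by blast
  next
    case (insert \<mu> F)
    then obtain t where t: "t \<in> T.RC" "lin h t \<noteq> 0" "\<forall>\<mu>\<in>F. lin (tch \<mu>) t = 0" by auto
    obtain A where A: "A \<in> carrier G.Q" "\<phi> A \<noteq> G.val \<mu> A" using n insert.prems by blast
    let ?s = "frag_of (1, A) - frag_of (G.val \<mu> A, \<one>\<^bsub>G.Q\<^esub>)"
    have s: "?s \<in> T.RC" by (intro T.add_RC T_frag G.Q_closed A)
    have "lin h (t \<otimes>\<^bsub>T.R\<^esub> ?s) = lin h t * lin h ?s"
      by (rule lin_mult) (use t(1) s hm in blast)+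
    also have "\<dots> \<noteq> 0" using t(2) A(2) by (simp add: lin_diff h_def f1)
    finally have "lin h (t \<otimes>\<^bsub>T.R\<^esub> ?s) \<noteq> 0" .
    moreover have "lin (tch \<nu>) (t \<otimes>\<^bsub>T.R\<^esub> ?s) = 0" if "\<nu> \<in> insert \<mu> F" for \<nu>
    proof -
      have \<nu>: "\<nu> \<in> Lam_sharp d" using that insert.prems by blast
      have "lin (tch \<nu>) t = 0 \<or> lin (tch \<nu>) ?s = 0"
        using that t(3) G.val_hom(4)[OF \<nu>] by (auto simp: lin_diff tch_def)
      then show ?thesis unfolding T.lin_RC[OF t(1) s \<nu>] by simp
    qed
    ultimately show ?case using T.mult_RC[OF t(1) s] by blast
  qed
  from this[OF G.finL subset_refl] obtain t where t: "t \<in> T.RC" "lin h t \<noteq> 0" "\<forall>\<mu>\<in>Lam_sharp d. lin (tch \<mu>) t = 0" by blast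
  then have "t \<in> W" unfolding W_eq_Ker by (simp add: T.Ker_def)
  then have "lin h t = 0" unfolding h_def using W_additive fa(1) by blast
  then show False using t(2) by simp
qed

section \<open>The characters of the quotient ring\<close>

lemma restrict_ring_hom:
  "\<mu> \<in> Lam_sharp d \<Longrightarrow> restrict (G.val \<mu>) (carrier G.Q) \<in> characters G.Q"
  unfolding characters_def by (intro IntI ring_hom_memI) (simp_all add: class_ring_simps G.val_hom G.Q_closed)

text \<open>Injectivity rests on \<open>ch_separates\<close>, the choice of representatives
  excluding the second of its two cases unless it coincides with the first. Surjectivity comes from
  \<open>ring_hom_val\<close>, moved within the orbit by \<open>val_iota\<close>.\<close>

lemma characters_bij:
  assumes R: "orbit_representatives d R"
  shows "bij_betw (\<lambda>\<mu>. restrict (G.val \<mu>) (carrier G.Q)) R (characters G.Q)"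
proof -
  have RL: "R \<subseteq> Lam_sharp d" and ex: "\<And>\<mu>. \<mu> \<in> Lam_sharp d \<Longrightarrow> \<exists>!\<nu>. \<nu> \<in> R \<and> (\<nu> = \<mu> \<or> \<nu> = iota d \<mu>)"
    using R by (auto simp: orbit_representatives_def)
  let ?\<psi> = "\<lambda>\<mu>. restrict (G.val \<mu>) (carrier G.Q)"
  have "inj_on ?\<psi> R"
  proof (rule inj_onI)
    fix \<mu> \<nu> assume m: "\<mu> \<in> R" "\<nu> \<in> R" and e: "?\<psi> \<mu> = ?\<psi> \<nu>"
    have L: "\<mu> \<in> Lam_sharp d" "\<nu> \<in> Lam_sharp d" using m RL by auto
    have "ch (fst \<mu>) (snd \<mu>) X = ch (fst \<nu>) (snd \<nu>) X" if X: "X \<in> C" for X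
    proof -
      have "G.cl (frag_of X) \<in> carrier G.Q" unfolding G.carrier_Q by (intro imageI frag_RC X)
      then have "G.val \<mu> (G.cl (frag_of X)) = G.val \<nu> (G.cl (frag_of X))" using fun_cong[OF e, of "G.cl (frag_of X)"] by simp
      then show ?thesis unfolding G.val_cl[OF L(1) frag_RC[OF X]] G.val_cl[OF L(2) frag_RC[OF X]] by (simp add: chh_def case_prod_beta)
    qed
    then have "\<nu> = \<mu> \<or> \<nu> = iota d \<mu>" using ch_separates[of "fst \<mu>" "snd \<mu>" "fst \<nu>" "snd \<nu>"] L by simp
    then show "\<mu> = \<nu>" using ex[OF L(1)] m by blast
  qed
  moreover have "?\<psi> ` R = characters G.Q"
  proof (rule subset_antisym; rule subsetI)
    fix \<phi> assume "\<phi> \<in> ?\<psi> ` R"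
    then show "\<phi> \<in> characters G.Q" using restrict_ring_hom RL by blast
  next
    fix \<phi> assume p: "\<phi> \<in> characters G.Q"
    then have pe: "\<phi> \<in> extensional (carrier G.Q)" by (simp add: characters_def)
    obtain \<mu> where m: "\<mu> \<in> Lam_sharp d" "\<And>A. A \<in> carrier G.Q \<Longrightarrow> \<phi> A = G.val \<mu> A"
      using ring_hom_val[of \<phi>] p unfolding characters_def by blast
    obtain \<nu> where v: "\<nu> \<in> R" "\<nu> = \<mu> \<or> \<nu> = iota d \<mu>" using ex[OF m(1)] by blast
    have "\<phi> = ?\<psi> \<nu>"
    proof (rule extensionalityI[OF pe restrict_extensional])
      fix A assume A: "A \<in> carrier G.Q"
      have "G.val \<nu> A = G.val \<mu> A" using v val_iota[OF m(1) _ A] RL by blast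
      then show "\<phi> A = ?\<psi> \<nu> A" using m(2)[OF A] A by simp
    qed
    then show "\<phi> \<in> ?\<psi> ` R" using v(1) by blast
  qed
  ultimately show ?thesis by (simp add: bij_betw_def)
qed

lemma chi_val: assumes \<mu>: "\<mu> \<in> Lam_sharp d" and A: "A \<in> carrier (Gr d \<zeta>)"
  shows "chi \<mu> A = restrict (G.val \<mu>) (carrier G.Q) (Gr_to_stB d \<zeta> A)"
proof -
  obtain c where c: "A = Gr_rel d \<zeta> +>\<^bsub>G.R\<^esub> c" "c \<in> G.RC" using A unfolding Gr_carrier by blast
  have "G.cl c \<in> carrier G.Q" unfolding G.carrier_Q using c(2) by (rule imageI)
  then show ?thesis unfolding c(1) Gr_coset[OF c(2)] by (simp only: restrict_apply' G.val_cl[OF \<mu> c(2)])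
qed

end

theorem theorem5p6:
  fixes d :: nat and \<zeta> :: complex
  assumes "d \<ge> 2"
    and "\<zeta> ^ d = 1" and "\<forall>k. 0 < k \<and> k < d \<longrightarrow> \<zeta> ^ k \<noteq> 1"
  shows
    "(\<forall>\<mu>\<in>Lam d.
        (\<exists>\<phi>\<in>Ring.ring_hom (Gr_stB d \<zeta>) complex_ring.
           \<forall>A\<in>carrier (Gr d \<zeta>). chi \<mu> A = \<phi> (Gr_to_stB d \<zeta> A))
        \<longleftrightarrow> \<mu> \<in> Lam_sharp d) \<and>
     (\<exists>\<psi>. (\<forall>\<mu>\<in>Lam_sharp d. \<forall>A\<in>carrier (Gr d \<zeta>). chi \<mu> A = \<psi> \<mu> (Gr_to_stB d \<zeta> A)) \<and>
          (\<forall>R. orbit_representatives d R \<longrightarrow> bij_betw \<psi> R (characters (Gr_stB d \<zeta>)))) \<and>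
     semisimple_ring (tensor_ring complex_ring (Gr_stB d \<zeta>))"
proof -
  interpret dbl d \<zeta> by unfold_locales (use assms in auto)
  show ?thesis
  proof (intro conjI ballI)
    fix \<mu> assume "\<mu> \<in> Lam d"
    then show "(\<exists>\<phi>\<in>Ring.ring_hom (Gr_stB d \<zeta>) complex_ring. \<forall>A\<in>carrier (Gr d \<zeta>). chi \<mu> A = \<phi> (Gr_to_stB d \<zeta> A)) \<longleftrightarrow>
        \<mu> \<in> Lam_sharp d"
      by (rule factors_iff)
  next
    \<comment> \<open>The witness is the value function on the quotient ring, restricted to the
      carrier because characters are taken extensional.\<close>
    show "\<exists>\<psi>. (\<forall>\<mu>\<in>Lam_sharp d. \<forall>A\<in>carrier (Gr d \<zeta>). chi \<mu> A = \<psi> \<mu> (Gr_to_stB d \<zeta> A)) \<and>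
        (\<forall>R. orbit_representatives d R \<longrightarrow> bij_betw \<psi> R (characters (Gr_stB d \<zeta>)))"
      unfolding Gr_stB_eq
      by (intro exI[of _ "\<lambda>\<mu>. restrict (G.val \<mu>) (carrier G.Q)"] conjI ballI allI impI chi_val characters_bij)
  qed (rule semisimple)
qed

end
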